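(* Let $\Gamma$ be a finite Coxeter graph each of whose connected components is a tree all of whose edge labels are odd. Then every Coxeter group $W$ with $\widehat W\cong\widehat{W_\Gamma}$ is isomorphic to $W_\Gamma$.
   Context: For a finite simplicial graph $\Gamma$ with edge labels $m\colon E(\Gamma)\to\mathbb{N}_{\ge2}$, $W_\Gamma=\langle V(\Gamma)\mid v^2,\ (vw)^{m(\{v,w\})}\text{ for }\{v,w\}\in E(\Gamma)\rangle$. $\widehat{G}$ is profinite completion. *)

theory Defs
  imports "HOL-Algebra.Algebra"
begin

text \<open>A finite simplicial graph with vertex set V, edge set E (2-element subsets of V)
  and edge labels m e \<ge> 2.  Non-adjacent vertices impose no relation.\<close>

definition coxeter_graph :: "'a set \<Rightarrow> 'a set set \<Rightarrow> ('a set \<Rightarrow> nat) \<Rightarrow> bool" where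
  "coxeter_graph V E m \<longleftrightarrow> finite V \<and>
     (\<forall>e\<in>E. \<exists>v w. v \<in> V \<and> w \<in> V \<and> v \<noteq> w \<and> e = {v, w}) \<and>
     (\<forall>e\<in>E. 2 \<le> m e)"

definition reach :: "'a set set \<Rightarrow> 'a \<Rightarrow> 'a \<Rightarrow> bool" where
  "reach E v w \<longleftrightarrow> (v, w) \<in> {(x, y). {x, y} \<in> E}\<^sup>*"

definition graph_components :: "'a set \<Rightarrow> 'a set set \<Rightarrow> 'a set set" where
  "graph_components V E = {{w \<in> V. reach E v w} | v. v \<in> V}"

definition induced_edges :: "'a set set \<Rightarrow> 'a set \<Rightarrow> 'a set set" where
  "induced_edges E C = {e \<in> E. e \<subseteq> C}"

definition has_cycle :: "'a set set \<Rightarrow> bool" where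
  "has_cycle E \<longleftrightarrow> (\<exists>cs. 3 \<le> length cs \<and> distinct cs \<and>
      (\<forall>i < length cs. {cs ! i, cs ! ((i + 1) mod length cs)} \<in> E))"

definition is_tree :: "'a set \<Rightarrow> 'a set set \<Rightarrow> bool" where
  "is_tree C E \<longleftrightarrow> C \<noteq> {} \<and> (\<forall>v\<in>C. \<forall>w\<in>C. reach E v w) \<and> \<not> has_cycle E"

text \<open>Since every generator is an involution, the group presented by
  \<open>\<langle>V | v^2, (vw)^m\<rangle>\<close> is the monoid presented on words over V by
  v v = 1 and (v w)^m = 1.\<close>

inductive coxeq :: "'a set \<Rightarrow> 'a set set \<Rightarrow> ('a set \<Rightarrow> nat) \<Rightarrow> 'a list \<Rightarrow> 'a list \<Rightarrow> bool"
  for V E m where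
  refl: "coxeq V E m xs xs"
| sym: "coxeq V E m xs ys \<Longrightarrow> coxeq V E m ys xs"
| trans: "coxeq V E m xs ys \<Longrightarrow> coxeq V E m ys zs \<Longrightarrow> coxeq V E m xs zs"
| ctx: "coxeq V E m xs ys \<Longrightarrow> set us \<subseteq> V \<Longrightarrow> set ws \<subseteq> V \<Longrightarrow>
          coxeq V E m (us @ xs @ ws) (us @ ys @ ws)"
| invol: "v \<in> V \<Longrightarrow> coxeq V E m [v, v] []"
| braid: "v \<in> V \<Longrightarrow> w \<in> V \<Longrightarrow> {v, w} \<in> E \<Longrightarrow>
          coxeq V E m (concat (replicate (m {v, w}) [v, w])) []"

definition cox_class :: "'a set \<Rightarrow> 'a set set \<Rightarrow> ('a set \<Rightarrow> nat) \<Rightarrow> 'a list \<Rightarrow> 'a list set" where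
  "cox_class V E m xs = {ys. set ys \<subseteq> V \<and> coxeq V E m xs ys}"

definition coxeter_group :: "'a set \<Rightarrow> 'a set set \<Rightarrow> ('a set \<Rightarrow> nat) \<Rightarrow> 'a list set monoid" where
  "coxeter_group V E m =
     \<lparr>carrier = {cox_class V E m xs | xs. set xs \<subseteq> V},
      monoid.mult = (\<lambda>A B. cox_class V E m ((SOME xs. xs \<in> A) @ (SOME ys. ys \<in> B))),
      one = cox_class V E m []\<rparr>"

definition fin_index_normals :: "('g, 'x) monoid_scheme \<Rightarrow> 'g set set" where
  "fin_index_normals G = {N. N \<lhd> G \<and> finite (rcosets\<^bsub>G\<^esub> N)}"

definition profinite_completion :: "('g, 'x) monoid_scheme \<Rightarrow> ('g set \<Rightarrow> 'g set) monoid" where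
  "profinite_completion G =
     \<lparr>carrier = {f. (\<forall>N\<in>fin_index_normals G. f N \<in> rcosets\<^bsub>G\<^esub> N) \<and>
                   (\<forall>N\<in>fin_index_normals G. \<forall>M\<in>fin_index_normals G. N \<subseteq> M \<longrightarrow> f N \<subseteq> f M) \<and>
                   (\<forall>N. N \<notin> fin_index_normals G \<longrightarrow> f N = undefined)},
      monoid.mult = (\<lambda>f g. \<lambda>N. if N \<in> fin_index_normals G then f N <#>\<^bsub>G\<^esub> g N else undefined),
      one = (\<lambda>N. if N \<in> fin_index_normals G then N else undefined)\<rparr>"

text \<open>Basic open normal subgroups of the completion: kernels of the projections to G/N.\<close>

definition completion_kernel :: "('g, 'x) monoid_scheme \<Rightarrow> 'g set \<Rightarrow> ('g set \<Rightarrow> 'g set) set" where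
  "completion_kernel G N = {f \<in> carrier (profinite_completion G). f N = N}"

text \<open>Continuity of a homomorphism between completions (continuity at the identity
  w.r.t. the inverse-limit topology).\<close>

definition completion_continuous ::
  "('g, 'x) monoid_scheme \<Rightarrow> ('h, 'y) monoid_scheme \<Rightarrow> (('g set \<Rightarrow> 'g set) \<Rightarrow> ('h set \<Rightarrow> 'h set)) \<Rightarrow> bool" where
  "completion_continuous G H \<phi> \<longleftrightarrow>
     (\<forall>N'\<in>fin_index_normals H. \<exists>N\<in>fin_index_normals G.
        \<phi> ` completion_kernel G N \<subseteq> completion_kernel H N')"

definition profinite_iso :: "('g, 'x) monoid_scheme \<Rightarrow> ('h, 'y) monoid_scheme \<Rightarrow> bool" where
  "profinite_iso G H \<longleftrightarrow> (\<exists>\<phi>. \<phi> \<in> iso (profinite_completion G) (profinite_completion H) \<and>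
      completion_continuous G H \<phi> \<and>
      completion_continuous H G (inv_into (carrier (profinite_completion G)) \<phi>))"

end

theory Submission
  imports Defs "HOL-Computational_Algebra.Computational_Algebra" "HOL-Number_Theory.Number_Theory"
begin

text \<open>
  A continuous isomorphism of profinite completions lets actions of the two Coxeter groups on finite
  sets correspond to each other, and everything is extracted from counting such actions. In a finite
  quotient of an odd forest group, an involution that lifts to an involution in every larger finite
  quotient is conjugate to a generator, so each generator of the other group acts, in every finite
  action, as a conjugate of a generator of the forest group. Fix a prime \<open>p\<close> with suitable roots of unity modulo \<open>p\<close>. Counting affine lifts (crossed homomorphisms) of the
  action on alternating forms over the reflection representation modulo \<open>p\<close> of the other group gives
  \<open>|E'| - |V'| \<le> |E| - |V|\<close>; together with the number of actions on two points this forces the other graph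
  to be an odd forest as well. For each component, the representations that send its generators to
  reflections of a dihedral group modulo \<open>p\<close>, weighted by the number of their affine lifts, have generating
  function \<open>N Y \<Prod>\<^sub>e (1 + (m\<^sub>e - 1) Y)\<close>, which determines the multiset of labels of the component. Finally an
  odd tree group depends only on its multiset of labels: generators joined by an odd edge are conjugate, so
  after conjugating each new leaf it can be attached to the root, which turns the tree into a star.
\<close>

section \<open>Forests\<close>

text \<open>Only finite actions pass between the two groups, so every invariant has to be a number
  attached to an action. Modulo \<open>p\<close> the reflection representation of the unknown group
  is such an action, but its own lifts see the vertices alone: the (-1)-eigenspaces of two
  generators are different lines, so a braid relation imposes nothing on a crossed homomorphism. On
  alternating forms the eigenspaces of adjacent generators meet in a line, and each edge of the
  unknown graph costs one equation. On the forest side the same action is known only through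
  conjugacy: a generator acts as a conjugate of a reflection, which fixes the size of its
  eigenspaces, but neighbours may act by the same map. Such collapsed edges are carried through both
  counts; counting lifts of the reflection representation itself determines their number, and in the
  comparison they cancel. Odd labels are used twice: to correct involutive lifts along an edge, and
  to make adjacent generators conjugate.\<close>

inductive forest :: "'a set \<Rightarrow> 'a set set \<Rightarrow> bool" where
  empty: "forest {} {}"
| isolated: "forest V E \<Longrightarrow> w \<notin> V \<Longrightarrow> forest (insert w V) E"
| leaf: "forest V E \<Longrightarrow> u \<in> V \<Longrightarrow> w \<notin> V \<Longrightarrow> forest (insert w V) (insert {u, w} E)"

lemma forest_finite: "forest V E \<Longrightarrow> finite V \<and> finite E"
  by (induction rule: forest.induct) auto

lemma forest_edge: "forest V E \<Longrightarrow> e \<in> E \<Longrightarrow> \<exists>u w. e = {u, w} \<and> u \<in> V \<and> w \<in> V \<and> u \<noteq> w"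
proof (induction arbitrary: e rule: forest.induct)
  case (leaf V E u w)
  then have "u \<noteq> w" by blast
  from leaf.prems consider "e = {u, w}" | "e \<in> E" by blast
  then show ?case
  proof cases
    case 1
    then show ?thesis using \<open>u \<noteq> w\<close> leaf.hyps(2) by blast
  next
    case 2
    then show ?thesis using leaf.IH[OF 2] by blast
  qed
qed blast+

lemma forest_new_edge: "forest V E \<Longrightarrow> w \<notin> V \<Longrightarrow> {u, w} \<notin> E" "forest V E \<Longrightarrow> w \<notin> V \<Longrightarrow> {w, u} \<notin> E"
  using forest_edge by (metis doubleton_eq_iff)+

definition graph_path :: "'a set set \<Rightarrow> 'a list \<Rightarrow> bool" where
  "graph_path E xs \<longleftrightarrow> distinct xs \<and> (\<forall>i. Suc i < length xs \<longrightarrow> {xs ! i, xs ! Suc i} \<in> E)"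

text \<open>An end of a longest path has all its neighbours on the path, and a neighbour other than
  the next vertex would close a cycle.\<close>

lemma acyclic_low_degree:
  assumes fin: "finite V" and "V \<noteq> {}"
    and edges: "\<forall>e\<in>E. \<exists>v w. v \<in> V \<and> w \<in> V \<and> v \<noteq> w \<and> e = {v, w}"
    and nocyc: "\<not> has_cycle E"
  obtains x where "x \<in> V" "\<And>y z. {x, y} \<in> E \<Longrightarrow> {x, z} \<in> E \<Longrightarrow> y = z"
proof -
  let ?P = "\<lambda>xs. xs \<noteq> [] \<and> set xs \<subseteq> V \<and> graph_path E xs"
  obtain v0 where "v0 \<in> V" using \<open>V \<noteq> {}\<close> by blast
  then have "?P [v0]" by (auto simp: graph_path_def)
  moreover have "length xs < Suc (card V)" if "?P xs" for xs
    using that card_mono[OF fin, of "set xs"] distinct_card[of xs] by (auto simp: graph_path_def)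
  ultimately obtain xs where xs: "?P xs" and max: "\<And>ys. ?P ys \<Longrightarrow> length ys \<le> length xs"
    using ex_has_greatest_nat[of ?P "[v0]" length "Suc (card V)"] by (metis less_imp_le_nat)
  define x where "x = xs ! 0"
  have xV: "x \<in> V" using xs by (auto simp: x_def)
  have inxs: "y \<in> set xs" if "{x, y} \<in> E" for y
  proof (rule ccontr)
    assume y: "y \<notin> set xs"
    have "y \<in> V" using edges that by (metis doubleton_eq_iff)
    moreover have "graph_path E (y # xs)"
      unfolding graph_path_def
    proof (intro conjI allI impI)
      show "distinct (y # xs)" using y xs by (simp add: graph_path_def)
      fix i assume i: "Suc i < length (y # xs)"
      show "{(y # xs) ! i, (y # xs) ! Suc i} \<in> E"
        using that i xs by (cases i) (auto simp: graph_path_def x_def insert_commute)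
    qed
    ultimately have "?P (y # xs)" using xs by auto
    then show False using max by fastforce
  qed
  have one: "y = xs ! 1" if y: "{x, y} \<in> E" for y
  proof (rule ccontr)
    assume ne: "y \<noteq> xs ! 1"
    obtain j where j: "j < length xs" "y = xs ! j" using inxs[OF y] by (metis in_set_conv_nth)
    have "y \<noteq> x" using edges y by (metis doubleton_eq_iff)
    \<comment> \<open>With the vertex itself and its successor excluded, the initial segment up to
      \<open>j\<close> has at least three vertices, as \<open>has_cycle\<close> demands.\<close>
    then have j2: "j \<ge> 2" using j ne by (cases j; cases "j - 1") (auto simp: x_def)
    let ?cs = "take (Suc j) xs"
    have len: "length ?cs = Suc j" using j by simp
    have "has_cycle E"
      unfolding has_cycle_def
    proof (intro exI[of _ ?cs] conjI allI impI)
      show "3 \<le> length ?cs" using j2 len by simp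
      show "distinct ?cs" using xs by (simp add: graph_path_def)
      fix i assume i: "i < length ?cs"
      show "{?cs ! i, ?cs ! ((i + 1) mod length ?cs)} \<in> E"
      proof (cases "i = j")
        case True
        then show ?thesis using y j by (simp add: len x_def insert_commute)
      next
        case False
        then show ?thesis using i len xs j by (auto simp: graph_path_def)
      qed
    qed
    then show False using nocyc by simp
  qed
  show ?thesis using that[OF xV] one by metis
qed

lemma has_cycle_mono: "has_cycle E \<Longrightarrow> E \<subseteq> F \<Longrightarrow> has_cycle F"
  unfolding has_cycle_def by blast

text \<open>Induction removes a vertex of degree at most one; putting it back is one of the two
  construction steps of \<open>forest\<close>.\<close>

lemma acyclic_forest:
  assumes "finite V"
    and "\<forall>e\<in>E. \<exists>v w. v \<in> V \<and> w \<in> V \<and> v \<noteq> w \<and> e = {v, w}"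
    and "\<not> has_cycle E"
  shows "forest V E"
  using assms
proof (induction "card V" arbitrary: V E)
  case 0
  then have "V = {}" "E = {}" by auto
  then show ?case by (simp add: forest.empty)
next
  case (Suc n)
  have "V \<noteq> {}" using Suc.hyps by auto
  then obtain x where x: "x \<in> V" and one: "\<And>y z. {x, y} \<in> E \<Longrightarrow> {x, z} \<in> E \<Longrightarrow> y = z"
    using acyclic_low_degree Suc.prems by metis
  let ?V = "V - {x}" and ?E = "{e \<in> E. x \<notin> e}"
  have fo: "forest ?V ?E"
  proof (rule Suc.hyps)
    show "n = card ?V" using Suc.hyps x Suc.prems by (simp)
    show "finite ?V" using Suc.prems by simp
    show "\<forall>e\<in>?E. \<exists>v w. v \<in> ?V \<and> w \<in> ?V \<and> v \<noteq> w \<and> e = {v, w}"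
    proof
      fix e assume e: "e \<in> ?E"
      then obtain v w where "v \<in> V" "w \<in> V" "v \<noteq> w" "e = {v, w}" using Suc.prems(2) by blast
      then show "\<exists>v w. v \<in> ?V \<and> w \<in> ?V \<and> v \<noteq> w \<and> e = {v, w}" using e by blast
    qed
    show "\<not> has_cycle ?E" using has_cycle_mono[of ?E E] Suc.prems by auto
  qed
  have V: "insert x ?V = V" using x by auto
  show ?case
  proof (cases "\<exists>e\<in>E. x \<in> e")
    case False
    then have "?E = E" by auto
    then show ?thesis using forest.isolated[OF fo, of x] V by auto
  next
    case True
    then obtain e v w where e: "e \<in> E" "x \<in> e" "v \<in> V" "w \<in> V" "v \<noteq> w" "e = {v, w}"
      using Suc.prems(2) by metis
    obtain u where u: "{x, u} \<in> E" "u \<in> ?V"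
    proof (cases "x = v")
      case True
      then show ?thesis using that[of w] e by auto
    next
      case False
      then show ?thesis using that[of v] e by (auto simp: insert_commute)
    qed
    have eu: "e = {u, x}" if e: "e \<in> E" "x \<in> e" for e
    proof -
      obtain v w where vw: "e = {v, w}" using bspec[OF Suc.prems(2) e(1)] by (elim exE conjE)
      obtain y where y: "e = {x, y}" using vw e(2) by (metis insert_iff insert_commute singletonD)
      have "{x, y} \<in> E" using e(1) unfolding y .
      from one[OF this u(1)] show ?thesis using y by (simp add: insert_commute)
    qed
    have uxE: "{u, x} \<in> E" using u(1) by (simp add: insert_commute)
    have "E = insert {u, x} ?E"
    proof (rule Set.set_eqI)
      fix e show "e \<in> E \<longleftrightarrow> e \<in> insert {u, x} ?E"
        using eu[of e] uxE by blast
    qed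
    then show ?thesis using forest.leaf[OF fo u(2), of x] V by simp
  qed
qed

lemma forest_card_le: "forest V E \<Longrightarrow> card E \<le> card V"
proof (induction rule: forest.induct)
  case (leaf V E u w)
  then show ?case using forest_finite[OF leaf.hyps(1)] forest_new_edge[OF leaf.hyps(1)] by simp
qed (auto dest!: forest_finite simp: card_insert_if)

text \<open>No edge crosses the border of \<open>C\<close>, so a leaf inside \<open>C\<close> has
  its neighbour there and the order of construction restricts to \<open>C\<close>.\<close>

lemma forest_subset:
  "forest V E \<Longrightarrow> (\<forall>e\<in>E. e \<subseteq> C \<or> e \<inter> C = {}) \<Longrightarrow> forest (V \<inter> C) {e \<in> E. e \<subseteq> C}"
proof (induction rule: forest.induct)
  case empty
  then show ?case by (simp add: forest.empty)
next
  case (isolated V E w)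
  then show ?case by (cases "w \<in> C") (auto intro: forest.isolated)
next
  case (leaf V E u w)
  then have IH: "forest (V \<inter> C) {e \<in> E. e \<subseteq> C}" by simp
  show ?case
  proof (cases "w \<in> C")
    case True
    then have "u \<in> C" using leaf.prems by auto
    then have "{e \<in> insert {u, w} E. e \<subseteq> C} = insert {u, w} {e \<in> E. e \<subseteq> C}" using True by auto
    then show ?thesis using forest.leaf[OF IH, of u w] leaf.hyps True \<open>u \<in> C\<close> by auto
  next
    case False
    then have "{e \<in> insert {u, w} E. e \<subseteq> C} = {e \<in> E. e \<subseteq> C}" by auto
    then show ?thesis using IH False by simp
  qed
qed

text \<open>Choices follow the order of construction: a new leaf has a single neighbour, so one
  condition is to be met and earlier choices are never revised. Edges are unordered, hence both
  orientations of \<open>R\<close> are demanded of the extension.\<close>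

lemma forest_choice:
  assumes "forest V E" "\<forall>v\<in>V. L v \<noteq> {}"
    and ext: "\<And>u w s. {u, w} \<in> E \<Longrightarrow> s \<in> L u \<Longrightarrow> \<exists>t\<in>L w. R u w s t \<and> R w u t s"
  shows "\<exists>a. (\<forall>v\<in>V. a v \<in> L v) \<and> (\<forall>u w. {u, w} \<in> E \<longrightarrow> R u w (a u) (a w))"
  using assms
proof (induction rule: forest.induct)
  case empty
  show ?case by simp
next
  case (isolated V E w)
  have "\<exists>a. (\<forall>v\<in>V. a v \<in> L v) \<and> (\<forall>u w. {u, w} \<in> E \<longrightarrow> R u w (a u) (a w))"
    by (rule isolated.IH) (use isolated.prems in blast)+
  then obtain a where a: "\<forall>v\<in>V. a v \<in> L v" "\<forall>u w. {u, w} \<in> E \<longrightarrow> R u w (a u) (a w)" by (elim exE conjE)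
  obtain t where t: "t \<in> L w" using isolated.prems(1) by blast
  have "\<forall>x y. {x, y} \<in> E \<longrightarrow> x \<noteq> w \<and> y \<noteq> w" using isolated.hyps forest_new_edge by metis
  then show ?case using a t isolated.hyps(2) by (intro exI[of _ "a(w := t)"]) auto
next
  case (leaf V E u w)
  have "\<exists>a. (\<forall>v\<in>V. a v \<in> L v) \<and> (\<forall>u w. {u, w} \<in> E \<longrightarrow> R u w (a u) (a w))"
    by (rule leaf.IH) (use leaf.prems in blast)+
  then obtain a where a: "\<forall>v\<in>V. a v \<in> L v" "\<forall>u w. {u, w} \<in> E \<longrightarrow> R u w (a u) (a w)" by (elim exE conjE)
  have au: "a u \<in> L u" using a leaf.hyps by blast
  obtain t where t: "t \<in> L w" "R u w (a u) t" "R w u t (a u)" using leaf.prems(2)[OF insertI1 au] by blast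
  have ne: "\<forall>x y. {x, y} \<in> E \<longrightarrow> x \<noteq> w \<and> y \<noteq> w" using leaf.hyps forest_new_edge by metis
  have uw: "u \<noteq> w" using leaf.hyps by blast
  show ?case
  proof (intro exI[of _ "a(w := t)"] conjI allI impI ballI)
    fix v assume "v \<in> insert w V"
    then show "(a(w := t)) v \<in> L v" using a(1) t(1) leaf.hyps(3) by auto
  next
    fix x y assume "{x, y} \<in> insert {u, w} E"
    then consider "{x, y} \<in> E" | "x = u" "y = w" | "x = w" "y = u" by (auto simp: doubleton_eq_iff)
    then show "R x y ((a(w := t)) x) ((a(w := t)) y)"
      by cases (use a(2) ne t uw in simp_all)
  qed
qed

text \<open>A cycle is connected, so it lies in the component of its first vertex and survives among
  the induced edges.\<close>

lemma tree_components_acyclic: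
  assumes cg: "coxeter_graph V E m"
    and tree: "\<forall>C\<in>graph_components V E. is_tree C (induced_edges E C)"
  shows "\<not> has_cycle E"
proof
  assume "has_cycle E"
  then obtain cs where cs: "3 \<le> length cs" "distinct cs"
    "\<And>i. i < length cs \<Longrightarrow> {cs ! i, cs ! ((i + 1) mod length cs)} \<in> E"
    unfolding has_cycle_def by blast
  have inV: "x \<in> V \<and> y \<in> V" if "{x, y} \<in> E" for x y
    using cg that unfolding coxeter_graph_def by (metis doubleton_eq_iff)
  have csV: "cs ! i \<in> V" if "i < length cs" for i using inV[OF cs(3)[OF that]] by simp
  have r: "reach E (cs ! 0) (cs ! i)" if "i < length cs" for i
    using that
  proof (induction i)
    case 0
    then show ?case by (simp add: reach_def)
  next
    case (Suc i)
    then have "{cs ! i, cs ! Suc i} \<in> E" using cs(3)[of i] by simp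
    then have "(cs ! i, cs ! Suc i) \<in> {(x, y). {x, y} \<in> E}" by simp
    then show ?case using Suc unfolding reach_def
      by (meson Suc_lessD rtrancl.rtrancl_into_rtrancl)
  qed
  let ?C = "{w \<in> V. reach E (cs ! 0) w}"
  have "0 < length cs" using cs(1) by linarith
  then have "?C \<in> graph_components V E" using csV[of 0] unfolding graph_components_def by auto
  then have "\<not> has_cycle (induced_edges E ?C)" using tree unfolding is_tree_def by blast
  moreover have "has_cycle (induced_edges E ?C)"
    unfolding has_cycle_def
  proof (intro exI[of _ cs] conjI allI impI)
    fix i assume i: "i < length cs"
    then have "(i + 1) mod length cs < length cs" by (intro mod_less_divisor) linarith
    then show "{cs ! i, cs ! ((i + 1) mod length cs)} \<in> induced_edges E ?C"
      using cs(3)[OF i] r csV i unfolding induced_edges_def by auto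
  qed (use cs in auto)
  ultimately show False by simp
qed

section \<open>Actions of Coxeter groups on finite sets\<close>

definition ev :: "('a \<Rightarrow> 'x \<Rightarrow> 'x) \<Rightarrow> 'a list \<Rightarrow> 'x \<Rightarrow> 'x" where
  "ev a xs = foldr (\<lambda>v f. a v \<circ> f) xs id"

lemma ev_simps [simp]: "ev a [] = id" "ev a (v # xs) = a v \<circ> ev a xs"
  by (simp_all add: ev_def)

lemma ev_append: "ev a (xs @ ys) = ev a xs \<circ> ev a ys"
  by (induction xs) (simp_all add: comp_assoc)

lemma ev_replicate: "ev a (concat (replicate n xs)) = (ev a xs) ^^ n"
  by (induction n) (simp_all add: ev_append)

text \<open>Permutations fix everything off \<open>S\<close> and names outside \<open>V\<close> act
  as \<open>id\<close>. With this normalisation equality of actions is equality of functions, which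
  is what makes the transfer below a bijection.\<close>

definition cact :: "'a set \<Rightarrow> 'a set set \<Rightarrow> ('a set \<Rightarrow> nat) \<Rightarrow> 'x set \<Rightarrow> ('a \<Rightarrow> 'x \<Rightarrow> 'x) \<Rightarrow> bool" where
  "cact V E m S a \<longleftrightarrow> finite S \<and> (\<forall>v. v \<notin> V \<longrightarrow> a v = id) \<and> (\<forall>v\<in>V. a v permutes S \<and> a v \<circ> a v = id) \<and>
     (\<forall>v w. ({v, w} \<in> E) \<longrightarrow> ((a v \<circ> a w) ^^ m {v, w}) = id)"

lemma cactD:
  assumes "cact V E m S a"
  shows "finite S" "v \<notin> V \<Longrightarrow> a v = id" "a v permutes S" "a v \<circ> a v = id"
    "{v, w} \<in> E \<Longrightarrow> (a v \<circ> a w) ^^ m {v, w} = id"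
proof -
  have c: "finite S" "\<forall>v. v \<notin> V \<longrightarrow> a v = id" "\<forall>v\<in>V. a v permutes S \<and> a v \<circ> a v = id"
    "\<forall>v w. ({v, w} \<in> E) \<longrightarrow> ((a v \<circ> a w) ^^ m {v, w}) = id"
    using assms unfolding cact_def by blast+
  show "finite S" "v \<notin> V \<Longrightarrow> a v = id" "{v, w} \<in> E \<Longrightarrow> (a v \<circ> a w) ^^ m {v, w} = id"
    using c by blast+
  show "a v permutes S" "a v \<circ> a v = id"
    using c(2,3) permutes_id[of S] by (cases "v \<in> V"; metis comp_id)+
qed

lemma cact_invol: "cact V E m S a \<Longrightarrow> a v (a v x) = x"
  using cactD(4)[of V E m S a v] by (metis comp_apply id_apply)

lemma cact_ext:
  assumes "cact V E m S a" "cact V E m S b" "\<And>v. v \<in> V \<Longrightarrow> a v = b v"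
  shows "a = b"
proof
  fix v show "a v = b v"
    by (cases "v \<in> V") (simp_all add: assms(3) cactD(2)[OF assms(1)] cactD(2)[OF assms(2)])
qed

lemma ev_permutes: "cact V E m S a \<Longrightarrow> ev a xs permutes S"
  by (induction xs) (auto simp: permutes_id intro: permutes_compose cactD(3))

lemma ev_rev: "cact V E m S a \<Longrightarrow> ev a (rev xs) \<circ> ev a xs = id"
proof (induction xs)
  case (Cons v xs)
  have "ev a (rev (v # xs)) \<circ> ev a (v # xs) = ev a (rev xs) \<circ> (a v \<circ> a v) \<circ> ev a xs"
    by (simp add: ev_append comp_assoc)
  then show ?case using Cons cactD(4) by (metis comp_id)
qed simp

lemma ev_rev': "cact V E m S a \<Longrightarrow> ev a xs \<circ> ev a (rev xs) = id"
  using ev_rev[of V E m S a "rev xs"] by simp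

lemma coxeq_ev: "coxeq V E m xs ys \<Longrightarrow> cact V E m S a \<Longrightarrow> ev a xs = ev a ys"
proof (induction rule: coxeq.induct)
  case (invol v)
  then show ?case by (simp add: cactD(4))
next
  case (braid v w)
  then show ?case by (simp add: ev_replicate cactD(5))
qed (simp_all add: ev_append)

text \<open>Brings a family of maps that is meaningful only on \<open>S\<close> into the normalised
  shape of \<open>cact\<close>.\<close>

definition mk :: "'a set \<Rightarrow> 'x set \<Rightarrow> ('a \<Rightarrow> 'x \<Rightarrow> 'x) \<Rightarrow> 'a \<Rightarrow> 'x \<Rightarrow> 'x" where
  "mk V S a = (\<lambda>v. if v \<in> V then (\<lambda>x. if x \<in> S then a v x else x) else id)"

lemma mk_apply: "v \<in> V \<Longrightarrow> x \<in> S \<Longrightarrow> mk V S a v x = a v x"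
  by (simp add: mk_def)

lemma mk_funpow:
  assumes "v \<in> V" "w \<in> V" "\<And>v x. v \<in> V \<Longrightarrow> x \<in> S \<Longrightarrow> a v x \<in> S" "x \<in> S"
  shows "((mk V S a v \<circ> mk V S a w) ^^ n) x = ((a v \<circ> a w) ^^ n) x \<and> ((a v \<circ> a w) ^^ n) x \<in> S"
  by (induction n) (use assms in \<open>simp_all add: mk_apply\<close>)

lemma cact_mk:
  assumes "finite S" and cl: "\<And>v x. v \<in> V \<Longrightarrow> x \<in> S \<Longrightarrow> a v x \<in> S"
    and inv: "\<And>v x. v \<in> V \<Longrightarrow> x \<in> S \<Longrightarrow> a v (a v x) = x"
    and rel: "\<And>v w x. {v, w} \<in> E \<Longrightarrow> x \<in> S \<Longrightarrow> ((a v \<circ> a w) ^^ m {v, w}) x = x"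
    and edges: "\<And>v w. {v, w} \<in> E \<Longrightarrow> v \<in> V \<and> w \<in> V"
  shows "cact V E m S (mk V S a)"
proof -
  have outs: "mk V S a v x = x" if "x \<notin> S" for v x using that by (simp add: mk_def)
  have io: "mk V S a v (mk V S a v x) = x" for v x
    by (cases "v \<in> V \<and> x \<in> S") (auto simp: mk_def cl inv)
  have ioo: "mk V S a v \<circ> mk V S a v = id" for v using io by (auto simp: fun_eq_iff)
  have pe: "mk V S a v permutes S" for v
  proof (rule bij_imp_permutes)
    show "bij_betw (mk V S a v) S S"
      by (rule bij_betw_byWitness[where f' = "mk V S a v"]) (use io cl in \<open>auto simp: mk_def\<close>)
  qed (use outs in blast)
  have br: "(mk V S a v \<circ> mk V S a w) ^^ m {v, w} = id" if e: "{v, w} \<in> E" for v w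
  proof
    fix x
    show "((mk V S a v \<circ> mk V S a w) ^^ m {v, w}) x = id x"
    proof (cases "x \<in> S")
      case True
      then show ?thesis using mk_funpow[of v V w S a x "m {v, w}"] edges[OF e] cl rel[OF e] by simp
    next
      case False
      have "((mk V S a v \<circ> mk V S a w) ^^ n) x = x" for n by (induction n) (use outs False in auto)
      then show ?thesis by simp
    qed
  qed
  have out: "mk V S a v = id" if "v \<notin> V" for v using that by (simp add: mk_def)
  show ?thesis unfolding cact_def using assms(1) pe ioo br out by blast
qed

lemma ev_mk:
  assumes "set xs \<subseteq> V" "x \<in> S" "\<And>v x. v \<in> V \<Longrightarrow> x \<in> S \<Longrightarrow> a v x \<in> S"
  shows "ev (mk V S a) xs x = ev a xs x \<and> ev a xs x \<in> S"
  using assms(1) by (induction xs) (use assms in \<open>simp_all add: mk_apply\<close>)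

definition perm_group :: "'x set \<Rightarrow> ('x \<Rightarrow> 'x) monoid" where
  "perm_group S = \<lparr>carrier = {p. p permutes S}, monoid.mult = (\<circ>), one = id\<rparr>"

lemma perm_group_group: "group (perm_group S)"
proof (rule groupI)
  fix p assume "p \<in> carrier (perm_group S)"
  then show "\<exists>q\<in>carrier (perm_group S). q \<otimes>\<^bsub>perm_group S\<^esub> p = \<one>\<^bsub>perm_group S\<^esub>"
    by (intro bexI[of _ "inv_into UNIV p"]) (auto simp: perm_group_def permutes_inv permutes_inv_o)
qed (auto simp: perm_group_def permutes_id permutes_compose comp_assoc)

section \<open>The group of classes of words\<close>

lemma coxeq_cong:
  assumes "coxeq V E m xs xs'" "coxeq V E m ys ys'" "set xs' \<subseteq> V" "set ys \<subseteq> V"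
  shows "coxeq V E m (xs @ ys) (xs' @ ys')"
proof -
  have "coxeq V E m ([] @ xs @ ys) ([] @ xs' @ ys)" using assms by (intro coxeq.ctx) auto
  moreover have "coxeq V E m (xs' @ ys @ []) (xs' @ ys' @ [])" using assms by (intro coxeq.ctx) auto
  ultimately show ?thesis by (auto intro: coxeq.trans)
qed

lemma coxeq_rev: "set xs \<subseteq> V \<Longrightarrow> coxeq V E m (rev xs @ xs) []"
proof (induction xs)
  case (Cons v xs)
  have "coxeq V E m (rev xs @ [v, v] @ xs) (rev xs @ [] @ xs)"
    using Cons.prems by (intro coxeq.ctx coxeq.invol) auto
  then show ?case using Cons by (auto intro: coxeq.trans)
qed (simp add: coxeq.refl)

lemma cox_class_eq_iff:
  assumes "set xs \<subseteq> V" "set ys \<subseteq> V"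
  shows "cox_class V E m xs = cox_class V E m ys \<longleftrightarrow> coxeq V E m xs ys"
proof
  assume "cox_class V E m xs = cox_class V E m ys"
  then have "xs \<in> cox_class V E m ys" using assms by (auto simp: cox_class_def coxeq.refl)
  then show "coxeq V E m xs ys" by (auto simp: cox_class_def intro: coxeq.sym)
qed (auto simp: cox_class_def intro: coxeq.sym coxeq.trans)

lemma cox_class_some:
  assumes "set xs \<subseteq> V"
  shows "set (SOME ys. ys \<in> cox_class V E m xs) \<subseteq> V" "coxeq V E m xs (SOME ys. ys \<in> cox_class V E m xs)"
proof -
  have "xs \<in> cox_class V E m xs" using assms by (simp add: cox_class_def coxeq.refl)
  then have "(SOME ys. ys \<in> cox_class V E m xs) \<in> cox_class V E m xs" by (rule someI)
  then show "set (SOME ys. ys \<in> cox_class V E m xs) \<subseteq> V" "coxeq V E m xs (SOME ys. ys \<in> cox_class V E m xs)"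
    by (auto simp: cox_class_def)
qed

text \<open>Multiplication is defined through chosen representatives; \<open>coxeq_cong\<close>
  makes the choice irrelevant.\<close>

lemma cox_mult:
  assumes "set xs \<subseteq> V" "set ys \<subseteq> V"
  shows "cox_class V E m xs \<otimes>\<^bsub>coxeter_group V E m\<^esub> cox_class V E m ys = cox_class V E m (xs @ ys)"
proof -
  let ?x = "SOME zs. zs \<in> cox_class V E m xs" and ?y = "SOME zs. zs \<in> cox_class V E m ys"
  note x = cox_class_some[OF assms(1), of E m] and y = cox_class_some[OF assms(2), of E m]
  have "coxeq V E m (xs @ ys) (?x @ ?y)" using coxeq_cong[OF x(2) y(2)] x(1) assms(2) by blast
  then have "cox_class V E m (?x @ ?y) = cox_class V E m (xs @ ys)"
    using cox_class_eq_iff[of "?x @ ?y" V "xs @ ys" E m] x(1) y(1) assms by (auto intro: coxeq.sym)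
  then show ?thesis by (simp add: coxeter_group_def)
qed

lemma cox_carrier: "g \<in> carrier (coxeter_group V E m) \<longleftrightarrow> (\<exists>xs. set xs \<subseteq> V \<and> g = cox_class V E m xs)"
  by (auto simp: coxeter_group_def)

lemma cox_one: "\<one>\<^bsub>coxeter_group V E m\<^esub> = cox_class V E m []"
  by (simp add: coxeter_group_def)

lemma coxeter_group_group: "group (coxeter_group V E m)"
proof (rule groupI)
  fix g h assume "g \<in> carrier (coxeter_group V E m)" "h \<in> carrier (coxeter_group V E m)"
  then obtain xs ys where "set xs \<subseteq> V" "set ys \<subseteq> V" "g = cox_class V E m xs" "h = cox_class V E m ys"
    by (auto simp: cox_carrier)
  then show "g \<otimes>\<^bsub>coxeter_group V E m\<^esub> h \<in> carrier (coxeter_group V E m)"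
    by (auto simp: cox_carrier cox_mult intro!: exI[of _ "xs @ ys"])
next
  show "\<one>\<^bsub>coxeter_group V E m\<^esub> \<in> carrier (coxeter_group V E m)"
    by (auto simp: cox_carrier cox_one intro!: exI[of _ "[]"])
next
  fix g h k assume "g \<in> carrier (coxeter_group V E m)" "h \<in> carrier (coxeter_group V E m)" "k \<in> carrier (coxeter_group V E m)"
  then obtain xs ys zs where "set xs \<subseteq> V" "set ys \<subseteq> V" "set zs \<subseteq> V"
    "g = cox_class V E m xs" "h = cox_class V E m ys" "k = cox_class V E m zs"
    by (auto simp: cox_carrier)
  then show "g \<otimes>\<^bsub>coxeter_group V E m\<^esub> h \<otimes>\<^bsub>coxeter_group V E m\<^esub> k = g \<otimes>\<^bsub>coxeter_group V E m\<^esub> (h \<otimes>\<^bsub>coxeter_group V E m\<^esub> k)"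
    by (simp add: cox_mult)
next
  fix g assume "g \<in> carrier (coxeter_group V E m)"
  then obtain xs where xs: "set xs \<subseteq> V" "g = cox_class V E m xs" by (auto simp: cox_carrier)
  then show "\<one>\<^bsub>coxeter_group V E m\<^esub> \<otimes>\<^bsub>coxeter_group V E m\<^esub> g = g"
    by (simp add: cox_one cox_mult)
  show "\<exists>h\<in>carrier (coxeter_group V E m). h \<otimes>\<^bsub>coxeter_group V E m\<^esub> g = \<one>\<^bsub>coxeter_group V E m\<^esub>"
  proof
    show "cox_class V E m (rev xs) \<in> carrier (coxeter_group V E m)"
      unfolding cox_carrier by (intro exI[of _ "rev xs"]) (use xs in simp)
    show "cox_class V E m (rev xs) \<otimes>\<^bsub>coxeter_group V E m\<^esub> g = \<one>\<^bsub>coxeter_group V E m\<^esub>"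
      using xs coxeq_rev[OF xs(1), of E m] by (simp add: cox_one cox_mult cox_class_eq_iff)
  qed
qed

lemma cox_inv:
  assumes "set xs \<subseteq> V"
  shows "inv\<^bsub>coxeter_group V E m\<^esub> cox_class V E m xs = cox_class V E m (rev xs)"
proof (rule group.inv_equality[OF coxeter_group_group])
  show "cox_class V E m (rev xs) \<otimes>\<^bsub>coxeter_group V E m\<^esub> cox_class V E m xs = \<one>\<^bsub>coxeter_group V E m\<^esub>"
    using assms coxeq_rev[OF assms, of E m] by (simp add: cox_mult cox_one cox_class_eq_iff)
next
  show "cox_class V E m (rev xs) \<in> carrier (coxeter_group V E m)"
    unfolding cox_carrier by (intro exI[of _ "rev xs"]) (use assms in simp)
  show "cox_class V E m xs \<in> carrier (coxeter_group V E m)"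
    unfolding cox_carrier by (intro exI[of _ xs]) (use assms in simp)
qed

section \<open>Transfer of finite actions along a profinite isomorphism\<close>

definition act_kernel :: "'a set \<Rightarrow> 'a set set \<Rightarrow> ('a set \<Rightarrow> nat) \<Rightarrow> ('a \<Rightarrow> 'x \<Rightarrow> 'x) \<Rightarrow> 'a list set set" where
  "act_kernel V E m a = {cox_class V E m xs | xs. set xs \<subseteq> V \<and> ev a xs = id}"

definition completion_emb :: "('g, 'y) monoid_scheme \<Rightarrow> 'g \<Rightarrow> 'g set \<Rightarrow> 'g set" where
  "completion_emb G g = (\<lambda>N. if N \<in> fin_index_normals G then N #>\<^bsub>G\<^esub> g else undefined)"

text \<open>The continuous extension of an action to the completion: the coordinate at the kernel of
  the action is a coset, and all words in it act alike.\<close>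

definition hat :: "'a set \<Rightarrow> 'a set set \<Rightarrow> ('a set \<Rightarrow> nat) \<Rightarrow> ('a \<Rightarrow> 'x \<Rightarrow> 'x) \<Rightarrow> ('a list set set \<Rightarrow> 'a list set set) \<Rightarrow> 'x \<Rightarrow> 'x" where
  "hat V E m a z = ev a (SOME xs. set xs \<subseteq> V \<and> cox_class V E m xs \<in> z (act_kernel V E m a))"

lemma completion_emb_carrier:
  assumes "group G" "g \<in> carrier G"
  shows "completion_emb G g \<in> carrier (profinite_completion G)"
proof -
  interpret group G by fact
  have "N #>\<^bsub>G\<^esub> g \<in> rcosets\<^bsub>G\<^esub> N" if "N \<in> fin_index_normals G" for N
    using that assms(2) by (auto simp: fin_index_normals_def RCOSETS_def)
  moreover have "N #>\<^bsub>G\<^esub> g \<subseteq> M #>\<^bsub>G\<^esub> g" if "N \<subseteq> M" for N M using that by (auto simp: r_coset_def)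
  ultimately show ?thesis by (auto simp: profinite_completion_def completion_emb_def)
qed

lemma completion_emb_mult:
  assumes "group G" "g \<in> carrier G" "h \<in> carrier G"
  shows "completion_emb G g \<otimes>\<^bsub>profinite_completion G\<^esub> completion_emb G h = completion_emb G (g \<otimes>\<^bsub>G\<^esub> h)"
  using assms normal.rcos_sum[of _ G g h]
  by (auto simp: profinite_completion_def completion_emb_def fin_index_normals_def fun_eq_iff)

lemma completion_mult_closed:
  assumes "group G" "y \<in> carrier (profinite_completion G)" "z \<in> carrier (profinite_completion G)"
  shows "y \<otimes>\<^bsub>profinite_completion G\<^esub> z \<in> carrier (profinite_completion G)"
proof -
  have "y N <#>\<^bsub>G\<^esub> z N \<in> rcosets\<^bsub>G\<^esub> N" if N: "N \<in> fin_index_normals G" for N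
  proof -
    have n: "N \<lhd> G" using N by (simp add: fin_index_normals_def)
    have "y N \<in> rcosets\<^bsub>G\<^esub> N" "z N \<in> rcosets\<^bsub>G\<^esub> N" using assms N by (auto simp: profinite_completion_def)
    then obtain g h where gh: "g \<in> carrier G" "h \<in> carrier G" "y N = N #>\<^bsub>G\<^esub> g" "z N = N #>\<^bsub>G\<^esub> h"
      by (auto simp: RCOSETS_def)
    then have "y N <#>\<^bsub>G\<^esub> z N = N #>\<^bsub>G\<^esub> (g \<otimes>\<^bsub>G\<^esub> h)" using normal.rcos_sum[OF n] by simp
    moreover have "g \<otimes>\<^bsub>G\<^esub> h \<in> carrier G" using gh assms(1) by (simp add: group.is_monoid monoid.m_closed)
    ultimately show ?thesis by (auto simp: RCOSETS_def)
  qed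
  moreover have "y N <#>\<^bsub>G\<^esub> z N \<subseteq> y M <#>\<^bsub>G\<^esub> z M" if "N \<in> fin_index_normals G" "M \<in> fin_index_normals G" "N \<subseteq> M" for N M
  proof -
    have "y N \<subseteq> y M" "z N \<subseteq> z M" using assms that by (auto simp: profinite_completion_def)
    then show ?thesis unfolding set_mult_def by blast
  qed
  ultimately show ?thesis by (simp add: profinite_completion_def)
qed

text \<open>The cosets of the kernel correspond to the permutations in the image, and a finite set
  has finitely many permutations.\<close>

lemma act_kernel_fin_index:
  assumes a: "cact V E m S a"
  shows "act_kernel V E m a \<in> fin_index_normals (coxeter_group V E m)"
proof -
  let ?W = "coxeter_group V E m" and ?P = "perm_group S" and ?N = "act_kernel V E m a"
  interpret W: group ?W by (rule coxeter_group_group)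
  interpret P: group ?P by (rule perm_group_group)
  define h where "h = (\<lambda>A. ev a (SOME xs. xs \<in> A))"
  have h: "h (cox_class V E m xs) = ev a xs" if "set xs \<subseteq> V" for xs
    unfolding h_def using coxeq_ev[OF cox_class_some(2)[OF that, of E m] a] by simp
  have hom: "h \<in> hom ?W ?P"
  proof (rule homI)
    fix g assume "g \<in> carrier ?W"
    then obtain xs where "set xs \<subseteq> V" "g = cox_class V E m xs" by (auto simp: cox_carrier)
    then show "h g \<in> carrier ?P" using ev_permutes[OF a] by (simp add: h perm_group_def)
  next
    fix g k assume "g \<in> carrier ?W" "k \<in> carrier ?W"
    then obtain xs ys where "set xs \<subseteq> V" "g = cox_class V E m xs" "set ys \<subseteq> V" "k = cox_class V E m ys"
      by (auto simp: cox_carrier)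
    then show "h (g \<otimes>\<^bsub>?W\<^esub> k) = h g \<otimes>\<^bsub>?P\<^esub> h k" by (simp add: h cox_mult ev_append perm_group_def)
  qed
  interpret h: group_hom ?W ?P h by unfold_locales (rule hom)
  have ker: "?N = kernel ?W ?P h"
    unfolding act_kernel_def kernel_def cox_carrier by (auto simp: h perm_group_def)
  have n: "?N \<lhd> ?W" unfolding ker by (rule h.normal_kernel)
  have "finite (h ` carrier ?W)"
  proof (rule finite_subset)
    show "h ` carrier ?W \<subseteq> {p. p permutes S}" using h.hom_closed by (auto simp: perm_group_def)
    show "finite {p. p permutes S}" using cactD(1)[OF a] by (rule finite_permutations)
  qed
  moreover have "rcosets\<^bsub>?W\<^esub> ?N \<subseteq> (\<lambda>p. {g \<in> carrier ?W. h g = p}) ` h ` carrier ?W"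
  proof
    fix C assume "C \<in> rcosets\<^bsub>?W\<^esub> ?N"
    then obtain g where g: "g \<in> carrier ?W" "C = ?N #>\<^bsub>?W\<^esub> g" by (auto simp: RCOSETS_def)
    have "C = {k \<in> carrier ?W. h k = h g}"
    proof (intro equalityI subsetI)
      fix k assume "k \<in> C"
      then show "k \<in> {k \<in> carrier ?W. h k = h g}" using g by (auto simp: ker kernel_def r_coset_def)
    next
      fix k assume k: "k \<in> {k \<in> carrier ?W. h k = h g}"
      then have "k \<otimes>\<^bsub>?W\<^esub> inv\<^bsub>?W\<^esub> g \<in> ?N" using g by (simp add: ker kernel_def)
      moreover have "k = (k \<otimes>\<^bsub>?W\<^esub> inv\<^bsub>?W\<^esub> g) \<otimes>\<^bsub>?W\<^esub> g" using k g by (simp add: W.m_assoc)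
      ultimately show "k \<in> C" unfolding g(2) r_coset_def by blast
    qed
    then show "C \<in> (\<lambda>p. {g \<in> carrier ?W. h g = p}) ` h ` carrier ?W" using g by blast
  qed
  ultimately have "finite (rcosets\<^bsub>?W\<^esub> ?N)" by (meson finite_imageI finite_subset)
  with n show ?thesis by (simp add: fin_index_normals_def)
qed

lemma act_kernel_iff:
  assumes "cact V E m S a" "set xs \<subseteq> V"
  shows "cox_class V E m xs \<in> act_kernel V E m a \<longleftrightarrow> ev a xs = id"
proof
  assume "cox_class V E m xs \<in> act_kernel V E m a"
  then obtain ys where "set ys \<subseteq> V" "ev a ys = id" "cox_class V E m xs = cox_class V E m ys"
    by (auto simp: act_kernel_def)
  then show "ev a xs = id" using assms coxeq_ev[OF _ assms(1), of xs ys] by (simp add: cox_class_eq_iff)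
qed (use assms in \<open>auto simp: act_kernel_def\<close>)

lemma completion_word:
  assumes "z \<in> carrier (profinite_completion (coxeter_group V E m))" "N \<in> fin_index_normals (coxeter_group V E m)"
  obtains xs where "set xs \<subseteq> V" "cox_class V E m xs \<in> z N" "z N = N #>\<^bsub>coxeter_group V E m\<^esub> cox_class V E m xs"
proof -
  interpret group "coxeter_group V E m" by (rule coxeter_group_group)
  have "z N \<in> rcosets\<^bsub>coxeter_group V E m\<^esub> N" using assms by (auto simp: profinite_completion_def)
  then obtain xs where xs: "set xs \<subseteq> V" "z N = N #>\<^bsub>coxeter_group V E m\<^esub> cox_class V E m xs"
    by (auto simp: RCOSETS_def cox_carrier)
  moreover have "cox_class V E m xs \<in> N #>\<^bsub>coxeter_group V E m\<^esub> cox_class V E m xs"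
    by (rule rcos_self) (use xs assms in \<open>auto simp: cox_carrier fin_index_normals_def normal_imp_subgroup\<close>)
  ultimately show ?thesis using that by simp
qed

lemma coset_ev_eq:
  assumes a: "cact V E m S a" and xs: "set xs \<subseteq> V" and ys: "set ys \<subseteq> V"
    and "cox_class V E m ys \<in> act_kernel V E m a #>\<^bsub>coxeter_group V E m\<^esub> cox_class V E m xs"
  shows "ev a ys = ev a xs"
proof -
  obtain zs where zs: "set zs \<subseteq> V" "ev a zs = id" "cox_class V E m ys = cox_class V E m (zs @ xs)"
    using assms(4) by (auto simp: r_coset_def act_kernel_def cox_mult xs)
  then have "coxeq V E m ys (zs @ xs)" using cox_class_eq_iff[of ys V "zs @ xs" E m] xs ys by simp
  then show ?thesis using coxeq_ev[OF _ a] zs by (simp add: ev_append)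
qed

lemma hat_eq:
  assumes a: "cact V E m S a" and z: "z \<in> carrier (profinite_completion (coxeter_group V E m))"
    and xs: "set xs \<subseteq> V" "cox_class V E m xs \<in> z (act_kernel V E m a)"
  shows "hat V E m a z = ev a xs"
proof -
  let ?ys = "SOME xs. set xs \<subseteq> V \<and> cox_class V E m xs \<in> z (act_kernel V E m a)"
  obtain zs where zs: "set zs \<subseteq> V"
    "z (act_kernel V E m a) = act_kernel V E m a #>\<^bsub>coxeter_group V E m\<^esub> cox_class V E m zs"
    using completion_word[OF z act_kernel_fin_index[OF a]] by metis
  have ys: "set ?ys \<subseteq> V \<and> cox_class V E m ?ys \<in> z (act_kernel V E m a)"
    by (rule someI[of _ xs]) (use xs in simp)
  have "ev a ?ys = ev a zs" by (rule coset_ev_eq[OF a zs(1)]) (use ys zs in auto)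
  moreover have "ev a xs = ev a zs" by (rule coset_ev_eq[OF a zs(1)]) (use xs zs in auto)
  ultimately show ?thesis by (simp add: hat_def)
qed

text \<open>The coordinates of an element of the completion are compatible, so a word read off at
  any smaller normal subgroup may replace one read off at the kernel. This is how one word is made
  to serve several actions.\<close>

lemma hat_approx:
  assumes a: "cact V E m S a" and z: "z \<in> carrier (profinite_completion (coxeter_group V E m))"
    and N: "N \<in> fin_index_normals (coxeter_group V E m)" "N \<subseteq> act_kernel V E m a"
    and xs: "set xs \<subseteq> V" "cox_class V E m xs \<in> z N"
  shows "hat V E m a z = ev a xs"
proof (rule hat_eq[OF a z xs(1)])
  show "cox_class V E m xs \<in> z (act_kernel V E m a)"
  proof -
    have "\<forall>N\<in>fin_index_normals (coxeter_group V E m). \<forall>M\<in>fin_index_normals (coxeter_group V E m). N \<subseteq> M \<longrightarrow> z N \<subseteq> z M"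
      using z by (simp add: profinite_completion_def)
    then show ?thesis using N act_kernel_fin_index[OF a] xs(2) by blast
  qed
qed

text \<open>The product action. Its kernel lies in both kernels when the sets are non-empty, so a
  word approximating in the product approximates in each factor.\<close>

definition pact :: "'x set \<Rightarrow> 'y set \<Rightarrow> 'a set \<Rightarrow> ('a \<Rightarrow> 'x \<Rightarrow> 'x) \<Rightarrow> ('a \<Rightarrow> 'y \<Rightarrow> 'y) \<Rightarrow> 'a \<Rightarrow> 'x \<times> 'y \<Rightarrow> 'x \<times> 'y" where
  "pact S U V a b = mk V (S \<times> U) (\<lambda>v. map_prod (a v) (b v))"

lemma cact_in: "cact V E m S a \<Longrightarrow> x \<in> S \<Longrightarrow> a v x \<in> S"
  using cactD(3) permutes_in_image by metis

lemma ev_in: "cact V E m S a \<Longrightarrow> x \<in> S \<Longrightarrow> ev a xs x \<in> S"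
  using ev_permutes permutes_in_image by metis

lemma cact_pact:
  assumes a: "cact V E m S a" and b: "cact V E m U b" and edges: "\<And>v w. {v, w} \<in> E \<Longrightarrow> v \<in> V \<and> w \<in> V"
  shows "cact V E m (S \<times> U) (pact S U V a b)"
  unfolding pact_def
proof (rule cact_mk)
  show "finite (S \<times> U)" using cactD(1)[OF a] cactD(1)[OF b] by simp
next
  fix v x assume "x \<in> S \<times> U"
  then show "map_prod (a v) (b v) x \<in> S \<times> U" using cact_in[OF a] cact_in[OF b] by auto
next
  fix v x show "map_prod (a v) (b v) (map_prod (a v) (b v) x) = x"
    by (cases x) (simp add: cact_invol[OF a] cact_invol[OF b])
next
  fix v w x assume e: "{v, w} \<in> E"
  have "((map_prod (a v) (b v) \<circ> map_prod (a w) (b w)) ^^ n) (s, u) = (((a v \<circ> a w) ^^ n) s, ((b v \<circ> b w) ^^ n) u)" for n s u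
    by (induction n) auto
  then show "((map_prod (a v) (b v) \<circ> map_prod (a w) (b w)) ^^ m {v, w}) x = x"
    using cactD(5)[OF a e] cactD(5)[OF b e] by (cases x) simp
qed (use edges in auto)

lemma ev_pact:
  assumes a: "cact V E m S a" and b: "cact V E m U b" and "set xs \<subseteq> V" "s \<in> S" "u \<in> U"
  shows "ev (pact S U V a b) xs (s, u) = (ev a xs s, ev b xs u)"
proof -
  have "ev (pact S U V a b) xs (s, u) = ev (\<lambda>v. map_prod (a v) (b v)) xs (s, u)"
    unfolding pact_def using assms cact_in[OF a] cact_in[OF b] ev_mk[of xs V "(s, u)" "S \<times> U" "\<lambda>v. map_prod (a v) (b v)"] by auto
  also have "\<dots> = (ev a xs s, ev b xs u)" by (induction xs) auto
  finally show ?thesis .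
qed

lemma hat_permutes:
  assumes a: "cact V E m S a" and z: "z \<in> carrier (profinite_completion (coxeter_group V E m))"
  shows "hat V E m a z permutes S"
  unfolding hat_def by (rule ev_permutes[OF a])

lemma hat_mult:
  assumes a: "cact V E m S a" and y: "y \<in> carrier (profinite_completion (coxeter_group V E m))"
    and z: "z \<in> carrier (profinite_completion (coxeter_group V E m))"
  shows "hat V E m a (y \<otimes>\<^bsub>profinite_completion (coxeter_group V E m)\<^esub> z) = hat V E m a y \<circ> hat V E m a z"
proof -
  note K = act_kernel_fin_index[OF a]
  obtain xs where xs: "set xs \<subseteq> V" "cox_class V E m xs \<in> y (act_kernel V E m a)" using completion_word[OF y K] by metis
  obtain ys where ys: "set ys \<subseteq> V" "cox_class V E m ys \<in> z (act_kernel V E m a)" using completion_word[OF z K] by metis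
  have "cox_class V E m (xs @ ys) \<in> (y \<otimes>\<^bsub>profinite_completion (coxeter_group V E m)\<^esub> z) (act_kernel V E m a)"
  proof -
    have "cox_class V E m xs \<otimes>\<^bsub>coxeter_group V E m\<^esub> cox_class V E m ys \<in> y (act_kernel V E m a) <#>\<^bsub>coxeter_group V E m\<^esub> z (act_kernel V E m a)"
      using xs(2) ys(2) unfolding set_mult_def by blast
    then show ?thesis using K by (simp add: profinite_completion_def cox_mult[OF xs(1) ys(1)])
  qed
  then have "hat V E m a (y \<otimes>\<^bsub>profinite_completion (coxeter_group V E m)\<^esub> z) = ev a (xs @ ys)"
    using xs ys by (intro hat_eq[OF a] completion_mult_closed coxeter_group_group y z) auto
  then show ?thesis using hat_eq[OF a y xs] hat_eq[OF a z ys] by (simp add: ev_append)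
qed

lemma hat_emb:
  assumes a: "cact V E m S a" and xs: "set xs \<subseteq> V"
  shows "hat V E m a (completion_emb (coxeter_group V E m) (cox_class V E m xs)) = ev a xs"
proof -
  interpret group "coxeter_group V E m" by (rule coxeter_group_group)
  have c: "cox_class V E m xs \<in> carrier (coxeter_group V E m)" using xs by (auto simp: cox_carrier)
  show ?thesis
  proof (rule hat_eq[OF a _ xs])
    show "completion_emb (coxeter_group V E m) (cox_class V E m xs) \<in> carrier (profinite_completion (coxeter_group V E m))"
      by (rule completion_emb_carrier[OF coxeter_group_group c])
    have K: "act_kernel V E m a \<in> fin_index_normals (coxeter_group V E m)" by (rule act_kernel_fin_index[OF a])
    then have "subgroup (act_kernel V E m a) (coxeter_group V E m)" by (simp add: fin_index_normals_def normal_imp_subgroup)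
    then show "cox_class V E m xs \<in> completion_emb (coxeter_group V E m) (cox_class V E m xs) (act_kernel V E m a)"
      using K rcos_self[OF c] by (simp add: completion_emb_def)
  qed
qed

text \<open>\<open>\<phi>\<close> leads from the completion of the primed group to that of the
  unprimed one. Actions are pulled back along it, so \<open>T\<close> turns an action of the
  unprimed group into one of the primed group on the same set.\<close>

locale transfer =
  fixes V :: "'a set" and E :: "'a set set" and m :: "'a set \<Rightarrow> nat"
    and V' :: "'b set" and E' :: "'b set set" and m' :: "'b set \<Rightarrow> nat"
    and \<phi> :: "('b list set set \<Rightarrow> 'b list set set) \<Rightarrow> ('a list set set \<Rightarrow> 'a list set set)"
  assumes \<phi>_hom: "\<phi> \<in> hom (profinite_completion (coxeter_group V' E' m')) (profinite_completion (coxeter_group V E m))"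
    and \<phi>_cont: "completion_continuous (coxeter_group V' E' m') (coxeter_group V E m) \<phi>"
    and edges: "\<And>v w. {v, w} \<in> E \<Longrightarrow> v \<in> V \<and> w \<in> V"
    and edges': "\<And>v w. {v, w} \<in> E' \<Longrightarrow> v \<in> V' \<and> w \<in> V'"
begin

abbreviation "W \<equiv> coxeter_group V E m"
abbreviation "W' \<equiv> coxeter_group V' E' m'"

definition \<theta> :: "'b list \<Rightarrow> 'a list set set \<Rightarrow> 'a list set set" where
  "\<theta> xs = \<phi> (completion_emb W' (cox_class V' E' m' xs))"

definition T :: "('a \<Rightarrow> 'x \<Rightarrow> 'x) \<Rightarrow> 'b \<Rightarrow> 'x \<Rightarrow> 'x" where
  "T a = (\<lambda>s. if s \<in> V' then hat V E m a (\<theta> [s]) else id)"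

lemma emb': "set xs \<subseteq> V' \<Longrightarrow> completion_emb W' (cox_class V' E' m' xs) \<in> carrier (profinite_completion W')"
  by (rule completion_emb_carrier[OF coxeter_group_group]) (auto simp: cox_carrier)

lemma \<phi>_carrier: "z \<in> carrier (profinite_completion W') \<Longrightarrow> \<phi> z \<in> carrier (profinite_completion W)"
  using \<phi>_hom by (auto simp: hom_def)

lemma \<theta>_carrier: "set xs \<subseteq> V' \<Longrightarrow> \<theta> xs \<in> carrier (profinite_completion W)"
  unfolding \<theta>_def by (intro \<phi>_carrier emb')

lemma hat_\<theta>_append:
  assumes a: "cact V E m S a" and "set xs \<subseteq> V'" "set ys \<subseteq> V'"
  shows "hat V E m a (\<theta> (xs @ ys)) = hat V E m a (\<theta> xs) \<circ> hat V E m a (\<theta> ys)"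
proof -
  have c: "cox_class V' E' m' xs \<in> carrier W'" "cox_class V' E' m' ys \<in> carrier W'"
    using assms by (auto simp: cox_carrier)
  have "\<theta> (xs @ ys) = \<theta> xs \<otimes>\<^bsub>profinite_completion W\<^esub> \<theta> ys"
    unfolding \<theta>_def using assms(2,3) hom_mult[OF \<phi>_hom emb' emb', of xs ys]
    by (simp add: completion_emb_mult[OF coxeter_group_group c] cox_mult)
  then show ?thesis using hat_mult[OF a \<theta>_carrier \<theta>_carrier] assms by simp
qed

lemma hat_\<theta>_Nil:
  assumes a: "cact V E m S a"
  shows "hat V E m a (\<theta> []) = id"
proof -
  let ?p = "hat V E m a (\<theta> [])"
  have p: "?p permutes S" by (rule hat_permutes[OF a \<theta>_carrier]) simp
  \<comment> \<open>An idempotent permutation is the identity; no computation with the unit of the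
    completion is needed.\<close>
  have "?p \<circ> ?p = ?p" using hat_\<theta>_append[OF a, of "[]" "[]"] by simp
  then have "?p (?p x) = ?p x" for x by (metis comp_apply)
  then show ?thesis using permutes_inj[OF p] by (auto simp: fun_eq_iff inj_def)
qed

lemma ev_T:
  assumes a: "cact V E m S a" and "set xs \<subseteq> V'"
  shows "ev (T a) xs = hat V E m a (\<theta> xs)"
  using assms(2)
proof (induction xs)
  case Nil
  then show ?case by (simp add: hat_\<theta>_Nil[OF a])
next
  case (Cons s xs)
  then show ?case using hat_\<theta>_append[OF a, of "[s]" xs] by (simp add: T_def)
qed

text \<open>\<open>T\<close> evaluates a word at the image of its class in the completion, and there
  every relator is already trivial.\<close>

lemma cact_T:
  assumes a: "cact V E m S a"
  shows "cact V' E' m' S (T a)"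
proof -
  have sound: "ev (T a) xs = id" if "coxeq V' E' m' xs []" "set xs \<subseteq> V'" for xs
  proof -
    have "cox_class V' E' m' xs = cox_class V' E' m' []" using that by (simp add: cox_class_eq_iff)
    then show ?thesis using ev_T[OF a that(2)] hat_\<theta>_Nil[OF a] by (simp add: \<theta>_def)
  qed
  have "T a s permutes S" for s using hat_permutes[OF a \<theta>_carrier[of "[s]"]] by (simp add: T_def permutes_id)
  moreover have "T a s \<circ> T a s = id" if "s \<in> V'" for s
    using sound[OF coxeq.invol[OF that]] that by simp
  moreover have "(T a s \<circ> T a t) ^^ m' {s, t} = id" if e: "{s, t} \<in> E'" for s t
  proof -
    have st: "s \<in> V'" "t \<in> V'" using edges'[OF e] by auto
    have "set (concat (replicate (m' {s, t}) [s, t])) \<subseteq> V'" using st by (induction "m' {s, t}") auto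
    from sound[OF coxeq.braid[OF st e] this] show ?thesis by (simp add: ev_replicate)
  qed
  moreover have "T a s = id" if "s \<notin> V'" for s using that by (simp add: T_def)
  ultimately show ?thesis using cactD(1)[OF a] unfolding cact_def by blast
qed

text \<open>Each transferred permutation is the value of a word of the unprimed group, and one word
  serves two actions at once. Properties shared by all word values, such as linearity or the
  compatibility of an affine map with its linear part, pass to \<open>T\<close> in this way.\<close>

lemma T_approx2:
  assumes a: "cact V E m S a" and b: "cact V E m U b" and ws: "set ws \<subseteq> V'"
  obtains xs where "set xs \<subseteq> V" "ev (T a) ws = ev a xs" "ev (T b) ws = ev b xs"
proof -
  note ab = cact_pact[OF a b edges]
  let ?N = "act_kernel V E m (pact S U V a b)"
  have N: "?N \<in> fin_index_normals W" by (rule act_kernel_fin_index[OF ab])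
  show ?thesis
  proof (cases "S = {} \<or> U = {}")
    \<comment> \<open>An empty factor empties the product, whose kernel then says nothing about the
      other factor. But everything acts as the identity on the empty set, so only the other action
      has to be approximated.\<close>
    case True
    then consider "S = {}" | "U = {}" by blast
    then show ?thesis
    proof cases
      case 1
      then have ai: "ev a xs = id" "ev (T a) ys = id" for xs ys
        using ev_permutes[OF a] ev_permutes[OF cact_T[OF a]] by simp_all
      obtain xs where "set xs \<subseteq> V" "cox_class V E m xs \<in> \<theta> ws (act_kernel V E m b)"
        using completion_word[OF \<theta>_carrier[OF ws] act_kernel_fin_index[OF b]] by metis
      then show ?thesis using that[of xs] ai hat_eq[OF b \<theta>_carrier[OF ws]] ev_T[OF b ws] by simp
    next
      case 2
      then have bi: "ev b xs = id" "ev (T b) ys = id" for xs ys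
        using ev_permutes[OF b] ev_permutes[OF cact_T[OF b]] by simp_all
      obtain xs where "set xs \<subseteq> V" "cox_class V E m xs \<in> \<theta> ws (act_kernel V E m a)"
        using completion_word[OF \<theta>_carrier[OF ws] act_kernel_fin_index[OF a]] by metis
      then show ?thesis using that[of xs] bi hat_eq[OF a \<theta>_carrier[OF ws]] ev_T[OF a ws] by simp
    qed
  next
    case False
    then obtain s0 u0 where su: "s0 \<in> S" "u0 \<in> U" by blast
    have "?N \<subseteq> act_kernel V E m a \<inter> act_kernel V E m b"
    proof
      fix g assume "g \<in> ?N"
      then obtain xs where xs: "set xs \<subseteq> V" "ev (pact S U V a b) xs = id" "g = cox_class V E m xs"
        by (auto simp: act_kernel_def)
      have p: "ev a xs s = s \<and> ev b xs u = u" if "s \<in> S" "u \<in> U" for s u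
        using ev_pact[OF a b xs(1) that] xs(2) by simp
      have "ev a xs = id"
        using p su permutes_not_in[OF ev_permutes[OF a]] by (metis eq_id_iff)
      moreover have "ev b xs = id"
        using p su permutes_not_in[OF ev_permutes[OF b]] by (metis eq_id_iff)
      ultimately show "g \<in> act_kernel V E m a \<inter> act_kernel V E m b" using xs by (auto simp: act_kernel_def)
    qed
    moreover obtain xs where xs: "set xs \<subseteq> V" "cox_class V E m xs \<in> \<theta> ws ?N"
      using completion_word[OF \<theta>_carrier[OF ws] N] by metis
    ultimately show ?thesis
      using that[of xs] hat_approx[OF a \<theta>_carrier[OF ws] N _ xs] hat_approx[OF b \<theta>_carrier[OF ws] N _ xs]
        ev_T[OF a ws] ev_T[OF b ws] by simp
  qed
qed

lemma T_approx:
  assumes a: "cact V E m S a" and ws: "set ws \<subseteq> V'"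
  obtains xs where "set xs \<subseteq> V" "ev (T a) ws = ev a xs"
  using T_approx2[OF a a ws] by metis

text \<open>On the image of the primed group both sides agree by construction. Continuity extends
  this to the completion: a word approximating \<open>z\<close> modulo a suitable \<open>N\<close>
  differs from \<open>z\<close> by an element that \<open>\<phi>\<close> sends into the kernel of
  the action.\<close>

lemma hat_T:
  assumes a: "cact V E m S a" and z: "z \<in> carrier (profinite_completion W')"
  shows "hat V' E' m' (T a) z = hat V E m a (\<phi> z)"
proof -
  note Ta = cact_T[OF a]
  note K = act_kernel_fin_index[OF a] and K' = act_kernel_fin_index[OF Ta]
  have idK: "hat V E m a y = id" if "y \<in> completion_kernel W (act_kernel V E m a)" for y
  proof -
    have "cox_class V E m [] \<in> act_kernel V E m a" by (simp add: act_kernel_iff[OF a])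
    then show ?thesis using that hat_eq[OF a, of y "[]"] by (simp add: completion_kernel_def)
  qed
  obtain N where N: "N \<in> fin_index_normals W'" "\<phi> ` completion_kernel W' N \<subseteq> completion_kernel W (act_kernel V E m a)"
    using \<phi>_cont K unfolding completion_continuous_def by blast
  interpret N: normal N W' using N(1) by (simp add: fin_index_normals_def)
  have NK: "N \<subseteq> act_kernel V' E' m' (T a)"
  proof
    fix g assume g: "g \<in> N"
    then obtain xs where xs: "set xs \<subseteq> V'" "g = cox_class V' E' m' xs" using g N.subset cox_carrier[of g V' E' m'] by blast
    have "completion_emb W' g \<in> completion_kernel W' N"
    proof -
      have "N #>\<^bsub>W'\<^esub> g = N" using g by (intro N.coset_join2) (auto intro: N.subgroup_axioms)
      then show ?thesis using emb'[OF xs(1)] xs(2) N(1) by (simp add: completion_kernel_def completion_emb_def)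
    qed
    then have "hat V E m a (\<theta> xs) = id" using N(2) idK xs(2) unfolding \<theta>_def by blast
    then show "g \<in> act_kernel V' E' m' (T a)" using xs ev_T[OF a xs(1)] by (auto simp: act_kernel_def)
  qed
  obtain xs where xs: "set xs \<subseteq> V'" "cox_class V' E' m' xs \<in> z N" "z N = N #>\<^bsub>W'\<^esub> cox_class V' E' m' xs"
    using completion_word[OF z N(1)] by metis
  have rx: "set (rev xs) \<subseteq> V'" using xs by simp
  have c: "cox_class V' E' m' xs \<in> carrier W'" "cox_class V' E' m' (rev xs) \<in> carrier W'"
    using xs rx cox_carrier[of _ V' E' m'] by blast+
  \<comment> \<open>The error made in replacing \<open>z\<close> by the word \<open>xs\<close>; it
    lies over the trivial coset of \<open>N\<close>.\<close>
  let ?u = "completion_emb W' (cox_class V' E' m' (rev xs)) \<otimes>\<^bsub>profinite_completion W'\<^esub> z"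
  have uc: "?u \<in> carrier (profinite_completion W')"
    by (intro completion_mult_closed coxeter_group_group emb' rx z)
  have "?u N = (N #>\<^bsub>W'\<^esub> cox_class V' E' m' (rev xs)) <#>\<^bsub>W'\<^esub> (N #>\<^bsub>W'\<^esub> cox_class V' E' m' xs)"
    using N(1) xs(3) by (simp add: profinite_completion_def completion_emb_def)
  also have "\<dots> = N #>\<^bsub>W'\<^esub> (cox_class V' E' m' (rev xs) \<otimes>\<^bsub>W'\<^esub> cox_class V' E' m' xs)"
    by (rule N.rcos_sum[OF c(2,1)])
  also have "cox_class V' E' m' (rev xs) \<otimes>\<^bsub>W'\<^esub> cox_class V' E' m' xs = \<one>\<^bsub>W'\<^esub>"
    using N.l_inv[OF c(1)] by (simp add: cox_inv[OF xs(1)])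
  also have "N #>\<^bsub>W'\<^esub> \<one>\<^bsub>W'\<^esub> = N" using N.subset by (rule N.coset_mult_one)
  finally have "?u \<in> completion_kernel W' N" using uc by (simp add: completion_kernel_def)
  then have "hat V E m a (\<phi> ?u) = id" using N(2) idK by blast
  moreover have "\<phi> ?u = \<theta> (rev xs) \<otimes>\<^bsub>profinite_completion W\<^esub> \<phi> z"
    unfolding \<theta>_def by (rule hom_mult[OF \<phi>_hom emb'[OF rx] z])
  ultimately have "ev (T a) (rev xs) \<circ> hat V E m a (\<phi> z) = id"
    using hat_mult[OF a \<theta>_carrier[OF rx] \<phi>_carrier[OF z]] ev_T[OF a rx] by simp
  then have "ev (T a) xs \<circ> ev (T a) (rev xs) \<circ> hat V E m a (\<phi> z) = ev (T a) xs"
    by (simp add: comp_assoc)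
  then have "hat V E m a (\<phi> z) = ev (T a) xs" using ev_rev'[OF Ta] by simp
  then show ?thesis using hat_approx[OF Ta z N(1) NK xs(1,2)] by simp
qed

end

locale transfer_pair = F: transfer V E m V' E' m' \<phi> + B: transfer V' E' m' V E m \<psi>
  for V :: "'a set" and E m and V' :: "'b set" and E' m' \<phi> \<psi> +
  assumes \<phi>\<psi>: "z \<in> carrier (profinite_completion (coxeter_group V E m)) \<Longrightarrow> \<phi> (\<psi> z) = z"
    and \<psi>\<phi>: "y \<in> carrier (profinite_completion (coxeter_group V' E' m')) \<Longrightarrow> \<psi> (\<phi> y) = y"
begin

text \<open>The round trip evaluates a generator at \<open>\<phi>\<close> of \<open>\<psi>\<close>
  of itself. Together with \<open>flip\<close>, the actions of the two groups on a given finite set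
  correspond one to one.\<close>

lemma BF: 
  assumes a: "cact V E m S a"
  shows "B.T (F.T a) = a"
proof
  fix v
  show "B.T (F.T a) v = a v"
  proof (cases "v \<in> V")
    case True
    then have v: "set [v] \<subseteq> V" by simp
    have "B.T (F.T a) v = hat V' E' m' (F.T a) (B.\<theta> [v])" using True by (simp add: B.T_def)
    also have "\<dots> = hat V E m a (\<phi> (B.\<theta> [v]))" by (rule F.hat_T[OF a B.\<theta>_carrier[OF v]])
    also have "\<phi> (B.\<theta> [v]) = completion_emb F.W (cox_class V E m [v])"
      unfolding B.\<theta>_def by (rule \<phi>\<psi>[OF B.emb'[OF v]])
    finally show ?thesis using hat_emb[OF a v] by simp
  qed (simp add: B.T_def cactD(2)[OF a])
qed

end

lemma (in transfer_pair) flip: "transfer_pair V' E' m' V E m \<psi> \<phi>"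
  by unfold_locales (use \<phi>\<psi> \<psi>\<phi> in auto)

lemma profinite_iso_transfer:
  assumes "profinite_iso (coxeter_group V' E' m') (coxeter_group V E m)"
    and "coxeter_graph V E m" "coxeter_graph V' E' m'"
  obtains \<phi> \<psi> where "transfer_pair V E m V' E' m' \<phi> \<psi>"
proof -
  let ?C = "profinite_completion (coxeter_group V E m)" and ?C' = "profinite_completion (coxeter_group V' E' m')"
  obtain \<phi> where \<phi>: "\<phi> \<in> iso ?C' ?C" "completion_continuous (coxeter_group V' E' m') (coxeter_group V E m) \<phi>"
    "completion_continuous (coxeter_group V E m) (coxeter_group V' E' m') (inv_into (carrier ?C') \<phi>)"
    using assms(1) unfolding profinite_iso_def by blast
  let ?\<psi> = "inv_into (carrier ?C') \<phi>"
  have h: "\<phi> \<in> hom ?C' ?C" and bij: "bij_betw \<phi> (carrier ?C') (carrier ?C)" using \<phi>(1) by (auto simp: iso_def)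
  have r: "\<phi> (?\<psi> z) = z" "?\<psi> z \<in> carrier ?C'" if "z \<in> carrier ?C" for z
    using that bij by (auto simp: bij_betw_def f_inv_into_f inv_into_into)
  have l: "?\<psi> (\<phi> y) = y" if "y \<in> carrier ?C'" for y
    using that bij by (auto simp: bij_betw_def inv_into_f_f)
  have "?\<psi> \<in> hom ?C ?C'"
  proof (rule homI)
    fix y z assume "y \<in> carrier ?C" "z \<in> carrier ?C"
    then show "?\<psi> (y \<otimes>\<^bsub>?C\<^esub> z) = ?\<psi> y \<otimes>\<^bsub>?C'\<^esub> ?\<psi> z"
      using hom_mult[OF h, of "?\<psi> y" "?\<psi> z"] r l completion_mult_closed[OF coxeter_group_group, of "?\<psi> y" V' E' m' "?\<psi> z"]
      by metis
  qed (use r in auto)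
  moreover have "{v, w} \<in> E \<Longrightarrow> v \<in> V \<and> w \<in> V" for v w
    using assms(2) unfolding coxeter_graph_def by (metis doubleton_eq_iff)
  moreover have "{v, w} \<in> E' \<Longrightarrow> v \<in> V' \<and> w \<in> V'" for v w
    using assms(3) unfolding coxeter_graph_def by (metis doubleton_eq_iff)
  ultimately have "transfer_pair V E m V' E' m' \<phi> ?\<psi>"
    using h \<phi>(2,3) r l by unfold_locales auto
  then show ?thesis by (rule that)
qed

section \<open>Involutions of odd forest groups\<close>

lemma funpow_left_inverse:
  fixes f g :: "'x \<Rightarrow> 'x"
  assumes "\<And>x. f (g x) = x"
  shows "(f ^^ k) ((g ^^ k) x) = x"
proof (induction k)
  case (Suc k)
  have "(f ^^ Suc k) ((g ^^ Suc k) x) = (f ^^ k) (f (g ((g ^^ k) x)))" by (simp add: funpow_swap1[of f])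
  then show ?case using Suc assms by simp
qed simp

lemma funpow_invol_cancel:
  fixes s t :: "'x \<Rightarrow> 'x"
  assumes s: "s \<circ> s = id" and t: "t \<circ> t = id"
  shows "(s \<circ> t) ^^ k \<circ> (t \<circ> s) ^^ k = id"
proof -
  have "(s \<circ> t) ((t \<circ> s) x) = x" for x using s t by (metis comp_apply id_apply)
  from funpow_left_inverse[of "s \<circ> t" "t \<circ> s", OF this] show ?thesis by (simp add: fun_eq_iff)
qed

lemma funpow_comp_commute:
  assumes "f \<circ> g = g \<circ> f"
  shows "(f \<circ> g) ^^ k = f ^^ k \<circ> g ^^ k"
proof (induction k)
  case (Suc k)
  have c: "g \<circ> f ^^ k = f ^^ k \<circ> g"
  proof (induction k)
    case (Suc k)
    have "g \<circ> f ^^ Suc k = f \<circ> (g \<circ> f ^^ k)" using assms by (simp only: funpow.simps(2) comp_assoc[symmetric])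
    also have "\<dots> = f ^^ Suc k \<circ> g" unfolding Suc by (simp only: funpow.simps(2) comp_assoc)
    finally show ?case .
  qed simp
  have "(f \<circ> g) ^^ Suc k = f \<circ> (g \<circ> f ^^ k) \<circ> g ^^ k"
    by (simp only: funpow.simps(2) Suc comp_assoc)
  also have "\<dots> = f ^^ Suc k \<circ> g ^^ Suc k" unfolding c by (simp only: funpow.simps(2) comp_assoc)
  finally show ?case .
qed simp

text \<open>Exchanging \<open>s\<close> and \<open>t\<close> inverts
  \<open>z = (s \<circ> t) ^^ n\<close>. If \<open>z\<close> squares to the identity, it therefore
  commutes with \<open>t\<close>, and multiplying \<open>t\<close> by \<open>z\<close> replaces
  \<open>z\<close> by \<open>z ^^ (n + 1)\<close>, which is trivial since \<open>n + 1\<close> is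
  even.\<close>

lemma dihedral_correct:
  fixes s t :: "'x \<Rightarrow> 'x"
  assumes s: "s \<circ> s = id" and t: "t \<circ> t = id" and n: "odd n" and z: "(s \<circ> t) ^^ n \<circ> (s \<circ> t) ^^ n = id"
  defines "t' \<equiv> t \<circ> (s \<circ> t) ^^ n"
  shows "t' \<circ> t' = id" "(s \<circ> t') ^^ n = id" "(t' \<circ> s) ^^ n = id"
proof -
  let ?z = "(s \<circ> t) ^^ n"
  have sw: "t \<circ> (s \<circ> t) ^^ k = (t \<circ> s) ^^ k \<circ> t" for k
    by (induction k) (simp_all add: fun_eq_iff)
  note cancel = funpow_invol_cancel[OF s t]
  have "(t \<circ> s) ^^ n = (?z \<circ> ?z) \<circ> (t \<circ> s) ^^ n" using z by simp
  then have ts: "(t \<circ> s) ^^ n = ?z" using cancel[of n] by (simp add: comp_assoc)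
  have tz: "t \<circ> ?z = ?z \<circ> t" using sw[of n] ts by simp
  have "t' \<circ> t' = t \<circ> (?z \<circ> t) \<circ> ?z" by (simp add: t'_def comp_assoc)
  then show tt: "t' \<circ> t' = id" using tz z t by (simp add: comp_assoc) (metis comp_assoc comp_id)
  have "(s \<circ> t) \<circ> ?z = ?z \<circ> (s \<circ> t)" using funpow_add[of 1 n "s \<circ> t"] funpow_add[of n 1 "s \<circ> t"] by simp
  from funpow_comp_commute[OF this] have pw: "(s \<circ> t') ^^ k = (s \<circ> t) ^^ k \<circ> ?z ^^ k" for k
    by (simp only: t'_def comp_assoc)
  obtain j where j: "Suc n = 2 * j" using n by (metis evenE even_Suc)
  have "(s \<circ> t') ^^ n = ?z ^^ Suc n" using pw[of n] by simp
  also have "\<dots> = (?z \<circ> ?z) ^^ j" unfolding j funpow_mult[symmetric] by (simp add: numeral_2_eq_2 del: funpow_mult)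
  finally show st: "(s \<circ> t') ^^ n = id" using z by simp
  show "(t' \<circ> s) ^^ n = id" using funpow_invol_cancel[OF s tt, of n] st by simp
qed

text \<open>
  \<open>Q\<close> is covered by an extension of it in which \<open>y\<close> lifts to elements of order 4, while an involution not
  conjugate to \<open>y\<close> still has an involutive lift. This separates \<open>y\<close> from the generators unless it is
  conjugate to one of them.
\<close>

locale cyclic_cover =
  fixes Q :: "('x \<Rightarrow> 'x) set" and y :: "'x \<Rightarrow> 'x"
  assumes finQ: "finite Q" and idQ: "id \<in> Q" and compQ: "p \<in> Q \<Longrightarrow> q \<in> Q \<Longrightarrow> p \<circ> q \<in> Q"
    and bijQ: "q \<in> Q \<Longrightarrow> bij q" and yQ: "y \<in> Q" and yy: "y \<circ> y = id" and yne: "y \<noteq> id"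
begin

definition rep :: "('x \<Rightarrow> 'x) \<Rightarrow> 'x \<Rightarrow> 'x" where "rep q = (SOME r. r \<in> {q, q \<circ> y})"

text \<open>Coset representatives modulo \<open>y\<close> times a cyclic group of order four, that
  is, \<open>Q\<close> induced from the group of \<open>y\<close> to its extension of order four.
  \<open>proj\<close> is two-to-one onto \<open>Q\<close>, and \<open>shift\<close> covers right
  multiplication by \<open>y\<close>.\<close>

definition cover :: "(('x \<Rightarrow> 'x) \<times> nat) set" where "cover = rep ` Q \<times> {..<4}"

definition shift :: "('x \<Rightarrow> 'x) \<times> nat \<Rightarrow> ('x \<Rightarrow> 'x) \<times> nat" where "shift z = (fst z, (snd z + 1) mod 4)"

definition proj :: "('x \<Rightarrow> 'x) \<times> nat \<Rightarrow> 'x \<Rightarrow> 'x" where "proj z = (if even (snd z) then fst z else fst z \<circ> y)"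

text \<open>The lifts of members of \<open>Q\<close> are closed under composition, and those of
  \<open>id\<close> square to the identity; this is the extension of \<open>Q\<close> in which
  relations are repaired.\<close>

definition lift :: "('x \<Rightarrow> 'x) \<Rightarrow> (('x \<Rightarrow> 'x) \<times> nat \<Rightarrow> ('x \<Rightarrow> 'x) \<times> nat) \<Rightarrow> bool" where
  "lift q g \<longleftrightarrow> g permutes cover \<and> (\<forall>z\<in>cover. g (shift z) = shift (g z) \<and> proj (g z) = q \<circ> proj z)"

lemma qyy: "q \<circ> y \<circ> y = q" using yy by (simp add: comp_assoc)

lemma rep_cases: "rep q = q \<or> rep q = q \<circ> y"
  using someI[of "\<lambda>r. r \<in> {q, q \<circ> y}" q] unfolding rep_def by auto

lemma rep_y [simp]: "rep (q \<circ> y) = rep q"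
proof -
  have "{q \<circ> y, q \<circ> y \<circ> y} = {q, q \<circ> y}" using qyy by auto
  then show ?thesis unfolding rep_def by simp
qed

lemma rep_rep [simp]: "rep (rep q) = rep q" using rep_cases[of q] by auto

lemma rep_in: "q \<in> Q \<Longrightarrow> rep q \<in> Q" using rep_cases[of q] compQ yQ by metis

lemma qy_ne: "q \<in> Q \<Longrightarrow> q \<circ> y \<noteq> q"
proof
  assume q: "q \<in> Q" "q \<circ> y = q"
  then have "q (y x) = q x" for x by (metis comp_apply)
  then have "y x = x" for x using bij_is_inj[OF bijQ[OF q(1)]] by (auto simp: inj_def)
  then show False using yne by (auto simp: fun_eq_iff)
qed

lemma cover_iff: "(t, i) \<in> cover \<longleftrightarrow> t \<in> Q \<and> rep t = t \<and> i < 4"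
  using rep_in by (auto simp: cover_def) (metis imageI)

lemma shift_in: "z \<in> cover \<Longrightarrow> shift z \<in> cover"
  by (cases z) (simp add: shift_def cover_iff)

lemma lift_in: "lift q g \<Longrightarrow> z \<in> cover \<Longrightarrow> g z \<in> cover"
  by (simp add: lift_def permutes_in_image)

lemma lift_id: "lift id id" by (simp add: lift_def permutes_id)

lemma lift_comp: "lift p f \<Longrightarrow> lift q g \<Longrightarrow> lift (p \<circ> q) (f \<circ> g)"
  unfolding lift_def by (auto simp: comp_assoc permutes_in_image intro!: permutes_compose) 

lemma lift_funpow: "lift p f \<Longrightarrow> lift (p ^^ n) (f ^^ n)"
  by (induction n) (simp_all add: lift_id lift_comp)

lemma rep_proj: "z \<in> cover \<Longrightarrow> rep (proj z) = fst z"
  by (cases z) (simp add: proj_def cover_iff)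

lemma shift4: "z \<in> cover \<Longrightarrow> shift (shift (shift (shift z))) = z"
  by (cases z) (auto simp: shift_def cover_iff mod_simps)

lemma proj_eq_cases:
  assumes "z \<in> cover" "z' \<in> cover" "proj z' = proj z"
  shows "z' = z \<or> z' = shift (shift z)"
proof -
  obtain t i t' i' where z: "z = (t, i)" "z' = (t', i')" by (metis surj_pair)
  have tt: "t' = t" using rep_proj[OF assms(1)] rep_proj[OF assms(2)] assms(3) z by simp
  have "t \<circ> y \<noteq> t" "i < 4" "i' < 4" using qy_ne assms z by (auto simp: cover_iff)
  then have "even i' = even i" using assms(3) z tt by (auto simp: proj_def split: if_splits)
  moreover have "i \<in> {0, 1, 2, 3}" "i' \<in> {0, 1, 2, 3}" using \<open>i < 4\<close> \<open>i' < 4\<close> by auto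
  ultimately show ?thesis using z tt by (auto simp: shift_def)
qed

text \<open>Within a fibre of \<open>proj\<close> a point can only stay or be shifted twice, and
  commuting with \<open>shift\<close> makes the second application undo the first.\<close>

lemma lift_id_invol:
  assumes "lift id k"
  shows "k \<circ> k = id"
proof
  fix z
  show "(k \<circ> k) z = id z"
  proof (cases "z \<in> cover")
    case True
    have "proj (k z) = proj z" using assms True by (simp add: lift_def)
    then consider "k z = z" | "k z = shift (shift z)"
      using proj_eq_cases[OF True lift_in[OF assms True]] by blast
    then show ?thesis
    proof cases
      case 2
      have "k (shift (shift z)) = shift (shift (k z))" using assms True shift_in[OF True] by (simp add: lift_def)
      then show ?thesis using 2 shift4[OF True] by simp
    qed simp
  next
    case False
    have "k permutes cover" using assms by (simp add: lift_def)
    then show ?thesis using False by (simp add: permutes_not_in)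
  qed
qed

text \<open>A non-trivial involution that is not conjugate to \<open>y\<close> permutes the cosets
  modulo \<open>y\<close> without fixed points. On every pair of exchanged cosets a shift in one
  direction is undone by the opposite shift on the way back.\<close>

lemma lift_exists:
  assumes p: "p \<in> Q" "p \<circ> p = id" and nc: "\<forall>q\<in>Q. p \<circ> q \<noteq> q \<circ> y"
  shows "\<exists>g. lift p g \<and> g \<circ> g = id"
proof (cases "p = id")
  case True
  then show ?thesis using lift_id by auto
next
  case False
  define \<sigma> where "\<sigma> t = rep (p \<circ> t)" for t
  \<comment> \<open>The amount by which \<open>g\<close> shifts. It is odd exactly when
    \<open>p\<close> introduces a factor \<open>y\<close>; then one coset of the pair gets 1 and the
    other 3, so that both together give 4. Choosing from the unordered pair yields the same choice
    at either member.\<close>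
  define J where "J t = (if p \<circ> t = \<sigma> t then 0 else if (SOME r. r \<in> {t, \<sigma> t}) = t then 1 else 3::nat)" for t
  define g where "g z = (if z \<in> cover then (\<sigma> (fst z), (snd z + J (fst z)) mod 4) else z)" for z
  have ppq: "p \<circ> (p \<circ> q) = q" for q using p(2) by (simp add: comp_assoc[symmetric])
  have \<sigma>: "\<sigma> t \<in> Q" "rep (\<sigma> t) = \<sigma> t" "\<sigma> t \<noteq> t" "\<sigma> (\<sigma> t) = t" "(p \<circ> \<sigma> t = t) = (p \<circ> t = \<sigma> t)"
    "p \<circ> t = \<sigma> t \<or> p \<circ> t = \<sigma> t \<circ> y"
    if t: "t \<in> Q" "rep t = t" for t
  proof -
    show "\<sigma> t \<in> Q" using t p compQ rep_in by (simp add: \<sigma>_def)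
    show "rep (\<sigma> t) = \<sigma> t" by (simp add: \<sigma>_def)
    have c: "\<sigma> t = p \<circ> t \<or> \<sigma> t = p \<circ> t \<circ> y" unfolding \<sigma>_def by (rule rep_cases)
    then show c': "p \<circ> t = \<sigma> t \<or> p \<circ> t = \<sigma> t \<circ> y" using qyy by metis
    show "\<sigma> t \<noteq> t"
    proof
      assume "\<sigma> t = t"
      \<comment> \<open>The other alternative, \<open>p \<circ> t = t \<circ> y\<close>, would make
        \<open>p\<close> conjugate to \<open>y\<close>.\<close>
      then have "p \<circ> t = t" using c' nc t by metis
      then have "p (t x) = t x" for x by (metis comp_apply)
      moreover have "surj t" by (rule bij_is_surj[OF bijQ[OF t(1)]])
      ultimately have "p x = x" for x by (metis surjD)
      then show False using False by auto
    qed
    show "\<sigma> (\<sigma> t) = t"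
    proof -
      have "p \<circ> \<sigma> t = t \<or> p \<circ> \<sigma> t = t \<circ> y" using c ppq[of t] ppq[of "t \<circ> y"] by (metis comp_assoc)
      then show ?thesis unfolding \<sigma>_def[of "\<sigma> t"] using t(2) by auto
    qed
    show "(p \<circ> \<sigma> t = t) = (p \<circ> t = \<sigma> t)" using ppq by metis
  qed
  have J2: "(J t + J (\<sigma> t)) mod 4 = 0" if t: "t \<in> Q" "rep t = t" for t
  proof -
    have s: "{\<sigma> t, \<sigma> (\<sigma> t)} = {t, \<sigma> t}" using \<sigma>(4)[OF t] by auto
    have "(SOME r. r \<in> {t, \<sigma> t}) \<in> {t, \<sigma> t}" by (rule someI[of _ t]) simp
    then show ?thesis using \<sigma>(3,4,5)[OF t] unfolding J_def s by auto
  qed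
  have gin: "g z \<in> cover" if "z \<in> cover" for z
    using that \<sigma>(1,2) by (cases z) (simp add: g_def cover_iff)
  have gg: "g (g z) = z" for z
  proof (cases "z \<in> cover")
    case True
    obtain t i where z: "z = (t, i)" by (cases z)
    then have t: "t \<in> Q" "rep t = t" "i < 4" using True by (auto simp: cover_iff)
    have "g (g z) = (\<sigma> (\<sigma> t), ((i + J t) mod 4 + J (\<sigma> t)) mod 4)"
      using gin[OF True] True z by (simp add: g_def)
    also have "((i + J t) mod 4 + J (\<sigma> t)) mod 4 = (i + (J t + J (\<sigma> t)) mod 4) mod 4"
      by (simp add: mod_simps add.assoc)
    finally show ?thesis using J2[OF t(1,2)] \<sigma>(4)[OF t(1,2)] z t(3) by simp
  qed (simp add: g_def)
  have "g permutes cover"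
  proof (rule bij_imp_permutes)
    show "bij_betw g cover cover" by (rule bij_betw_byWitness[where f' = g]) (use gg gin in auto)
  qed (simp add: g_def)
  moreover have "g (shift z) = shift (g z) \<and> proj (g z) = p \<circ> proj z" if z: "z \<in> cover" for z
  proof
    obtain t i where ti: "z = (t, i)" by (cases z)
    then have t: "t \<in> Q" "rep t = t" "i < 4" using z by (auto simp: cover_iff)
    show "g (shift z) = shift (g z)"
      using z shift_in[OF z] ti by (simp add: g_def shift_def mod_simps add.commute)
    have ev: "even ((i + J t) mod 4) = even (i + J t)" by (metis dvd_mod_iff even_numeral dvd_refl numeral_Bit0_eq_double dvd_triv_left)
    have "odd (J t) = (p \<circ> t \<noteq> \<sigma> t)" by (auto simp: J_def)
    then show "proj (g z) = p \<circ> proj z"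
      using z ti \<sigma>(6)[OF t(1,2)] qyy[of "\<sigma> t"] ev by (auto simp: g_def proj_def comp_assoc[symmetric])
  qed
  ultimately have "lift p g" by (simp add: lift_def)
  then show ?thesis using gg by (auto simp: fun_eq_iff)
qed

text \<open>\<open>y\<close> fixes its own coset, and over this coset a lift must shift by one or by
  three. Its square is then the double shift, which moves the point.\<close>

lemma lift_y_not_invol:
  assumes "lift y g"
  shows "g \<circ> g \<noteq> id"
proof
  assume gg: "g \<circ> g = id"
  let ?t = "rep id" and ?z = "(rep id, 0::nat)"
  have z: "?z \<in> cover" using rep_in idQ by (simp add: cover_iff)
  have comm: "y \<circ> ?t = ?t \<circ> y" using rep_cases[of id] by auto
  obtain t' i where ti: "g ?z = (t', i)" by (metis surj_pair)
  have gz: "g ?z \<in> cover" by (rule lift_in[OF assms z])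
  have pr: "proj (g ?z) = ?t \<circ> y" using assms z comm by (simp add: lift_def proj_def)
  then have t': "t' = ?t" using rep_proj[OF gz] ti by simp
  have "?t \<circ> y \<noteq> ?t" using qy_ne rep_in idQ by blast
  then have "odd i" using pr ti t' by (auto simp: proj_def split: if_splits)
  moreover have "i < 4" using gz ti by (simp add: cover_iff)
  ultimately have i: "i = 1 \<or> i = 3" by presburger
  have sh: "g (shift x) = shift (g x)" if "x \<in> cover" for x using assms that by (simp add: lift_def)
  show False
  proof (cases "i = 1")
    case True
    then have "g ?z = shift ?z" using ti t' by (simp add: shift_def)
    then have "g (g ?z) = shift (shift ?z)" using sh[OF z] by simp
    then show False using gg by (simp add: fun_eq_iff shift_def) 
  next
    case False
    then have e: "g ?z = shift (shift (shift ?z))" using ti t' i by (simp add: shift_def)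
    have "g (g ?z) = shift (shift (shift (g ?z)))"
      using sh[OF z] sh[OF shift_in[OF z]] sh[OF shift_in[OF shift_in[OF z]]] e by simp
    then have "g (g ?z) = shift (shift ?z)" using e by (simp add: shift_def)
    then show False using gg by (simp add: fun_eq_iff shift_def)
  qed
qed

end

text \<open>In the cover attached to \<open>ev a w0\<close> all generators have involutive lifts.
  The power \<open>(s \<circ> t) ^^ m\<close> of two such lifts covers \<open>id\<close> and so
  squares to the identity; oddness of the label lets one of the two be corrected, leaf by leaf along
  the forest. In the resulting action every word lying over \<open>ev a w0\<close> fails to be an
  involution.\<close>

lemma conjugate_of_lifted_involution:
  fixes a :: "'a \<Rightarrow> 'x \<Rightarrow> 'x"
  assumes fo: "forest V E" and odd: "\<forall>e\<in>E. odd (m e)" and a: "cact V E m S a"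
    and w0: "set w0 \<subseteq> V" and yy: "ev a w0 \<circ> ev a w0 = id" and yne: "ev a w0 \<noteq> id"
    and nc: "\<forall>v\<in>V. \<forall>w. set w \<subseteq> V \<longrightarrow> a v \<circ> ev a w \<noteq> ev a w \<circ> ev a w0"
  shows "\<exists>(U :: (('x \<Rightarrow> 'x) \<times> nat) set) b. cact V E m U b \<and> (\<forall>w. set w \<subseteq> V \<longrightarrow> ev a w = ev a w0 \<longrightarrow> ev b w \<circ> ev b w \<noteq> id)"
proof -
  define Q where "Q = {ev a w | w. set w \<subseteq> V}"
  interpret cyclic_cover Q "ev a w0"
  proof
    have "Q \<subseteq> {p. p permutes S}" using ev_permutes[OF a] by (auto simp: Q_def)
    then show "finite Q" using finite_permutations[OF cactD(1)[OF a]] finite_subset by blast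
    show "id \<in> Q" unfolding Q_def by (auto intro!: exI[of _ "[]"])
    show "ev a w0 \<in> Q" using w0 by (auto simp: Q_def)
    fix p q assume "p \<in> Q" "q \<in> Q"
    then obtain v w where "set v \<subseteq> V" "set w \<subseteq> V" "p = ev a v" "q = ev a w" by (auto simp: Q_def)
    then show "p \<circ> q \<in> Q" unfolding Q_def by (auto simp: ev_append intro!: exI[of _ "v @ w"])
  next
    fix q assume "q \<in> Q"
    then show "bij q" using permutes_bij[OF ev_permutes[OF a]] by (auto simp: Q_def)
  qed (use yy yne in auto)
  have aQ: "a v \<in> Q" if "v \<in> V" for v using that unfolding Q_def by (auto intro!: exI[of _ "[v]"])
  define L where "L v = {g. lift (a v) g \<and> g \<circ> g = id}" for v
  have "\<exists>b. (\<forall>v\<in>V. b v \<in> L v) \<and> (\<forall>u w. {u, w} \<in> E \<longrightarrow> (b u \<circ> b w) ^^ m {u, w} = id)"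
  proof (rule forest_choice[OF fo, of L "\<lambda>u w s t. (s \<circ> t) ^^ m {u, w} = id"])
    show "\<forall>v\<in>V. L v \<noteq> {}"
    proof
      fix v assume v: "v \<in> V"
      have "\<forall>q\<in>Q. a v \<circ> q \<noteq> q \<circ> ev a w0" using nc v by (auto simp: Q_def)
      from lift_exists[OF aQ[OF v] cactD(4)[OF a] this] show "L v \<noteq> {}" by (auto simp: L_def)
    qed
    fix u w s assume e: "{u, w} \<in> E" and s: "s \<in> L u"
    then obtain t where t: "t \<in> L w"
      using \<open>\<forall>v\<in>V. L v \<noteq> {}\<close> forest_edge[OF fo e] by (metis all_not_in_conv doubleton_eq_iff)
    let ?n = "m {u, w}" and ?z = "(s \<circ> t) ^^ m {u, w}"
    have "lift ((a u \<circ> a w) ^^ ?n) ?z" using s t by (intro lift_funpow lift_comp) (auto simp: L_def)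
    then have lz: "lift id ?z" using cactD(5)[OF a e] by simp
    then have zz: "?z \<circ> ?z = id" by (rule lift_id_invol)
    have st: "s \<circ> s = id" "t \<circ> t = id" "odd ?n" using s t odd e by (auto simp: L_def)
    \<comment> \<open>Only the lift at the new leaf \<open>w\<close> is altered, and it stays over
      \<open>a w\<close> because the correcting factor covers \<open>id\<close>.\<close>
    note c = dihedral_correct[OF st zz]
    have "lift (a w) (t \<circ> ?z)" using lift_comp[OF _ lz, of "a w" t] t by (simp add: L_def)
    then have "t \<circ> ?z \<in> L w" using c(1) by (simp add: L_def)
    then show "\<exists>t\<in>L w. (s \<circ> t) ^^ m {u, w} = id \<and> (t \<circ> s) ^^ m {w, u} = id"
      using c(2,3) by (auto simp: insert_commute)
  qed
  then obtain b0 where b0: "\<forall>v\<in>V. b0 v \<in> L v" "\<forall>u w. {u, w} \<in> E \<longrightarrow> (b0 u \<circ> b0 w) ^^ m {u, w} = id" by blast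
  define b where "b v = (if v \<in> V then b0 v else id)" for v
  have bv: "b v permutes cover \<and> b v \<circ> b v = id \<and> lift (a v) (b v)" if "v \<in> V" for v
    using b0(1) that by (auto simp: b_def L_def lift_def)
  have "cact V E m cover b"
    unfolding cact_def
  proof (intro conjI allI impI ballI)
    show "finite cover" using finQ by (simp add: cover_def)
    fix u w assume e: "{u, w} \<in> E"
    then have "u \<in> V" "w \<in> V" using forest_edge[OF fo e] by (auto simp: doubleton_eq_iff)
    then show "(b u \<circ> b w) ^^ m {u, w} = id" using b0(2) e by (simp add: b_def)
  qed (use bv in \<open>auto simp: b_def\<close>)
  moreover have "ev b w \<circ> ev b w \<noteq> id" if "set w \<subseteq> V" "ev a w = ev a w0" for w
  proof (rule lift_y_not_invol)
    have "lift (ev a w) (ev b w)" using that(1) by (induction w) (simp_all add: lift_id lift_comp bv)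
    then show "lift (ev a w0) (ev b w)" using that(2) by simp
  qed
  ultimately show ?thesis by blast
qed

text \<open>Both sides are alternating words of length \<open>2 * j + 1\<close>, starting with
  \<open>u\<close> and with \<open>w\<close>. Their product is the relation, and the second one is
  an involution, so they agree.\<close>

lemma odd_dihedral_conjugate:
  fixes u w :: "'x \<Rightarrow> 'x"
  assumes u: "u \<circ> u = id" and w: "w \<circ> w = id" and rel: "(u \<circ> w) ^^ (2 * j + 1) = id"
  shows "u \<circ> (w \<circ> u) ^^ j = (w \<circ> u) ^^ j \<circ> w"
proof -
  have sw: "w \<circ> (u \<circ> w) ^^ k = (w \<circ> u) ^^ k \<circ> w" for k
  proof (induction k)
    case (Suc k)
    have "w \<circ> (u \<circ> w) ^^ Suc k = (w \<circ> u) \<circ> (w \<circ> (u \<circ> w) ^^ k)" by (simp only: funpow.simps(2) comp_assoc)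
    then show ?case by (simp only: Suc funpow.simps(2) comp_assoc)
  qed simp
  have sw': "u \<circ> (w \<circ> u) ^^ k = (u \<circ> w) ^^ k \<circ> u" for k
  proof (induction k)
    case (Suc k)
    have "u \<circ> (w \<circ> u) ^^ Suc k = (u \<circ> w) \<circ> (u \<circ> (w \<circ> u) ^^ k)" by (simp only: funpow.simps(2) comp_assoc)
    then show ?case by (simp only: Suc funpow.simps(2) comp_assoc)
  qed simp
  let ?A = "u \<circ> (w \<circ> u) ^^ j" and ?B = "w \<circ> (u \<circ> w) ^^ j"
  have "?A \<circ> ?B = (u \<circ> w) ^^ j \<circ> (u \<circ> w) \<circ> (u \<circ> w) ^^ j" unfolding sw' by (simp only: comp_assoc)
  also have "\<dots> = (u \<circ> w) ^^ (j + 1 + j)" by (simp only: funpow_add One_nat_def funpow.simps comp_id)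
  finally have AB: "?A \<circ> ?B = id" using rel by (simp add: mult_2)
  have "?B \<circ> ?B = (w \<circ> u) ^^ j \<circ> (w \<circ> w) \<circ> (u \<circ> w) ^^ j" using sw[of j] by (simp add: comp_assoc)
  also have "\<dots> = id" using w funpow_invol_cancel[OF w u] by simp
  finally have BB: "?B \<circ> ?B = id" .
  have "?A = ?A \<circ> ?B \<circ> ?B" using BB by (simp add: comp_assoc)
  then show ?thesis using AB sw[of j] by simp
qed

lemma edge_conjugate:
  assumes f: "cact V E m S f" and e: "{u, w} \<in> E" and "odd (m {u, w})" and "u \<in> V" "w \<in> V"
  shows "\<exists>ws. set ws \<subseteq> V \<and> f u \<circ> ev f ws = ev f ws \<circ> f w"
proof -
  obtain j where j: "m {u, w} = 2 * j + 1" using assms(3) by (elim oddE)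
  have "(f u \<circ> f w) ^^ (2 * j + 1) = id" using cactD(5)[OF f e] j by simp
  from odd_dihedral_conjugate[OF cactD(4)[OF f] cactD(4)[OF f] this]
  have "f u \<circ> ev f (concat (replicate j [w, u])) = ev f (concat (replicate j [w, u])) \<circ> f w"
    by (simp add: ev_replicate)
  moreover have "set (concat (replicate j [w, u])) \<subseteq> V" using assms(4,5) by (induction j) auto
  ultimately show ?thesis by blast
qed

lemma reach_conjugate:
  assumes f: "cact V E m S f" and odd: "\<forall>e\<in>E. odd (m e)" and ed: "\<And>u w. {u, w} \<in> E \<Longrightarrow> u \<in> V \<and> w \<in> V"
    and "(u, w) \<in> {(x, y). {x, y} \<in> E}\<^sup>*"
  shows "\<exists>ws. set ws \<subseteq> V \<and> f u \<circ> ev f ws = ev f ws \<circ> f w"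
  using assms(4)
proof (induction rule: rtrancl_induct)
  case base
  show ?case by (intro exI[of _ "[]"]) simp
next
  case (step x y)
  then have e: "{x, y} \<in> E" by simp
  obtain ws where ws: "set ws \<subseteq> V" "f u \<circ> ev f ws = ev f ws \<circ> f x" using step.IH by blast
  obtain zs where zs: "set zs \<subseteq> V" "f x \<circ> ev f zs = ev f zs \<circ> f y"
    using edge_conjugate[OF f e] odd e ed[OF e] by blast
  have "f u \<circ> ev f (ws @ zs) = ev f (ws @ zs) \<circ> f y"
    unfolding ev_append using ws(2) zs(2) by (metis comp_assoc)
  then show ?case using ws zs by (intro exI[of _ "ws @ zs"]) simp
qed

section \<open>Components of the forest and generators of the other group\<close>

definition toggle :: "'a \<Rightarrow> 'a set \<Rightarrow> 'a set" where
  "toggle r D = (D - {r}) \<union> ({r} - D)"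

lemma toggle_toggle [simp]: "toggle r (toggle r D) = D"
  by (auto simp: toggle_def)

definition sdiff :: "'a set \<Rightarrow> 'a set \<Rightarrow> 'a set" where
  "sdiff A B = (A - B) \<union> (B - A)"

text \<open>\<open>\<rho>\<close> sends a vertex to a chosen root of its component. About the primed
  graph nothing is assumed beyond the transfer, since that it is a forest is still to be
  derived.\<close>

locale forest_pair = transfer_pair +
  fixes \<rho>
  assumes fo: "forest V E" and odd: "\<forall>e\<in>E. odd (m e)"
    and \<rho>_in: "\<And>v. v \<in> V \<Longrightarrow> \<rho> v \<in> V" and \<rho>\<rho>: "\<And>v. v \<in> V \<Longrightarrow> \<rho> (\<rho> v) = \<rho> v"
    and \<rho>_edge: "\<And>u w. {u, w} \<in> E \<Longrightarrow> \<rho> u = \<rho> w"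
    and \<rho>_reach: "\<And>v. v \<in> V \<Longrightarrow> (v, \<rho> v) \<in> {(x, y). {x, y} \<in> E}\<^sup>*"
begin

lemma FB: "cact V' E' m' S b \<Longrightarrow> F.T (B.T b) = b"
  by (rule transfer_pair.BF[OF flip])

lemma T_pact:
  assumes f: "cact V E m S f" and h: "cact V E m U h" and s: "s \<in> V'" and "x \<in> S" "u \<in> U"
  shows "F.T (pact S U V f h) s (x, u) = (F.T f s x, F.T h s u)"
proof -
  note p = cact_pact[OF f h F.edges]
  have s': "set [s] \<subseteq> V'" using s by simp
  obtain xs where xs: "set xs \<subseteq> V" "ev (F.T (pact S U V f h)) [s] = ev (pact S U V f h) xs" "ev (F.T f) [s] = ev f xs"
    by (rule F.T_approx2[OF p f s'])
  obtain ys where ys: "set ys \<subseteq> V" "ev (F.T (pact S U V f h)) [s] = ev (pact S U V f h) ys" "ev (F.T h) [s] = ev h ys"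
    by (rule F.T_approx2[OF p h s'])
  show ?thesis
    using xs ys ev_pact[OF f h xs(1) assms(4,5)] ev_pact[OF f h ys(1) assms(4,5)] by simp
qed

text \<open>The sign character. All relators have even length, so it exists for every graph, and it
  moves every generator.\<close>

definition sgn' :: "'b \<Rightarrow> bool \<Rightarrow> bool" where "sgn' = (\<lambda>s. if s \<in> V' then Not else id)"

lemma cact_sgn': "cact V' E' m' UNIV sgn'"
proof -
  have "(Not \<circ> Not) = id" by auto
  moreover have "Not permutes UNIV" by (rule bij_imp_permutes) (auto simp: bij_def inj_def surj_def)
  ultimately show ?thesis unfolding cact_def sgn'_def using F.edges' by (auto simp: id_def[symmetric])
qed

text \<open>A transferred generator is an involution in every finite action, hence also in the
  cover, where a value conjugate to no generator has no involutive lift. A single word computes its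
  values in both actions.\<close>

lemma T_nontrivial_conjugate:
  assumes p: "cact V E m S p" and s: "s \<in> V'" and ne: "F.T p s \<noteq> id"
  shows "\<exists>v\<in>V. \<exists>w. set w \<subseteq> V \<and> p v \<circ> ev p w = ev p w \<circ> F.T p s"
proof (rule ccontr)
  assume neg: "\<not> ?thesis"
  have s': "set [s] \<subseteq> V'" using s by simp
  obtain w0 where w0: "set w0 \<subseteq> V" "ev (F.T p) [s] = ev p w0" by (rule F.T_approx[OF p s'])
  have y: "ev p w0 = F.T p s" using w0(2) by simp
  have yy: "ev p w0 \<circ> ev p w0 = id" unfolding y by (rule cactD(4)[OF F.cact_T[OF p]])
  have "\<forall>v\<in>V. \<forall>w. set w \<subseteq> V \<longrightarrow> p v \<circ> ev p w \<noteq> ev p w \<circ> ev p w0" using neg unfolding y by blast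
  from conjugate_of_lifted_involution[OF fo odd p w0(1) yy _ this]
  obtain U :: "(('c \<Rightarrow> 'c) \<times> nat) set" and b where b: "cact V E m U b"
    "\<forall>w. set w \<subseteq> V \<longrightarrow> ev p w = ev p w0 \<longrightarrow> ev b w \<circ> ev b w \<noteq> id" using ne y by auto
  obtain xs where xs: "set xs \<subseteq> V" "ev (F.T p) [s] = ev p xs" "ev (F.T b) [s] = ev b xs"
    by (rule F.T_approx2[OF p b(1) s'])
  have "F.T b s \<circ> F.T b s = id" by (rule cactD(4)[OF F.cact_T[OF b(1)]])
  then show False using b(2) xs w0(2) by simp
qed

text \<open>Pairing \<open>f\<close> with the action that transfers to the sign character makes the
  transferred generator non-trivial, so that the preceding lemma applies to any \<open>f\<close>;
  the first coordinate is then read off.\<close>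

lemma T_conjugate:
  assumes f: "cact V E m S f" and "S \<noteq> {}" and s: "s \<in> V'"
  shows "\<exists>v\<in>V. \<exists>w. set w \<subseteq> V \<and> f v \<circ> ev f w = ev f w \<circ> F.T f s"
proof -
  define \<beta> where "\<beta> = B.T sgn'"
  have \<beta>: "cact V E m UNIV \<beta>" unfolding \<beta>_def by (rule B.cact_T[OF cact_sgn'])
  have T\<beta>: "F.T \<beta> = sgn'" unfolding \<beta>_def by (rule FB[OF cact_sgn'])
  let ?p = "pact S UNIV V f \<beta>"
  have p: "cact V E m (S \<times> UNIV) ?p" by (rule cact_pact[OF f \<beta> F.edges])
  obtain x0 where x0: "x0 \<in> S" using assms(2) by blast
  have Tp: "F.T ?p s (x, u) = (F.T f s x, \<not> u)" if "x \<in> S" for x u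
    using T_pact[OF f \<beta> s that UNIV_I] T\<beta> s by (simp add: sgn'_def)
  have "F.T ?p s (x0, True) \<noteq> (x0, True)" using Tp[OF x0] by simp
  then have "F.T ?p s \<noteq> id" by (metis id_apply)
  from T_nontrivial_conjugate[OF p s this]
  obtain v w where v: "v \<in> V" and w: "set w \<subseteq> V" and eq: "?p v \<circ> ev ?p w = ev ?p w \<circ> F.T ?p s" by blast
  have "f v (ev f w x) = ev f w (F.T f s x)" for x
  proof (cases "x \<in> S")
    case True
    have "(?p v \<circ> ev ?p w) (x, True) = (ev ?p w \<circ> F.T ?p s) (x, True)" by (simp only: eq)
    moreover have "ev ?p (v # w) (x, True) = (f v (ev f w x), \<beta> v (ev \<beta> w True))"
      using ev_pact[OF f \<beta>, of "v # w" x True] v w True by simp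
    moreover have "ev ?p w (F.T f s x, False) = (ev f w (F.T f s x), ev \<beta> w False)"
      using ev_pact[OF f \<beta>, of w "F.T f s x" False] w cact_in[OF F.cact_T[OF f] True] by simp
    ultimately show ?thesis using Tp[OF True] by simp
  next
    case False
    then show ?thesis using permutes_not_in[OF cactD(3)[OF f]] permutes_not_in[OF ev_permutes[OF f]]
        permutes_not_in[OF cactD(3)[OF F.cact_T[OF f]]] by metis
  qed
  then show ?thesis using v w by (auto simp: fun_eq_iff)
qed

text \<open>The abelianisation: one group of order two for each component, acting on sets by
  toggling the root of the component.\<close>

definition \<delta> :: "'a \<Rightarrow> 'a set \<Rightarrow> 'a set" where "\<delta> = mk V (Pow V) (\<lambda>v. toggle (\<rho> v))"

lemma cact_\<delta>: "cact V E m (Pow V) \<delta>"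
  unfolding \<delta>_def
proof (rule cact_mk)
  show "finite (Pow V)" using forest_finite[OF fo] by simp
  fix v D assume "v \<in> V" "D \<in> Pow V"
  then show "toggle (\<rho> v) D \<in> Pow V" using \<rho>_in by (auto simp: toggle_def)
next
  fix v w D assume "{v, w} \<in> E"
  then have "\<rho> v = \<rho> w" by (rule \<rho>_edge)
  then have "toggle (\<rho> v) \<circ> toggle (\<rho> w) = id" by auto
  then show "((toggle (\<rho> v) \<circ> toggle (\<rho> w)) ^^ m {v, w}) D = D" by (simp add: id_def[symmetric])
qed (use F.edges in auto)

lemma \<delta>_apply: "v \<in> V \<Longrightarrow> D \<subseteq> V \<Longrightarrow> \<delta> v D = toggle (\<rho> v) D"
  by (simp add: \<delta>_def mk_apply)

lemma ev_\<delta>: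
  assumes "set ws \<subseteq> V" "D \<subseteq> V"
  shows "ev \<delta> ws D = sdiff D (ev \<delta> ws {}) \<and> ev \<delta> ws {} \<subseteq> V"
  using assms(1)
proof (induction ws)
  case Nil
  then show ?case by (simp add: sdiff_def)
next
  case (Cons v ws)
  then have IH: "ev \<delta> ws D = sdiff D (ev \<delta> ws {})" "ev \<delta> ws {} \<subseteq> V" "v \<in> V" by auto
  have "sdiff D (ev \<delta> ws {}) \<subseteq> V" using IH assms(2) by (auto simp: sdiff_def)
  then show ?case using IH \<rho>_in[OF IH(3)] by (simp add: \<delta>_apply) (auto simp: toggle_def sdiff_def)
qed

text \<open>In the abelian action \<open>s\<close> toggles a single root, which names the component
  that belongs to \<open>s\<close>.\<close>

definition \<kappa> :: "'b \<Rightarrow> 'a" where "\<kappa> s = the_elem (F.T \<delta> s {})"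

text \<open>Conjugation is invisible in an abelian action, so \<open>F.T \<delta> s\<close> is
  itself the action of a generator, determined up to its component. Pairing an arbitrary action with
  \<open>\<delta>\<close> forces the conjugate generator of that action into the same
  component.\<close>

lemma \<kappa>:
  assumes s: "s \<in> V'"
  shows "\<kappa> s \<in> V" "\<rho> (\<kappa> s) = \<kappa> s" "F.T \<delta> s = \<delta> (\<kappa> s)"
    "cact V E m S f \<Longrightarrow> S \<noteq> {} \<Longrightarrow> \<exists>v\<in>V. \<rho> v = \<kappa> s \<and> (\<exists>w. set w \<subseteq> V \<and> f v \<circ> ev f w = ev f w \<circ> F.T f s)"
proof -
  have s': "set [s] \<subseteq> V'" using s by simp
  obtain xs where xs: "set xs \<subseteq> V" "ev (F.T \<delta>) [s] = ev \<delta> xs" by (rule F.T_approx[OF cact_\<delta> s'])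
  have T\<delta>: "F.T \<delta> s D = sdiff D (F.T \<delta> s {})" if "D \<subseteq> V" for D
    using ev_\<delta>[OF xs(1) that] xs(2) by simp
  \<comment> \<open>The value of the conjugating word is a symmetric difference with a fixed set and
    cancels from both sides.\<close>
  have key: "F.T \<delta> s {} = {\<rho> v}"
    if v: "v \<in> V" and w: "set w \<subseteq> V" and eq: "\<delta> v (ev \<delta> w {}) = ev \<delta> w (F.T \<delta> s {})" for v w
  proof -
    have sub: "F.T \<delta> s {} \<subseteq> V" using ev_\<delta>[OF xs(1), of "{}"] xs(2) by simp
    have "toggle (\<rho> v) (ev \<delta> w {}) = sdiff (F.T \<delta> s {}) (ev \<delta> w {})"
      using eq ev_\<delta>[OF w sub] ev_\<delta>[OF w, of "{}"] \<delta>_apply[OF v] by simp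
    then show ?thesis by (auto simp: toggle_def sdiff_def set_eq_iff)
  qed
  obtain v w where v: "v \<in> V" and w: "set w \<subseteq> V" and eq: "\<delta> v \<circ> ev \<delta> w = ev \<delta> w \<circ> F.T \<delta> s"
    using T_conjugate[OF cact_\<delta> _ s] by blast
  have T0: "F.T \<delta> s {} = {\<rho> v}" by (rule key[OF v w]) (use eq in \<open>metis comp_apply\<close>)
  then have k: "\<kappa> s = \<rho> v" by (simp add: \<kappa>_def)
  show "\<kappa> s \<in> V" "\<rho> (\<kappa> s) = \<kappa> s" using k v \<rho>_in \<rho>\<rho> by auto
  show "F.T \<delta> s = \<delta> (\<kappa> s)"
  proof
    fix D
    show "F.T \<delta> s D = \<delta> (\<kappa> s) D"
    proof (cases "D \<subseteq> V")
      case True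
      have "sdiff D {\<rho> v} = toggle (\<rho> v) D" by (auto simp: sdiff_def toggle_def)
      then show ?thesis using T\<delta>[OF True] T0 k \<delta>_apply[OF \<rho>_in[OF v] True] \<rho>\<rho>[OF v] by simp
    next
      case False
      then show ?thesis using permutes_not_in[OF cactD(3)[OF F.cact_T[OF cact_\<delta>]]] permutes_not_in[OF cactD(3)[OF cact_\<delta>]]
        by (metis PowD)
    qed
  qed
  assume f: "cact V E m S f" and "S \<noteq> {}"
  let ?p = "pact S (Pow V) V f \<delta>"
  have p: "cact V E m (S \<times> Pow V) ?p" by (rule cact_pact[OF f cact_\<delta> F.edges])
  obtain v w where v: "v \<in> V" and w: "set w \<subseteq> V" and eq: "?p v \<circ> ev ?p w = ev ?p w \<circ> F.T ?p s"
    using T_conjugate[OF p _ s] \<open>S \<noteq> {}\<close> by blast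
  have c: "f v (ev f w x) = ev f w (F.T f s x) \<and> \<delta> v (ev \<delta> w {}) = ev \<delta> w (F.T \<delta> s {})" if x: "x \<in> S" for x
  proof -
    have e: "{} \<in> Pow V" by simp
    have "(?p v \<circ> ev ?p w) (x, {}) = (ev ?p w \<circ> F.T ?p s) (x, {})" by (simp only: eq)
    moreover have "ev ?p (v # w) (x, {}) = (f v (ev f w x), \<delta> v (ev \<delta> w {}))"
      using ev_pact[OF f cact_\<delta>, of "v # w" x "{}"] v w x by simp
    moreover have "F.T \<delta> s {} \<in> Pow V" by (rule cact_in[OF F.cact_T[OF cact_\<delta>] e])
    then have "ev ?p w (F.T f s x, F.T \<delta> s {}) = (ev f w (F.T f s x), ev \<delta> w (F.T \<delta> s {}))"
      using ev_pact[OF f cact_\<delta> w cact_in[OF F.cact_T[OF f] x]] by simp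
    ultimately show ?thesis using T_pact[OF f cact_\<delta> s x e] by simp
  qed
  have "f v (ev f w x) = ev f w (F.T f s x)" for x
  proof (cases "x \<in> S")
    case False
    then show ?thesis using permutes_not_in[OF cactD(3)[OF f]] permutes_not_in[OF ev_permutes[OF f]]
        permutes_not_in[OF cactD(3)[OF F.cact_T[OF f]]] by metis
  qed (use c in blast)
  then have "f v \<circ> ev f w = ev f w \<circ> F.T f s" by (simp add: fun_eq_iff)
  moreover have "\<kappa> s = \<rho> v" using c key[OF v w] \<open>S \<noteq> {}\<close> by (auto simp: \<kappa>_def)
  ultimately show "\<exists>v\<in>V. \<rho> v = \<kappa> s \<and> (\<exists>w. set w \<subseteq> V \<and> f v \<circ> ev f w = ev f w \<circ> F.T f s)"
    using v w by metis
qed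

lemma conj_sym:
  assumes "cact V E m S f" "set w \<subseteq> V" "g \<circ> ev f w = ev f w \<circ> h"
  shows "\<exists>w. set w \<subseteq> V \<and> h \<circ> ev f w = ev f w \<circ> g"
proof -
  have "h \<circ> ev f (rev w) = ev f (rev w) \<circ> ev f w \<circ> h \<circ> ev f (rev w)" using ev_rev[OF assms(1)] by simp
  also have "\<dots> = ev f (rev w) \<circ> g \<circ> (ev f w \<circ> ev f (rev w))" using assms(3) by (metis comp_assoc)
  finally have "h \<circ> ev f (rev w) = ev f (rev w) \<circ> g" using ev_rev'[OF assms(1)] by simp
  then show ?thesis using assms(2) by (intro exI[of _ "rev w"]) simp
qed

text \<open>Odd edges make all generators of a component conjugate, so the generator supplied by
  \<open>\<kappa>\<close> can be exchanged, by way of the root, for any other in the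
  component.\<close>

lemma main_conj:
  assumes f: "cact V E m S f" and "S \<noteq> {}" and s: "s \<in> V'" and v: "v \<in> V" and "\<kappa> s = \<rho> v"
  shows "\<exists>w. set w \<subseteq> V \<and> f v \<circ> ev f w = ev f w \<circ> F.T f s"
proof -
  obtain v' w' where v': "v' \<in> V" "\<rho> v' = \<kappa> s" "set w' \<subseteq> V" "f v' \<circ> ev f w' = ev f w' \<circ> F.T f s"
    using \<kappa>(4)[OF s f assms(2)] by blast
  obtain w1 where w1: "set w1 \<subseteq> V" "f v \<circ> ev f w1 = ev f w1 \<circ> f (\<rho> v)"
    using reach_conjugate[OF f odd F.edges \<rho>_reach[OF v]] by blast
  obtain w2 where w2: "set w2 \<subseteq> V" "f v' \<circ> ev f w2 = ev f w2 \<circ> f (\<rho> v')"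
    using reach_conjugate[OF f odd F.edges \<rho>_reach[OF v'(1)]] by blast
  obtain w3 where w3: "set w3 \<subseteq> V" "f (\<rho> v') \<circ> ev f w3 = ev f w3 \<circ> f v'" using conj_sym[OF f w2] by blast
  have "\<rho> v' = \<rho> v" using v' assms by simp
  then have "f v \<circ> ev f (w1 @ w3 @ w') = ev f (w1 @ w3 @ w') \<circ> F.T f s"
    unfolding ev_append using w1(2) w3(2) v'(4) by (metis comp_assoc)
  then show ?thesis using w1 w3 v' by (intro exI[of _ "w1 @ w3 @ w'"]) simp
qed

text \<open>If no \<open>s\<close> belonged to a component, the sign character of this component
  would transfer to the trivial action, from which transferring back could not recover it.\<close>

lemma \<kappa>_surj:
  assumes r: "r \<in> V" "\<rho> r = r"
  shows "\<exists>s\<in>V'. \<kappa> s = r"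
proof (rule ccontr)
  assume neg: "\<not> ?thesis"
  define \<epsilon> where "\<epsilon> = (\<lambda>v. if v \<in> V \<and> \<rho> v = r then Not else id)"
  have NN: "Not \<circ> Not = id" by auto
  have "Not permutes UNIV" by (rule bij_imp_permutes) (auto simp: bij_def inj_def surj_def)
  moreover have "(\<epsilon> v \<circ> \<epsilon> w) ^^ m {v, w} = id" if "{v, w} \<in> E" for v w
    using \<rho>_edge[OF that] F.edges[OF that] NN by (auto simp: \<epsilon>_def id_def[symmetric])
  ultimately have \<epsilon>: "cact V E m UNIV \<epsilon>" unfolding cact_def using NN by (auto simp: \<epsilon>_def permutes_id)
  have "F.T \<epsilon> s = id" for s
  proof (cases "s \<in> V'")
    case True
    then obtain v w where v: "v \<in> V" "\<rho> v = \<kappa> s" "\<epsilon> v \<circ> ev \<epsilon> w = ev \<epsilon> w \<circ> F.T \<epsilon> s"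
      using \<kappa>(4)[OF True \<epsilon>] by blast
    have "\<rho> v \<noteq> r" using neg True v by metis
    then have "ev \<epsilon> w = ev \<epsilon> w \<circ> F.T \<epsilon> s" using v by (simp add: \<epsilon>_def)
    then have "ev \<epsilon> (rev w) \<circ> ev \<epsilon> w = ev \<epsilon> (rev w) \<circ> ev \<epsilon> w \<circ> F.T \<epsilon> s" by (simp add: comp_assoc)
    then show ?thesis using ev_rev[OF \<epsilon>] by simp
  qed (simp add: F.T_def)
  then have triv: "ev (F.T \<epsilon>) w = id" for w by (induction w) simp_all
  have "set [r] \<subseteq> V" using r by simp
  then obtain xs where "ev (B.T (F.T \<epsilon>)) [r] = ev (F.T \<epsilon>) xs" by (rule B.T_approx[OF F.cact_T[OF \<epsilon>]])
  then have "\<epsilon> r = id" using BF[OF \<epsilon>] triv by simp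
  then show False using r by (auto simp: \<epsilon>_def fun_eq_iff)
qed

lemma conj_exists:
  assumes f: "cact V E m S f" and "S \<noteq> {}" and v: "v \<in> V"
  shows "\<exists>s\<in>V'. \<kappa> s = \<rho> v \<and> (\<exists>w. set w \<subseteq> V \<and> f v \<circ> ev f w = ev f w \<circ> F.T f s)"
  using \<kappa>_surj[OF \<rho>_in[OF v] \<rho>\<rho>[OF v]] main_conj[OF f assms(2) _ v] by metis

end

section \<open>Actions on two points\<close>

text \<open>The unions of connected components, here viewed as the solutions of one linear equation
  per edge over the field with two elements.\<close>

definition closed_sets :: "'a set \<Rightarrow> 'a set set \<Rightarrow> 'a set set" where
  "closed_sets V E = {D. D \<subseteq> V \<and> (\<forall>u w. ({u, w} \<in> E) \<longrightarrow> (u \<in> D \<longleftrightarrow> w \<in> D))}"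

lemma finite_closed_sets: "finite V \<Longrightarrow> finite (closed_sets V E)"
  by (rule finite_subset[of _ "Pow V"]) (auto simp: closed_sets_def)

lemma closed_sets_insert:
  assumes "e = {u, w}"
  shows "closed_sets V (insert e E) = {D \<in> closed_sets V E. u \<in> D \<longleftrightarrow> w \<in> D}"
  using assms unfolding closed_sets_def by (auto simp: doubleton_eq_iff)

text \<open>A further linear equation at most halves the number of solutions: symmetric difference
  with one set violating it embeds the violating sets into those satisfying it.\<close>

lemma card_closed_sets_ge:
  assumes "finite E" "finite V" "\<forall>e\<in>E. \<exists>u w. e = {u, w} \<and> u \<in> V \<and> w \<in> V \<and> u \<noteq> w"
  shows "2 ^ card V \<le> card (closed_sets V E) * 2 ^ card E"
  using assms
proof (induction E)
  case empty
  have "closed_sets V {} = Pow V" by (auto simp: closed_sets_def)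
  then show ?case using empty by (simp add: card_Pow)
next
  case (insert e E)
  obtain u w where e: "e = {u, w}" using insert.prems by blast
  let ?C = "closed_sets V E" and ?C1 = "closed_sets V (insert e E)" and ?C2 = "{D \<in> closed_sets V E. (u \<in> D) \<noteq> (w \<in> D)}"
  have fin: "finite ?C" "finite ?C1" using finite_closed_sets insert.prems by auto
  have C1: "?C1 = {D \<in> ?C. u \<in> D \<longleftrightarrow> w \<in> D}" by (rule closed_sets_insert[OF e])
  have "card ?C2 \<le> card ?C1"
  proof (cases "?C2 = {}")
    case False
    then obtain D0 where D0: "D0 \<in> ?C2" by blast
    show ?thesis
    proof (rule card_inj_on_le[OF _ _ fin(2)])
      show "inj_on (\<lambda>D. sdiff D D0) ?C2" by (auto simp: inj_on_def sdiff_def set_eq_iff)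
      show "(\<lambda>D. sdiff D D0) ` ?C2 \<subseteq> ?C1"
        unfolding C1 using D0 by (auto simp: sdiff_def closed_sets_def)
    qed
  next
    case True
    show ?thesis unfolding True by simp
  qed
  moreover have "card ?C = card ?C1 + card ?C2"
    unfolding C1 by (subst card_Un_disjoint[symmetric]) (use fin in \<open>auto intro!: arg_cong[of _ _ card]\<close>)
  ultimately have "card ?C \<le> 2 * card ?C1" by simp
  have "2 ^ card V \<le> card ?C * 2 ^ card E" using insert by simp
  also have "\<dots> \<le> (2 * card ?C1) * 2 ^ card E" using \<open>card ?C \<le> 2 * card ?C1\<close> by (intro mult_right_mono) auto
  finally show ?case using insert.hyps by (simp add: mult.assoc)
qed

text \<open>On a cycle the equation of the closing edge follows from the other ones. Removing that
  edge leaves the solutions unchanged and saves a factor of two in the bound.\<close>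

lemma card_closed_sets_cycle:
  assumes "finite E" "finite V" "\<forall>e\<in>E. \<exists>u w. e = {u, w} \<and> u \<in> V \<and> w \<in> V \<and> u \<noteq> w" "has_cycle E"
  shows "2 * 2 ^ card V \<le> card (closed_sets V E) * 2 ^ card E"
proof -
  obtain cs where cs: "3 \<le> length cs" "distinct cs"
    "\<And>i. i < length cs \<Longrightarrow> {cs ! i, cs ! ((i + 1) mod length cs)} \<in> E"
    using assms(4) unfolding has_cycle_def by blast
  define l where "l = length cs - 1"
  have l: "length cs = Suc l" "2 \<le> l" using cs(1) by (auto simp: l_def)
  let ?e = "{cs ! l, cs ! 0}"
  have e: "?e \<in> E" using cs(3)[of l] l by simp
  let ?E = "E - {?e}"
  have path: "cs ! 0 \<in> D \<longleftrightarrow> cs ! i \<in> D" if D: "D \<in> closed_sets V ?E" and "i \<le> l" for D i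
    using that(2)
  proof (induction i)
    case (Suc i)
    have "{cs ! i, cs ! Suc i} \<in> E" using cs(3)[of i] l Suc by simp
    moreover have "{cs ! i, cs ! Suc i} \<noteq> ?e"
      using cs(2) l Suc.prems by (auto simp: doubleton_eq_iff nth_eq_iff_index_eq)
    ultimately have "cs ! i \<in> D \<longleftrightarrow> cs ! Suc i \<in> D" using D by (simp add: closed_sets_def)
    then show ?case using Suc by simp
  qed simp
  have ins: "insert ?e ?E = E" using e by blast
  have "closed_sets V E = {D \<in> closed_sets V ?E. cs ! l \<in> D \<longleftrightarrow> cs ! 0 \<in> D}"
    using closed_sets_insert[of ?e "cs ! l" "cs ! 0" V ?E] ins by simp
  then have eq: "closed_sets V E = closed_sets V ?E" using path[of _ l] by auto
  have "2 ^ card V \<le> card (closed_sets V ?E) * 2 ^ card ?E"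
    by (rule card_closed_sets_ge) (use assms in auto)
  moreover have "card E = Suc (card ?E)" using e assms(1) by (metis card_Suc_Diff1)
  ultimately show ?thesis using eq by simp
qed

text \<open>The equations of a forest are independent: a leaf adds one unknown and one equation that
  determines it.\<close>

lemma card_closed_sets_forest:
  "forest V E \<Longrightarrow> card (closed_sets V E) * 2 ^ card E = 2 ^ card V"
proof (induction rule: forest.induct)
  case empty
  have "closed_sets {} {} = {{} :: 'a set}" by (auto simp: closed_sets_def)
  then show ?case by simp
next
  case (isolated V E w)
  note fin = forest_finite[OF isolated.hyps(1)]
  have wE: "{x, y} \<in> E \<Longrightarrow> x \<in> V \<and> y \<in> V" for x y using forest_edge[OF isolated.hyps(1), of "{x, y}"] by (auto simp: doubleton_eq_iff)
  have "closed_sets (insert w V) E = closed_sets V E \<union> insert w ` closed_sets V E"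
  proof (intro equalityI subsetI)
    fix D assume D: "D \<in> closed_sets (insert w V) E"
    show "D \<in> closed_sets V E \<union> insert w ` closed_sets V E"
    proof (cases "w \<in> D")
      case True
      have "D - {w} \<in> closed_sets V E" using D wE isolated.hyps(2) unfolding closed_sets_def by blast
      then show ?thesis using True by (metis UnI2 image_eqI insert_Diff)
    next
      case False
      then have "D \<in> closed_sets V E" using D unfolding closed_sets_def by blast
      then show ?thesis by blast
    qed
  next
    fix D assume "D \<in> closed_sets V E \<union> insert w ` closed_sets V E"
    then show "D \<in> closed_sets (insert w V) E" using wE isolated.hyps(2) unfolding closed_sets_def by blast
  qed
  moreover have "card (closed_sets V E \<union> insert w ` closed_sets V E) = card (closed_sets V E) + card (insert w ` closed_sets V E)"
    using fin finite_closed_sets isolated.hyps(2) by (intro card_Un_disjoint) (auto simp: closed_sets_def)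
  moreover have "card (insert w ` closed_sets V E) = card (closed_sets V E)"
    by (rule card_image) (use isolated.hyps(2) in \<open>auto simp: inj_on_def closed_sets_def\<close>)
  ultimately show ?case using isolated.IH isolated.hyps(2) fin by (simp add: distrib_right)
next
  case (leaf V E u w)
  note fin = forest_finite[OF leaf.hyps(1)]
  have wE: "{x, y} \<in> E \<Longrightarrow> x \<in> V \<and> y \<in> V" for x y using forest_edge[OF leaf.hyps(1), of "{x, y}"] by (auto simp: doubleton_eq_iff)
  have nE: "{u, w} \<notin> E" using wE leaf.hyps(3) by blast
  have uw: "u \<noteq> w" using leaf.hyps by blast
  have "bij_betw (\<lambda>D. D - {w}) (closed_sets (insert w V) (insert {u, w} E)) (closed_sets V E)"
  proof (rule bij_betw_byWitness[where f' = "\<lambda>D. if u \<in> D then insert w D else D"])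
    show "\<forall>D\<in>closed_sets (insert w V) (insert {u, w} E). (if u \<in> D - {w} then insert w (D - {w}) else D - {w}) = D"
      using uw by (auto simp: closed_sets_def)
    show "\<forall>D\<in>closed_sets V E. (if u \<in> D then insert w D else D) - {w} = D"
      using leaf.hyps(3) by (auto simp: closed_sets_def)
    show "(\<lambda>D. D - {w}) ` closed_sets (insert w V) (insert {u, w} E) \<subseteq> closed_sets V E"
      using wE leaf.hyps(3) unfolding closed_sets_def by blast
    show "(\<lambda>D. if u \<in> D then insert w D else D) ` closed_sets V E \<subseteq> closed_sets (insert w V) (insert {u, w} E)"
    proof
      fix D' assume "D' \<in> (\<lambda>D. if u \<in> D then insert w D else D) ` closed_sets V E"
      then obtain D where D: "D \<in> closed_sets V E" "D' = (if u \<in> D then insert w D else D)" by blast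
      have "D' \<subseteq> insert w V" using D unfolding closed_sets_def by auto
      moreover have "x \<in> D' \<longleftrightarrow> y \<in> D'" if "{x, y} \<in> insert {u, w} E" for x y
      proof (cases "{x, y} \<in> E")
        case True
        then have "x \<noteq> w" "y \<noteq> w" "x \<in> D \<longleftrightarrow> y \<in> D" using wE leaf.hyps(3) D(1) unfolding closed_sets_def by blast+
        then show ?thesis using D(2) by auto
      next
        case False
        then have "x = u \<and> y = w \<or> x = w \<and> y = u" using that by (auto simp: doubleton_eq_iff)
        moreover have "w \<notin> D" using D(1) leaf.hyps(3) unfolding closed_sets_def by blast
        ultimately show ?thesis using D(2) uw by auto
      qed
      ultimately show "D' \<in> closed_sets (insert w V) (insert {u, w} E)" unfolding closed_sets_def by blast
    qed
  qed
  from bij_betw_same_card[OF this] show ?case using leaf.IH leaf.hyps(3) fin nE by simp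
qed

lemma bool_perm:
  assumes p: "(p :: bool \<Rightarrow> bool) permutes UNIV"
  shows "p = id \<or> p = Not"
proof -
  have "p True \<noteq> p False" using permutes_inj[OF p] by (metis injD)
  then show ?thesis by (cases "p True"; cases "p False") (auto simp: fun_eq_iff all_bool_eq)
qed

lemma Not_permutes: "Not permutes UNIV"
  by (rule bij_imp_permutes) (auto simp: bij_def inj_def surj_def)

lemma Not_Not_id: "Not \<circ> Not = id" by auto

lemma Not_funpow: "Not ^^ n = (if even n then id else Not)"
  by (induction n) (auto simp: fun_eq_iff)

text \<open>The permutations of two points form a group of order two, so an even label imposes
  nothing and an odd one makes both ends act alike.\<close>

lemma bij_bool_actions:
  assumes "\<And>v w. {v, w} \<in> E \<Longrightarrow> v \<in> V \<and> w \<in> V"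
  shows "bij_betw (\<lambda>a. {v \<in> V. a v \<noteq> id}) {a :: 'a \<Rightarrow> bool \<Rightarrow> bool. cact V E m UNIV a} (closed_sets V {e \<in> E. odd (m e)})"
proof (rule bij_betw_byWitness[where f' = "\<lambda>D v. if v \<in> D then Not else id"])
  have ne: "Not \<noteq> id" by (auto simp: fun_eq_iff)
  have cases: "a v = id \<or> a v = Not" if "cact V E m UNIV a" for a :: "'a \<Rightarrow> bool \<Rightarrow> bool" and v
    by (rule bool_perm[OF cactD(3)[OF that]])
  show "\<forall>a\<in>{a. cact V E m UNIV a}. (\<lambda>v. if v \<in> {v \<in> V. a v \<noteq> id} then Not else id) = a"
  proof
    fix a assume "a \<in> {a :: 'a \<Rightarrow> bool \<Rightarrow> bool. cact V E m UNIV a}"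
    then have a: "cact V E m UNIV a" by simp
    show "(\<lambda>v. if v \<in> {v \<in> V. a v \<noteq> id} then Not else id) = a"
    proof
      fix v show "(if v \<in> {v \<in> V. a v \<noteq> id} then Not else id) = a v"
        using cases[OF a, of v] cactD(2)[OF a, of v] by (cases "v \<in> V") auto
    qed
  qed
  show "\<forall>D\<in>closed_sets V {e \<in> E. odd (m e)}. {v \<in> V. (if v \<in> D then Not else id) \<noteq> id} = D"
    using ne by (auto simp: closed_sets_def)
  show "(\<lambda>a. {v \<in> V. a v \<noteq> id}) ` {a :: 'a \<Rightarrow> bool \<Rightarrow> bool. cact V E m UNIV a} \<subseteq> closed_sets V {e \<in> E. odd (m e)}"
  proof
    fix D assume "D \<in> (\<lambda>a. {v \<in> V. a v \<noteq> id}) ` {a :: 'a \<Rightarrow> bool \<Rightarrow> bool. cact V E m UNIV a}"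
    then obtain a :: "'a \<Rightarrow> bool \<Rightarrow> bool" where a: "cact V E m UNIV a" and D: "D = {v \<in> V. a v \<noteq> id}" by blast
    have "a u = a w" if e: "{u, w} \<in> E" "odd (m {u, w})" for u w
      using cases[OF a, of u] cases[OF a, of w] cactD(5)[OF a e(1)] e(2) ne by (auto simp: Not_funpow)
    then show "D \<in> closed_sets V {e \<in> E. odd (m e)}" using D assms by (auto simp: closed_sets_def)
  qed
  show "(\<lambda>D v. if v \<in> D then Not else id) ` closed_sets V {e \<in> E. odd (m e)} \<subseteq> {a. cact V E m UNIV a}"
  proof
    fix a assume "a \<in> (\<lambda>D v. if v \<in> D then Not else id) ` closed_sets V {e \<in> E. odd (m e)}"
    then obtain D where D: "D \<in> closed_sets V {e \<in> E. odd (m e)}" and a: "a = (\<lambda>v. if v \<in> D then Not else id)" by blast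
    have "(a u \<circ> a w) ^^ m {u, w} = id" if e: "{u, w} \<in> E" for u w
    proof (cases "odd (m {u, w})")
      case True
      then have "u \<in> D \<longleftrightarrow> w \<in> D" using D e by (auto simp: closed_sets_def)
      then have "a u \<circ> a w = id" using Not_Not_id by (simp add: a)
      then show ?thesis by (simp add: id_def[symmetric])
    next
      case False
      then have "Not ^^ m {u, w} = id" by (simp add: Not_funpow)
      moreover have "a u \<circ> a w = id \<or> a u \<circ> a w = Not" by (auto simp: a Not_Not_id)
      ultimately show ?thesis by (auto simp: id_def[symmetric])
    qed
    then show "a \<in> {a. cact V E m UNIV a}"
      unfolding cact_def using D Not_permutes by (auto simp: a closed_sets_def permutes_id Not_Not_id)
  qed
qed

lemma (in transfer_pair) bij_T:
  assumes "\<And>a. cact V E m S a \<Longrightarrow> P a \<Longrightarrow> P' (F.T a)" "\<And>b. cact V' E' m' S b \<Longrightarrow> P' b \<Longrightarrow> P (B.T b)"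
  shows "bij_betw F.T {a. cact V E m S a \<and> P a} {b. cact V' E' m' S b \<and> P' b}"
proof (rule bij_betw_byWitness[where f' = B.T])
  show "\<forall>a\<in>{a. cact V E m S a \<and> P a}. B.T (F.T a) = a" using BF by blast
  show "\<forall>b\<in>{b. cact V' E' m' S b \<and> P' b}. F.T (B.T b) = b" using transfer_pair.BF[OF flip] by blast
qed (use assms F.cact_T B.cact_T in auto)

text \<open>Both graphs have the same number \<open>?c\<close> of actions on two points. The forest
  formula and the inequality on edges give \<open>?c * 2 ^ card E' \<le> 2 ^ card V'\<close>,
  whereas the odd edges alone already require \<open>2 ^ card V' \<le> ?c * 2 ^ card ?O\<close>. So
  there is no room for an even edge, nor for the factor of two that a cycle would bring.\<close>

lemma (in forest_pair) odd_forest_criterion: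
  assumes fin: "finite V'" "finite E'" and e': "\<forall>e\<in>E'. \<exists>u w. e = {u, w} \<and> u \<in> V' \<and> w \<in> V' \<and> u \<noteq> w"
    and card: "card E' + card V \<le> card E + card V'"
  shows "forest V' E' \<and> (\<forall>e\<in>E'. odd (m' e))"
proof -
  let ?O = "{e \<in> E'. odd (m' e)}"
  have "{e \<in> E. odd (m e)} = E" using odd by auto
  then have "card (closed_sets V E) = card {a :: 'a \<Rightarrow> bool \<Rightarrow> bool. cact V E m UNIV a}"
    using bij_betw_same_card[OF bij_bool_actions[of E V m, OF F.edges]] by simp
  also have "\<dots> = card {b :: 'b \<Rightarrow> bool \<Rightarrow> bool. cact V' E' m' UNIV b}"
    using bij_betw_same_card[OF bij_T[of UNIV "\<lambda>_. True" "\<lambda>_. True"]] by simp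
  also have "\<dots> = card (closed_sets V' ?O)"
    by (rule bij_betw_same_card[OF bij_bool_actions]) (use F.edges' in auto)
  finally have c: "card (closed_sets V E) = card (closed_sets V' ?O)" .
  let ?c = "card (closed_sets V E)"
  have f: "?c * 2 ^ card E = 2 ^ card V" by (rule card_closed_sets_forest[OF fo])
  then have cpos: "?c > 0" by (metis mult_eq_0_iff neq0_conv power_not_zero zero_neq_numeral)
  have g: "2 ^ card V' \<le> ?c * 2 ^ card ?O" unfolding c by (rule card_closed_sets_ge) (use fin e' in auto)
  have sub: "card ?O \<le> card E'" by (rule card_mono) (use fin in auto)
  have up: "?c * 2 ^ card E' \<le> 2 ^ card V'"
  proof -
    have "?c * 2 ^ card E' * 2 ^ card V \<le> ?c * 2 ^ card E * 2 ^ card V'"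
      using power_increasing[OF card, of "2::nat"] by (simp add: power_add mult.assoc)
    then show ?thesis unfolding f by simp
  qed
  then have "?c * 2 ^ card E' \<le> ?c * 2 ^ card ?O" using g by linarith
  then have "(2::nat) ^ card E' \<le> 2 ^ card ?O" using cpos by simp
  then have "card E' \<le> card ?O" by simp
  then have O: "?O = E'" using fin sub by (intro card_subset_eq) auto
  have "\<not> has_cycle E'"
  proof
    assume "has_cycle E'"
    from card_closed_sets_cycle[OF fin(2,1) e' this] have "2 * 2 ^ card V' \<le> ?c * 2 ^ card E'" using c O by simp
    then have "2 * 2 ^ card V' \<le> (2::nat) ^ card V'" using up by linarith
    then show False by simp
  qed
  then have "forest V' E'" using e' fin by (intro acyclic_forest) blast+
  then show ?thesis using O by blast
qed

section \<open>Affine lifts and cocycles\<close>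

text \<open>The (-1)-eigenspace, in multiplicative notation.\<close>

definition eig :: "('m, 'z) monoid_scheme \<Rightarrow> ('m \<Rightarrow> 'm) \<Rightarrow> 'm set" where
  "eig G h = {x \<in> carrier G. h x = inv\<^bsub>G\<^esub> x}"

definition linear_act :: "'a set \<Rightarrow> ('m, 'z) monoid_scheme \<Rightarrow> ('a \<Rightarrow> 'm \<Rightarrow> 'm) \<Rightarrow> bool" where
  "linear_act V G b \<longleftrightarrow> (\<forall>v\<in>V. b v \<in> hom G G)"

definition affine_over :: "'a set \<Rightarrow> ('m, 'z) monoid_scheme \<Rightarrow> ('a \<Rightarrow> 'm \<Rightarrow> 'm) \<Rightarrow> ('a \<Rightarrow> 'm \<Rightarrow> 'm) \<Rightarrow> bool" where
  "affine_over V G b \<alpha> \<longleftrightarrow> (\<forall>v\<in>V. \<forall>x\<in>carrier G. \<alpha> v x = \<alpha> v \<one>\<^bsub>G\<^esub> \<otimes>\<^bsub>G\<^esub> b v x)"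

text \<open>Actions by affine maps whose linear parts are given by \<open>b\<close>; their
  translation parts are the crossed homomorphisms.\<close>

definition lifts :: "'a set \<Rightarrow> 'a set set \<Rightarrow> ('a set \<Rightarrow> nat) \<Rightarrow> ('m, 'z) monoid_scheme \<Rightarrow> ('a \<Rightarrow> 'm \<Rightarrow> 'm) \<Rightarrow> ('a \<Rightarrow> 'm \<Rightarrow> 'm) set" where
  "lifts V E m G b = {\<alpha>. cact V E m (carrier G) \<alpha> \<and> affine_over V G b \<alpha>}"

lemma ev_hom: "linear_act V G b \<Longrightarrow> set xs \<subseteq> V \<Longrightarrow> ev b xs \<in> hom G G"
proof (induction xs)
  case (Cons v xs)
  then have "b v \<in> hom G G" "ev b xs \<in> hom G G" by (auto simp: linear_act_def)
  then have "(b v \<circ> ev b xs) \<in> hom G G" by (simp add: hom_def Pi_iff)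
  then show ?case by (simp only: ev_simps)
qed (auto simp: hom_def)

lemma funpow_rotate:
  fixes s t :: "'x \<Rightarrow> 'x"
  shows "s \<circ> (t \<circ> s) ^^ k = (s \<circ> t) ^^ k \<circ> s"
proof (induction k)
  case (Suc k)
  have "s \<circ> (t \<circ> s) ^^ Suc k = (s \<circ> t) \<circ> (s \<circ> (t \<circ> s) ^^ k)" by (simp only: funpow.simps(2) comp_assoc)
  then show ?case by (simp only: Suc funpow.simps(2) comp_assoc)
qed simp

lemma (in group) ev_affine:
  assumes lin: "linear_act V G b" and b: "cact V E m (carrier G) b" and a: "cact V E m (carrier G) \<alpha>"
    and aff: "affine_over V G b \<alpha>" and "set xs \<subseteq> V" "x \<in> carrier G"
  shows "ev \<alpha> xs x = ev \<alpha> xs \<one> \<otimes> ev b xs x"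
  using assms(5)
proof (induction xs)
  case (Cons v xs)
  let ?t = "ev \<alpha> xs \<one>" and ?y = "ev b xs x"
  have v: "v \<in> V" and IH: "ev \<alpha> xs x = ?t \<otimes> ?y" using Cons by auto
  have c: "?t \<in> carrier G" "?y \<in> carrier G" "\<alpha> v \<one> \<in> carrier G"
    using ev_in[OF a] ev_in[OF b] cact_in[OF a] assms(6) by auto
  have bc: "b v ?t \<in> carrier G" "b v ?y \<in> carrier G" using c cact_in[OF b] by auto
  have "\<alpha> v (?t \<otimes> ?y) = \<alpha> v \<one> \<otimes> b v (?t \<otimes> ?y)" using aff v c unfolding affine_over_def by blast
  also have "b v (?t \<otimes> ?y) = b v ?t \<otimes> b v ?y" using lin v c by (auto simp: linear_act_def hom_def)
  also have "\<alpha> v \<one> \<otimes> (b v ?t \<otimes> b v ?y) = (\<alpha> v \<one> \<otimes> b v ?t) \<otimes> b v ?y" using c bc by (simp add: m_assoc)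
  also have "\<alpha> v \<one> \<otimes> b v ?t = \<alpha> v ?t" using aff v c unfolding affine_over_def by metis
  finally show ?case using IH by simp
qed (use assms in simp)

lemma (in transfer) linear_T:
  assumes b: "cact V E m (carrier G) b" and lin: "linear_act V G b"
  shows "linear_act V' G (T b)"
  unfolding linear_act_def
proof
  fix s assume "s \<in> V'"
  then have "set [s] \<subseteq> V'" by simp
  then obtain xs where "set xs \<subseteq> V" "ev (T b) [s] = ev b xs" by (rule T_approx[OF b])
  then show "T b s \<in> hom G G" using ev_hom[OF lin] by simp
qed

lemma (in transfer) affine_T:
  assumes "group G" and b: "cact V E m (carrier G) b" and lin: "linear_act V G b"
    and a: "cact V E m (carrier G) \<alpha>" and aff: "affine_over V G b \<alpha>"
  shows "affine_over V' G (T b) (T \<alpha>)"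
  unfolding affine_over_def
proof (intro ballI)
  fix s x assume s: "s \<in> V'" and x: "x \<in> carrier G"
  then have "set [s] \<subseteq> V'" by simp
  then obtain xs where "set xs \<subseteq> V" "ev (T \<alpha>) [s] = ev \<alpha> xs" "ev (T b) [s] = ev b xs" by (rule T_approx2[OF a b])
  then show "T \<alpha> s x = T \<alpha> s \<one>\<^bsub>G\<^esub> \<otimes>\<^bsub>G\<^esub> T b s x"
    using group.ev_affine[OF assms(1) lin b a aff, of xs x] x by simp
qed

text \<open>The numerical invariant behind all later comparisons: an action over \<open>b\<close>
  transfers to one over \<open>F.T b\<close>, since one word computes both, and the transfer is
  invertible.\<close>

lemma (in transfer_pair) card_lifts:
  assumes "group G" and b: "cact V E m (carrier G) b" and lin: "linear_act V G b"
  shows "card (lifts V E m G b) = card (lifts V' E' m' G (F.T b))"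
  unfolding lifts_def
proof (rule bij_betw_same_card[OF bij_T])
  fix \<alpha> assume "cact V E m (carrier G) \<alpha>" "affine_over V G b \<alpha>"
  then show "affine_over V' G (F.T b) (F.T \<alpha>)" by (rule F.affine_T[OF assms])
next
  fix \<beta> assume "cact V' E' m' (carrier G) \<beta>" "affine_over V' G (F.T b) \<beta>"
  from B.affine_T[OF assms(1) F.cact_T[OF b] F.linear_T[OF b lin] this]
  show "affine_over V G b (B.T \<beta>)" using BF[OF b] by simp
qed

text \<open>The translation part of the \<open>k\<close>-th power of the product of the affine maps
  with linear parts \<open>s\<close>, \<open>t\<close> and translations \<open>x\<close>,
  \<open>y\<close>; see \<open>aff_funpow\<close>.\<close>

fun tau :: "('m, 'z) monoid_scheme \<Rightarrow> ('m \<Rightarrow> 'm) \<Rightarrow> ('m \<Rightarrow> 'm) \<Rightarrow> 'm \<Rightarrow> 'm \<Rightarrow> nat \<Rightarrow> 'm" where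
  "tau G s t x y 0 = \<one>\<^bsub>G\<^esub>"
| "tau G s t x y (Suc k) = x \<otimes>\<^bsub>G\<^esub> s y \<otimes>\<^bsub>G\<^esub> s (t (tau G s t x y k))"

definition aff :: "('m, 'z) monoid_scheme \<Rightarrow> ('m \<Rightarrow> 'm) \<Rightarrow> 'm \<Rightarrow> 'm \<Rightarrow> 'm" where
  "aff G s x = (\<lambda>z. if z \<in> carrier G then x \<otimes>\<^bsub>G\<^esub> s z else z)"

text \<open>Crossed homomorphisms recorded by their values on generators. The relation of an
  involution puts the value into the eigenspace, and a braid relation makes one \<open>tau\<close>
  vanish.\<close>

definition cocycles :: "'a set \<Rightarrow> 'a set set \<Rightarrow> ('a set \<Rightarrow> nat) \<Rightarrow> ('m, 'z) monoid_scheme \<Rightarrow> ('a \<Rightarrow> 'm \<Rightarrow> 'm) \<Rightarrow> ('a \<Rightarrow> 'm) set" where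
  "cocycles V E m G b = {y \<in> \<Pi>\<^sub>E v\<in>V. eig G (b v). \<forall>u w. ({u, w} \<in> E) \<longrightarrow> tau G (b u) (b w) (y u) (y w) (m {u, w}) = \<one>\<^bsub>G\<^esub>}"

context comm_group
begin

lemma hom_inv_self: "s \<in> hom G G \<Longrightarrow> x \<in> carrier G \<Longrightarrow> s (inv x) = inv (s x)"
  using group_hom.hom_inv[of G G s x] group_axioms by (auto simp: group_hom_def group_hom_axioms_def)

lemma eig_subgroup:
  assumes s: "s \<in> hom G G"
  shows "subgroup (eig G s) G"
proof (rule subgroup.intro)
  show "\<one> \<in> eig G s" using hom_one[OF s] group_axioms by (auto simp: eig_def)
qed (auto simp: eig_def hom_mult[OF s] inv_mult hom_inv_self[OF s])

context
  fixes s t :: "'a \<Rightarrow> 'a"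
  assumes s: "s \<in> hom G G" and t: "t \<in> hom G G"
    and ss: "\<And>x. x \<in> carrier G \<Longrightarrow> s (s x) = x" and tt: "\<And>x. x \<in> carrier G \<Longrightarrow> t (t x) = x"
begin

lemma s_closed [simp]: "x \<in> carrier G \<Longrightarrow> s x \<in> carrier G" and t_closed [simp]: "x \<in> carrier G \<Longrightarrow> t x \<in> carrier G"
  using s t by (auto simp: hom_def)

lemma s_mult: "x \<in> carrier G \<Longrightarrow> y \<in> carrier G \<Longrightarrow> s (x \<otimes> y) = s x \<otimes> s y"
  and t_mult: "x \<in> carrier G \<Longrightarrow> y \<in> carrier G \<Longrightarrow> t (x \<otimes> y) = t x \<otimes> t y"
  using s t by (auto simp: hom_def)

lemma s_one [simp]: "s \<one> = \<one>" and t_one [simp]: "t \<one> = \<one>"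
  using hom_one[OF s] hom_one[OF t] group_axioms by auto

lemma tau_closed [simp]: "x \<in> carrier G \<Longrightarrow> y \<in> carrier G \<Longrightarrow> tau G s t x y k \<in> carrier G"
  by (induction k) auto

lemma tau_mult:
  assumes "x \<in> carrier G" "y \<in> carrier G" "x' \<in> carrier G" "y' \<in> carrier G"
  shows "tau G s t (x \<otimes> x') (y \<otimes> y') k = tau G s t x y k \<otimes> tau G s t x' y' k"
  by (induction k) (use assms in \<open>simp_all add: s_mult t_mult m_ac\<close>)

lemma aff_funpow:
  assumes "x \<in> carrier G" "y \<in> carrier G" "z \<in> carrier G"
  shows "((aff G s x \<circ> aff G t y) ^^ k) z = tau G s t x y k \<otimes> ((s \<circ> t) ^^ k) z \<and> ((s \<circ> t) ^^ k) z \<in> carrier G"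
  by (induction k) (use assms in \<open>simp_all add: aff_def s_mult t_mult m_ac\<close>)

lemma aff_invol: "x \<in> eig G s \<Longrightarrow> aff G s x \<circ> aff G s x = id" "y \<in> eig G t \<Longrightarrow> aff G t y \<circ> aff G t y = id"
  by (auto simp: aff_def eig_def fun_eq_iff s_mult t_mult ss tt m_assoc[symmetric])

text \<open>When the linear parts satisfy the relation, the \<open>n\<close>-th power of the product
  of the affine involutions is a translation. Conjugation by either involution inverts it, so both
  linear parts invert the translation vector.\<close>

lemma tau_eig:
  assumes x: "x \<in> eig G s" and y: "y \<in> eig G t" and n: "\<And>z. z \<in> carrier G \<Longrightarrow> ((s \<circ> t) ^^ n) z = z"
  shows "tau G s t x y n \<in> eig G s \<inter> eig G t"
proof -
  have xy: "x \<in> carrier G" "y \<in> carrier G" using x y by (auto simp: eig_def)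
  let ?f = "aff G s x" and ?g = "aff G t y" and ?c = "tau G s t x y n"
  let ?P = "(?f \<circ> ?g) ^^ n"
  have c: "?c \<in> carrier G" using xy by simp
  have P: "?P z = ?c \<otimes> z" if "z \<in> carrier G" for z using aff_funpow[OF xy that] n that by simp
  note ff = aff_invol(1)[OF x] and gg = aff_invol(2)[OF y]
  have sw: "?f \<circ> ?P \<circ> ?f = (?g \<circ> ?f) ^^ n" "?g \<circ> ?P \<circ> ?g = (?g \<circ> ?f) ^^ n"
  proof -
    have "?f \<circ> ?P \<circ> ?f = ?f \<circ> (?f \<circ> (?g \<circ> ?f) ^^ n)" by (simp only: comp_assoc funpow_rotate)
    also have "\<dots> = (?f \<circ> ?f) \<circ> (?g \<circ> ?f) ^^ n" by (simp only: comp_assoc)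
    finally show "?f \<circ> ?P \<circ> ?f = (?g \<circ> ?f) ^^ n" using ff by simp
    have "?g \<circ> ?P \<circ> ?g = (?g \<circ> ?f) ^^ n \<circ> (?g \<circ> ?g)" by (simp only: comp_assoc funpow_rotate)
    then show "?g \<circ> ?P \<circ> ?g = (?g \<circ> ?f) ^^ n" using gg by simp
  qed
  have inv: "(?g \<circ> ?f) ^^ n \<circ> ?P = id" by (rule funpow_invol_cancel[OF gg ff])
  have f1: "?f (?P (?f (?P z))) = z" and g1: "?g (?P (?g (?P z))) = z" for z
    using inv sw by (metis comp_apply id_apply)+
  have "x \<otimes> s (?c \<otimes> (x \<otimes> s ?c)) = \<one>"
    using f1[of \<one>] P xy c by (simp add: aff_def)
  then have "(s ?c \<otimes> ?c) \<otimes> (x \<otimes> s x) = \<one>" using xy c by (simp add: s_mult ss m_ac)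
  then have "s ?c \<otimes> ?c = \<one>" using x xy c by (simp add: eig_def)
  then have 1: "s ?c = inv ?c" using c by (simp add: inv_equality)
  have "y \<otimes> t (?c \<otimes> (y \<otimes> t ?c)) = \<one>"
    using g1[of \<one>] P xy c by (simp add: aff_def)
  then have "(t ?c \<otimes> ?c) \<otimes> (y \<otimes> t y) = \<one>" using xy c by (simp add: t_mult tt m_ac)
  then have "t ?c \<otimes> ?c = \<one>" using y xy c by (simp add: eig_def)
  then have "t ?c = inv ?c" using c by (simp add: inv_equality)
  with 1 c show ?thesis by (simp add: eig_def)
qed

text \<open>Edges are unordered, so the vanishing must not depend on which end comes first: the
  powers of the two products are inverse to each other. The hypothesis \<open>fl\<close> is
  \<open>aff_funpow\<close> for the exchanged pair and is discharged in
  \<open>tau_flip'\<close>.\<close>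

lemma tau_flip:
  assumes x: "x \<in> eig G s" and y: "y \<in> eig G t" and n: "\<And>z. z \<in> carrier G \<Longrightarrow> ((s \<circ> t) ^^ n) z = z"
    and n': "\<And>z. z \<in> carrier G \<Longrightarrow> ((t \<circ> s) ^^ n) z = z"
    and fl: "\<And>z k. z \<in> carrier G \<Longrightarrow> ((aff G t y \<circ> aff G s x) ^^ k) z = tau G t s y x k \<otimes> ((t \<circ> s) ^^ k) z"
    and "tau G s t x y n = \<one>" and cl: "tau G t s y x n \<in> carrier G"
  shows "tau G t s y x n = \<one>"
proof -
  have xy: "x \<in> carrier G" "y \<in> carrier G" using x y by (auto simp: eig_def)
  have "((aff G s x \<circ> aff G t y) ^^ n) z = z" if "z \<in> carrier G" for z
    using aff_funpow[OF xy that] n that assms(6) by simp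
  moreover have "((aff G s x \<circ> aff G t y) ^^ n) (((aff G t y \<circ> aff G s x) ^^ n) \<one>) = \<one>"
    using funpow_invol_cancel[OF aff_invol(1)[OF x] aff_invol(2)[OF y], of n] by (metis comp_apply id_apply)
  ultimately show ?thesis using fl[of \<one> n] n'[of \<one>] cl by simp
qed

text \<open>The displacement \<open>?d\<close> of \<open>x\<close> under \<open>s \<circ> t\<close>
  lies in the common eigenspace and is fixed by \<open>s \<circ> t\<close>, so the
  \<open>k\<close>-th iterate of \<open>x\<close> is \<open>x\<close> times the \<open>k\<close>-th
  power of \<open>?d\<close>. The order of \<open>?d\<close> then divides both \<open>n\<close> and
  \<open>p\<close>.\<close>

lemma equal_eig_imp_equal:
  assumes eq: "eig G s = eig G t" and n: "\<And>z. z \<in> carrier G \<Longrightarrow> ((s \<circ> t) ^^ n) z = z"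
    and p: "\<And>x. x \<in> carrier G \<Longrightarrow> x [^] p = \<one>" and cop: "coprime n p" and x: "x \<in> carrier G"
  shows "s x = t x"
proof -
  let ?d = "s (t x) \<otimes> inv x"
  have inv_s: "s (inv z) = inv (s z)" and inv_t: "t (inv z) = inv (t z)" if "z \<in> carrier G" for z
    using that s t group_hom.hom_inv[of G G s z] group_hom.hom_inv[of G G t z] group_axioms
    by (auto simp: group_hom_def group_hom_axioms_def)
  have se: "s z \<otimes> inv z \<in> eig G s" if "z \<in> carrier G" for z
    using that by (simp add: eig_def s_mult ss inv_s inv_mult m_comm)
  have te: "t z \<otimes> inv z \<in> eig G t" if "z \<in> carrier G" for z
    using that by (simp add: eig_def t_mult tt inv_t inv_mult m_comm)
  have "?d = (s (t x) \<otimes> inv (t x)) \<otimes> (t x \<otimes> inv x)" using x by (simp add: m_assoc inv_solve_left)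
  then have d: "?d \<in> eig G s"
    using se[of "t x"] te[OF x] eq x subgroup.m_closed[OF eig_subgroup[OF s]] by simp
  then have dc: "?d \<in> carrier G" and d2: "s ?d = inv ?d" "t ?d = inv ?d" using eq by (auto simp: eig_def)
  have std: "s (t (?d [^] (k::nat) \<otimes> x)) = ?d [^] Suc k \<otimes> x" for k
  proof -
    have hs: "s (?d [^] k) = (inv ?d) [^] k" "t (?d [^] k) = (inv ?d) [^] k" 
      using d2 dc s t group_hom.hom_nat_pow[of G G s ?d k] group_hom.hom_nat_pow[of G G t ?d k] group_axioms
      by (auto simp: group_hom_def group_hom_axioms_def)
    have "s (t (?d [^] k)) = ?d [^] k"
      using hs dc ss[of "?d [^] k"] by simp
    then have "s (t (?d [^] k \<otimes> x)) = ?d [^] k \<otimes> (?d \<otimes> x)" using dc x by (simp add: s_mult t_mult m_assoc)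
    then show ?thesis using dc x by (simp add: m_assoc)
  qed
  have "((s \<circ> t) ^^ k) x = ?d [^] k \<otimes> x" for k
  proof (induction k)
    case (Suc k)
    then show ?case using std[of k] by simp
  qed (use x in simp)
  then have "?d [^] n \<otimes> x = x" using n[OF x] by simp
  then have dn: "?d [^] n = \<one>" using dc x by (simp add: l_cancel_one')
  have "ord ?d dvd n" "ord ?d dvd p" using dn p[OF dc] dc pow_eq_id by auto
  then have "ord ?d = 1" using cop by (metis coprime_common_divisor_nat)
  then have "?d = \<one>" using dc ord_eq_1 by blast
  then have "s (t x) = x" using x by (metis inv_equality inv_inv s_closed t_closed inv_closed)
  then show "s x = t x" using ss[of "t x"] x by simp
qed

end

lemma tau_flip':
  assumes s: "s \<in> hom G G" and t: "t \<in> hom G G"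
    and ss: "\<And>x. x \<in> carrier G \<Longrightarrow> s (s x) = x" and tt: "\<And>x. x \<in> carrier G \<Longrightarrow> t (t x) = x"
    and x: "x \<in> eig G s" and y: "y \<in> eig G t" and n: "\<And>z. z \<in> carrier G \<Longrightarrow> ((s \<circ> t) ^^ n) z = z"
    and n': "\<And>z. z \<in> carrier G \<Longrightarrow> ((t \<circ> s) ^^ n) z = z"
    and one: "tau G s t x y n = \<one>"
  shows "tau G t s y x n = \<one>"
proof -
  have xy: "x \<in> carrier G" "y \<in> carrier G" using x y by (auto simp: eig_def)
  show ?thesis
    by (rule tau_flip[OF s t ss tt x y n n' _ one])
      (use aff_funpow[OF t s tt ss xy(2,1)] tau_closed[OF t s tt ss xy(2,1)] in auto)
qed

end

lemma (in group) prime_order_subgroup_subset: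
  assumes H: "subgroup H G" and K: "subgroup K G" and "card H = p" "Factorial_Ring.prime p"
    and c: "c \<in> H" "c \<in> K" "c \<noteq> \<one>"
  shows "H \<subseteq> K"
proof -
  have fin: "finite H" using assms(3,4) by (metis card.infinite not_prime_0)
  interpret H: group "G\<lparr>carrier := H\<rparr>" by (rule subgroup_imp_group[OF H])
  have HK: "subgroup (H \<inter> K) G" using H K by (rule subgroups_Inter_pair)
  then have sub: "subgroup (H \<inter> K) (G\<lparr>carrier := H\<rparr>)" using H by (intro subgroup_incl) auto
  have "Coset.order (G\<lparr>carrier := H\<rparr>) = p" using assms(3) by (simp add: Coset.order_def)
  with H.lagrange[OF sub] have "card (H \<inter> K) dvd p" by (metis dvd_triv_right)
  moreover have "card (H \<inter> K) \<noteq> 1"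
  proof
    assume "card (H \<inter> K) = 1"
    then have "is_singleton (H \<inter> K)" by (simp add: is_singleton_altdef)
    moreover have "\<one> \<in> H \<inter> K" "c \<in> H \<inter> K" using subgroup.one_closed[OF HK] c by auto
    ultimately show False using c(3) by (metis is_singletonE singletonD)
  qed
  ultimately have "card (H \<inter> K) = card H" using assms(3,4) prime_nat_iff by blast
  then have "H \<inter> K = H" using fin by (intro card_subset_eq) auto
  then show ?thesis by blast
qed

context comm_group
begin

lemma tau_equal:
  assumes s: "s \<in> hom G G" and ss: "\<And>x. x \<in> carrier G \<Longrightarrow> s (s x) = x" and x: "x \<in> eig G s" and y: "y \<in> eig G s"
  shows "tau G s s x y k = (x \<otimes> inv y) [^] k"
proof (induction k)
  case (Suc k)
  have "x \<in> carrier G" "y \<in> carrier G" using x y by (auto simp: eig_def)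
  then show ?case using Suc ss y m_comm[of "x \<otimes> inv y" "(x \<otimes> inv y) [^] k"] by (simp add: eig_def)
qed simp

text \<open>Two different maps have different eigenspaces of prime order, which meet trivially, so
  by \<open>tau_eig\<close> the relation holds by itself. If the maps coincide, \<open>tau\<close>
  is a power of the quotient of the two values with exponent prime to \<open>p\<close>.\<close>

lemma cocycle_edge_iff:
  assumes b: "cact V E m (carrier G) b" and lin: "linear_act V G b" and ed: "{u, w} \<in> E" and uw: "u \<in> V" "w \<in> V"
    and p: "\<And>x. x \<in> carrier G \<Longrightarrow> x [^] p = \<one>" and "Factorial_Ring.prime p" and cop: "coprime (m {u, w}) p"
    and card: "b u = b w \<or> card (eig G (b u)) = p \<and> card (eig G (b w)) = p"
    and x: "x \<in> eig G (b u)" and y: "y \<in> eig G (b w)"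
  shows "tau G (b u) (b w) x y (m {u, w}) = \<one> \<longleftrightarrow> (b u = b w \<longrightarrow> x = y)"
proof -
  have h: "b u \<in> hom G G" "b w \<in> hom G G" using lin uw by (auto simp: linear_act_def)
  have inv: "b u (b u z) = z" "b w (b w z) = z" for z using cact_invol[OF b] by auto
  have rel: "((b u \<circ> b w) ^^ m {u, w}) z = z" for z using cactD(5)[OF b ed] by simp
  have xy: "x \<in> carrier G" "y \<in> carrier G" using x y by (auto simp: eig_def)
  show ?thesis
  proof (cases "b u = b w")
    case True
    have "tau G (b u) (b w) x y (m {u, w}) = (x \<otimes> inv y) [^] m {u, w}"
      using tau_equal[OF h(1) inv(1) x] y True by simp
    moreover have "(x \<otimes> inv y) [^] m {u, w} = \<one> \<longleftrightarrow> x = y"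
    proof
      assume "(x \<otimes> inv y) [^] m {u, w} = \<one>"
      then have "ord (x \<otimes> inv y) dvd m {u, w}" "ord (x \<otimes> inv y) dvd p" using xy p pow_eq_id by auto
      then have "ord (x \<otimes> inv y) = 1" using cop by (metis coprime_common_divisor_nat)
      then have "x \<otimes> inv y = \<one>" using xy ord_eq_1 by simp
      then show "x = y" using xy by (metis inv_equality inv_inv inv_closed)
    qed (use xy in simp)
    ultimately show ?thesis using True by simp
  next
    case False
    then have c: "card (eig G (b u)) = p" "card (eig G (b w)) = p" using card by auto
    let ?c = "tau G (b u) (b w) x y (m {u, w})"
    have mem: "?c \<in> eig G (b u) \<inter> eig G (b w)" using tau_eig[OF h inv x y] rel by blast
    have "?c = \<one>"
    proof (rule ccontr)
      assume ne: "?c \<noteq> \<one>"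
      note sub = eig_subgroup[OF h(1)] eig_subgroup[OF h(2)]
      have "eig G (b u) = eig G (b w)"
        using prime_order_subgroup_subset[OF sub c(1) \<open>Factorial_Ring.prime p\<close> _ _ ne] prime_order_subgroup_subset[OF sub(2,1) c(2) \<open>Factorial_Ring.prime p\<close> _ _ ne] mem
        by blast
      from equal_eig_imp_equal[OF h inv this rel p cop] have "b u z = b w z" if "z \<in> carrier G" for z using that by blast
      then have "b u = b w" using permutes_not_in[OF cactD(3)[OF b]] by (metis ext)
      then show False using False by simp
    qed
    then show ?thesis using False by simp
  qed
qed

text \<open>An affine map with known linear part is determined by the image of the unit, that is, by
  its translation.\<close>

lemma bij_lifts_cocycles:
  assumes b: "cact V E m (carrier G) b" and lin: "linear_act V G b" and edges: "\<And>u w. {u, w} \<in> E \<Longrightarrow> u \<in> V \<and> w \<in> V"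
  shows "bij_betw (\<lambda>\<alpha>. \<lambda>v\<in>V. \<alpha> v \<one>) (lifts V E m G b) (cocycles V E m G b)"
proof (rule bij_betw_byWitness[where f' = "\<lambda>y. mk V (carrier G) (\<lambda>v. aff G (b v) (y v))"])
  have h: "b v \<in> hom G G" if "v \<in> V" for v using lin that by (auto simp: linear_act_def)
  have inv: "b v (b v z) = z" for v z using cact_invol[OF b] by auto
  have rel: "((b u \<circ> b w) ^^ m {u, w}) z = z" if "{u, w} \<in> E" for u w z using cactD(5)[OF b that] by simp
  have aff_eq: "\<alpha> v z = aff G (b v) (\<alpha> v \<one>) z" if "\<alpha> \<in> lifts V E m G b" "v \<in> V" for \<alpha> v z
  proof (cases "z \<in> carrier G")
    case True
    then have "\<alpha> v z = \<alpha> v \<one> \<otimes> b v z" using that unfolding lifts_def affine_over_def by blast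
    then show ?thesis using True by (simp add: aff_def)
  next
    case False
    have "cact V E m (carrier G) \<alpha>" using that by (simp add: lifts_def)
    then have "\<alpha> v z = z" using False permutes_not_in[OF cactD(3)] by metis
    then show ?thesis using False by (simp add: aff_def)
  qed
  show "\<forall>\<alpha>\<in>lifts V E m G b. mk V (carrier G) (\<lambda>v. aff G (b v) ((\<lambda>v\<in>V. \<alpha> v \<one>) v)) = \<alpha>"
  proof
    fix \<alpha> assume a: "\<alpha> \<in> lifts V E m G b"
    then have ac: "cact V E m (carrier G) \<alpha>" by (simp add: lifts_def)
    show "mk V (carrier G) (\<lambda>v. aff G (b v) ((\<lambda>v\<in>V. \<alpha> v \<one>) v)) = \<alpha>"
    proof (intro ext)
      fix v z show "mk V (carrier G) (\<lambda>v. aff G (b v) ((\<lambda>v\<in>V. \<alpha> v \<one>) v)) v z = \<alpha> v z"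
        using aff_eq[OF a, of v z] cactD(2)[OF ac, of v] permutes_not_in[OF cactD(3)[OF ac], of z v]
        by (cases "v \<in> V") (auto simp: mk_def)
    qed
  qed
  have mk1: "mk V (carrier G) (\<lambda>v. aff G (b v) (y v)) v \<one> = y v" if "y \<in> cocycles V E m G b" "v \<in> V" for y v
  proof -
    have "y v \<in> carrier G" using that by (auto simp: cocycles_def eig_def PiE_def Pi_def)
    then show ?thesis using hom_one[OF h[OF that(2)]] group_axioms that(2) by (simp add: mk_def aff_def)
  qed
  show "\<forall>y\<in>cocycles V E m G b. (\<lambda>v\<in>V. mk V (carrier G) (\<lambda>v. aff G (b v) (y v)) v \<one>) = y"
  proof
    fix y assume y: "y \<in> cocycles V E m G b"
    then have "y \<in> extensional V" by (simp add: cocycles_def PiE_def)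
    then show "(\<lambda>v\<in>V. mk V (carrier G) (\<lambda>v. aff G (b v) (y v)) v \<one>) = y"
      using mk1[OF y] by (intro extensionalityI[of _ V]) auto
  qed
  show "(\<lambda>\<alpha>. \<lambda>v\<in>V. \<alpha> v \<one>) ` lifts V E m G b \<subseteq> cocycles V E m G b"
  proof
    fix y assume "y \<in> (\<lambda>\<alpha>. \<lambda>v\<in>V. \<alpha> v \<one>) ` lifts V E m G b"
    then obtain \<alpha> where a: "\<alpha> \<in> lifts V E m G b" and y: "y = (\<lambda>v\<in>V. \<alpha> v \<one>)" by blast
    then have ac: "cact V E m (carrier G) \<alpha>" by (simp add: lifts_def)
    have yc: "\<alpha> v \<one> \<in> carrier G" for v using cact_in[OF ac] by simp
    have ye: "\<alpha> v \<one> \<in> eig G (b v)" if v: "v \<in> V" for v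
    proof -
      have "\<alpha> v \<one> \<otimes> b v (\<alpha> v \<one>) = \<one>" using cact_invol[OF ac, of v \<one>] aff_eq[OF a v, of "\<alpha> v \<one>"] yc by (simp add: aff_def)
      then have "b v (\<alpha> v \<one>) \<otimes> \<alpha> v \<one> = \<one>" using yc[of v] cact_in[OF b yc] by (simp add: m_comm)
      then show ?thesis using yc[of v] cact_in[OF b yc] by (simp add: eig_def inv_equality)
    qed
    have "tau G (b u) (b w) (\<alpha> u \<one>) (\<alpha> w \<one>) (m {u, w}) = \<one>" if e: "{u, w} \<in> E" for u w
    proof -
      have uw: "u \<in> V" "w \<in> V" using edges[OF e] by auto
      have eqs: "aff G (b u) (\<alpha> u \<one>) = \<alpha> u" "aff G (b w) (\<alpha> w \<one>) = \<alpha> w"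
        by (rule ext, rule aff_eq[OF a uw(1), symmetric]) (rule ext, rule aff_eq[OF a uw(2), symmetric])
      have "((aff G (b u) (\<alpha> u \<one>) \<circ> aff G (b w) (\<alpha> w \<one>)) ^^ m {u, w}) \<one> = \<one>"
        unfolding eqs using cactD(5)[OF ac e] by simp
      then show ?thesis
        using aff_funpow[OF h[OF uw(1)] h[OF uw(2)] inv inv yc[of u] yc[of w] one_closed, of "m {u, w}"] rel[OF e]
          tau_closed[OF h[OF uw(1)] h[OF uw(2)] inv inv yc[of u] yc[of w]] by simp
    qed
    then show "y \<in> cocycles V E m G b" using ye edges by (auto simp: cocycles_def y)
  qed
  show "(\<lambda>y. mk V (carrier G) (\<lambda>v. aff G (b v) (y v))) ` cocycles V E m G b \<subseteq> lifts V E m G b"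
  proof
    fix \<alpha> assume "\<alpha> \<in> (\<lambda>y. mk V (carrier G) (\<lambda>v. aff G (b v) (y v))) ` cocycles V E m G b"
    then obtain y where y: "y \<in> cocycles V E m G b" and al: "\<alpha> = mk V (carrier G) (\<lambda>v. aff G (b v) (y v))" by blast
    have ye: "y v \<in> eig G (b v)" "y v \<in> carrier G" if "v \<in> V" for v using y that by (auto simp: cocycles_def eig_def PiE_def Pi_def)
    have "cact V E m (carrier G) \<alpha>"
      unfolding al
    proof (rule cact_mk)
      show "finite (carrier G)" using cactD(1)[OF b] .
      fix v z assume "v \<in> V" "z \<in> carrier G"
      then show "aff G (b v) (y v) z \<in> carrier G" using ye cact_in[OF b] by (simp add: aff_def)
    next
      fix v z assume v: "v \<in> V"
      show "aff G (b v) (y v) (aff G (b v) (y v) z) = z"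
        using aff_invol(1)[OF h[OF v] h[OF v] inv inv ye(1)[OF v]] by (metis comp_apply id_apply)
    next
      fix u w z assume e: "{u, w} \<in> E" and z: "z \<in> carrier G"
      have uw: "u \<in> V" "w \<in> V" using edges[OF e] by auto
      have "tau G (b u) (b w) (y u) (y w) (m {u, w}) = \<one>" using y e by (auto simp: cocycles_def)
      then show "((aff G (b u) (y u) \<circ> aff G (b w) (y w)) ^^ m {u, w}) z = z"
        using aff_funpow[OF h[OF uw(1)] h[OF uw(2)] inv inv ye(2)[OF uw(1)] ye(2)[OF uw(2)] z, of "m {u, w}"] rel[OF e] z by simp
    qed (use edges in auto)
    moreover have "affine_over V G b \<alpha>"
      unfolding affine_over_def
    proof (intro ballI)
      fix v z assume v: "v \<in> V" "z \<in> carrier G"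
      then show "\<alpha> v z = \<alpha> v \<one> \<otimes> b v z" using mk1[OF y v(1)] by (simp add: al mk_def aff_def)
    qed
    ultimately show "\<alpha> \<in> lifts V E m G b" by (simp add: lifts_def)
  qed
qed

lemma cocycles_collapse:
  assumes b: "cact V E m (carrier G) b" and lin: "linear_act V G b" and edges: "\<And>u w. {u, w} \<in> E \<Longrightarrow> u \<in> V \<and> w \<in> V"
    and p: "\<And>x. x \<in> carrier G \<Longrightarrow> x [^] p = \<one>" and "Factorial_Ring.prime p" and cop: "\<And>e. e \<in> E \<Longrightarrow> coprime (m e) p"
    and card: "\<And>u w. {u, w} \<in> E \<Longrightarrow> b u = b w \<or> card (eig G (b u)) = p \<and> card (eig G (b w)) = p"
  shows "cocycles V E m G b = {y \<in> \<Pi>\<^sub>E v\<in>V. eig G (b v). \<forall>u w. ({u, w} \<in> E) \<longrightarrow> (b u = b w \<longrightarrow> y u = y w)}"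
proof -
  have "tau G (b u) (b w) (y u) (y w) (m {u, w}) = \<one> \<longleftrightarrow> (b u = b w \<longrightarrow> y u = y w)"
    if "y \<in> (\<Pi>\<^sub>E v\<in>V. eig G (b v))" "{u, w} \<in> E" for y u w
    by (rule cocycle_edge_iff[OF b lin that(2) _ _ p \<open>Factorial_Ring.prime p\<close> cop[OF that(2)] card[OF that(2)]])
      (use edges[OF that(2)] that(1) in auto)
  then show ?thesis unfolding cocycles_def by blast
qed

end

section \<open>Counting assignments on a forest\<close>

lemma card_PiE_insert:
  assumes w: "w \<notin> V" and fin: "finite V" "\<And>v. v \<in> insert w V \<Longrightarrow> finite (Y v)"
  shows "card {y \<in> PiE (insert w V) Y. Q (y(w := undefined)) \<and> R (y(w := undefined)) (y w)}
    = (\<Sum>y\<in>{y \<in> PiE V Y. Q y}. card {t \<in> Y w. R y t})"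
proof -
  let ?A = "{y \<in> PiE (insert w V) Y. Q (y(w := undefined)) \<and> R (y(w := undefined)) (y w)}"
  let ?B = "SIGMA y:{y \<in> PiE V Y. Q y}. {t \<in> Y w. R y t}"
  have und: "y(w := undefined) = y" if "y \<in> PiE V Y" for y
    using PiE_arb[OF that w] by (metis fun_upd_triv)
  have "bij_betw (\<lambda>y. (y(w := undefined), y w)) ?A ?B"
  proof (rule bij_betw_byWitness[where f' = "\<lambda>(y, t). y(w := t)"])
    show "\<forall>y\<in>?A. (case (y(w := undefined), y w) of (y, t) \<Rightarrow> y(w := t)) = y" by simp
    show "\<forall>z\<in>?B. ((case z of (y, t) \<Rightarrow> y(w := t))(w := undefined), (case z of (y, t) \<Rightarrow> y(w := t)) w) = z"
      using und by auto
    show "(\<lambda>y. (y(w := undefined), y w)) ` ?A \<subseteq> ?B"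
    proof
      fix z assume "z \<in> (\<lambda>y. (y(w := undefined), y w)) ` ?A"
      then obtain y where y: "y \<in> PiE (insert w V) Y" "Q (y(w := undefined))" "R (y(w := undefined)) (y w)" "z = (y(w := undefined), y w)" by blast
      have "y(w := undefined) \<in> PiE V Y" using y(1) w by (auto simp: PiE_def Pi_def extensional_def)
      then show "z \<in> ?B" using y by auto
    qed
    show "(\<lambda>(y, t). y(w := t)) ` ?B \<subseteq> ?A"
    proof
      fix z assume "z \<in> (\<lambda>(y, t). y(w := t)) ` ?B"
      then obtain y t where y: "y \<in> PiE V Y" "Q y" "t \<in> Y w" "R y t" "z = y(w := t)" by auto
      have "z \<in> PiE (insert w V) Y" unfolding y(5) by (rule PiE_fun_upd[OF y(3,1)])
      then show "z \<in> ?A" using y und[OF y(1)] by simp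
    qed
  qed
  from bij_betw_same_card[OF this] have "card ?A = card ?B" .
  also have "\<dots> = (\<Sum>y\<in>{y \<in> PiE V Y. Q y}. card {t \<in> Y w. R y t})"
  proof (rule card_SigmaI)
    have "finite (PiE V Y)" using fin by (intro finite_PiE) auto
    then show "finite {y \<in> PiE V Y. Q y}" by simp
  qed (use fin in simp)
  finally show ?thesis .
qed

text \<open>The value at a new leaf is dictated by its neighbour across a collapsed edge and free
  otherwise. The weights \<open>q\<close> stand on the left in order to avoid division.\<close>

lemma card_forest_collapse:
  fixes Y :: "'a \<Rightarrow> 'm set"
  assumes "forest V E" "\<And>v. v \<in> V \<Longrightarrow> finite (Y v)" "\<And>u w. {u, w} \<in> E \<Longrightarrow> c u = c w \<Longrightarrow> Y u = Y w"
    "\<And>u w. {u, w} \<in> E \<Longrightarrow> q {u, w} = (if c u = c w then card (Y w) else 1)"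
  shows "card {y \<in> PiE V Y. \<forall>u w. ({u, w} \<in> E) \<longrightarrow> (c u = c w \<longrightarrow> y u = y w)} * (\<Prod>e\<in>E. q e)
    = (\<Prod>v\<in>V. card (Y v))"
  using assms
proof (induction rule: forest.induct)
  case empty
  show ?case by simp
next
  case (isolated V E w)
  let ?Q = "\<lambda>y. \<forall>u w. ({u, w} \<in> E) \<longrightarrow> (c u = c w \<longrightarrow> y u = y w)"
  note fin = forest_finite[OF isolated.hyps(1)]
  have wE: "x \<noteq> w \<and> y \<noteq> w" if "{x, y} \<in> E" for x y using forest_new_edge[OF isolated.hyps(1)] isolated.hyps(2) that by blast
  have iff: "?Q y \<longleftrightarrow> ?Q (y(w := undefined)) \<and> True" for y :: "'a \<Rightarrow> 'm" using wE by auto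
  have "card {y \<in> PiE (insert w V) Y. ?Q (y(w := undefined)) \<and> True} = (\<Sum>y\<in>{y \<in> PiE V Y. ?Q y}. card {t \<in> Y w. True})"
    by (rule card_PiE_insert[OF isolated.hyps(2)]) (use fin isolated.prems(1) in blast)+
  then have "card {y \<in> PiE (insert w V) Y. ?Q y} = card {y \<in> PiE V Y. ?Q y} * card (Y w)"
    unfolding iff[symmetric] by simp
  moreover have "card {y \<in> PiE V Y. ?Q y} * (\<Prod>e\<in>E. q e) = (\<Prod>v\<in>V. card (Y v))"
    by (rule isolated.IH) (use isolated.prems in blast)+
  ultimately show ?case using isolated.hyps(2) fin by (simp add: mult.assoc mult.left_commute mult.commute)
next
  case (leaf V E u w)
  let ?Q = "\<lambda>y. \<forall>u w. ({u, w} \<in> E) \<longrightarrow> (c u = c w \<longrightarrow> y u = y w)"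
  let ?R = "\<lambda>y t. c u = c w \<longrightarrow> y u = t"
  note fin = forest_finite[OF leaf.hyps(1)]
  have wE: "x \<noteq> w \<and> y \<noteq> w" if "{x, y} \<in> E" for x y using forest_new_edge[OF leaf.hyps(1)] leaf.hyps(3) that by blast
  have uw: "u \<noteq> w" using leaf.hyps by blast
  have nE: "{u, w} \<notin> E" using wE by blast
  have iff: "(\<forall>x z. ({x, z} \<in> insert {u, w} E) \<longrightarrow> (c x = c z \<longrightarrow> y x = y z)) \<longleftrightarrow> ?Q (y(w := undefined)) \<and> ?R (y(w := undefined)) (y w)"
    for y :: "'a \<Rightarrow> 'm"
    using wE uw by (auto simp: doubleton_eq_iff)
  have "card {y \<in> PiE (insert w V) Y. \<forall>x z. ({x, z} \<in> insert {u, w} E) \<longrightarrow> (c x = c z \<longrightarrow> y x = y z)}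
      = (\<Sum>y\<in>{y \<in> PiE V Y. ?Q y}. card {t \<in> Y w. ?R y t})"
    unfolding iff by (rule card_PiE_insert[OF leaf.hyps(3)]) (use fin leaf.prems(1) in blast)+
  also have "\<dots> * q {u, w} = card {y \<in> PiE V Y. ?Q y} * card (Y w)"
  proof (cases "c u = c w")
    case True
    have "{t \<in> Y w. ?R y t} = {y u}" if "y \<in> PiE V Y" for y
      using that leaf.hyps(2) leaf.prems(2)[of u w] True by (auto simp: PiE_def Pi_def)
    then have "(\<Sum>y\<in>{y \<in> PiE V Y. ?Q y}. card {t \<in> Y w. ?R y t}) = card {y \<in> PiE V Y. ?Q y}" by simp
    then show ?thesis using leaf.prems(3)[of u w] True by simp
  next
    case False
    then show ?thesis using leaf.prems(3)[of u w] by simp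
  qed
  finally have "card {y \<in> PiE (insert w V) Y. \<forall>x z. ({x, z} \<in> insert {u, w} E) \<longrightarrow> (c x = c z \<longrightarrow> y x = y z)} * q {u, w}
      = card {y \<in> PiE V Y. ?Q y} * card (Y w)" .
  moreover have "card {y \<in> PiE V Y. ?Q y} * (\<Prod>e\<in>E. q e) = (\<Prod>v\<in>V. card (Y v))"
    by (rule leaf.IH) (use leaf.prems in blast)+
  ultimately show ?case using leaf.hyps(3) nE fin by (simp add: mult.assoc[symmetric])
qed

section \<open>Alternating forms modulo a prime\<close>

lemma card_le_fibres:
  assumes "finite D" and "\<And>c. c \<in> f ` D \<Longrightarrow> card {y \<in> D. f y = c} \<le> k"
  shows "card D \<le> card (f ` D) * k"
proof -
  have "D = (\<Union>c\<in>f ` D. {y \<in> D. f y = c})" by blast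
  then have "card D \<le> (\<Sum>c\<in>f ` D. card {y \<in> D. f y = c})"
    using card_UN_le[of "f ` D" "\<lambda>c. {y \<in> D. f y = c}"] assms(1) by simp
  also have "\<dots> \<le> card (f ` D) * k" using sum_bounded_above[of "f ` D" "\<lambda>c. card {y \<in> D. f y = c}" k] assms(2) by simp
  finally show ?thesis .
qed

context comm_group
begin

text \<open>\<open>tau\<close> is additive in the pair of values and lands in the common eigenspace
  of the two ends. Hence \<open>\<Theta>\<close> is a homomorphism on all families of eigenvectors
  with the cocycles as kernel, and its image is at most the product of these common
  eigenspaces.\<close>

lemma card_cocycles_ge:
  assumes b: "cact V E m (carrier G) b" and lin: "linear_act V G b" and edges: "\<And>u w. {u, w} \<in> E \<Longrightarrow> u \<in> V \<and> w \<in> V"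
    and fin: "finite V" "finite E" and pairs: "\<forall>e\<in>E. \<exists>u w. e = {u, w}"
  shows "(\<Prod>v\<in>V. card (eig G (b v))) \<le> card (cocycles V E m G b) * (\<Prod>e\<in>E. card {x \<in> carrier G. \<forall>v\<in>e. b v x = inv x})"
proof -
  have h: "b v \<in> hom G G" if "v \<in> V" for v using lin that by (auto simp: linear_act_def)
  have inv: "b v (b v z) = z" for v z using cact_invol[OF b] by auto
  have rel: "((b u \<circ> b w) ^^ m {u, w}) z = z" if "{u, w} \<in> E" for u w z using cactD(5)[OF b that] by simp
  have finG: "finite (carrier G)" by (rule cactD(1)[OF b])
  let ?M = "\<lambda>e. {x \<in> carrier G. \<forall>v\<in>e. b v x = inv x}"
  let ?D = "\<Pi>\<^sub>E v\<in>V. eig G (b v)" and ?Z = "cocycles V E m G b"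
  have finD: "finite ?D" using fin finG by (intro finite_PiE) (auto simp: eig_def)
  then have finZ: "finite ?Z" by (rule finite_subset[rotated]) (auto simp: cocycles_def)
  have finP: "finite (\<Pi>\<^sub>E e\<in>E. ?M e)" using fin finG by (intro finite_PiE) auto
  have "\<forall>e\<in>E. \<exists>z. e = {fst z, snd z}" using pairs by (metis fst_conv snd_conv)
  \<comment> \<open>\<open>z\<close> orients every edge, because \<open>tau\<close> distinguishes
    its two arguments.\<close>
  then obtain z where z: "\<And>e. e \<in> E \<Longrightarrow> e = {fst (z e), snd (z e)}" by (metis bchoice)
  define \<Theta> where "\<Theta> y = (\<lambda>e\<in>E. tau G (b (fst (z e))) (b (snd (z e))) (y (fst (z e))) (y (snd (z e))) (m e))" for y
  have ends: "{fst (z e), snd (z e)} \<in> E" "fst (z e) \<in> V" "snd (z e) \<in> V" if "e \<in> E" for e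
    using z[OF that] that edges[of "fst (z e)" "snd (z e)"] by auto
  have eigc: "y v \<in> eig G (b v)" "y v \<in> carrier G" if "y \<in> ?D" "v \<in> V" for y v
    using that by (auto simp: PiE_def Pi_def eig_def)
  have \<Theta>in: "\<Theta> y \<in> (\<Pi>\<^sub>E e\<in>E. ?M e)" if y: "y \<in> ?D" for y
  proof
    fix e assume e: "e \<in> E"
    note en = ends[OF e]
    have "tau G (b (fst (z e))) (b (snd (z e))) (y (fst (z e))) (y (snd (z e))) (m {fst (z e), snd (z e)}) \<in> eig G (b (fst (z e))) \<inter> eig G (b (snd (z e)))"
      by (rule tau_eig[OF h[OF en(2)] h[OF en(3)] inv inv eigc(1)[OF y en(2)] eigc(1)[OF y en(3)] rel[OF en(1)]])
    moreover have e': "{fst (z e), snd (z e)} = e" using z[OF e] by simp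
    ultimately have "\<Theta> y e \<in> eig G (b (fst (z e))) \<inter> eig G (b (snd (z e)))" using e by (simp add: \<Theta>_def)
    then have "\<Theta> y e \<in> carrier G" "\<forall>v\<in>{fst (z e), snd (z e)}. b v (\<Theta> y e) = inv (\<Theta> y e)" by (auto simp: eig_def)
    then show "\<Theta> y e \<in> ?M e" unfolding e' by blast
  qed (simp add: \<Theta>_def)
  have fib: "card {y \<in> ?D. \<Theta> y = c} \<le> card ?Z" if "c \<in> \<Theta> ` ?D" for c
  proof -
    obtain y0 where y0: "y0 \<in> ?D" "\<Theta> y0 = c" using \<open>c \<in> \<Theta> ` ?D\<close> by blast
    \<comment> \<open>Dividing by a fixed member of the fibre embeds the fibre into the
      kernel.\<close>
    let ?f = "\<lambda>y. \<lambda>v\<in>V. y v \<otimes> inv (y0 v)"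
    show ?thesis
    proof (rule card_inj_on_le[OF _ _ finZ])
      show "inj_on ?f {y \<in> ?D. \<Theta> y = c}"
      proof (rule inj_onI)
        fix y y' assume y: "y \<in> {y \<in> ?D. \<Theta> y = c}" and y': "y' \<in> {y \<in> ?D. \<Theta> y = c}" and eq: "?f y = ?f y'"
        have yD: "y \<in> ?D" and yD': "y' \<in> ?D" using y y' by auto
        show "y = y'"
        proof (rule PiE_ext[OF yD yD'])
          fix v assume v: "v \<in> V"
          have "y v \<otimes> inv (y0 v) = y' v \<otimes> inv (y0 v)" using fun_cong[OF eq, of v] v by simp
          then show "y v = y' v" using eigc(2)[OF yD v] eigc(2)[OF yD' v] eigc(2)[OF y0(1) v] by simp
        qed
      qed
      show "?f ` {y \<in> ?D. \<Theta> y = c} \<subseteq> ?Z"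
      proof
        fix x assume "x \<in> ?f ` {y \<in> ?D. \<Theta> y = c}"
        then obtain y where y: "y \<in> ?D" "\<Theta> y = c" and x: "x = ?f y" by blast
        have xe: "x v \<in> eig G (b v)" if v: "v \<in> V" for v
          using subgroup.m_closed[OF eig_subgroup[OF h[OF v]] eigc(1)[OF y(1) v] subgroup.m_inv_closed[OF eig_subgroup[OF h[OF v]] eigc(1)[OF y0(1) v]]]
          by (simp add: x v)
        have xD: "x \<in> ?D" using xe by (auto simp: x)
        have one: "tau G (b u) (b w) (x u) (x w) (m {u, w}) = \<one>" if zz: "z e = (u, w)" and e: "e \<in> E" for e u w
        proof -
          have en: "{u, w} \<in> E" "u \<in> V" "w \<in> V" "e = {u, w}" using ends[OF e] z[OF e] zz by auto
          note T = tau_closed[OF h[OF en(2)] h[OF en(3)] inv inv]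
          have "tau G (b u) (b w) (y u) (y w) (m e) = tau G (b u) (b w) (y0 u) (y0 w) (m e)"
          proof -
            have "\<Theta> y e = \<Theta> y0 e" using y(2) y0(2) by simp
            then show ?thesis by (simp add: \<Theta>_def e zz)
          qed
          also have "y u = x u \<otimes> y0 u" using eigc(2)[OF y(1) en(2)] eigc(2)[OF y0(1) en(2)] en by (simp add: x m_assoc)
          also have "y w = x w \<otimes> y0 w" using eigc(2)[OF y(1) en(3)] eigc(2)[OF y0(1) en(3)] en by (simp add: x m_assoc)
          also have "tau G (b u) (b w) (x u \<otimes> y0 u) (x w \<otimes> y0 w) (m e) = tau G (b u) (b w) (x u) (x w) (m e) \<otimes> tau G (b u) (b w) (y0 u) (y0 w) (m e)"
            by (rule tau_mult[OF h[OF en(2)] h[OF en(3)] inv inv eigc(2)[OF xD en(2)] eigc(2)[OF xD en(3)] eigc(2)[OF y0(1) en(2)] eigc(2)[OF y0(1) en(3)]])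
          finally show ?thesis
            using T[OF eigc(2)[OF xD en(2)] eigc(2)[OF xD en(3)]] T[OF eigc(2)[OF y0(1) en(2)] eigc(2)[OF y0(1) en(3)]] en(4)
            by (metis r_cancel_one')
        qed
        have "tau G (b u) (b w) (x u) (x w) (m {u, w}) = \<one>" if e: "{u, w} \<in> E" for u w
        proof -
          obtain u' w' where zz: "z {u, w} = (u', w')" by (metis surj_pair)
          then have "{u, w} = {u', w'}" using z[OF e] by simp
          then consider "u' = u" "w' = w" | "u' = w" "w' = u" by (auto simp: doubleton_eq_iff)
          then show ?thesis
          proof cases
            case 1
            then show ?thesis using one[OF zz e] by simp
          next
            case 2
            have wu: "w \<in> V" "u \<in> V" "{w, u} \<in> E" using edges[OF e] e by (auto simp: insert_commute)
            have "tau G (b w) (b u) (x w) (x u) (m {u, w}) = \<one>" using one[OF zz e] 2 by (simp add: insert_commute)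
            then show ?thesis
              by (intro tau_flip'[OF h[OF wu(1)] h[OF wu(2)] inv inv eigc(1)[OF xD wu(1)] eigc(1)[OF xD wu(2)]])
                (use rel[OF e] rel[OF wu(3)] in \<open>auto simp: insert_commute\<close>)
          qed
        qed
        then show "x \<in> ?Z" using xD by (simp add: cocycles_def)
      qed
    qed
  qed
  have "(\<Prod>v\<in>V. card (eig G (b v))) = card ?D" by (rule card_PiE[symmetric, OF fin(1)])
  also have "\<dots> \<le> card (\<Theta> ` ?D) * card ?Z" by (rule card_le_fibres[OF finD fib])
  also have "card (\<Theta> ` ?D) \<le> card (\<Pi>\<^sub>E e\<in>E. ?M e)" by (rule card_mono[OF finP]) (use \<Theta>in in blast)
  also have "card (\<Pi>\<^sub>E e\<in>E. ?M e) = (\<Prod>e\<in>E. card (?M e))" by (rule card_PiE[OF fin(2)])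
  finally show ?thesis by (simp add: mult.commute)
qed

end

text \<open>The space of vectors modulo \<open>p\<close> indexed by \<open>I\<close>. Entries are
  least non-negative residues and vanish off \<open>I\<close>, so that equality of vectors is
  equality of functions.\<close>

definition zp_space :: "nat \<Rightarrow> 'i set \<Rightarrow> ('i \<Rightarrow> int) monoid" where
  "zp_space p I = \<lparr>carrier = {x. \<forall>i. 0 \<le> x i \<and> x i < int p \<and> (i \<notin> I \<longrightarrow> x i = 0)},
     monoid.mult = (\<lambda>x y i. (x i + y i) mod int p), one = (\<lambda>i. 0)\<rparr>"

lemma zp_carrier: "x \<in> carrier (zp_space p I) \<longleftrightarrow> (\<forall>i. 0 \<le> x i \<and> x i < int p \<and> (i \<notin> I \<longrightarrow> x i = 0))"
  and zp_mult: "x \<otimes>\<^bsub>zp_space p I\<^esub> y = (\<lambda>i. (x i + y i) mod int p)"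
  and zp_one: "\<one>\<^bsub>zp_space p I\<^esub> = (\<lambda>i. 0)"
  by (simp_all add: zp_space_def)

lemma zp_mod: "x \<in> carrier (zp_space p I) \<Longrightarrow> x i mod int p = x i"
  by (simp add: zp_carrier)

lemma zp_comm_group:
  assumes "p > 0"
  shows "comm_group (zp_space p I)"
proof (rule comm_groupI)
  fix x assume x: "x \<in> carrier (zp_space p I)"
  have "(\<lambda>i. (- x i) mod int p) \<in> carrier (zp_space p I)" using x assms by (auto simp: zp_carrier)
  moreover have "(\<lambda>i. (- x i) mod int p) \<otimes>\<^bsub>zp_space p I\<^esub> x = \<one>\<^bsub>zp_space p I\<^esub>"
    by (simp add: zp_mult zp_one mod_simps)
  ultimately show "\<exists>y\<in>carrier (zp_space p I). y \<otimes>\<^bsub>zp_space p I\<^esub> x = \<one>\<^bsub>zp_space p I\<^esub>" by blast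
qed (use assms in \<open>auto simp: zp_carrier zp_mult zp_one mod_simps algebra_simps fun_eq_iff\<close>)

lemma zp_inv:
  assumes "p > 0" "x \<in> carrier (zp_space p I)"
  shows "inv\<^bsub>zp_space p I\<^esub> x = (\<lambda>i. (- x i) mod int p)"
proof -
  interpret comm_group "zp_space p I" by (rule zp_comm_group[OF assms(1)])
  show ?thesis
  proof (rule inv_equality)
    show "(\<lambda>i. (- x i) mod int p) \<otimes>\<^bsub>zp_space p I\<^esub> x = \<one>\<^bsub>zp_space p I\<^esub>" by (simp add: zp_mult zp_one mod_simps)
  qed (use assms in \<open>auto simp: zp_carrier\<close>)
qed

lemma zp_pow: "p > 0 \<Longrightarrow> x [^]\<^bsub>zp_space p I\<^esub> (n::nat) = (\<lambda>i. (int n * x i) mod int p)"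
proof (induction n)
  case 0
  then interpret comm_group "zp_space p I" by (intro zp_comm_group)
  show ?case by (simp add: zp_one)
next
  case (Suc n)
  then interpret comm_group "zp_space p I" by (intro zp_comm_group)
  show ?case using Suc by (simp add: zp_mult mod_simps algebra_simps)
qed

lemma zp_exponent: "p > 0 \<Longrightarrow> x [^]\<^bsub>zp_space p I\<^esub> p = \<one>\<^bsub>zp_space p I\<^esub>"
  by (simp add: zp_pow zp_one)

lemma zp_bij: "bij_betw (\<lambda>x. restrict x I) (carrier (zp_space p I)) (I \<rightarrow>\<^sub>E {0..<int p})" if "p > 0"
proof (rule bij_betw_byWitness[where f' = "\<lambda>x i. if i \<in> I then x i else 0"])
  show "\<forall>x\<in>carrier (zp_space p I). (\<lambda>i. if i \<in> I then restrict x I i else 0) = x"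
    by (auto simp: zp_carrier fun_eq_iff)
  show "\<forall>x\<in>I \<rightarrow>\<^sub>E {0..<int p}. restrict (\<lambda>i. if i \<in> I then x i else 0) I = x"
    by (auto simp: PiE_def extensional_def fun_eq_iff)
qed (use that in \<open>auto simp: zp_carrier PiE_def Pi_def\<close>)

lemma zp_finite: "finite I \<Longrightarrow> p > 0 \<Longrightarrow> finite (carrier (zp_space p I))"
  using bij_betw_finite[OF zp_bij[of p I]] finite_PiE[of I "\<lambda>_. {0..<int p}"] by simp

definition alt_forms :: "nat \<Rightarrow> ('m, 'z) monoid_scheme \<Rightarrow> ('m \<times> 'm \<Rightarrow> int) set" where
  "alt_forms p G = {y \<in> carrier (zp_space p (carrier G \<times> carrier G)).
     (\<forall>x\<in>carrier G. y (x, x) = 0) \<and>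
     (\<forall>x\<in>carrier G. \<forall>x'\<in>carrier G. \<forall>z\<in>carrier G. y (x \<otimes>\<^bsub>G\<^esub> x', z) = (y (x, z) + y (x', z)) mod int p
        \<and> y (z, x \<otimes>\<^bsub>G\<^esub> x') = (y (z, x) + y (z, x')) mod int p)}"

definition Alt :: "nat \<Rightarrow> ('m, 'z) monoid_scheme \<Rightarrow> ('m \<times> 'm \<Rightarrow> int) monoid" where
  "Alt p G = (zp_space p (carrier G \<times> carrier G))\<lparr>carrier := alt_forms p G\<rparr>"

lemma Alt_carrier [simp]: "carrier (Alt p G) = alt_forms p G"
  and Alt_mult: "y \<otimes>\<^bsub>Alt p G\<^esub> y' = (\<lambda>i. (y i + y' i) mod int p)"
  and Alt_one: "\<one>\<^bsub>Alt p G\<^esub> = (\<lambda>i. 0)"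
  by (simp_all add: Alt_def zp_mult zp_one)

lemma mod_add_exchange: "((a + b) mod q + (c + d) mod q) mod q = ((a + c) mod q + (b + d) mod q) mod (q::int)"
  by (simp add: mod_add_eq add.assoc add.left_commute)

lemma Alt_comm_group:
  assumes "p > 0"
  shows "comm_group (Alt p G)"
proof (rule comm_groupI)
  fix y assume y: "y \<in> carrier (Alt p G)"
  have "(\<lambda>i. (- y i) mod int p) \<in> carrier (Alt p G)"
    using y assms by (auto simp: alt_forms_def zp_carrier mod_simps algebra_simps)
  moreover have "(\<lambda>i. (- y i) mod int p) \<otimes>\<^bsub>Alt p G\<^esub> y = \<one>\<^bsub>Alt p G\<^esub>"
    by (simp add: Alt_mult Alt_one mod_simps)
  ultimately show "\<exists>z\<in>carrier (Alt p G). z \<otimes>\<^bsub>Alt p G\<^esub> y = \<one>\<^bsub>Alt p G\<^esub>" by blast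
next
  fix y z assume "y \<in> carrier (Alt p G)" "z \<in> carrier (Alt p G)"
  then have y: "y \<in> alt_forms p G" and z: "z \<in> alt_forms p G" by simp_all
  have "(\<lambda>i. (y i + z i) mod int p) \<in> alt_forms p G"
    unfolding alt_forms_def
  proof (intro CollectI conjI ballI)
    show "(\<lambda>i. (y i + z i) mod int p) \<in> carrier (zp_space p (carrier G \<times> carrier G))"
      using assms y z by (auto simp: alt_forms_def zp_carrier)
  next
    fix x assume "x \<in> carrier G"
    then show "(y (x, x) + z (x, x)) mod int p = 0" using y z by (simp add: alt_forms_def)
  next
    fix x x' w assume x: "x \<in> carrier G" "x' \<in> carrier G" "w \<in> carrier G"
    have "y (x \<otimes>\<^bsub>G\<^esub> x', w) = (y (x, w) + y (x', w)) mod int p" "z (x \<otimes>\<^bsub>G\<^esub> x', w) = (z (x, w) + z (x', w)) mod int p"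
      "y (w, x \<otimes>\<^bsub>G\<^esub> x') = (y (w, x) + y (w, x')) mod int p" "z (w, x \<otimes>\<^bsub>G\<^esub> x') = (z (w, x) + z (w, x')) mod int p"
      using y z x by (simp_all add: alt_forms_def)
    note eqs = this
    show "(y (x \<otimes>\<^bsub>G\<^esub> x', w) + z (x \<otimes>\<^bsub>G\<^esub> x', w)) mod int p = ((y (x, w) + z (x, w)) mod int p + (y (x', w) + z (x', w)) mod int p) mod int p"
      unfolding eqs by (rule mod_add_exchange)
    show "(y (w, x \<otimes>\<^bsub>G\<^esub> x') + z (w, x \<otimes>\<^bsub>G\<^esub> x')) mod int p = ((y (w, x) + z (w, x)) mod int p + (y (w, x') + z (w, x')) mod int p) mod int p"
      unfolding eqs by (rule mod_add_exchange)
  qed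
  then show "y \<otimes>\<^bsub>Alt p G\<^esub> z \<in> carrier (Alt p G)" by (simp add: Alt_mult)
qed (use assms in \<open>auto simp: alt_forms_def zp_carrier Alt_mult Alt_one mod_simps algebra_simps fun_eq_iff\<close>)

lemma Alt_inv:
  assumes "p > 0" "y \<in> alt_forms p G"
  shows "inv\<^bsub>Alt p G\<^esub> y = (\<lambda>i. (- y i) mod int p)"
proof -
  interpret comm_group "Alt p G" by (rule Alt_comm_group[OF assms(1)])
  show ?thesis
  proof (rule inv_equality)
    show "(\<lambda>i. (- y i) mod int p) \<otimes>\<^bsub>Alt p G\<^esub> y = \<one>\<^bsub>Alt p G\<^esub>" by (simp add: Alt_mult Alt_one mod_simps)
    show "(\<lambda>i. (- y i) mod int p) \<in> carrier (Alt p G)"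
      using assms by (auto simp: alt_forms_def zp_carrier mod_simps algebra_simps)
  qed (use assms in simp)
qed

lemma Alt_finite: "finite (carrier G) \<Longrightarrow> p > 0 \<Longrightarrow> finite (alt_forms p G)"
  by (rule finite_subset[OF _ zp_finite[of "carrier G \<times> carrier G" p]]) (auto simp: alt_forms_def)

definition pull :: "('m, 'z) monoid_scheme \<Rightarrow> ('m \<Rightarrow> 'm) \<Rightarrow> ('m \<times> 'm \<Rightarrow> int) \<Rightarrow> 'm \<times> 'm \<Rightarrow> int" where
  "pull G h y = (\<lambda>(x, x'). if x \<in> carrier G \<and> x' \<in> carrier G then y (h x, h x') else 0)"

lemma pull_in:
  assumes "group G" "p > 0" "h \<in> hom G G" "y \<in> alt_forms p G"
  shows "pull G h y \<in> alt_forms p G"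
proof -
  interpret group G by fact
  have "h x \<in> carrier G" "x \<in> carrier G \<Longrightarrow> z \<in> carrier G \<Longrightarrow> h (x \<otimes>\<^bsub>G\<^esub> z) = h x \<otimes>\<^bsub>G\<^esub> h z" if "x \<in> carrier G" for x z
    using assms(3) that by (auto simp: hom_def)
  then show ?thesis using assms(2,4) by (auto simp: alt_forms_def zp_carrier pull_def)
qed

lemma pull_hom: "group G \<Longrightarrow> p > 0 \<Longrightarrow> h \<in> hom G G \<Longrightarrow> pull G h \<in> hom (Alt p G) (Alt p G)"
  by (rule homI) (simp_all add: pull_in, auto simp: Alt_mult pull_def fun_eq_iff)

lemma pull_pull:
  assumes "k \<in> hom G G"
  shows "pull G k (pull G h y) = pull G (h \<circ> k) y"
  using assms by (auto simp: pull_def fun_eq_iff hom_def)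

lemma pull_id: "y \<in> alt_forms p G \<Longrightarrow> pull G id y = y"
  by (auto simp: pull_def fun_eq_iff alt_forms_def zp_carrier)

definition alt_act :: "'a set \<Rightarrow> nat \<Rightarrow> ('m, 'z) monoid_scheme \<Rightarrow> ('a \<Rightarrow> 'm \<Rightarrow> 'm) \<Rightarrow> 'a \<Rightarrow> ('m \<times> 'm \<Rightarrow> int) \<Rightarrow> 'm \<times> 'm \<Rightarrow> int" where
  "alt_act V p G b = mk V (alt_forms p G) (\<lambda>v. pull G (b v))"

lemma cact_alt_act:
  assumes "group G" "p > 0" and b: "cact V E m (carrier G) b" and lin: "linear_act V G b"
    and edges: "\<And>u w. {u, w} \<in> E \<Longrightarrow> u \<in> V \<and> w \<in> V"
  shows "cact V E m (carrier (Alt p G)) (alt_act V p G b)" "linear_act V (Alt p G) (alt_act V p G b)"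
proof -
  have h: "b v \<in> hom G G" if "v \<in> V" for v using lin that by (auto simp: linear_act_def)
  have hc: "b u \<circ> b w \<in> hom G G" if "u \<in> V" "w \<in> V" for u w using h[OF that(1)] h[OF that(2)] by (simp add: hom_def Pi_iff)
  have hp: "(b u \<circ> b w) ^^ k \<in> hom G G" if "u \<in> V" "w \<in> V" for u w k
    by (induction k) (use hc[OF that] in \<open>simp_all add: hom_def Pi_iff\<close>)
  show "cact V E m (carrier (Alt p G)) (alt_act V p G b)"
    unfolding alt_act_def Alt_carrier
  proof (rule cact_mk)
    show "finite (alt_forms p G)" using cactD(1)[OF b] assms(2) by (rule Alt_finite)
    fix v y assume v: "v \<in> V" and y: "y \<in> alt_forms p G"
    show "pull G (b v) y \<in> alt_forms p G" by (rule pull_in[OF assms(1,2) h[OF v] y])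
    show "pull G (b v) (pull G (b v) y) = y"
      using pull_pull[OF h[OF v], of "b v" y] cactD(4)[OF b, of v] pull_id[OF y] by simp
  next
    fix u w y assume e: "{u, w} \<in> E" and y: "y \<in> alt_forms p G"
    have uw: "u \<in> V" "w \<in> V" using edges[OF e] by auto
    have "((pull G (b u) \<circ> pull G (b w)) ^^ k) y = pull G ((b w \<circ> b u) ^^ k) y" for k
    proof (induction k)
      case (Suc k)
      have "((pull G (b u) \<circ> pull G (b w)) ^^ Suc k) y = pull G (b u) (pull G (b w) (pull G ((b w \<circ> b u) ^^ k) y))"
        by (subst Suc[symmetric]) simp
      also have "\<dots> = pull G ((b w \<circ> b u) ^^ k \<circ> (b w \<circ> b u)) y"
        by (simp only: pull_pull[OF h[OF uw(1)]] pull_pull[OF h[OF uw(2)]] comp_assoc)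
      finally show ?case by (simp only: funpow_Suc_right)
    qed (simp add: pull_id[OF y, unfolded id_def])
    moreover have "(b w \<circ> b u) ^^ m {u, w} = id" using cactD(5)[OF b, of w u] e by (simp add: insert_commute)
    ultimately show "((pull G (b u) \<circ> pull G (b w)) ^^ m {u, w}) y = y" using pull_id[OF y] by simp
  qed (use edges in auto)
  show "linear_act V (Alt p G) (alt_act V p G b)"
    unfolding linear_act_def
  proof
    fix v assume v: "v \<in> V"
    have "pull G (b v) \<in> hom (Alt p G) (Alt p G)" by (rule pull_hom[OF assms(1,2) h[OF v]])
    moreover have "alt_act V p G b v y = pull G (b v) y" if "y \<in> carrier (Alt p G)" for y
      using that v by (simp add: alt_act_def mk_def)
    moreover have "y \<otimes>\<^bsub>Alt p G\<^esub> y' \<in> carrier (Alt p G)" if "y \<in> carrier (Alt p G)" "y' \<in> carrier (Alt p G)" for y y'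
    proof -
      interpret A: comm_group "Alt p G" by (rule Alt_comm_group[OF assms(2)])
      show ?thesis using that by (rule A.m_closed)
    qed
    ultimately show "alt_act V p G b v \<in> hom (Alt p G) (Alt p G)" by (simp add: hom_def Pi_iff)
  qed
qed

text \<open>Pulling back is contravariant, which reverses the word.\<close>

lemma ev_alt_act:
  assumes "group G" "p > 0" and b: "cact V E m (carrier G) b" and lin: "linear_act V G b"
    and "set xs \<subseteq> V" "y \<in> alt_forms p G"
  shows "ev (alt_act V p G b) xs y = pull G (ev b (rev xs)) y"
  using assms(5)
proof (induction xs)
  case Nil
  show ?case using pull_id[OF assms(6)] by (metis ev_simps(1) rev.simps(1) id_apply)
next
  case (Cons v xs)
  then have v: "v \<in> V" "set (rev xs) \<subseteq> V" and IH: "ev (alt_act V p G b) xs y = pull G (ev b (rev xs)) y" by auto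
  have h: "b v \<in> hom G G" using lin v by (auto simp: linear_act_def)
  have "pull G (ev b (rev xs)) y \<in> alt_forms p G" by (rule pull_in[OF assms(1,2) ev_hom[OF lin v(2)] assms(6)])
  then have "ev (alt_act V p G b) (v # xs) y = pull G (b v) (pull G (ev b (rev xs)) y)"
    using IH v by (simp add: alt_act_def mk_def)
  then show ?case by (simp only: pull_pull[OF h] rev.simps ev_append ev_simps comp_id)
qed

text \<open>The reversal in \<open>ev_alt_act\<close> does no harm here: a transferred generator is
  an involution, so a word representing it and the reversed word have the same value.\<close>

lemma (in transfer) T_alt_act:
  assumes "group G" "p > 0" and b: "cact V E m (carrier G) b" and lin: "linear_act V G b"
  shows "T (alt_act V p G b) = alt_act V' p G (T b)"
proof (rule cact_ext)
  note ab = cact_alt_act(1)[OF assms edges]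
  note Tb = cact_T[OF b]
  note ab' = cact_alt_act(1)[OF assms(1,2) Tb linear_T[OF b lin] edges']
  show "cact V' E' m' (carrier (Alt p G)) (T (alt_act V p G b))" by (rule cact_T[OF ab])
  show "cact V' E' m' (carrier (Alt p G)) (alt_act V' p G (T b))" by (rule ab')
  fix s assume s: "s \<in> V'"
  then have s': "set [s] \<subseteq> V'" by simp
  obtain xs where xs: "set xs \<subseteq> V" "ev (T (alt_act V p G b)) [s] = ev (alt_act V p G b) xs" "ev (T b) [s] = ev b xs"
    by (rule T_approx2[OF ab b s'])
  have "ev b (rev xs) = ev b (rev xs) \<circ> (T b s \<circ> T b s)" using cactD(4)[OF Tb] by simp
  also have "\<dots> = (ev b (rev xs) \<circ> ev b xs) \<circ> T b s" using xs(3) by (simp add: comp_assoc)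
  finally have r: "ev b (rev xs) = T b s" using ev_rev[OF b] by simp
  show "T (alt_act V p G b) s = alt_act V' p G (T b) s"
  proof
    fix y
    show "T (alt_act V p G b) s y = alt_act V' p G (T b) s y"
    proof (cases "y \<in> alt_forms p G")
      case True
      then show ?thesis using ev_alt_act[OF assms xs(1) True] xs(2) r s by (simp add: alt_act_def mk_def)
    next
      case False
      then show ?thesis
        using permutes_not_in[OF cactD(3)[OF cact_T[OF ab]], of y s] permutes_not_in[OF cactD(3)[OF ab'], of y s] by simp
    qed
  qed
qed

lemma int_mod_eq_0:
  fixes a q :: int
  assumes "0 \<le> a" "a < q" "q dvd a"
  shows "a = 0"
proof (rule ccontr)
  assume "a \<noteq> 0"
  then have "q \<le> a" using assms by (intro zdvd_imp_le) auto
  then show False using assms by simp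
qed

context comm_group
begin

lemma hom_self_closed: "s \<in> hom G G \<Longrightarrow> x \<in> carrier G \<Longrightarrow> s x \<in> carrier G"
  unfolding hom_def by (simp add: Pi_iff)

context
  fixes p :: nat and y :: "'a \<times> 'a \<Rightarrow> int"
  assumes p: "p > 0" and y: "y \<in> alt_forms p G"
begin

lemma alt_range: "0 \<le> y z" "y z < int p"
  using y unfolding alt_forms_def zp_carrier by blast+

lemma alt_mod [simp]: "y z mod int p = y z"
  using alt_range by simp

lemma alt_diag: "x \<in> carrier G \<Longrightarrow> y (x, x) = 0"
  using y by (simp add: alt_forms_def)

lemma alt_add1: "x \<in> carrier G \<Longrightarrow> x' \<in> carrier G \<Longrightarrow> z \<in> carrier G \<Longrightarrow> y (x \<otimes> x', z) = (y (x, z) + y (x', z)) mod int p"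
  and alt_add2: "x \<in> carrier G \<Longrightarrow> x' \<in> carrier G \<Longrightarrow> z \<in> carrier G \<Longrightarrow> y (z, x \<otimes> x') = (y (z, x) + y (z, x')) mod int p"
  using y by (simp_all add: alt_forms_def)

lemma alt_one1:
  assumes z: "z \<in> carrier G"
  shows "y (\<one>, z) = 0"
proof -
  have "(y (\<one>, z) + y (\<one>, z)) mod int p = y (\<one>, z) mod int p" using alt_add1[of \<one> \<one> z] z by simp
  then have "int p dvd (y (\<one>, z) + y (\<one>, z)) - y (\<one>, z)" by (rule mod_eq_dvd_iff[THEN iffD1])
  then have "int p dvd y (\<one>, z)" by simp
  then show ?thesis by (rule int_mod_eq_0[OF alt_range])
qed

lemma alt_swap:
  assumes xz: "x \<in> carrier G" "z \<in> carrier G"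
  shows "(y (x, z) + y (z, x)) mod int p = 0"
proof -
  have "y (x \<otimes> z, x \<otimes> z) = (y (x, x \<otimes> z) + y (z, x \<otimes> z)) mod int p" using xz by (simp add: alt_add1)
  also have "\<dots> = (y (x, z) + y (z, x)) mod int p" using xz by (simp add: alt_add2 alt_diag mod_simps)
  finally show ?thesis using alt_diag[of "x \<otimes> z"] xz by simp
qed

lemma alt_one2: "z \<in> carrier G \<Longrightarrow> y (z, \<one>) = 0"
  using alt_swap[of \<one> z] alt_one1[of z] by simp

lemma alt_kernel_subgroup:
  assumes c: "c \<in> carrier G"
  shows "subgroup {x \<in> carrier G. y (c, x) = 0} G"
proof (rule subgroup.intro)
  fix x assume x: "x \<in> {x \<in> carrier G. y (c, x) = 0}"
  have "y (c, x \<otimes> inv x) = (y (c, x) + y (c, inv x)) mod int p" using x c by (intro alt_add2) auto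
  then show "inv x \<in> {x \<in> carrier G. y (c, x) = 0}" using x c alt_one2[OF c] by simp
qed (use c in \<open>auto simp: alt_one2 alt_add2\<close>)

lemma alt_kernel_subgroup1:
  assumes c: "c \<in> carrier G"
  shows "subgroup {x \<in> carrier G. y (x, c) = 0} G"
proof -
  have "y (x, c) = 0 \<longleftrightarrow> y (c, x) = 0" if "x \<in> carrier G" for x
    using alt_swap[OF that c] alt_range[of "(x, c)"] alt_range[of "(c, x)"] by (metis add.commute add.right_neutral alt_mod)
  then have "{x \<in> carrier G. y (x, c) = 0} = {x \<in> carrier G. y (c, x) = 0}" by blast
  then show ?thesis using alt_kernel_subgroup[OF c] by simp
qed

text \<open>If all displacements of \<open>s\<close> lie in the radical, \<open>s\<close> acts
  trivially modulo the radical and preserves the form. It also negates it, and \<open>p\<close> is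
  odd.\<close>

lemma alt_zero:
  assumes odd: "odd p" and s: "s \<in> hom G G" and neg: "\<And>x z. x \<in> carrier G \<Longrightarrow> z \<in> carrier G \<Longrightarrow> y (s x, s z) = (- y (x, z)) mod int p"
    and L: "\<And>x. x \<in> carrier G \<Longrightarrow> s x \<otimes> inv x \<in> L" "L \<subseteq> carrier G"
    and z: "\<And>c x. c \<in> L \<Longrightarrow> x \<in> carrier G \<Longrightarrow> y (c, x) = 0"
  shows "y = (\<lambda>i. 0)"
proof
  fix i show "y i = 0"
  proof (cases "i \<in> carrier G \<times> carrier G")
    case True
    then obtain x x' where i: "i = (x, x')" "x \<in> carrier G" "x' \<in> carrier G" by blast
    have sx: "s x \<in> carrier G" "s x' \<in> carrier G" using hom_self_closed[OF s] i(2,3) by blast+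
    let ?c = "s x \<otimes> inv x" and ?c' = "s x' \<otimes> inv x'"
    have c: "?c \<in> L" "?c' \<in> L" "?c \<in> carrier G" "?c' \<in> carrier G" using L(1)[OF i(2)] L(1)[OF i(3)] L(2) by blast+
    have z': "y (x, ?c') = 0" using alt_swap[of x ?c'] z[OF c(2), of x] i c by simp
    have e: "s x = ?c \<otimes> x" "s x' = ?c' \<otimes> x'" using i sx by (simp_all add: m_assoc)
    have "y (s x, s x') = y (?c \<otimes> x, ?c' \<otimes> x')" using e by simp
    also have "\<dots> = (y (?c, ?c' \<otimes> x') + y (x, ?c' \<otimes> x')) mod int p" using i c by (intro alt_add1) auto
    also have "\<dots> = y (x, ?c' \<otimes> x')" using z[OF c(1), of "?c' \<otimes> x'"] i c by simp
    also have "\<dots> = (y (x, ?c') + y (x, x')) mod int p" using i c by (intro alt_add2) auto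
    finally have "y (x, x') = (- y (x, x')) mod int p" using z' neg[OF i(2,3)] by simp
    then have "y (x, x') mod int p = (- y (x, x')) mod int p" by simp
    then have "int p dvd y (x, x') - (- y (x, x'))" by (rule mod_eq_dvd_iff[THEN iffD1])
    then have "int p dvd 2 * y (x, x')" by simp
    moreover have "coprime (int p) 2" using odd by (simp add: coprime_right_2_iff_odd)
    ultimately have "int p dvd y (x, x')" using coprime_dvd_mult_right_iff by blast
    then show ?thesis unfolding i(1) by (rule int_mod_eq_0[OF alt_range])
  next
    case False
    then show ?thesis using y unfolding alt_forms_def zp_carrier by blast
  qed
qed

end

text \<open>On the span of the two eigenlines an alternating form is given by its value at
  \<open>(c, d)\<close>; averaging over the rotation \<open>s \<circ> t\<close> shows that nothing
  else is left. An average is fixed by the rotation, hence by \<open>s\<close>, and a form negated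
  by \<open>s\<close> vanishes on vectors fixed by \<open>s\<close>. As \<open>n\<close> is
  invertible modulo \<open>p\<close>, this makes \<open>c\<close> orthogonal to everything, and
  \<open>alt_zero\<close> applies.\<close>

lemma alt_dihedral_zero:
  assumes pp: "Factorial_Ring.prime p" and odd: "odd p" and y: "y \<in> alt_forms p G"
    and s: "s \<in> hom G G" and t: "t \<in> hom G G"
    and ss: "\<And>x. x \<in> carrier G \<Longrightarrow> s (s x) = x" and tt: "\<And>x. x \<in> carrier G \<Longrightarrow> t (t x) = x"
    and n: "\<And>x. x \<in> carrier G \<Longrightarrow> ((s \<circ> t) ^^ n) x = x" and cop: "coprime n p"
    and cs: "card (eig G s) = p" and ct: "card (eig G t) = p" and disj: "eig G s \<inter> eig G t = {\<one>}"
    and negs: "\<And>x z. x \<in> carrier G \<Longrightarrow> z \<in> carrier G \<Longrightarrow> y (s x, s z) = (- y (x, z)) mod int p"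
    and negt: "\<And>x z. x \<in> carrier G \<Longrightarrow> z \<in> carrier G \<Longrightarrow> y (t x, t z) = (- y (x, z)) mod int p"
    and c: "c \<in> eig G s" "c \<noteq> \<one>" and d: "d \<in> eig G t" "d \<noteq> \<one>" and cd: "y (c, d) = 0"
  shows "y = (\<lambda>i. 0)"
proof -
  have p: "p > 0" using pp prime_gt_0_nat by blast
  note rng = alt_range[OF p y]
  have cc: "c \<in> carrier G" and dc: "d \<in> carrier G" using c d by (auto simp: eig_def)
  let ?A = "s \<circ> t"
  have sc: "s x \<in> carrier G" "t x \<in> carrier G" if "x \<in> carrier G" for x
    using hom_self_closed[OF s that] hom_self_closed[OF t that] by blast+
  have Ac: "?A x \<in> carrier G" if "x \<in> carrier G" for x using sc that by simp
  have Akc: "(?A ^^ k) x \<in> carrier G" if "x \<in> carrier G" for k x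
    by (induction k) (use that sc in auto)
  have Am: "?A (x \<otimes> z) = ?A x \<otimes> ?A z" if "x \<in> carrier G" "z \<in> carrier G" for x z
    using that sc hom_mult[OF s] hom_mult[OF t] by simp
  have A1: "?A \<one> = \<one>" using hom_one[OF s] hom_one[OF t] group_axioms by auto
  note sub_s = eig_subgroup[OF s] and sub_t = eig_subgroup[OF t]
  let ?K = "{x \<in> carrier G. y (c, x) = 0}"
  note subK = alt_kernel_subgroup[OF p y cc]
  have sK: "eig G s \<subseteq> ?K"
    by (rule prime_order_subgroup_subset[OF sub_s subK cs pp c(1) _ c(2)]) (use cc alt_diag[OF p y cc] in simp)
  have tK: "eig G t \<subseteq> ?K"
    by (rule prime_order_subgroup_subset[OF sub_t subK ct pp d(1) _ d(2)]) (use dc cd in simp)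
  let ?K2 = "{x \<in> carrier G. y (d, x) = 0}"
  have se: "s x \<otimes> inv x \<in> eig G s" if "x \<in> carrier G" for x
    using that sc hom_mult[OF s] hom_inv_self[OF s] ss by (simp add: eig_def inv_mult m_comm)
  have te: "t x \<otimes> inv x \<in> eig G t" if "x \<in> carrier G" for x
    using that sc hom_mult[OF t] hom_inv_self[OF t] tt by (simp add: eig_def inv_mult m_comm)
  have dA: "?A x \<otimes> inv x = (s (t x) \<otimes> inv (t x)) \<otimes> (t x \<otimes> inv x)" if "x \<in> carrier G" for x
    using that sc by (simp add: m_assoc inv_solve_left)
  \<comment> \<open>The rotation displaces a vector by an element of one eigenline times an element
    of the other, and \<open>c\<close> is orthogonal to both lines.\<close>
  have cA: "y (c, ?A x) = y (c, x)" if x: "x \<in> carrier G" for x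
  proof -
    have "s (t x) \<otimes> inv (t x) \<in> ?K" "t x \<otimes> inv x \<in> ?K" using se[of "t x"] te[OF x] sK tK sc[OF x] by auto
    then have "?A x \<otimes> inv x \<in> ?K" unfolding dA[OF x] by (rule subgroup.m_closed[OF subK])
    then have k: "y (c, ?A x \<otimes> inv x) = 0" by simp
    have "?A x = (?A x \<otimes> inv x) \<otimes> x" using x Ac[OF x] by (simp add: m_assoc)
    then have "y (c, ?A x) = y (c, (?A x \<otimes> inv x) \<otimes> x)" by simp
    also have "\<dots> = (y (c, ?A x \<otimes> inv x) + y (c, x)) mod int p"
      using x Ac[OF x] cc by (intro alt_add2[OF p y]) auto
    finally show ?thesis using k alt_mod[OF p y] by simp
  qed
  have yA: "y (?A x, ?A z) = y (x, z)" if "x \<in> carrier G" "z \<in> carrier G" for x z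
    using negs[OF sc(2)[OF that(1)] sc(2)[OF that(2)]] negt[OF that] alt_mod[OF p y] by (simp add: mod_simps)
  \<comment> \<open>The sum of the first \<open>k\<close> iterates of \<open>x\<close> under the
    rotation; for \<open>k = n\<close> it is the average up to the invertible factor
    \<open>n\<close>.\<close>
  define N where "N x = rec_nat \<one> (\<lambda>k z. z \<otimes> (?A ^^ k) x)" for x
  have N0: "N x 0 = \<one>" and NS: "N x (Suc k) = N x k \<otimes> (?A ^^ k) x" for x k by (simp_all add: N_def)
  have Nc: "N x k \<in> carrier G" if "x \<in> carrier G" for x k
    by (induction k) (use Akc[OF that] in \<open>simp_all add: N0 NS\<close>)
  have AN: "?A (N x k) \<otimes> x = N x (Suc k)" if x: "x \<in> carrier G" for x k
  proof (induction k)
    case 0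
    then show ?case using A1 x by (simp add: N0 NS)
  next
    case (Suc k)
    have "?A (N x (Suc k)) \<otimes> x = (?A (N x k) \<otimes> x) \<otimes> ?A ((?A ^^ k) x)"
      unfolding NS[of x k] using Am[OF Nc[OF x] Akc[OF x]] Ac[OF Nc[OF x]] Ac[OF Akc[OF x]] x by (simp add: m_ac)
    also have "\<dots> = N x (Suc k) \<otimes> (?A ^^ Suc k) x" unfolding Suc by simp
    finally show ?case by (simp only: NS)
  qed
  have ANn: "?A (N x n) = N x n" if x: "x \<in> carrier G" for x
    using AN[OF x, of n] n[OF x] Nc[OF x] Ac[OF Nc[OF x]] x by (simp add: NS)
  \<comment> \<open>On a fixed vector of the rotation \<open>s\<close> and \<open>t\<close> agree,
    so its displacement lies in both eigenspaces.\<close>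
  have sfix: "s v = v" if v: "v \<in> carrier G" "?A v = v" for v
  proof -
    have "t v = s v" using v ss[of "t v"] sc by simp
    then have "s v \<otimes> inv v \<in> eig G s \<inter> eig G t" using se[OF v(1)] te[OF v(1)] by simp
    then have "s v \<otimes> inv v = \<one>" using disj by blast
    then show ?thesis using v sc by (metis inv_equality inv_inv inv_closed)
  qed
  have half: "a = 0" if "0 \<le> a" "a < int p" "a = (- a) mod int p" for a
  proof -
    have "a mod int p = (- a) mod int p" using that by simp
    then have "int p dvd a - (- a)" by (rule mod_eq_dvd_iff[THEN iffD1])
    then have "int p dvd 2 * a" by simp
    moreover have "coprime (int p) 2" using odd by (simp add: coprime_right_2_iff_odd)
    ultimately have "int p dvd a" using coprime_dvd_mult_right_iff by blast
    then show ?thesis using that int_mod_eq_0 by blast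
  qed
  have cancel_n: "a = 0" if "0 \<le> a" "a < int p" "(int n * a) mod int p = 0" for a
  proof -
    have "int p dvd int n * a" using that by auto
    moreover have "coprime (int p) (int n)" using cop by (simp add: coprime_commute)
    ultimately have "int p dvd a" using coprime_dvd_mult_right_iff by blast
    then show ?thesis using that int_mod_eq_0 by blast
  qed
  have yc: "y (c, x) = 0" if x: "x \<in> carrier G" for x
  proof -
    have fix0: "y (v, v') = 0" if "v \<in> carrier G" "?A v = v" "v' \<in> carrier G" "?A v' = v'" for v v'
      using negs[OF that(1,3)] sfix[OF that(1,2)] sfix[OF that(3,4)] rng half by metis
    have yAk: "y ((?A ^^ k) c, v) = y (c, v)" if "v \<in> carrier G" "?A v = v" for k v
    proof (induction k)
      case (Suc k)
      have "y (?A ((?A ^^ k) c), ?A v) = y ((?A ^^ k) c, v)" by (rule yA[OF Akc[OF cc] that(1)])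
      moreover have "(?A ^^ Suc k) c = ?A ((?A ^^ k) c)" by simp
      ultimately show ?case using that(2) Suc by metis
    qed simp
    have "y (N c k, v) = (int k * y (c, v)) mod int p" if "v \<in> carrier G" "?A v = v" for k v
    proof (induction k)
      case (Suc k)
      have "y (N c (Suc k), v) = (y (N c k, v) + y ((?A ^^ k) c, v)) mod int p"
        unfolding NS by (rule alt_add1[OF p y Nc[OF cc] Akc[OF cc] that(1)])
      then show ?case using Suc yAk[OF that] by (simp add: mod_simps algebra_simps)
    qed (use alt_one1[OF p y that(1)] in \<open>simp add: N0\<close>)
    \<comment> \<open>The rotation preserves the form, so averaging the first argument against a
      fixed vector merely multiplies by \<open>n\<close>; the value at two averages is zero.\<close>
    then have "(int n * y (c, N x n)) mod int p = y (N c n, N x n)" using Nc[OF x] ANn[OF x] by simp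
    also have "\<dots> = 0" by (rule fix0[OF Nc[OF cc] ANn[OF cc] Nc[OF x] ANn[OF x]])
    finally have cN: "y (c, N x n) = 0" by (rule cancel_n[OF rng(1) rng(2)])
    have cAk: "y (c, (?A ^^ k) x) = y (c, x)" for k
    proof (induction k)
      case (Suc k)
      have "(?A ^^ Suc k) x = ?A ((?A ^^ k) x)" by simp
      then show ?case using cA[OF Akc[OF x], of k] Suc by metis
    qed simp
    have "y (c, N x k) = (int k * y (c, x)) mod int p" for k
    proof (induction k)
      case (Suc k)
      have "y (c, N x (Suc k)) = (y (c, N x k) + y (c, (?A ^^ k) x)) mod int p"
        unfolding NS by (rule alt_add2[OF p y Nc[OF x] Akc[OF x] cc])
      then show ?case using Suc cAk by (simp add: mod_simps algebra_simps)
    qed (use alt_one2[OF p y cc] in \<open>simp add: N0\<close>)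
    then have "(int n * y (c, x)) mod int p = 0" using cN by metis
    then show ?thesis by (rule cancel_n[OF rng(1) rng(2)])
  qed
  show ?thesis
  proof (rule alt_zero[OF p y odd s negs se])
    show "eig G s \<subseteq> carrier G" by (auto simp: eig_def)
    fix e x assume e: "e \<in> eig G s" and x: "x \<in> carrier G"
    have "eig G s \<subseteq> {z \<in> carrier G. y (z, x) = 0}"
      by (rule prime_order_subgroup_subset[OF sub_s alt_kernel_subgroup1[OF p y x] cs pp c(1) _ c(2)]) (use cc yc[OF x] in simp)
    then show "y (e, x) = 0" using e by blast
  qed auto
qed

end

section \<open>The reflection representation modulo a prime\<close>

definition unit_vec :: "'i \<Rightarrow> 'i \<Rightarrow> int" where "unit_vec s = (\<lambda>u. if u = s then 1 else 0)"

lemma unit_vec_carrier: "p > 1 \<Longrightarrow> s \<in> I \<Longrightarrow> unit_vec s \<in> carrier (zp_space p I)"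
  by (auto simp: zp_carrier unit_vec_def)

lemma zp_generated:
  assumes p: "p > 1" and "finite I" and K: "subgroup K (zp_space p I)" and e: "\<And>s. s \<in> I \<Longrightarrow> unit_vec s \<in> K"
  shows "K = carrier (zp_space p I)"
proof -
  interpret comm_group "zp_space p I" using p by (intro zp_comm_group) simp
  have "\<forall>x\<in>carrier (zp_space p I). (\<forall>i. i \<notin> J \<longrightarrow> x i = 0) \<longrightarrow> x \<in> K" if "finite J" "J \<subseteq> I" for J
    using that
  proof (induction J)
    case empty
    have "x = \<one>\<^bsub>zp_space p I\<^esub>" if "\<forall>i. x i = 0" for x using that by (auto simp: zp_one)
    then show ?case using subgroup.one_closed[OF K] by auto
  next
    case (insert j J)
    show ?case
    proof (intro ballI impI)
      fix x assume x: "x \<in> carrier (zp_space p I)" "\<forall>i. i \<notin> insert j J \<longrightarrow> x i = 0"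
      let ?x = "x(j := 0)" and ?e = "unit_vec j [^]\<^bsub>zp_space p I\<^esub> nat (x j)"
      have r: "0 \<le> x j" "x j < int p" using x(1) unfolding zp_carrier by blast+
      have "?x \<in> carrier (zp_space p I)" using x(1) p unfolding zp_carrier by auto
      then have "?x \<in> K" using insert x by auto
      moreover have "unit_vec j [^]\<^bsub>zp_space p I\<^esub> (n::nat) \<in> K" for n
        by (induction n) (use e[of j] insert.prems subgroup.m_closed[OF K] subgroup.one_closed[OF K] in auto)
      then have "?e \<in> K" .
      ultimately have "?x \<otimes>\<^bsub>zp_space p I\<^esub> ?e \<in> K" by (intro subgroup.m_closed[OF K])
      moreover have "?x \<otimes>\<^bsub>zp_space p I\<^esub> ?e = x"
      proof -
        have "?e = (\<lambda>i. (int (nat (x j)) * unit_vec j i) mod int p)" using p by (intro zp_pow) simp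
        then show ?thesis using r zp_mod[OF x(1)] by (auto simp: zp_mult unit_vec_def fun_eq_iff)
      qed
      ultimately show "x \<in> K" by simp
    qed
  qed
  from this[OF \<open>finite I\<close> subset_refl] have "carrier (zp_space p I) \<subseteq> K" by (auto simp: zp_carrier)
  then show ?thesis using subgroup.subset[OF K] by blast
qed

text \<open>
  \<open>q\<close> runs through the coordinates of the iterates of a product of two reflections whose simple roots have
  pairing \<open>c\<close>; the condition says that the \<open>n\<close>-th power of that product is trivial modulo \<open>p\<close>.
\<close>

definition good_weight :: "nat \<Rightarrow> nat \<Rightarrow> int \<Rightarrow> bool" where
  "good_weight p n c \<longleftrightarrow> (\<forall>q :: nat \<Rightarrow> int. (\<forall>k. [q (Suc (Suc k)) = - q k - c * q (Suc k)] (mod int p)) \<longrightarrow> int p dvd (\<Sum>j<n. q (2 * j)))"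

text \<open>\<open>g\<close> is the Gram matrix of the simple roots modulo \<open>p\<close>;
  \<open>good\<close> takes the place of the usual condition that off-diagonal entries be negative
  doubled cosines.\<close>

locale tits_rep =
  fixes V :: "'b set" and E :: "'b set set" and m :: "'b set \<Rightarrow> nat" and p :: nat and g :: "'b \<Rightarrow> 'b \<Rightarrow> int"
  assumes fin: "finite V" and edge: "\<And>s t. {s, t} \<in> E \<Longrightarrow> s \<in> V \<and> t \<in> V \<and> s \<noteq> t"
    and prime: "Factorial_Ring.prime p" and odd: "odd p" and cop: "\<And>e. e \<in> E \<Longrightarrow> coprime (m e) p"
    and gss: "\<And>s. g s s = 2" and gsym: "\<And>s t. g s t = g t s"
    and good: "\<And>s t. {s, t} \<in> E \<Longrightarrow> good_weight p (m {s, t}) (g s t)"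
begin

definition G :: "('b \<Rightarrow> int) monoid" where "G = zp_space p V"

definition form :: "'b \<Rightarrow> ('b \<Rightarrow> int) \<Rightarrow> int" where "form s x = (\<Sum>t\<in>V. g s t * x t)"

definition tit :: "'b \<Rightarrow> ('b \<Rightarrow> int) \<Rightarrow> 'b \<Rightarrow> int" where
  "tit s x = (\<lambda>u. if u = s then (x s - form s x) mod int p else x u)"

lemma p2: "p > 2" "p > 1" "p > 0"
proof -
  have "p \<noteq> 2" using odd by auto
  then show "p > 2" using prime_ge_2_nat[OF prime] by simp
  then show "p > 1" "p > 0" by auto
qed

sublocale G: comm_group G unfolding G_def using p2 by (intro zp_comm_group)

lemma form_tit:
  assumes t: "t \<in> V"
  shows "[form s (tit t x) = form s x - g s t * form t x] (mod int p)"
proof -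
  have "form s (tit t x) = g s t * tit t x t + (\<Sum>u\<in>V - {t}. g s u * tit t x u)"
    unfolding form_def using fin t by (simp add: sum.remove)
  also have "(\<Sum>u\<in>V - {t}. g s u * tit t x u) = (\<Sum>u\<in>V - {t}. g s u * x u)"
    by (rule sum.cong) (auto simp: tit_def)
  also have "\<dots> = form s x - g s t * x t"
    unfolding form_def using fin t by (simp add: sum.remove)
  finally have e: "form s (tit t x) = g s t * tit t x t + (form s x - g s t * x t)" .
  have "[tit t x t = x t - form t x] (mod int p)" by (simp add: tit_def)
  then have "[g s t * tit t x t + (form s x - g s t * x t) = g s t * (x t - form t x) + (form s x - g s t * x t)] (mod int p)"
    by (intro cong_add cong_mult cong_refl)
  then show ?thesis unfolding e by (simp add: algebra_simps)
qed

lemma tit_in: "s \<in> V \<Longrightarrow> x \<in> carrier G \<Longrightarrow> tit s x \<in> carrier G"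
  using p2 by (auto simp: G_def zp_carrier tit_def)

lemma carrier_cong_eq: "x \<in> carrier G \<Longrightarrow> y \<in> carrier G \<Longrightarrow> (\<And>u. [x u = y u] (mod int p)) \<Longrightarrow> x = y"
  using zp_mod[of _ p V] unfolding G_def cong_def by (metis ext)

lemma tit_tit:
  assumes s: "s \<in> V" and x: "x \<in> carrier G"
  shows "tit s (tit s x) = x"
proof (rule carrier_cong_eq)
  show "tit s (tit s x) \<in> carrier G" "x \<in> carrier G" using assms tit_in by auto
  fix u show "[tit s (tit s x) u = x u] (mod int p)"
  proof (cases "u = s")
    case True
    have "[tit s (tit s x) s = tit s x s - form s (tit s x)] (mod int p)" by (simp add: tit_def[of s "tit s x"])
    also have "[tit s x s - form s (tit s x) = (x s - form s x) - (form s x - g s s * form s x)] (mod int p)"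
      by (rule cong_diff[OF _ form_tit[OF s]]) (simp add: tit_def)
    finally show ?thesis using True gss by simp
  qed (simp add: tit_def)
qed

lemma form_mult: "[form s (x \<otimes>\<^bsub>G\<^esub> y) = form s x + form s y] (mod int p)"
proof -
  have "[form s (x \<otimes>\<^bsub>G\<^esub> y) = (\<Sum>t\<in>V. g s t * (x t + y t))] (mod int p)"
    unfolding form_def by (rule cong_sum) (simp add: G_def zp_mult cong_scalar_left)
  also have "(\<Sum>t\<in>V. g s t * (x t + y t)) = form s x + form s y"
    unfolding form_def by (simp add: distrib_left sum.distrib)
  finally show ?thesis .
qed

lemma tit_hom: "s \<in> V \<Longrightarrow> tit s \<in> hom G G"
proof (rule homI)
  fix x y assume s: "s \<in> V" and xy: "x \<in> carrier G" "y \<in> carrier G"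
  show "tit s (x \<otimes>\<^bsub>G\<^esub> y) = tit s x \<otimes>\<^bsub>G\<^esub> tit s y"
  proof (rule carrier_cong_eq)
    show "tit s (x \<otimes>\<^bsub>G\<^esub> y) \<in> carrier G" "tit s x \<otimes>\<^bsub>G\<^esub> tit s y \<in> carrier G" using s xy tit_in by auto
    fix u
    have m: "[(x \<otimes>\<^bsub>G\<^esub> y) u = x u + y u] (mod int p)" for x y u by (simp add: G_def zp_mult)
    show "[tit s (x \<otimes>\<^bsub>G\<^esub> y) u = (tit s x \<otimes>\<^bsub>G\<^esub> tit s y) u] (mod int p)"
    proof (cases "u = s")
      case True
      have "[tit s (x \<otimes>\<^bsub>G\<^esub> y) s = (x \<otimes>\<^bsub>G\<^esub> y) s - form s (x \<otimes>\<^bsub>G\<^esub> y)] (mod int p)" by (simp add: tit_def)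
      also have "[(x \<otimes>\<^bsub>G\<^esub> y) s - form s (x \<otimes>\<^bsub>G\<^esub> y) = (x s + y s) - (form s x + form s y)] (mod int p)"
        by (rule cong_diff[OF m form_mult])
      also have "(x s + y s) - (form s x + form s y) = (x s - form s x) + (y s - form s y)" by simp
      also have "[(x s - form s x) + (y s - form s y) = tit s x s + tit s y s] (mod int p)"
        by (rule cong_add) (simp_all add: tit_def)
      also have "[tit s x s + tit s y s = (tit s x \<otimes>\<^bsub>G\<^esub> tit s y) s] (mod int p)" using m cong_sym by blast
      finally show ?thesis using True by simp
    next
      case False
      then show ?thesis by (simp add: tit_def G_def zp_mult)
    qed
  qed
qed (rule tit_in)

text \<open>Each reflection subtracts a multiple of one unit vector. The multiples, listed
  alternately for \<open>t\<close> and \<open>s\<close>, obey the recurrence of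
  \<open>good_weight\<close>, and the total displacement along each of the two unit vectors is the
  sum of every other term.\<close>

lemma tit_relation:
  assumes e: "{s, t} \<in> E" and x: "x \<in> carrier G"
  shows "((tit s \<circ> tit t) ^^ m {s, t}) x = x"
proof -
  let ?A = "tit s \<circ> tit t"
  note st = edge[OF e]
  define X' where "X' k = (?A ^^ k) x" for k
  have XS: "X' (Suc k) = tit s (tit t (X' k))" for k by (simp add: X'_def)
  have Xc: "X' k \<in> carrier G" for k
  proof (induction k)
    case 0
    show ?case using x by (simp add: X'_def)
  next
    case (Suc k)
    then show ?case unfolding XS using tit_in st by blast
  qed
  \<comment> \<open>Even entries are what \<open>tit t\<close> subtracts from the current vector,
    odd entries what \<open>tit s\<close> subtracts afterwards, the latter only up to
    congruence.\<close>
  define q where "q k = (if even k then form t (X' (k div 2)) else form s (X' (k div 2)) - g s t * form t (X' (k div 2)))" for k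
  have q0: "q (2 * k) = form t (X' k)" and q1: "q (Suc (2 * k)) = form s (X' k) - g s t * form t (X' k)" for k
    by (simp_all add: q_def)
  have fs: "[form s (tit t (X' k)) = q (Suc (2 * k))] (mod int p)" for k
    unfolding q1 using form_tit st by blast
  have ft: "[form t (X' (Suc k)) = - q (2 * k) - g s t * q (Suc (2 * k))] (mod int p)" for k
  proof -
    have "[form t (X' (Suc k)) = form t (tit t (X' k)) - g t s * form s (tit t (X' k))] (mod int p)"
      unfolding XS using form_tit st by blast
    also have "[form t (tit t (X' k)) - g t s * form s (tit t (X' k)) = (form t (X' k) - g t t * form t (X' k)) - g t s * q (Suc (2 * k))] (mod int p)"
      by (intro cong_diff cong_mult cong_refl fs) (use form_tit st in blast)
    finally show ?thesis using q0 gss gsym[of t s] by simp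
  qed
  have fs': "[form s (X' (Suc k)) = - q (Suc (2 * k))] (mod int p)" for k
  proof -
    have "[form s (X' (Suc k)) = form s (tit t (X' k)) - g s s * form s (tit t (X' k))] (mod int p)"
      unfolding XS using form_tit st by blast
    also have "form s (tit t (X' k)) - g s s * form s (tit t (X' k)) = - form s (tit t (X' k))" using gss by simp
    also have "[- form s (tit t (X' k)) = - q (Suc (2 * k))] (mod int p)" using fs cong_minus_minus_iff by blast
    finally show ?thesis .
  qed
  have rec: "[q (Suc (Suc k)) = - q k - g s t * q (Suc k)] (mod int p)" for k
  proof (cases "even k")
    case True
    then obtain j where j: "k = 2 * j" by blast
    have "q (Suc (Suc k)) = form t (X' (Suc j))" using q0[of "Suc j"] j by simp
    then show ?thesis using ft[of j] j by simp
  next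
    case False
    then obtain j where j: "k = Suc (2 * j)" by (metis oddE Suc_eq_plus1)
    have "q (Suc (Suc k)) = form s (X' (Suc j)) - g s t * q (Suc k)" using q1[of "Suc j"] q0[of "Suc j"] j by simp
    also have "[form s (X' (Suc j)) - g s t * q (Suc k) = - q (Suc (2 * j)) - g s t * q (Suc k)] (mod int p)"
      by (rule cong_diff[OF fs' cong_refl])
    finally show ?thesis using j by simp
  qed
  have step: "[X' k u = x u - (if u = t then \<Sum>j<k. q (2 * j) else 0) - (if u = s then \<Sum>j<k. q (Suc (2 * j)) else 0)] (mod int p)" for k u
  proof (induction k)
    case 0
    show ?case by (simp add: X'_def)
  next
    case (Suc k)
    have "[X' (Suc k) u = X' k u - (if u = t then q (2 * k) else 0) - (if u = s then q (Suc (2 * k)) else 0)] (mod int p)"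
    proof -
      consider "u = s" | "u = t" | "u \<noteq> s" "u \<noteq> t" by blast
      then show ?thesis
      proof cases
        case 1
        have "[X' (Suc k) s = tit t (X' k) s - form s (tit t (X' k))] (mod int p)" unfolding XS by (simp add: tit_def[of s])
        also have "[tit t (X' k) s - form s (tit t (X' k)) = X' k s - q (Suc (2 * k))] (mod int p)"
          by (rule cong_diff[OF _ fs]) (use st in \<open>simp add: tit_def\<close>)
        finally show ?thesis using 1 st by simp
      next
        case 2
        have "t \<noteq> s" using st by blast
        then have "X' (Suc k) t = (X' k t - form t (X' k)) mod int p" unfolding XS by (simp add: tit_def)
        then show ?thesis using 2 \<open>t \<noteq> s\<close> q0[of k] by simp
      next
        case 3
        then show ?thesis unfolding XS by (simp add: tit_def)
      qed
    qed
    also have "[X' k u - (if u = t then q (2 * k) else 0) - (if u = s then q (Suc (2 * k)) else 0)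
      = (x u - (if u = t then \<Sum>j<k. q (2 * j) else 0) - (if u = s then \<Sum>j<k. q (Suc (2 * j)) else 0)) - (if u = t then q (2 * k) else 0) - (if u = s then q (Suc (2 * k)) else 0)] (mod int p)"
      by (intro cong_diff Suc cong_refl)
    also have "(x u - (if u = t then \<Sum>j<k. q (2 * j) else 0) - (if u = s then \<Sum>j<k. q (Suc (2 * j)) else 0)) - (if u = t then q (2 * k) else 0) - (if u = s then q (Suc (2 * k)) else 0)
      = x u - (if u = t then \<Sum>j<Suc k. q (2 * j) else 0) - (if u = s then \<Sum>j<Suc k. q (Suc (2 * j)) else 0)"
      by simp
    finally show ?case .
  qed
  have d0: "int p dvd (\<Sum>j<m {s, t}. q (2 * j))"
    using good[OF e] rec unfolding good_weight_def by blast
  \<comment> \<open>The recurrence is invariant under shifting the index, so the odd terms are the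
    even terms of the shifted sequence.\<close>
  have d1: "int p dvd (\<Sum>j<m {s, t}. q (Suc (2 * j)))"
    using good[OF e, unfolded good_weight_def, rule_format, of "\<lambda>k. q (Suc k)"] rec by simp
  have "X' (m {s, t}) = x"
  proof (rule carrier_cong_eq[OF Xc x])
    fix u
    have "[x u - (if u = t then \<Sum>j<m {s, t}. q (2 * j) else 0) - (if u = s then \<Sum>j<m {s, t}. q (Suc (2 * j)) else 0) = x u - 0 - 0] (mod int p)"
      by (intro cong_diff cong_refl) (use d0 d1 in \<open>auto simp: cong_0_iff\<close>)
    with step[of "m {s, t}" u] show "[X' (m {s, t}) u = x u] (mod int p)" by (auto intro: cong_trans)
  qed
  then show ?thesis by (simp add: X'_def)
qed

definition rep :: "'b \<Rightarrow> ('b \<Rightarrow> int) \<Rightarrow> 'b \<Rightarrow> int" where "rep = mk V (carrier G) tit"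

lemma cact_rep: "cact V E m (carrier G) rep"
  unfolding rep_def
proof (rule cact_mk)
  show "finite (carrier G)" unfolding G_def using fin p2 by (intro zp_finite)
qed (use tit_in tit_tit tit_relation edge in blast)+

lemma rep_eq: "s \<in> V \<Longrightarrow> x \<in> carrier G \<Longrightarrow> rep s x = tit s x"
  by (simp add: rep_def mk_apply)

lemma linear_rep: "linear_act V G rep"
  unfolding linear_act_def
proof
  fix s assume s: "s \<in> V"
  show "rep s \<in> hom G G"
    by (rule homI) (use rep_eq[OF s] tit_in[OF s] hom_mult[OF tit_hom[OF s]] in simp_all)
qed

lemma unit_in: "s \<in> V \<Longrightarrow> unit_vec s \<in> carrier G"
  unfolding G_def by (rule unit_vec_carrier[OF p2(2)])

lemma form_unit: "t \<in> V \<Longrightarrow> form s (unit_vec t) = g s t"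
  unfolding form_def unit_vec_def using fin by (simp add: if_distrib[of "\<lambda>x. _ * x"] cong: if_cong)

lemma rep_inj: "s \<in> V \<Longrightarrow> t \<in> V \<Longrightarrow> s \<noteq> t \<Longrightarrow> rep s \<noteq> rep t"
proof
  assume st: "s \<in> V" "t \<in> V" "s \<noteq> t" and "rep s = rep t"
  then have "tit s (unit_vec s) s = tit t (unit_vec s) s" using rep_eq unit_in by metis
  moreover have "tit s (unit_vec s) s = (- 1) mod int p" using form_unit[OF st(1), of s] gss by (simp add: tit_def unit_vec_def)
  moreover have "tit t (unit_vec s) s = 1" using st by (simp add: tit_def unit_vec_def)
  ultimately have "[- 1 = 1] (mod int p)" using p2 by (simp add: cong_def)
  then have "int p dvd 2" by (simp add: cong_iff_dvd_diff)
  then show False using p2 by (metis int_dvd_int_iff of_nat_numeral nat_dvd_not_less zero_less_numeral)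
qed

lemma half_zero: "[a = - a] (mod int p) \<Longrightarrow> [a = 0] (mod int p)"
proof -
  assume "[a = - a] (mod int p)"
  then have "int p dvd 2 * a" by (simp add: cong_iff_dvd_diff)
  moreover have "coprime (int p) 2" using odd by (simp add: coprime_right_2_iff_odd)
  ultimately show ?thesis by (simp add: cong_0_iff coprime_dvd_mult_right_iff)
qed

lemma eig_rep:
  assumes s: "s \<in> V"
  shows "eig G (rep s) = {x \<in> carrier G. \<forall>u. u \<noteq> s \<longrightarrow> x u = 0}"
proof (intro equalityI subsetI)
  fix x assume "x \<in> eig G (rep s)"
  then have x: "x \<in> carrier G" "tit s x = inv\<^bsub>G\<^esub> x" using rep_eq[OF s] by (auto simp: eig_def)
  have "x u = 0" if "u \<noteq> s" for u
  proof -
    have "x u = (- x u) mod int p"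
      using fun_cong[OF x(2), of u] that zp_inv[of p x V] x(1) p2 by (simp add: tit_def G_def)
    then have "[x u = - x u] (mod int p)" using cong_mod_right cong_refl by metis
    then have "[x u = 0] (mod int p)" by (rule half_zero)
    then show ?thesis using x(1) zp_mod[of x p V u] by (simp add: cong_def G_def)
  qed
  then show "x \<in> {x \<in> carrier G. \<forall>u. u \<noteq> s \<longrightarrow> x u = 0}" using x by simp
next
  fix x assume "x \<in> {x \<in> carrier G. \<forall>u. u \<noteq> s \<longrightarrow> x u = 0}"
  then have x: "x \<in> carrier G" "\<And>u. u \<noteq> s \<Longrightarrow> x u = 0" by auto
  have "form s x = (\<Sum>t\<in>V. if t = s then 2 * x s else 0)"
    unfolding form_def by (rule sum.cong) (use x(2) gss in auto)
  then have "form s x = 2 * x s" using fin s by simp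
  then have "tit s x = inv\<^bsub>G\<^esub> x" using x zp_inv[of p x V] p2 by (auto simp: tit_def G_def fun_eq_iff)
  then show "x \<in> eig G (rep s)" using x rep_eq[OF s x(1)] by (simp add: eig_def)
qed

lemma card_eig_rep:
  assumes s: "s \<in> V"
  shows "card (eig G (rep s)) = p"
proof -
  have "bij_betw (\<lambda>x. x s) (eig G (rep s)) {0..<int p}"
    unfolding eig_rep[OF s]
    by (rule bij_betw_byWitness[where f' = "\<lambda>a u. if u = s then a else 0"])
      (use s p2 in \<open>auto simp: G_def zp_carrier fun_eq_iff\<close>)
  from bij_betw_same_card[OF this] show ?thesis by simp
qed

text \<open>Different generators act by different reflections, so no edge is collapsed and each
  vertex contributes its eigenline freely.\<close>

lemma card_lifts_rep: "card (lifts V E m G rep) = p ^ card V"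
proof -
  have "card (lifts V E m G rep) = card (cocycles V E m G rep)"
    by (rule bij_betw_same_card[OF G.bij_lifts_cocycles[OF cact_rep linear_rep]]) (use edge in blast)
  also have "cocycles V E m G rep = {y \<in> \<Pi>\<^sub>E v\<in>V. eig G (rep v). \<forall>u w. ({u, w} \<in> E) \<longrightarrow> (rep u = rep w \<longrightarrow> y u = y w)}"
  proof (rule G.cocycles_collapse[OF cact_rep linear_rep _ _ prime cop])
    show "x [^]\<^bsub>G\<^esub> p = \<one>\<^bsub>G\<^esub>" for x unfolding G_def using p2 by (intro zp_exponent)
  qed (use edge card_eig_rep in blast)+
  also have "\<dots> = (\<Pi>\<^sub>E v\<in>V. eig G (rep v))" using edge rep_inj by blast
  also have "card \<dots> = p ^ card V" using fin card_eig_rep by (simp add: card_PiE)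
  finally show ?thesis .
qed

end

section \<open>Alternating forms on the reflection representation\<close>

context comm_group
begin

lemma eig_diff:
  assumes s: "s \<in> hom G G" and ss: "\<And>x. x \<in> carrier G \<Longrightarrow> s (s x) = x" and x: "x \<in> carrier G"
  shows "s x \<otimes> inv x \<in> eig G s"
  using x hom_self_closed[OF s] hom_mult[OF s] hom_inv_self[OF s] ss by (simp add: eig_def inv_mult m_comm)

lemma eig_alt_iff:
  assumes p: "p > 0" and v: "v \<in> V"
  shows "y \<in> eig (Alt p G) (alt_act V p G b v) \<longleftrightarrow>
    y \<in> alt_forms p G \<and> (\<forall>x\<in>carrier G. \<forall>x'\<in>carrier G. y (b v x, b v x') = (- y (x, x')) mod int p)"
proof (cases "y \<in> alt_forms p G")
  case True
  have "alt_act V p G b v y = pull G (b v) y" using True v by (simp add: alt_act_def mk_def)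
  moreover have "pull G (b v) y = (\<lambda>i. (- y i) mod int p) \<longleftrightarrow> (\<forall>x\<in>carrier G. \<forall>x'\<in>carrier G. y (b v x, b v x') = (- y (x, x')) mod int p)"
  proof
    assume e: "pull G (b v) y = (\<lambda>i. (- y i) mod int p)"
    show "\<forall>x\<in>carrier G. \<forall>x'\<in>carrier G. y (b v x, b v x') = (- y (x, x')) mod int p"
    proof (intro ballI)
      fix x x' assume "x \<in> carrier G" "x' \<in> carrier G"
      then show "y (b v x, b v x') = (- y (x, x')) mod int p" using fun_cong[OF e, of "(x, x')"] by (simp add: pull_def)
    qed
  next
    assume h: "\<forall>x\<in>carrier G. \<forall>x'\<in>carrier G. y (b v x, b v x') = (- y (x, x')) mod int p"
    show "pull G (b v) y = (\<lambda>i. (- y i) mod int p)"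
    proof
      fix i
      have "y i = 0" if "i \<notin> carrier G \<times> carrier G" using True that unfolding alt_forms_def zp_carrier by blast
      then show "pull G (b v) y i = (- y i) mod int p" using h by (cases i) (auto simp: pull_def)
    qed
  qed
  ultimately show ?thesis using True Alt_inv[OF p True] by (simp add: eig_def)
qed (simp add: eig_def)

text \<open>This concerns all alternating forms, not only those negated by \<open>s\<close>. The
  vector \<open>c\<close> generates the eigenline, which is isotropic and contains the displacement
  of \<open>x\<close>; so replacing \<open>x\<close> by \<open>s x\<close> changes nothing, while
  \<open>s\<close> inverts \<open>c\<close>.\<close>

lemma alt_neg_edge:
  assumes pp: "Factorial_Ring.prime p" and y: "y \<in> alt_forms p G" and s: "s \<in> hom G G"
    and ss: "\<And>x. x \<in> carrier G \<Longrightarrow> s (s x) = x" and cs: "card (eig G s) = p"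
    and c: "c \<in> eig G s" "c \<noteq> \<one>" and x: "x \<in> carrier G"
  shows "y (s c, s x) = (- y (c, x)) mod int p" "y (s x, s c) = (- y (x, c)) mod int p"
proof -
  have p: "p > 0" using pp prime_gt_0_nat by blast
  have cc: "c \<in> carrier G" and sc: "s c = inv c" using c by (auto simp: eig_def)
  let ?d = "s x \<otimes> inv x"
  have d: "?d \<in> eig G s" by (rule eig_diff[OF s ss x])
  then have dc: "?d \<in> carrier G" by (simp add: eig_def)
  have "eig G s \<subseteq> {z \<in> carrier G. y (c, z) = 0}"
    by (rule prime_order_subgroup_subset[OF eig_subgroup[OF s] alt_kernel_subgroup[OF p y cc] cs pp c(1) _ c(2)])
      (use cc alt_diag[OF p y cc] in simp)
  then have cd: "y (c, ?d) = 0" using d by blast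
  have sx: "s x = ?d \<otimes> x" using x hom_self_closed[OF s x] by (simp add: m_assoc)
  have inv1: "y (inv c, z) = (- y (c, z)) mod int p" if z: "z \<in> carrier G" for z
  proof -
    have "(y (inv c, z) + y (c, z)) mod int p = 0" using alt_add1[OF p y _ cc z, of "inv c"] cc alt_one1[OF p y z] by simp
    then have "[y (inv c, z) = - y (c, z)] (mod int p)" by (simp add: cong_iff_dvd_diff mod_eq_0_iff_dvd)
    then show ?thesis using alt_mod[OF p y] by (simp add: cong_def)
  qed
  have "y (c, ?d \<otimes> x) = y (c, x)" using alt_add2[OF p y dc x cc] cd alt_mod[OF p y] by simp
  then have cx: "y (c, s x) = y (c, x)" unfolding sx[symmetric] .
  have "y (s c, s x) = (- y (c, s x)) mod int p" unfolding sc by (rule inv1[OF hom_self_closed[OF s x]])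
  also have "\<dots> = (- y (c, x)) mod int p" unfolding cx by simp
  finally show 1: "y (s c, s x) = (- y (c, x)) mod int p" .
  have "[y (s x, s c) = - y (s c, s x)] (mod int p)" "[y (x, c) = - y (c, x)] (mod int p)"
    using alt_swap[OF p y, of "s x" "s c"] alt_swap[OF p y x cc] hom_self_closed[OF s] x cc
    by (simp_all add: cong_iff_dvd_diff mod_eq_0_iff_dvd)
  then have "[y (s x, s c) = - y (x, c)] (mod int p)"
    unfolding 1 by (metis cong_minus_minus_iff cong_mod_right cong_sym cong_trans minus_minus)
  then show "y (s x, s c) = (- y (x, c)) mod int p" using alt_mod[OF p y] by (simp add: cong_def)
qed

end

context tits_rep
begin

abbreviation "AA \<equiv> alt_act V p G rep"

lemma group_G: "group G" by (rule G.group_axioms)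

lemma cact_AA: "cact V E m (carrier (Alt p G)) AA" and linear_AA: "linear_act V (Alt p G) AA"
  by (rule cact_alt_act[OF group_G p2(3) cact_rep linear_rep]; use edge in blast)+

lemma rep_hom: "s \<in> V \<Longrightarrow> rep s \<in> hom G G" using linear_rep by (simp add: linear_act_def)

lemma rep_rep: "rep s (rep s x) = x" by (rule cact_invol[OF cact_rep])

lemma unit_eig: "s \<in> V \<Longrightarrow> unit_vec s \<in> eig G (rep s)"
  unfolding eig_rep using unit_in by (auto simp: eig_rep unit_vec_def)

lemma unit_ne: "unit_vec s \<noteq> \<one>\<^bsub>G\<^esub>"
  by (auto simp: G_def zp_one unit_vec_def fun_eq_iff)

text \<open>The unit vectors generate the space, so the hypothesis puts the eigenline of
  \<open>s\<close> into the radical, and \<open>alt_zero\<close> finishes.\<close>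

lemma eig_alt_zero:
  assumes s: "s \<in> V" and y: "y \<in> eig (Alt p G) (AA s)" and z: "\<And>t. t \<in> V \<Longrightarrow> t \<noteq> s \<Longrightarrow> y (unit_vec s, unit_vec t) = 0"
  shows "y = (\<lambda>i. 0)"
proof -
  have ya: "y \<in> alt_forms p G" and neg: "\<And>x x'. x \<in> carrier G \<Longrightarrow> x' \<in> carrier G \<Longrightarrow> y (rep s x, rep s x') = (- y (x, x')) mod int p"
    using y G.eig_alt_iff[OF p2(3) s] by blast+
  have es: "unit_vec s \<in> carrier G" by (rule unit_in[OF s])
  note subK = G.alt_kernel_subgroup[OF p2(3) ya es]
  have "{x \<in> carrier G. y (unit_vec s, x) = 0} = carrier G"
    unfolding G_def
  proof (rule zp_generated[OF p2(2) fin])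
    show "subgroup {x \<in> carrier (zp_space p V). y (unit_vec s, x) = 0} (zp_space p V)" using subK by (simp add: G_def)
    fix t assume t: "t \<in> V"
    then show "unit_vec t \<in> {x \<in> carrier (zp_space p V). y (unit_vec s, x) = 0}"
      using unit_in[OF t] z[OF t] G.alt_diag[OF p2(3) ya es] by (cases "t = s") (auto simp: G_def)
  qed
  then have all: "y (unit_vec s, x) = 0" if "x \<in> carrier G" for x using that by blast
  show ?thesis
  proof (rule G.alt_zero[OF p2(3) ya odd rep_hom[OF s] neg])
    show "rep s x \<otimes>\<^bsub>G\<^esub> inv\<^bsub>G\<^esub> x \<in> eig G (rep s)" if "x \<in> carrier G" for x
      by (rule G.eig_diff[OF rep_hom[OF s] rep_rep that])
    show "eig G (rep s) \<subseteq> carrier G" by (auto simp: eig_def)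
    fix c x assume c: "c \<in> eig G (rep s)" and x: "x \<in> carrier G"
    have "eig G (rep s) \<subseteq> {z \<in> carrier G. y (z, x) = 0}"
      by (rule G.prime_order_subgroup_subset[OF G.eig_subgroup[OF rep_hom[OF s]] G.alt_kernel_subgroup1[OF p2(3) ya x]
          card_eig_rep[OF s] prime unit_eig[OF s] _ unit_ne]) (use es all[OF x] in simp)
    then show "y (c, x) = 0" using c by blast
  qed
qed

lemma eig_alt_inj:
  assumes s: "s \<in> V" and y: "y \<in> eig (Alt p G) (AA s)" "y' \<in> eig (Alt p G) (AA s)"
    and eq: "\<And>t. t \<in> V \<Longrightarrow> t \<noteq> s \<Longrightarrow> y (unit_vec s, unit_vec t) = y' (unit_vec s, unit_vec t)"
  shows "y = y'"
proof -
  interpret A: comm_group "Alt p G" by (rule Alt_comm_group[OF p2(3)])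
  have h: "AA s \<in> hom (Alt p G) (Alt p G)" using linear_AA s by (simp add: linear_act_def)
  have c: "y \<in> carrier (Alt p G)" "y' \<in> carrier (Alt p G)" using y by (auto simp: eig_def)
  let ?z = "y \<otimes>\<^bsub>Alt p G\<^esub> inv\<^bsub>Alt p G\<^esub> y'"
  note sub = A.eig_subgroup[OF h]
  have "?z \<in> eig (Alt p G) (AA s)" by (intro subgroup.m_closed[OF sub] subgroup.m_inv_closed[OF sub] y)
  moreover have "?z (unit_vec s, unit_vec t) = 0" if "t \<in> V" "t \<noteq> s" for t
    using eq[OF that] c(2) p2(3) by (simp add: Alt_mult Alt_inv mod_simps)
  ultimately have "?z = \<one>\<^bsub>Alt p G\<^esub>" using eig_alt_zero[OF s] by (simp add: Alt_one)
  then show ?thesis using c by (metis A.inv_equality A.inv_inv A.inv_closed)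
qed

text \<open>The exterior product of the functional \<open>form s\<close>, which \<open>s\<close>
  negates, with the functional having coefficients \<open>\<eta>\<close> off \<open>s\<close>, which
  \<open>s\<close> fixes.\<close>

definition wedge :: "'b \<Rightarrow> ('b \<Rightarrow> int) \<Rightarrow> ('b \<Rightarrow> int) \<times> ('b \<Rightarrow> int) \<Rightarrow> int" where
  "wedge s \<eta> = (\<lambda>(x, x'). if x \<in> carrier G \<and> x' \<in> carrier G
     then (form s x * (\<Sum>t\<in>V - {s}. \<eta> t * x' t) - form s x' * (\<Sum>t\<in>V - {s}. \<eta> t * x t)) mod int p else 0)"

lemma wedge_eig:
  assumes s: "s \<in> V"
  shows "wedge s \<eta> \<in> eig (Alt p G) (AA s)"
proof -
  let ?\<xi> = "\<lambda>x. \<Sum>t\<in>V - {s}. \<eta> t * x t"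
  have \<xi>m: "[?\<xi> (x \<otimes>\<^bsub>G\<^esub> y) = ?\<xi> x + ?\<xi> y] (mod int p)" for x y
  proof -
    have "[?\<xi> (x \<otimes>\<^bsub>G\<^esub> y) = (\<Sum>t\<in>V - {s}. \<eta> t * (x t + y t))] (mod int p)"
      by (rule cong_sum) (simp add: G_def zp_mult cong_scalar_left)
    then show ?thesis by (simp add: distrib_left sum.distrib)
  qed
  have \<xi>s: "?\<xi> (rep s x) = ?\<xi> x" if "x \<in> carrier G" for x
    by (rule sum.cong) (auto simp: rep_eq[OF s that] tit_def)
  have fs: "[form s (rep s x) = - form s x] (mod int p)" if "x \<in> carrier G" for x
    using form_tit[OF s, of s x] gss by (simp add: rep_eq[OF s that])
  have rc: "rep s x \<in> carrier G" if "x \<in> carrier G" for x using G.hom_self_closed[OF rep_hom[OF s] that] .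
  have "wedge s \<eta> \<in> alt_forms p G"
    unfolding alt_forms_def
  proof (intro CollectI conjI ballI)
    show "wedge s \<eta> \<in> carrier (zp_space p (carrier G \<times> carrier G))" using p2 by (auto simp: zp_carrier wedge_def)
  next
    fix x assume "x \<in> carrier G"
    then show "wedge s \<eta> (x, x) = 0" by (simp add: wedge_def)
  next
    fix x x' z assume x: "x \<in> carrier G" "x' \<in> carrier G" "z \<in> carrier G"
    have xx: "x \<otimes>\<^bsub>G\<^esub> x' \<in> carrier G" using x by simp
    have "[form s (x \<otimes>\<^bsub>G\<^esub> x') * ?\<xi> z - form s z * ?\<xi> (x \<otimes>\<^bsub>G\<^esub> x') = (form s x + form s x') * ?\<xi> z - form s z * (?\<xi> x + ?\<xi> x')] (mod int p)"
      by (intro cong_diff cong_mult cong_refl form_mult \<xi>m)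
    also have "(form s x + form s x') * ?\<xi> z - form s z * (?\<xi> x + ?\<xi> x') = (form s x * ?\<xi> z - form s z * ?\<xi> x) + (form s x' * ?\<xi> z - form s z * ?\<xi> x')"
      by (simp add: algebra_simps)
    finally show "wedge s \<eta> (x \<otimes>\<^bsub>G\<^esub> x', z) = (wedge s \<eta> (x, z) + wedge s \<eta> (x', z)) mod int p"
      using x xx by (simp add: wedge_def cong_def mod_add_eq)
    have "[form s z * ?\<xi> (x \<otimes>\<^bsub>G\<^esub> x') - form s (x \<otimes>\<^bsub>G\<^esub> x') * ?\<xi> z = form s z * (?\<xi> x + ?\<xi> x') - (form s x + form s x') * ?\<xi> z] (mod int p)"
      by (intro cong_diff cong_mult cong_refl form_mult \<xi>m)
    also have "form s z * (?\<xi> x + ?\<xi> x') - (form s x + form s x') * ?\<xi> z = (form s z * ?\<xi> x - form s x * ?\<xi> z) + (form s z * ?\<xi> x' - form s x' * ?\<xi> z)"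
      by (simp add: algebra_simps)
    finally show "wedge s \<eta> (z, x \<otimes>\<^bsub>G\<^esub> x') = (wedge s \<eta> (z, x) + wedge s \<eta> (z, x')) mod int p"
      using x xx by (simp add: wedge_def cong_def mod_add_eq)
  qed
  moreover have "wedge s \<eta> (rep s x, rep s x') = (- wedge s \<eta> (x, x')) mod int p" if x: "x \<in> carrier G" "x' \<in> carrier G" for x x'
  proof -
    have "[form s (rep s x) * ?\<xi> x' - form s (rep s x') * ?\<xi> x = - form s x * ?\<xi> x' - - form s x' * ?\<xi> x] (mod int p)"
      by (intro cong_diff cong_mult cong_refl fs x)
    then show ?thesis using x rc \<xi>s by (simp add: wedge_def cong_def mod_minus_eq)
  qed
  ultimately show ?thesis using G.eig_alt_iff[OF p2(3) s] by blast
qed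

lemma wedge_unit:
  assumes "s \<in> V" "t \<in> V" "t \<noteq> s"
  shows "wedge s \<eta> (unit_vec s, unit_vec t) = (2 * \<eta> t) mod int p"
proof -
  have "(\<Sum>u\<in>V - {s}. \<eta> u * unit_vec t u) = \<eta> t"
    unfolding unit_vec_def using fin assms by (simp add: if_distrib[of "\<lambda>x. _ * x"] cong: if_cong)
  moreover have "(\<Sum>u\<in>V - {s}. \<eta> u * unit_vec s u) = 0"
    by (rule sum.neutral) (auto simp: unit_vec_def)
  ultimately show ?thesis using assms unit_in form_unit gss by (simp add: wedge_def)
qed

text \<open>A form negated by \<open>s\<close> is determined by pairing \<open>unit_vec s\<close>
  with the other unit vectors, which bounds the number from above; exterior products supply equally
  many such forms.\<close>

lemma card_eig_alt:
  assumes s: "s \<in> V"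
  shows "card (eig (Alt p G) (AA s)) = p ^ (card V - 1)"
proof (rule antisym)
  let ?P = "V - {s} \<rightarrow>\<^sub>E {0..<int p}"
  have finP: "finite ?P" using fin by (intro finite_PiE) auto
  have cP: "card ?P = p ^ (card V - 1)" using fin s by (simp add: card_PiE)
  have "finite (alt_forms p G)" by (rule Alt_finite[OF cactD(1)[OF cact_rep] p2(3)])
  then have finE: "finite (eig (Alt p G) (AA s))" by (simp add: eig_def)
  show "card (eig (Alt p G) (AA s)) \<le> p ^ (card V - 1)"
    unfolding cP[symmetric]
  proof (rule card_inj_on_le[OF _ _ finP])
    show "inj_on (\<lambda>y. \<lambda>t\<in>V - {s}. y (unit_vec s, unit_vec t)) (eig (Alt p G) (AA s))"
    proof (rule inj_onI)
      fix y y' assume y: "y \<in> eig (Alt p G) (AA s)" "y' \<in> eig (Alt p G) (AA s)"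
        and eq: "(\<lambda>t\<in>V - {s}. y (unit_vec s, unit_vec t)) = (\<lambda>t\<in>V - {s}. y' (unit_vec s, unit_vec t))"
      show "y = y'"
      proof (rule eig_alt_inj[OF s y])
        fix t assume "t \<in> V" "t \<noteq> s"
        then show "y (unit_vec s, unit_vec t) = y' (unit_vec s, unit_vec t)" using fun_cong[OF eq, of t] by simp
      qed
    qed
    show "(\<lambda>y. \<lambda>t\<in>V - {s}. y (unit_vec s, unit_vec t)) ` eig (Alt p G) (AA s) \<subseteq> ?P"
    proof
      fix \<eta> assume "\<eta> \<in> (\<lambda>y. \<lambda>t\<in>V - {s}. y (unit_vec s, unit_vec t)) ` eig (Alt p G) (AA s)"
      then obtain y where y: "y \<in> eig (Alt p G) (AA s)" "\<eta> = (\<lambda>t\<in>V - {s}. y (unit_vec s, unit_vec t))" by blast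
      then have "y i \<in> {0..<int p}" for i using G.alt_range[OF p2(3), of y i] by (simp add: eig_def)
      then show "\<eta> \<in> ?P" unfolding y(2) by simp
    qed
  qed
  show "p ^ (card V - 1) \<le> card (eig (Alt p G) (AA s))"
    unfolding cP[symmetric]
  proof (rule card_inj_on_le[OF _ _ finE])
    show "wedge s ` ?P \<subseteq> eig (Alt p G) (AA s)" using wedge_eig[OF s] by blast
    show "inj_on (wedge s) ?P"
    proof (rule inj_onI)
      fix \<eta> \<eta>' assume h: "\<eta> \<in> ?P" "\<eta>' \<in> ?P" and eq: "wedge s \<eta> = wedge s \<eta>'"
      show "\<eta> = \<eta>'"
      proof (rule PiE_ext[OF h])
        fix t assume t: "t \<in> V - {s}"
        then have "[2 * \<eta> t = 2 * \<eta>' t] (mod int p)" using wedge_unit[OF s] eq by (simp add: cong_def) (metis)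
        then have "int p dvd 2 * (\<eta> t - \<eta>' t)" by (simp add: cong_iff_dvd_diff right_diff_distrib)
        moreover have "coprime (int p) 2" using odd by (simp add: coprime_right_2_iff_odd)
        ultimately have "int p dvd \<eta> t - \<eta>' t" using coprime_dvd_mult_right_iff[of "int p" 2] by blast
        then have "[\<eta> t = \<eta>' t] (mod int p)" by (simp add: cong_iff_dvd_diff)
        moreover have "0 \<le> \<eta> t" "\<eta> t < int p" "0 \<le> \<eta>' t" "\<eta>' t < int p" using PiE_mem[OF h(1) t] PiE_mem[OF h(2) t] by auto
        ultimately show "\<eta> t = \<eta>' t" by (simp add: cong_def)
      qed
    qed
  qed
qed

text \<open>This is the equation that an edge costs. Evaluated at the two unit vectors, both
  generators act on every alternating form by a sign, so the \<open>k\<close>-th \<open>tau\<close>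
  becomes \<open>k\<close> times the difference of the two values, and the label is invertible
  modulo \<open>p\<close>.\<close>

lemma cocycle_constraint:
  assumes y: "y \<in> cocycles V E m (Alt p G) AA" and e: "{s, t} \<in> E"
  shows "y s (unit_vec s, unit_vec t) = y t (unit_vec s, unit_vec t)"
proof -
  interpret A: comm_group "Alt p G" by (rule Alt_comm_group[OF p2(3)])
  note st = edge[OF e]
  have s: "s \<in> V" and t: "t \<in> V" using st by auto
  have h: "AA v \<in> hom (Alt p G) (Alt p G)" if "v \<in> V" for v using linear_AA that by (simp add: linear_act_def)
  have yc: "y v \<in> carrier (Alt p G)" if "v \<in> V" for v using y that by (auto simp: cocycles_def eig_def PiE_def Pi_def)
  let ?i = "(unit_vec s, unit_vec t)"
  note us = unit_in[OF s] and ut = unit_in[OF t]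
  have AA_ev: "AA v z (x, x') = z (rep v x, rep v x')" if "z \<in> alt_forms p G" "v \<in> V" "x \<in> carrier G" "x' \<in> carrier G" for v z x x'
    using that by (simp add: alt_act_def mk_def pull_def)
  have ls: "[AA s z ?i = - z ?i] (mod int p)" if z: "z \<in> alt_forms p G" for z
    using AA_ev[OF z s us ut] G.alt_neg_edge(1)[OF prime z rep_hom[OF s] rep_rep card_eig_rep[OF s] unit_eig[OF s] unit_ne ut] by (simp add: cong_def)
  have lt: "[AA t z ?i = - z ?i] (mod int p)" if z: "z \<in> alt_forms p G" for z
    using AA_ev[OF z t us ut] G.alt_neg_edge(2)[OF prime z rep_hom[OF t] rep_rep card_eig_rep[OF t] unit_eig[OF t] unit_ne us] by (simp add: cong_def)
  let ?tau = "\<lambda>k. tau (Alt p G) (AA s) (AA t) (y s) (y t) k"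
  have inv: "AA v (AA v z) = z" for v z by (rule cact_invol[OF cact_AA])
  have tc: "?tau k \<in> carrier (Alt p G)" for k
    by (rule A.tau_closed[OF h[OF s] h[OF t] inv inv yc[OF s] yc[OF t]])
  have "[?tau k ?i = int k * (y s ?i - y t ?i)] (mod int p)" for k
  proof (induction k)
    case 0
    show ?case by (simp add: Alt_one)
  next
    case (Suc k)
    have tk: "AA t (?tau k) \<in> alt_forms p G" using A.hom_self_closed[OF h[OF t] tc] by simp
    have "[?tau (Suc k) ?i = (y s ?i + AA s (y t) ?i) + AA s (AA t (?tau k)) ?i] (mod int p)"
      by (simp add: Alt_mult mod_simps cong_def)
    also have "[(y s ?i + AA s (y t) ?i) + AA s (AA t (?tau k)) ?i = (y s ?i + - y t ?i) + - (- ?tau k ?i)] (mod int p)"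
      by (intro cong_add cong_refl ls cong_trans[OF ls[OF tk]] cong_minus_minus_iff[THEN iffD2] lt) (use yc[OF t] tc[of k] in simp_all)
    also have "[(y s ?i + - y t ?i) + - (- ?tau k ?i) = (y s ?i + - y t ?i) + int k * (y s ?i - y t ?i)] (mod int p)"
      using Suc by (simp add: cong_add_lcancel)
    finally show ?case by (simp add: algebra_simps)
  qed
  moreover have "?tau (m {s, t}) = \<one>\<^bsub>Alt p G\<^esub>" using y e by (simp add: cocycles_def)
  ultimately have "[0 = int (m {s, t}) * (y s ?i - y t ?i)] (mod int p)" by (metis Alt_one)
  then have "[int (m {s, t}) * (y s ?i - y t ?i) = 0] (mod int p)" by (rule cong_sym)
  then have "int p dvd int (m {s, t}) * (y s ?i - y t ?i)" by (simp only: cong_0_iff)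
  moreover have "coprime (int p) (int (m {s, t}))" using cop[OF e] by (simp add: coprime_commute)
  ultimately have "int p dvd y s ?i - y t ?i" by (simp add: coprime_dvd_mult_right_iff)
  then have "[y s ?i = y t ?i] (mod int p)" by (simp add: cong_iff_dvd_diff)
  then show ?thesis
    using G.alt_mod[OF p2(3), of "y s"] G.alt_mod[OF p2(3), of "y t"] yc[OF s] yc[OF t] by (simp add: cong_def)
qed

text \<open>A cocycle is determined by one residue for each ordered pair of distinct vertices, and
  every edge makes one of these redundant.\<close>

lemma card_cocycles_alt_le:
  assumes pairs: "\<forall>e\<in>E. \<exists>s t. e = {s, t}"
  shows "card (cocycles V E m (Alt p G) AA) * p ^ card E \<le> p ^ (card V * (card V - 1))"
proof -
  have "\<forall>e\<in>E. \<exists>z. e = {fst z, snd z}" using pairs by (metis fst_conv snd_conv)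
  \<comment> \<open>Of the two coordinates belonging to an edge, the one in the chosen orientation
    is dropped; the opposite one is kept and determines it through
    \<open>cocycle_constraint\<close>.\<close>
  then obtain ori where ori: "\<And>e. e \<in> E \<Longrightarrow> e = {fst (ori e), snd (ori e)}" by (metis bchoice)
  define P where "P = (SIGMA s:V. V - {s})"
  have finP: "finite P" unfolding P_def using fin by auto
  have cardP: "card P = card V * (card V - 1)" unfolding P_def using fin by (simp add: card_SigmaI)
  have orP: "ori ` E \<subseteq> P"
  proof
    fix z assume "z \<in> ori ` E"
    then obtain e where e: "e \<in> E" "z = ori e" by blast
    then have "{fst z, snd z} \<in> E" using ori by metis
    from edge[OF this] show "z \<in> P" unfolding P_def by (cases z) auto
  qed
  have orinj: "inj_on ori E" by (rule inj_onI) (metis ori)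
  then have cR: "card (ori ` E) = card E" by (rule card_image)
  let ?Q = "P - ori ` E"
  have cQ: "card ?Q + card E = card V * (card V - 1)"
    using card_Diff_subset[OF finite_subset[OF orP finP] orP] card_mono[OF finP orP] cR cardP by simp
  let ?T = "?Q \<rightarrow>\<^sub>E {0..<int p}"
  have finT: "finite ?T" using finP by (intro finite_PiE) auto
  let ?f = "\<lambda>y. \<lambda>z\<in>?Q. y (fst z) (unit_vec (fst z), unit_vec (snd z))"
  have yin: "y s \<in> eig (Alt p G) (AA s)" if "y \<in> cocycles V E m (Alt p G) AA" "s \<in> V" for y s
    using that by (auto simp: cocycles_def)
  have "card (cocycles V E m (Alt p G) AA) \<le> card ?T"
  proof (rule card_inj_on_le[OF _ _ finT])
    show "?f ` cocycles V E m (Alt p G) AA \<subseteq> ?T"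
    proof
      fix z assume "z \<in> ?f ` cocycles V E m (Alt p G) AA"
      then obtain y where y: "y \<in> cocycles V E m (Alt p G) AA" "z = ?f y" by blast
      have "y s i \<in> {0..<int p}" if "s \<in> V" for s i
        using yin[OF y(1) that] G.alt_range[OF p2(3), of "y s" i] by (simp add: eig_def)
      then show "z \<in> ?T" unfolding y(2) by (auto simp: P_def)
    qed
    show "inj_on ?f (cocycles V E m (Alt p G) AA)"
    proof (rule inj_onI)
      fix y y' assume y: "y \<in> cocycles V E m (Alt p G) AA" and y': "y' \<in> cocycles V E m (Alt p G) AA" and eq: "?f y = ?f y'"
      have off: "y s (unit_vec s, unit_vec t) = y' s (unit_vec s, unit_vec t)" if "(s, t) \<in> ?Q" for s t
        using fun_cong[OF eq, of "(s, t)"] that by simp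
      have all: "y s (unit_vec s, unit_vec t) = y' s (unit_vec s, unit_vec t)" if st: "s \<in> V" "t \<in> V" "t \<noteq> s" for s t
      proof (cases "(s, t) \<in> ori ` E")
        case False
        then show ?thesis using off st by (simp add: P_def)
      next
        case True
        then obtain e where e: "e \<in> E" "ori e = (s, t)" by auto
        then have es: "e = {s, t}" using ori[OF e(1)] by simp
        have "(t, s) \<notin> ori ` E"
        proof
          assume "(t, s) \<in> ori ` E"
          then obtain e' where e': "e' \<in> E" "ori e' = (t, s)" by auto
          then have "e' = e" using ori[OF e'(1)] es by auto
          then show False using e e' st by simp
        qed
        then have o: "y t (unit_vec t, unit_vec s) = y' t (unit_vec t, unit_vec s)" using off[of t s] st by (simp add: P_def)
        have sw: "[z (unit_vec s, unit_vec t) = - z (unit_vec t, unit_vec s)] (mod int p)" if "z \<in> alt_forms p G" for z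
          using G.alt_swap[OF p2(3) that unit_in[OF st(1)] unit_in[OF st(2)]] by (simp add: cong_iff_dvd_diff mod_eq_0_iff_dvd)
        have ya: "y t \<in> alt_forms p G" "y' t \<in> alt_forms p G" using yin[OF y st(2)] yin[OF y' st(2)] by (auto simp: eig_def)
        have "[y t (unit_vec s, unit_vec t) = y' t (unit_vec s, unit_vec t)] (mod int p)"
          using sw[OF ya(1)] sw[OF ya(2)] o by (metis cong_sym cong_trans)
        then have "y t (unit_vec s, unit_vec t) = y' t (unit_vec s, unit_vec t)"
          using G.alt_mod[OF p2(3) ya(1)] G.alt_mod[OF p2(3) ya(2)] by (simp add: cong_def)
        then show ?thesis using cocycle_constraint[OF y] cocycle_constraint[OF y'] e(1) es by metis
      qed
      show "y = y'"
      proof (rule PiE_ext[of y V "\<lambda>v. eig (Alt p G) (AA v)" y'])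
        show "y \<in> (\<Pi>\<^sub>E v\<in>V. eig (Alt p G) (AA v))" "y' \<in> (\<Pi>\<^sub>E v\<in>V. eig (Alt p G) (AA v))" using y y' by (auto simp: cocycles_def)
        fix s assume s: "s \<in> V"
        show "y s = y' s" by (rule eig_alt_inj[OF s yin[OF y s] yin[OF y' s]]) (use all s in blast)
      qed
    qed
  qed
  also have "card ?T = p ^ card ?Q" using finP by (simp add: card_PiE)
  finally have "card (cocycles V E m (Alt p G) AA) * p ^ card E \<le> p ^ card ?Q * p ^ card E" by simp
  also have "\<dots> = p ^ (card V * (card V - 1))" unfolding cQ[symmetric] by (simp add: power_add)
  finally show ?thesis .
qed

end

section \<open>The inequality between edges and vertices\<close>

lemma (in group) card_eig_conj:
  assumes h: "h \<in> hom G G" "bij_betw h (carrier G) (carrier G)" and l: "\<And>x. x \<in> carrier G \<Longrightarrow> l x \<in> carrier G"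
    and kh: "\<And>x. x \<in> carrier G \<Longrightarrow> k (h x) = h (l x)"
  shows "card (eig G k) = card (eig G l)"
proof -
  have hc: "h x \<in> carrier G" if "x \<in> carrier G" for x using h(2) that bij_betwE by blast
  have hi: "h (inv x) = inv (h x)" if "x \<in> carrier G" for x
    using that h(1) group_hom.hom_inv[of G G h x] group_axioms by (auto simp: group_hom_def group_hom_axioms_def)
  have inj: "inj_on h (carrier G)" using h(2) by (simp add: bij_betw_def)
  have "h ` eig G l = eig G k"
  proof (intro equalityI subsetI)
    fix z assume "z \<in> h ` eig G l"
    then obtain x where "x \<in> carrier G" "l x = inv x" "z = h x" by (auto simp: eig_def)
    then show "z \<in> eig G k" using hc hi kh by (simp add: eig_def)
  next
    fix z assume z: "z \<in> eig G k"
    then obtain x where x: "x \<in> carrier G" "z = h x" using h(2) by (auto simp: eig_def bij_betw_def)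
    then have "h (l x) = h (inv x)" using z kh hi by (simp add: eig_def)
    then have "l x = inv x" using inj_onD[OF inj _ l[OF x(1)], of "inv x"] x by simp
    then show "z \<in> h ` eig G l" using x by (simp add: eig_def)
  qed
  moreover have "inj_on h (eig G l)" using inj by (rule inj_on_subset) (auto simp: eig_def)
  ultimately show ?thesis using card_image by metis
qed

text \<open>By \<open>alt_dihedral_zero\<close> a form negated by both maps is determined by its
  value at one pair of non-trivial eigenvectors.\<close>

lemma (in comm_group) card_alt_dihedral_le:
  assumes pp: "Factorial_Ring.prime p" and odd: "odd p" and b: "cact V E m (carrier G) b" and lin: "linear_act V G b"
    and ed: "{u, w} \<in> E" and uw: "u \<in> V" "w \<in> V" and cop: "coprime (m {u, w}) p"
    and exp: "\<And>x. x \<in> carrier G \<Longrightarrow> x [^] p = \<one>"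
    and cu: "card (eig G (b u)) = p" and cw: "card (eig G (b w)) = p" and ne: "b u \<noteq> b w"
  shows "card (eig (Alt p G) (alt_act V p G b u) \<inter> eig (Alt p G) (alt_act V p G b w)) \<le> p"
proof -
  have p: "p > 0" "p > 1" using pp prime_gt_0_nat prime_gt_1_nat by blast+
  interpret A: comm_group "Alt p G" by (rule Alt_comm_group[OF p(1)])
  have h: "b u \<in> hom G G" "b w \<in> hom G G" using lin uw by (auto simp: linear_act_def)
  have inv: "b u (b u z) = z" "b w (b w z) = z" for z using cact_invol[OF b] by auto
  have rel: "((b u \<circ> b w) ^^ m {u, w}) z = z" for z using cactD(5)[OF b ed] by simp
  note sub = eig_subgroup[OF h(1)] eig_subgroup[OF h(2)]
  have disj: "eig G (b u) \<inter> eig G (b w) = {\<one>}"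
  proof (rule ccontr)
    assume "eig G (b u) \<inter> eig G (b w) \<noteq> {\<one>}"
    then obtain c where c: "c \<in> eig G (b u)" "c \<in> eig G (b w)" "c \<noteq> \<one>"
      using subgroup.one_closed[OF sub(1)] subgroup.one_closed[OF sub(2)] by blast
    have "eig G (b u) = eig G (b w)"
      using prime_order_subgroup_subset[OF sub cu pp c] prime_order_subgroup_subset[OF sub(2,1) cw pp c(2,1,3)] by blast
    from equal_eig_imp_equal[OF h inv this rel exp cop] have "b u z = b w z" if "z \<in> carrier G" for z using that by blast
    then have "b u = b w" using permutes_not_in[OF cactD(3)[OF b]] by (metis ext)
    then show False using ne by simp
  qed
  have ex: "\<exists>c\<in>eig G (b v). c \<noteq> \<one>" if "card (eig G (b v)) = p" for v
  proof (rule ccontr)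
    assume "\<not> ?thesis"
    then have "eig G (b v) \<subseteq> {\<one>}" by blast
    then have "card (eig G (b v)) \<le> 1" using card_mono[of "{\<one>}"] by fastforce
    then show False using that p by simp
  qed
  obtain c where c: "c \<in> eig G (b u)" "c \<noteq> \<one>" using ex[OF cu] by blast
  obtain d where d: "d \<in> eig G (b w)" "d \<noteq> \<one>" using ex[OF cw] by blast
  let ?B = "alt_act V p G b"
  let ?M = "eig (Alt p G) (?B u) \<inter> eig (Alt p G) (?B w)"
  have hB: "?B v \<in> hom (Alt p G) (Alt p G)" if "v \<in> V" for v
  proof -
    have hv: "b v \<in> hom G G" using lin that by (simp add: linear_act_def)
    have "?B v y = pull G (b v) y" if "y \<in> alt_forms p G" for y using that \<open>v \<in> V\<close> by (simp add: alt_act_def mk_def)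
    moreover have "y \<otimes>\<^bsub>Alt p G\<^esub> z \<in> alt_forms p G" if "y \<in> alt_forms p G" "z \<in> alt_forms p G" for y z
      using A.m_closed[of y z] that by simp
    ultimately show ?thesis using pull_hom[OF group_axioms p(1) hv] by (simp add: hom_def Pi_iff)
  qed
  note subA = A.eig_subgroup[OF hB[OF uw(1)]] A.eig_subgroup[OF hB[OF uw(2)]]
  have "card ?M \<le> card {0..<int p}"
  proof (rule card_inj_on_le[where f = "\<lambda>y. y (c, d)"])
    show "(\<lambda>y. y (c, d)) ` ?M \<subseteq> {0..<int p}"
    proof
      fix a assume "a \<in> (\<lambda>y. y (c, d)) ` ?M"
      then obtain y where "y \<in> alt_forms p G" "a = y (c, d)" by (auto simp: eig_def)
      then show "a \<in> {0..<int p}" using alt_range[OF p(1)] by simp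
    qed
    show "inj_on (\<lambda>y. y (c, d)) ?M"
    proof (rule inj_onI)
      fix y y' assume y: "y \<in> ?M" "y' \<in> ?M" and eq: "y (c, d) = y' (c, d)"
      have yc: "y \<in> carrier (Alt p G)" "y' \<in> carrier (Alt p G)" using y by (auto simp: eig_def)
      let ?z = "y \<otimes>\<^bsub>Alt p G\<^esub> inv\<^bsub>Alt p G\<^esub> y'"
      have z: "?z \<in> eig (Alt p G) (?B u)" "?z \<in> eig (Alt p G) (?B w)"
        using subgroup.m_closed[OF subA(1) _ subgroup.m_inv_closed[OF subA(1)]]
          subgroup.m_closed[OF subA(2) _ subgroup.m_inv_closed[OF subA(2)]] y by blast+
      then have za: "?z \<in> alt_forms p G"
        and zu: "\<And>x x'. x \<in> carrier G \<Longrightarrow> x' \<in> carrier G \<Longrightarrow> ?z (b u x, b u x') = (- ?z (x, x')) mod int p"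
        and zw: "\<And>x x'. x \<in> carrier G \<Longrightarrow> x' \<in> carrier G \<Longrightarrow> ?z (b w x, b w x') = (- ?z (x, x')) mod int p"
        using eig_alt_iff[OF p(1) uw(1)] eig_alt_iff[OF p(1) uw(2)] by blast+
      have zcd: "?z (c, d) = 0" using eq yc(2) p(1) by (simp add: Alt_mult Alt_inv mod_simps)
      have "?z = (\<lambda>i. 0)" by (rule alt_dihedral_zero[OF pp odd za h inv rel cop cu cw disj zu zw c d zcd])
      then have "?z = \<one>\<^bsub>Alt p G\<^esub>" by (simp add: Alt_one)
      then show "y = y'" using yc by (metis A.inv_equality A.inv_inv A.inv_closed)
    qed
  qed simp
  then show ?thesis by simp
qed

lemma prod_if_power: "finite E \<Longrightarrow> (\<Prod>e\<in>E. if P e then (p::nat) else 1) = p ^ card {e \<in> E. P e}"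
  by (simp add: prod.inter_filter[symmetric])

text \<open>Write \<open>n\<close> for \<open>card V'\<close> and \<open>k\<close> for the number of
  collapsed edges. Lifts of the reflection representation give \<open>card V = n + k\<close>. For
  alternating forms the number of cocycles is at least \<open>p\<close> to the power
  \<open>(n - 1) * (n + k)\<close>, less \<open>n - 1\<close> for each collapsed edge and one for
  each other edge; counted on the primed side it is at most \<open>p\<close> to the power
  \<open>n * (n - 1) - card E'\<close>. The terms \<open>(n - 1) * k\<close> cancel and leave
  \<open>card E' \<le> card E - k\<close>.\<close>

lemma (in forest_pair) edge_count:
  assumes tits: "tits_rep V' E' m' p g" and cop: "\<And>e. e \<in> E \<Longrightarrow> coprime (m e) p"
    and pairs': "\<forall>e\<in>E'. \<exists>s t. e = {s, t}"
  shows "card E' + card V \<le> card E + card V'"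
proof -
  interpret R: tits_rep V' E' m' p g by fact
  let ?G = "R.G" and ?n = "card V'"
  have finV: "finite V" "finite E" using forest_finite[OF fo] by auto
  define b where "b = B.T R.rep"
  have b: "cact V E m (carrier ?G) b" unfolding b_def by (rule B.cact_T[OF R.cact_rep])
  have lin: "linear_act V ?G b" unfolding b_def by (rule B.linear_T[OF R.cact_rep R.linear_rep])
  have Tb: "F.T b = R.rep" unfolding b_def by (rule FB[OF R.cact_rep])
  have ne: "carrier ?G \<noteq> {}" by blast
  have exp: "x [^]\<^bsub>?G\<^esub> p = \<one>\<^bsub>?G\<^esub>" for x unfolding R.G_def using R.p2 by (intro zp_exponent)
  have bijev: "bij_betw (ev b w) (carrier ?G) (carrier ?G)" for w by (rule permutes_imp_bij[OF ev_permutes[OF b]])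
  \<comment> \<open>The action on the forest side is explicit only up to conjugacy, which suffices
    for the size of an eigenspace.\<close>
  have ce: "card (eig ?G (b v)) = p" if v: "v \<in> V" for v
  proof -
    obtain s w where sw: "s \<in> V'" "set w \<subseteq> V" "b v \<circ> ev b w = ev b w \<circ> R.rep s"
      using conj_exists[OF b ne v] Tb by metis
    have "card (eig ?G (b v)) = card (eig ?G (R.rep s))"
    proof (rule R.G.card_eig_conj[OF ev_hom[OF lin sw(2)] bijev])
      show "R.rep s x \<in> carrier ?G" if "x \<in> carrier ?G" for x by (rule cact_in[OF R.cact_rep that])
      show "b v (ev b w x) = ev b w (R.rep s x)" for x using sw(3) by (metis comp_apply)
    qed
    then show ?thesis using R.card_eig_rep[OF sw(1)] by simp
  qed
  let ?A = "Alt p ?G" and ?a = "alt_act V p ?G b"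
  interpret A: comm_group ?A by (rule Alt_comm_group[OF R.p2(3)])
  note a = cact_alt_act[OF R.group_G R.p2(3) b lin F.edges]
  have Ta: "F.T ?a = R.AA" using F.T_alt_act[OF R.group_G R.p2(3) b lin] Tb by simp
  have neA: "carrier ?A \<noteq> {}" using A.one_closed by blast
  have bijev2: "bij_betw (ev ?a w) (carrier ?A) (carrier ?A)" for w by (rule permutes_imp_bij[OF ev_permutes[OF a(1)]])
  have ca: "card (eig ?A (?a v)) = p ^ (?n - 1)" if v: "v \<in> V" for v
  proof -
    obtain s w where sw: "s \<in> V'" "set w \<subseteq> V" "?a v \<circ> ev ?a w = ev ?a w \<circ> R.AA s"
      using conj_exists[OF a(1) neA v] Ta by metis
    have "card (eig ?A (?a v)) = card (eig ?A (R.AA s))"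
    proof (rule A.card_eig_conj[OF ev_hom[OF a(2) sw(2)] bijev2])
      show "R.AA s x \<in> carrier ?A" if "x \<in> carrier ?A" for x by (rule cact_in[OF R.cact_AA that])
      show "?a v (ev ?a w x) = ev ?a w (R.AA s x)" for x using sw(3) by (metis comp_apply)
    qed
    then show ?thesis using R.card_eig_alt[OF sw(1)] by simp
  qed
  \<comment> \<open>The collapsed edges, described without ordering their ends.\<close>
  let ?P = "\<lambda>e. \<exists>d. b ` e = {d}"
  let ?col = "card {e \<in> E. ?P e}"
  have Pe: "?P {u, w} \<longleftrightarrow> b u = b w" for u w by auto
  have "card (cocycles V E m ?G b) * (\<Prod>e\<in>E. if ?P e then p else 1) = (\<Prod>v\<in>V. card (eig ?G (b v)))"
  proof -
    have "cocycles V E m ?G b = {y \<in> \<Pi>\<^sub>E v\<in>V. eig ?G (b v). \<forall>u w. ({u, w} \<in> E) \<longrightarrow> (b u = b w \<longrightarrow> y u = y w)}"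
      by (rule R.G.cocycles_collapse[OF b lin F.edges exp R.prime cop]) (use ce F.edges in blast)+
    moreover have "finite (eig ?G (b v))" for v using cactD(1)[OF b] by (simp add: eig_def)
    ultimately show ?thesis
      using card_forest_collapse[OF fo, of "\<lambda>v. eig ?G (b v)" b "\<lambda>e. if ?P e then p else 1"] ce F.edges Pe by simp
  qed
  moreover have "card (cocycles V E m ?G b) = p ^ ?n"
  proof -
    have "card (cocycles V E m ?G b) = card (lifts V E m ?G b)"
      by (rule bij_betw_same_card[symmetric, OF R.G.bij_lifts_cocycles[OF b lin F.edges]])
    also have "\<dots> = card (lifts V' E' m' ?G R.rep)" using card_lifts[OF R.group_G b lin] Tb by simp
    finally show ?thesis using R.card_lifts_rep by simp
  qed
  ultimately have "p ^ ?n * p ^ ?col = p ^ card V" using prod_if_power[OF finV(2), of ?P p] ce by simp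
  then have "p ^ (?n + ?col) = p ^ card V" by (simp only: power_add)
  then have V: "card V = ?n + ?col" using power_inject_exp[OF R.p2(2), of "?n + ?col" "card V"] by simp
  have cA: "card (cocycles V E m ?A ?a) = card (cocycles V' E' m' ?A R.AA)"
  proof -
    have "card (cocycles V E m ?A ?a) = card (lifts V E m ?A ?a)"
      by (rule bij_betw_same_card[symmetric, OF A.bij_lifts_cocycles[OF a F.edges]])
    also have "\<dots> = card (lifts V' E' m' ?A R.AA)" using card_lifts[OF A.group_axioms a] Ta by simp
    also have "\<dots> = card (cocycles V' E' m' ?A R.AA)"
      by (rule bij_betw_same_card[OF A.bij_lifts_cocycles[OF R.cact_AA R.linear_AA F.edges']])
    finally show ?thesis .
  qed
  let ?M = "\<lambda>e. {x \<in> carrier ?A. \<forall>v\<in>e. ?a v x = inv\<^bsub>?A\<^esub> x}"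
  have M: "card (?M e) \<le> (if ?P e then p ^ (?n - 1) else 1) * (if \<not> ?P e then p else 1)" if e: "e \<in> E" for e
  proof -
    obtain u w where uw: "e = {u, w}" "u \<in> V" "w \<in> V" using forest_edge[OF fo e] by blast
    have Me: "?M e = eig ?A (?a u) \<inter> eig ?A (?a w)" using uw by (auto simp: eig_def)
    have finM: "finite (eig ?A (?a u))" using cactD(1)[OF a(1)] by (simp add: eig_def)
    show ?thesis
    proof (cases "?P e")
      case True
      have "card (?M e) \<le> card (eig ?A (?a u))" unfolding Me by (rule card_mono[OF finM]) blast
      then show ?thesis using True ca[OF uw(2)] by simp
    next
      case False
      then have "b u \<noteq> b w" using uw by auto
      moreover have "{u, w} \<in> E" "coprime (m {u, w}) p" using e uw cop[OF e] by auto
      ultimately have "card (?M e) \<le> p"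
        unfolding Me using R.G.card_alt_dihedral_le[OF R.prime R.odd b lin _ uw(2,3) _ exp ce[OF uw(2)] ce[OF uw(3)]] by blast
      then show ?thesis using False by simp
    qed
  qed
  have split: "card {e \<in> E. \<not> ?P e} + ?col = card E"
  proof -
    have "{e \<in> E. \<not> ?P e} \<union> {e \<in> E. ?P e} = E" by blast
    moreover have "card ({e \<in> E. \<not> ?P e} \<union> {e \<in> E. ?P e}) = card {e \<in> E. \<not> ?P e} + ?col"
      by (rule card_Un_disjoint) (use finV(2) in auto)
    ultimately show ?thesis by simp
  qed
  let ?C = "card (cocycles V E m ?A ?a)" and ?D = "(p ^ (?n - 1)) ^ ?col * p ^ card {e \<in> E. \<not> ?P e}"
  have "(\<Prod>e\<in>E. card (?M e)) \<le> (\<Prod>e\<in>E. (if ?P e then p ^ (?n - 1) else 1) * (if \<not> ?P e then p else 1))"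
    by (rule prod_mono) (use M in auto)
  also have "\<dots> = ?D" by (simp only: prod.distrib prod_if_power[OF finV(2)])
  finally have MD: "(\<Prod>e\<in>E. card (?M e)) \<le> ?D" .
  have pr: "\<forall>e\<in>E. \<exists>u w. e = {u, w}"
  proof
    fix e assume "e \<in> E"
    then show "\<exists>u w. e = {u, w}" using forest_edge[OF fo, of e] by blast
  qed
  have "p ^ ((?n - 1) * card V) = (\<Prod>v\<in>V. card (eig ?A (?a v)))" using ca by (simp add: power_mult)
  also have "\<dots> \<le> ?C * (\<Prod>e\<in>E. card (?M e))"
    by (rule A.card_cocycles_ge[OF a F.edges finV pr])
  also have "\<dots> \<le> ?C * ?D" by (rule mult_le_mono2[OF MD])
  finally have "p ^ ((?n - 1) * card V) * p ^ card E' \<le> ?C * ?D * p ^ card E'" by (rule mult_le_mono1)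
  also have "?C * ?D * p ^ card E' = ?C * p ^ card E' * ?D" by (simp only: ac_simps)
  also have "\<dots> \<le> p ^ (?n * (?n - 1)) * ?D"
    unfolding cA by (rule mult_le_mono1[OF R.card_cocycles_alt_le[OF pairs']])
  finally have "p ^ ((?n - 1) * card V) * p ^ card E' \<le> p ^ (?n * (?n - 1)) * ?D" .
  then have "p ^ ((?n - 1) * card V + card E') \<le> p ^ (?n * (?n - 1) + ((?n - 1) * ?col + card {e \<in> E. \<not> ?P e}))"
    by (simp only: power_add power_mult)
  then have "(?n - 1) * card V + card E' \<le> ?n * (?n - 1) + ((?n - 1) * ?col + card {e \<in> E. \<not> ?P e})"
    using R.p2(2) by simp
  then have "card E' \<le> card {e \<in> E. \<not> ?P e}" unfolding V by (simp add: algebra_simps)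
  then show ?thesis using V split by simp
qed

section \<open>Primes with primitive roots of unity\<close>

lemma map_poly_of_int_mult: "map_poly (of_int :: int \<Rightarrow> complex) (A * C) = map_poly of_int A * map_poly of_int C"
  by (intro poly_eqI) (simp add: coeff_map_poly coeff_mult)

text \<open>The polynomial \<open>F\<close> plays the part of a minimal polynomial of
  \<open>w\<close>. A non-zero member \<open>D\<close> of least degree in the ideal of
  \<open>F\<close> and \<open>H\<close> divides both up to constants. It does not vanish at
  \<open>w\<close>, because \<open>H\<close> does not; so the cofactor of \<open>D\<close> in
  \<open>F\<close> does, and minimality of \<open>F\<close> leaves degree zero for
  \<open>D\<close>.\<close>

lemma poly_ideal_constant:
  fixes F H :: "int poly" and w :: complex
  assumes F: "poly (map_poly of_int F) w = 0" "F \<noteq> 0"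
    and min: "\<And>Q. Q \<noteq> 0 \<Longrightarrow> poly (map_poly of_int Q) w = 0 \<Longrightarrow> Polynomial.degree F \<le> Polynomial.degree Q"
    and H: "poly (map_poly of_int H) w \<noteq> 0"
  shows "\<exists>u v c. c \<noteq> 0 \<and> u * F + v * H = [:c:]"
proof -
  let ?I = "{u * F + v * H | u v. True}"
  have FI: "F \<in> ?I" by (rule CollectI, rule exI[of _ 1], rule exI[of _ 0]) simp
  have HI: "H \<in> ?I" by (rule CollectI, rule exI[of _ 0], rule exI[of _ 1]) simp
  have lin: "A * Q - C * D \<in> ?I" if Q: "Q \<in> ?I" and D: "D \<in> ?I" for A C Q D
  proof -
    obtain u v where 1: "Q = u * F + v * H" using Q by blast
    obtain u' v' where 2: "D = u' * F + v' * H" using D by blast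
    have "A * Q - C * D = (A * u - C * u') * F + (A * v - C * v') * H" unfolding 1 2 by (simp add: algebra_simps)
    then show ?thesis by blast
  qed
  have "\<exists>D. D \<in> ?I \<and> D \<noteq> 0" using FI F(2) by blast
  then obtain D where D: "D \<in> ?I" "D \<noteq> 0" and Dmin: "\<And>Q. Q \<in> ?I \<Longrightarrow> Q \<noteq> 0 \<Longrightarrow> Polynomial.degree D \<le> Polynomial.degree Q"
    using ex_has_least_nat[of "\<lambda>D. D \<in> ?I \<and> D \<noteq> 0" _ Polynomial.degree] by blast
  \<comment> \<open>Coefficients are integers, so division is possible only after multiplying by a
    power of the leading coefficient; the remainder lies in the ideal and is zero by minimality of
    \<open>D\<close>.\<close>
  have dvd: "\<exists>c q. c \<noteq> 0 \<and> smult c Q = D * q" if Q: "Q \<in> ?I" for Q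
  proof -
    obtain q r where qr: "pseudo_divmod Q D = (q, r)" by (metis surj_pair)
    let ?c = "Polynomial.coeff D (Polynomial.degree D) ^ (Suc (Polynomial.degree Q) - Polynomial.degree D)"
    note pd = pseudo_divmod[OF D(2) qr]
    have "[:?c:] * Q - q * D \<in> ?I" by (rule lin[OF Q D(1)])
    moreover have "[:?c:] * Q - q * D = r" using pd(1) by (simp add: algebra_simps)
    ultimately have "r = 0" using pd(2) Dmin[of r] by fastforce
    then have "smult ?c Q = D * q" using pd(1) by simp
    moreover have "?c \<noteq> 0" using D(2) by simp
    ultimately show ?thesis by blast
  qed
  have ev: "poly (map_poly of_int (A * C)) w = poly (map_poly of_int A) w * poly (map_poly of_int C) w" for A C :: "int poly"
    by (simp add: map_poly_of_int_mult)
  have "Polynomial.degree D = 0"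
  proof (rule ccontr)
    assume d: "Polynomial.degree D \<noteq> 0"
    obtain c q where cq: "c \<noteq> 0" "smult c F = D * q" using dvd[OF FI] by blast
    obtain c' q' where cq': "c' \<noteq> 0" "smult c' H = D * q'" using dvd[OF HI] by blast
    have "poly (map_poly of_int D) w \<noteq> 0"
    proof
      assume "poly (map_poly of_int D) w = 0"
      then have "poly (map_poly of_int ([:c':] * H)) w = 0" using cq' ev[of D q'] by simp
      then show False using ev[of "[:c':]" H] H cq'(1) by (simp add: map_poly_pCons)
    qed
    moreover have "poly (map_poly of_int (D * q)) w = 0" using ev[of "[:c:]" F] F(1) cq(2) by simp
    ultimately have "poly (map_poly of_int q) w = 0" using ev by simp
    moreover have "q \<noteq> 0" using cq F(2) by auto
    ultimately have "Polynomial.degree F \<le> Polynomial.degree q" by (rule min[rotated])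
    moreover have "Polynomial.degree F = Polynomial.degree D + Polynomial.degree q"
      using cq D(2) \<open>q \<noteq> 0\<close> degree_smult_eq[of c F] degree_mult_eq[of D q] by simp
    ultimately show False using d by simp
  qed
  then obtain c where "D = [:c:]" by (metis degree_eq_zeroE)
  moreover obtain u v where "D = u * F + v * H" using D(1) by blast
  ultimately have "c \<noteq> 0 \<and> u * F + v * H = [:c:]" using D(2) by auto
  then show ?thesis by blast
qed

text \<open>Euclid's argument with \<open>F\<close>, an integer multiple of the cyclotomic
  polynomial. A prime dividing \<open>F\<close> at \<open>a\<close> makes \<open>a\<close> an
  \<open>N\<close>-th root of unity unless it divides \<open>c0\<close>, and allows a smaller
  exponent \<open>d\<close> only if it divides the constant \<open>c d\<close>. The point
  \<open>a\<close> is chosen so that some prime factor of the value avoids these finitely many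
  constants.\<close>

lemma exists_prime_root_of_unity:
  assumes N: "N \<ge> 3"
  shows "\<exists>p (a::int). Factorial_Ring.prime (p::nat) \<and> [a ^ N = 1] (mod int p) \<and> (\<forall>d. 0 < d \<and> d < N \<longrightarrow> \<not> [a ^ d = 1] (mod int p))"
proof -
  define w where "w = cis (2 * pi / real N)"
  have wd: "w ^ d = cis (2 * pi * real d / real N)" for d by (simp add: w_def DeMoivre mult.commute)
  have wN: "w ^ N = 1" using N by (simp add: wd)
  have wne: "w ^ d \<noteq> 1" if "0 < d" "d < N" for d
  proof
    assume "w ^ d = 1"
    then have "cis (2 * pi * real d / real N) = cis (2 * pi * real 0 / real N)" by (simp add: wd)
    moreover have inj: "inj_on (\<lambda>k. cis (2 * pi * real k / real N)) {..<N}"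
      using bij_betw_roots_unity[of N] N by (simp add: bij_betw_def)
    ultimately have "d = 0" using that by (intro inj_onD[OF inj, of d 0]) simp_all
    then show False using that by simp
  qed
  let ?ev = "\<lambda>Q. poly (map_poly of_int Q) w"
  have evX: "?ev (Polynomial.monom 1 d - 1) = w ^ d - 1" for d
  proof -
    have "map_poly (of_int :: int \<Rightarrow> complex) (Polynomial.monom 1 d - 1) = Polynomial.monom 1 d - 1"
      by (intro poly_eqI) (simp add: coeff_map_poly)
    then show ?thesis by (simp add: poly_monom)
  qed
  have "Polynomial.coeff (Polynomial.monom (1::int) N - 1) N = 1" using N by simp
  then have nz: "Polynomial.monom (1::int) N - 1 \<noteq> 0" by force
  have "\<exists>Q. Q \<noteq> 0 \<and> ?ev Q = 0" using nz evX[of N] wN by (intro exI[of _ "Polynomial.monom 1 N - 1"]) simp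
  then obtain F where F: "F \<noteq> 0" "?ev F = 0" and Fmin: "\<And>Q. Q \<noteq> 0 \<Longrightarrow> ?ev Q = 0 \<Longrightarrow> Polynomial.degree F \<le> Polynomial.degree Q"
    using ex_has_least_nat[of "\<lambda>Q. Q \<noteq> 0 \<and> ?ev Q = 0" _ Polynomial.degree] by blast
  have dF: "Polynomial.degree F \<noteq> 0"
  proof
    assume "Polynomial.degree F = 0"
    then obtain c where c: "F = [:c:]" by (metis degree_eq_zeroE)
    then show False using F by (simp add: map_poly_pCons)
  qed
  obtain q r where qr: "pseudo_divmod (Polynomial.monom 1 N - 1) F = (q, r)" by (metis surj_pair)
  define c0 where "c0 = Polynomial.coeff F (Polynomial.degree F) ^ (Suc (Polynomial.degree (Polynomial.monom (1::int) N - 1)) - Polynomial.degree F)"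
  have pd: "smult c0 (Polynomial.monom 1 N - 1) = F * q + r" "r = 0 \<or> Polynomial.degree r < Polynomial.degree F"
    using pseudo_divmod[OF F(1) qr] by (simp_all add: c0_def)
  have c0: "c0 \<noteq> 0" using F by (simp add: c0_def)
  have evadd: "?ev (A + C) = ?ev A + ?ev C" for A C :: "int poly"
  proof -
    have "map_poly (of_int :: int \<Rightarrow> complex) (A + C) = map_poly of_int A + map_poly of_int C"
      by (intro poly_eqI) (simp add: coeff_map_poly)
    then show ?thesis by simp
  qed
  have evm: "?ev (A * C) = ?ev A * ?ev C" for A C :: "int poly" by (simp add: map_poly_of_int_mult)
  have "?ev (Polynomial.smult c0 (Polynomial.monom 1 N - 1)) = ?ev [:c0:] * ?ev (Polynomial.monom 1 N - 1)"
    using evm[of "[:c0:]" "Polynomial.monom 1 N - 1"] by simp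
  moreover have "?ev (Polynomial.smult c0 (Polynomial.monom 1 N - 1)) = ?ev (F * q) + ?ev r" using pd(1) evadd[of "F * q" r] by simp
  ultimately have "?ev r = 0" using evm[of F q] F(2) evX[of N] wN by simp
  then have "r = 0" using pd(2) Fmin[of r] by fastforce
  then have F_dvd: "smult c0 (Polynomial.monom 1 N - 1) = F * q" using pd(1) by simp
  have "\<exists>u v c. c \<noteq> 0 \<and> u * F + v * (Polynomial.monom 1 d - 1) = [:c:]" if "0 < d" "d < N" for d
    by (rule poly_ideal_constant[OF F(2,1) Fmin]) (use evX[of d] wne[OF that] in auto)
  then obtain u v c where uvc: "\<And>d. 0 < d \<Longrightarrow> d < N \<Longrightarrow> c d \<noteq> 0 \<and> u d * F + v d * (Polynomial.monom 1 d - 1) = [:c d:]"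
    by metis
  \<comment> \<open>Collects all constants whose prime divisors have to be avoided.\<close>
  define C where "C = c0 * (\<Prod>d\<in>{0<..<N}. c d)"
  have C0: "C \<noteq> 0" using c0 uvc by (auto simp: C_def)
  have C_c0: "c0 dvd C" by (simp add: C_def)
  have C_c: "c d dvd C" if "0 < d" "d < N" for d
    unfolding C_def using that by (intro dvd_mult dvd_prodI) auto
  obtain f0 R where FR: "F = pCons f0 R" by (metis pCons_cases)
  have f0: "f0 \<noteq> 0"
  proof
    assume "f0 = 0"
    then have FX: "F = [:0, 1:] * R" using FR by simp
    have "R \<noteq> 0" using F FX by auto
    moreover have "w \<noteq> 0" by (simp add: w_def)
    then have "?ev R = 0" using F(2) evm[of "[:0, 1:]" R] FX by (simp add: map_poly_pCons)
    moreover have "Polynomial.degree F = Suc (Polynomial.degree R)" using FR \<open>R \<noteq> 0\<close> by simp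
    ultimately show False using Fmin[of R] by simp
  qed
  have fin: "finite {x. poly F x = k}" for k
  proof -
    have "F - [:k:] \<noteq> 0" using dF by auto
    then have "finite {x. poly (F - [:k:]) x = 0}" by (rule poly_roots_finite)
    then show ?thesis by simp
  qed
  have "inj (\<lambda>y::int. C * f0 * y)" using C0 f0 by (auto simp: inj_def)
  then have "infinite (range (\<lambda>y::int. C * f0 * y))" by (simp add: finite_image_iff)
  moreover have "finite ({x. poly F x = f0} \<union> {x. poly F x = - f0} \<union> {x. poly F x = 0})" using fin by simp
  ultimately have "\<not> range (\<lambda>y::int. C * f0 * y) \<subseteq> {x. poly F x = f0} \<union> {x. poly F x = - f0} \<union> {x. poly F x = 0}"
    using finite_subset by blast
  \<comment> \<open>Since \<open>F\<close> is not constant, each excluded value is taken finitely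
    often. Excluding them keeps the factor \<open>t\<close> below away from 1, -1 and 0.\<close>
  then obtain y where y: "poly F (C * f0 * y) \<noteq> f0" "poly F (C * f0 * y) \<noteq> - f0" "poly F (C * f0 * y) \<noteq> 0" by blast
  define a where "a = C * f0 * y"
  \<comment> \<open>Taking \<open>a\<close> divisible by \<open>C * f0\<close> lets the constant
    term \<open>f0\<close> be factored out of the value; the remaining factor \<open>t\<close> is 1
    modulo \<open>C\<close>.\<close>
  define t where "t = 1 + C * y * poly R a"
  have Fa: "poly F a = f0 * t" unfolding FR t_def by (simp add: a_def algebra_simps)
  then have "t \<noteq> 1" "t \<noteq> - 1" "t \<noteq> 0" using y unfolding a_def[symmetric] by auto
  then have "\<bar>t\<bar> \<noteq> 1" by auto
  then have "nat \<bar>t\<bar> \<noteq> 1" by simp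
  then obtain p where p: "Factorial_Ring.prime p" "p dvd nat \<bar>t\<bar>" using prime_factor_nat by blast
  then have pt: "int p dvd t" by (simp add: int_dvd_int_iff[symmetric])
  have pC: "\<not> int p dvd C"
  proof
    assume "int p dvd C"
    then have "int p dvd C * y * poly R a" by (simp add: dvd_mult2)
    then have "int p dvd t - C * y * poly R a" using pt by (rule dvd_diff[rotated])
    then have "int p dvd 1" by (simp add: t_def)
    then show False using p(1) by simp
  qed
  have pF: "int p dvd poly F a" using pt Fa by simp
  have pp: "Factorial_Ring.prime (int p)" using p(1) by simp
  have "[a ^ N = 1] (mod int p)"
  proof -
    have "poly (smult c0 (Polynomial.monom 1 N - 1)) a = poly (F * q) a" using F_dvd by simp
    then have "c0 * (a ^ N - 1) = poly F a * poly q a" by (simp add: poly_monom)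
    then have "int p dvd c0 * (a ^ N - 1)" using pF by (metis dvd_mult2)
    moreover have "\<not> int p dvd c0" using pC C_c0 dvd_trans by blast
    ultimately have "int p dvd a ^ N - 1" using prime_dvd_multD[OF pp] by blast
    then show ?thesis by (simp add: cong_iff_dvd_diff)
  qed
  moreover have "\<not> [a ^ d = 1] (mod int p)" if d: "0 < d" "d < N" for d
  proof
    assume "[a ^ d = 1] (mod int p)"
    then have pd: "int p dvd a ^ d - 1" by (simp add: cong_iff_dvd_diff)
    have "poly (u d * F + v d * (Polynomial.monom 1 d - 1)) a = c d" using uvc[OF d] by simp
    then have "poly (u d) a * poly F a + poly (v d) a * (a ^ d - 1) = c d" by (simp add: poly_monom)
    moreover have "int p dvd poly (u d) a * poly F a + poly (v d) a * (a ^ d - 1)" using pF pd by simp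
    ultimately have "int p dvd c d" by simp
    then show False using pC C_c[OF d] dvd_trans by blast
  qed
  ultimately show ?thesis using p(1) by blast
qed

text \<open>The exact order \<open>N\<close> of \<open>a\<close> divides \<open>p - 1\<close>. As
  \<open>N \<ge> 3\<close>, this makes \<open>p\<close> odd, and it makes every divisor of
  \<open>N\<close> prime to \<open>p\<close>. Powers of \<open>a\<close> provide the roots for all
  divisors.\<close>

lemma exists_primitive_roots:
  assumes N: "N \<ge> 3"
  obtains p \<zeta> where "Factorial_Ring.prime p" "odd p" "\<And>n. n dvd N \<Longrightarrow> coprime n p"
    "\<And>n. n dvd N \<Longrightarrow> [\<zeta> n ^ n = (1::int)] (mod int p)"
    "\<And>n d. n dvd N \<Longrightarrow> 0 < d \<Longrightarrow> d < n \<Longrightarrow> \<not> [\<zeta> n ^ d = 1] (mod int p)"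
proof -
  obtain p :: nat and a :: int where p: "Factorial_Ring.prime p" and a: "[a ^ N = 1] (mod int p)"
    and prim: "\<And>d. 0 < d \<Longrightarrow> d < N \<Longrightarrow> \<not> [a ^ d = 1] (mod int p)"
    using exists_prime_root_of_unity[OF N] by blast
  have "\<not> int p dvd a"
  proof
    assume "int p dvd a"
    then have "int p dvd a ^ N" using N by (simp add: dvd_power_le[of _ a 1 N, simplified])
    then have "int p dvd 1" using a by (metis cong_dvd_iff)
    then show False using p by simp
  qed
  then have "\<not> int p dvd a mod int p" by (simp add: dvd_mod_iff)
  moreover have a0: "0 \<le> a mod int p" using prime_gt_0_nat[OF p] by simp
  ultimately have "\<not> p dvd nat (a mod int p)" by (metis int_dvd_int_iff int_nat_eq)
  then have "[nat (a mod int p) ^ (p - 1) = 1] (mod p)" by (rule fermat_theorem[OF p])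
  then have "[int (nat (a mod int p) ^ (p - 1)) = int 1] (mod int p)" by (simp only: cong_int_iff)
  then have "[(a mod int p) ^ (p - 1) = 1] (mod int p)" using a0 by simp
  then have f: "[a ^ (p - 1) = 1] (mod int p)" by (simp add: cong_def mod_simps)
  have N_dvd: "N dvd p - 1"
  proof (rule ccontr)
    assume "\<not> N dvd p - 1"
    then have d: "0 < (p - 1) mod N" "(p - 1) mod N < N" using N by (auto simp: dvd_eq_mod_eq_0)
    have "a ^ (p - 1) = (a ^ N) ^ ((p - 1) div N) * a ^ ((p - 1) mod N)"
      by (simp add: power_add[symmetric] power_mult[symmetric])
    moreover have "[(a ^ N) ^ ((p - 1) div N) * a ^ ((p - 1) mod N) = 1 ^ ((p - 1) div N) * a ^ ((p - 1) mod N)] (mod int p)"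
      using a by (intro cong_mult cong_pow) auto
    ultimately have "[a ^ (p - 1) = a ^ ((p - 1) mod N)] (mod int p)" by simp
    then have "[a ^ ((p - 1) mod N) = 1] (mod int p)" using f cong_sym cong_trans by blast
    then show False using prim[OF d] by simp
  qed
  have p1: "p \<ge> 2" using p by (rule prime_ge_2_nat)
  have "N \<le> p - 1" using N_dvd p1 by (intro dvd_imp_le) auto
  then have "odd p" using p N by (intro prime_odd_nat) auto
  moreover have "coprime n p" if "n dvd N" for n
  proof -
    have "n dvd p - 1" using that N_dvd dvd_trans by blast
    moreover have "coprime (p - 1) p" using p1 by (intro coprime_diff_one_left_nat) simp
    ultimately show ?thesis using coprime_divisors[of n "p - 1" p p] by simp
  qed
  moreover have "[(a ^ (N div n)) ^ n = 1] (mod int p)" if "n dvd N" for n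
    using that a by (simp add: power_mult[symmetric])
  moreover have "\<not> [(a ^ (N div n)) ^ d = 1] (mod int p)" if n: "n dvd N" and d: "0 < d" "d < n" for n d
  proof -
    have "N = N div n * n" using n by simp
    moreover have "N div n > 0" using calculation N by (metis mult_0 not_gr0 not_numeral_le_zero)
    ultimately have "0 < N div n * d" "N div n * d < N" using d by (simp, metis mult_less_cancel1)
    then show ?thesis using prim[of "N div n * d"] by (simp add: power_mult)
  qed
  ultimately show ?thesis using p that[of p "\<lambda>n. a ^ (N div n)"] by blast
qed

text \<open>The recurrence has the characteristic roots \<open>- \<zeta>\<close> and
  \<open>- \<xi>\<close>. Eliminating either one leaves a geometric sequence, whose terms of even
  index have as ratio the square of the other root; \<open>n\<close> of them sum to zero because
  that square is not 1. The difference of the two results is the wanted sum times the invertible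
  factor \<open>\<zeta> - \<xi>\<close>.\<close>

lemma good_weight_root:
  assumes p: "Factorial_Ring.prime p" and z: "[\<zeta> * \<xi> = 1] (mod int p)" and zn: "[\<zeta> ^ n = 1] (mod int p)"
    and z2: "\<not> [\<zeta> ^ 2 = 1] (mod int p)"
  shows "good_weight p n (\<zeta> + \<xi>)"
  unfolding good_weight_def
proof (intro allI impI)
  fix q :: "nat \<Rightarrow> int"
  assume q: "\<forall>k. [q (Suc (Suc k)) = - q k - (\<zeta> + \<xi>) * q (Suc k)] (mod int p)"
  have pp: "Factorial_Ring.prime (int p)" using p by simp
  have geo: "int p dvd (\<Sum>j<n. q (Suc (2 * j)) + x * q (2 * j))"
    if xy: "[x * y = 1] (mod int p)" and c: "\<zeta> + \<xi> = x + y" and y2: "\<not> [y ^ 2 = 1] (mod int p)" and yn: "[y ^ n = 1] (mod int p)" for x y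
  proof -
    define e where "e k = q (Suc k) + x * q k" for k
    have step: "[e (Suc k) = - y * e k] (mod int p)" for k
    proof -
      have "[e (Suc k) = - q k - (x + y) * q (Suc k) + x * q (Suc k)] (mod int p)"
        unfolding e_def using q[rule_format, of k] c by (intro cong_add) auto
      also have "- q k - (x + y) * q (Suc k) + x * q (Suc k) = - y * e k + (x * y - 1) * q k" by (simp add: e_def algebra_simps)
      also have "[\<dots> = - y * e k + (1 - 1) * q k] (mod int p)" using xy by (intro cong_add cong_mult cong_diff) auto
      finally show ?thesis by simp
    qed
    have e: "[e (2 * j) = (y ^ 2) ^ j * e 0] (mod int p)" for j
    proof (induction j)
      case (Suc j)
      have "[e (2 * Suc j) = - y * e (Suc (2 * j))] (mod int p)" using step[of "Suc (2 * j)"] by simp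
      also have "[- y * e (Suc (2 * j)) = - y * (- y * e (2 * j))] (mod int p)" using step by (intro cong_mult) auto
      also have "- y * (- y * e (2 * j)) = y ^ 2 * e (2 * j)" by (simp add: power2_eq_square)
      also have "[y ^ 2 * e (2 * j) = y ^ 2 * ((y ^ 2) ^ j * e 0)] (mod int p)" using Suc by (intro cong_mult) auto
      finally show ?case by (simp add: mult.assoc)
    qed simp
    have "[(\<Sum>j<n. e (2 * j)) = (\<Sum>j<n. (y ^ 2) ^ j * e 0)] (mod int p)" by (rule cong_sum) (rule e)
    then have s: "[(\<Sum>j<n. e (2 * j)) = (\<Sum>j<n. (y ^ 2) ^ j) * e 0] (mod int p)" by (simp add: sum_distrib_right)
    have "(y ^ 2 - 1) * (\<Sum>j<n. (y ^ 2) ^ j) = (y ^ 2) ^ n - 1" by (simp add: power_diff_1_eq)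
    also have "\<dots> = y ^ n * y ^ n - 1" by (simp add: power_mult[symmetric] power_add[symmetric] mult_2)
    finally have g: "(y ^ 2 - 1) * (\<Sum>j<n. (y ^ 2) ^ j) = y ^ n * y ^ n - 1" .
    have "[y ^ n * y ^ n - 1 = 1 * 1 - 1] (mod int p)" by (intro cong_mult cong_diff yn cong_refl)
    then have "[(y ^ 2 - 1) * (\<Sum>j<n. (y ^ 2) ^ j) = 1 * 1 - 1] (mod int p)" unfolding g .
    then have "int p dvd (y ^ 2 - 1) * (\<Sum>j<n. (y ^ 2) ^ j)" by (simp add: cong_0_iff)
    moreover have "\<not> int p dvd y ^ 2 - 1" using y2 by (simp add: cong_iff_dvd_diff)
    ultimately have "int p dvd (\<Sum>j<n. (y ^ 2) ^ j)" using prime_dvd_multD[OF pp] by blast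
    then have "int p dvd (\<Sum>j<n. (y ^ 2) ^ j) * e 0" by (rule dvd_mult2)
    then show ?thesis using cong_dvd_iff[OF s] unfolding e_def by blast
  qed
  have zx2: "[\<zeta> ^ k * \<xi> ^ k = 1] (mod int p)" for k
    using cong_pow[OF z, of k] by (simp add: power_mult_distrib)
  have 1: "\<not> [\<xi> ^ 2 = 1] (mod int p)"
  proof
    assume "[\<xi> ^ 2 = 1] (mod int p)"
    then have "[\<zeta> ^ 2 * \<xi> ^ 2 = \<zeta> ^ 2 * 1] (mod int p)" by (intro cong_mult) auto
    then have "[\<zeta> ^ 2 * \<xi> ^ 2 = \<zeta> ^ 2] (mod int p)" by simp
    then show False using z2 zx2[of 2] cong_sym cong_trans by blast
  qed
  have "[\<zeta> ^ n * \<xi> ^ n = 1 * \<xi> ^ n] (mod int p)" using zn by (intro cong_mult) auto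
  then have "[\<zeta> ^ n * \<xi> ^ n = \<xi> ^ n] (mod int p)" by simp
  then have 2: "[\<xi> ^ n = 1] (mod int p)" using zx2[of n] cong_sym cong_trans by blast
  have A: "int p dvd (\<Sum>j<n. q (Suc (2 * j)) + \<zeta> * q (2 * j))" by (rule geo[OF z _ 1 2]) simp
  have B: "int p dvd (\<Sum>j<n. q (Suc (2 * j)) + \<xi> * q (2 * j))"
    by (rule geo[OF _ _ z2 zn]) (use z in \<open>simp_all add: mult.commute\<close>)
  have "(\<Sum>j<n. q (Suc (2 * j)) + \<zeta> * q (2 * j)) - (\<Sum>j<n. q (Suc (2 * j)) + \<xi> * q (2 * j)) = (\<zeta> - \<xi>) * (\<Sum>j<n. q (2 * j))"
    by (simp add: sum_subtractf[symmetric] sum_distrib_left algebra_simps)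
  then have "int p dvd (\<zeta> - \<xi>) * (\<Sum>j<n. q (2 * j))" using dvd_diff[OF A B] by simp
  moreover have "\<not> int p dvd \<zeta> - \<xi>"
  proof
    assume "int p dvd \<zeta> - \<xi>"
    then have "[\<zeta> * \<zeta> = \<zeta> * \<xi>] (mod int p)" by (intro cong_mult) (simp_all add: cong_iff_dvd_diff)
    then have "[\<zeta> * \<zeta> = 1] (mod int p)" using z by (rule cong_trans)
    then show False using z2 by (simp add: power2_eq_square)
  qed
  ultimately show "int p dvd (\<Sum>j<n. q (2 * j))" using prime_dvd_multD[OF pp] by blast
qed

lemma good_weight_two: "good_weight p 2 0"
  unfolding good_weight_def
proof (intro allI impI)
  fix q :: "nat \<Rightarrow> int"
  assume "\<forall>k. [q (Suc (Suc k)) = - q k - 0 * q (Suc k)] (mod int p)"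
  then have "[q 2 = - q 0] (mod int p)" by (auto simp: numeral_2_eq_2 dest: spec[of _ 0])
  then show "int p dvd (\<Sum>j<2. q (2 * j))" by (simp add: cong_iff_dvd_diff numeral_2_eq_2 add.commute)
qed

section \<open>Counting dihedral representations\<close>

text \<open>A label \<open>a\<close> contributes the root \<open>-1 / (a - 1)\<close>, which
  determines \<open>a\<close> and is not 0, the only root of the leading power. Common factors are
  cancelled one at a time.\<close>

lemma mset_eq_of_prod_poly:
  fixes A B :: "nat multiset"
  assumes "\<forall>a\<in>#A. a \<ge> 2" "\<forall>b\<in>#B. b \<ge> 2" and K: "K \<noteq> (0::real)"
    and "[:0, K:] ^ c * prod_mset (image_mset (\<lambda>a. [:1, real a - 1:]) A)
      = [:0, K:] ^ d * prod_mset (image_mset (\<lambda>a. [:1, real a - 1:]) B)"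
  shows "A = B"
proof -
  let ?P = "\<lambda>A :: nat multiset. prod_mset (image_mset (\<lambda>a. [:1, real a - 1:]) A)"
  have zero: "poly (?P A) z = 0 \<longleftrightarrow> (\<exists>a\<in>#A. 1 + z * (real a - 1) = 0)" for A :: "nat multiset" and z
  proof (induction A)
    case (add a A)
    have "poly (?P (add_mset a A)) z = (1 + z * (real a - 1)) * poly (?P A) z" by (simp add: algebra_simps)
    then show ?case unfolding mult_eq_0_iff using add by (metis mult_eq_0_iff set_mset_add_mset_insert insert_iff)
  qed simp
  show ?thesis using assms(1,2,4)
  proof (induction A arbitrary: B)
    case empty
    show ?case
    proof (rule ccontr)
      assume "{#} \<noteq> B"
      then obtain b where b: "b \<in># B" by (metis multiset_nonemptyE)
      define z where "z = - 1 / (real b - 1)"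
      have b2: "(real b - 1) > 0" using b empty(2) by fastforce
      have z: "z \<noteq> 0" "1 + z * (real b - 1) = 0" using b2 by (auto simp: z_def)
      have "poly ([:0, K:] ^ d * ?P B) z = 0" using zero[of B z] z(2) b by auto
      then have "poly ([:0, K:] ^ c * ?P {#}) z = 0" using empty(3) by simp
      then show False using z(1) K by simp
    qed
  next
    case (add a A)
    have a2: "(real a - 1) > 0" using add.prems(1) by fastforce
    define z where "z = - 1 / (real a - 1)"
    have z: "z \<noteq> 0" "1 + z * (real a - 1) = 0" using a2 by (auto simp: z_def)
    have "poly ([:0, K:] ^ c * ?P (add_mset a A)) z = 0" using zero[of "add_mset a A" z] z(2) by auto
    then have "poly ([:0, K:] ^ d * ?P B) z = 0" by (simp only: add.prems(3))
    then have "poly (?P B) z = 0" using z(1) K by simp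
    then obtain b where b: "b \<in># B" "1 + z * (real b - 1) = 0" using zero by blast
    then have "(real b - 1) = (real a - 1)" using z by (metis add_left_cancel mult_left_cancel)
    then have "b = a" by simp
    then obtain B' where B': "B = add_mset a B'" using b(1) by (metis insert_DiffM)
    have "[:1, real a - 1:] * ([:0, K:] ^ c * ?P A) = [:1, real a - 1:] * ([:0, K:] ^ d * ?P B')"
      using add.prems(3) unfolding B' by (simp only: image_mset_add_mset prod_mset.add_mset ac_simps)
    moreover have "[:1, real a - 1:] \<noteq> 0" by simp
    ultimately have "[:0, K:] ^ c * ?P A = [:0, K:] ^ d * ?P B'" using mult_left_cancel by blast
    then have "A = B'" using add.IH[of B'] add.prems(1,2) B' by simp
    then show ?case using B' by simp
  qed
qed

text \<open>An identity at infinitely many numbers \<open>Y\<close> is an identity of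
  polynomials.\<close>

lemma mset_eq_of_products:
  fixes A B :: "'e set" and n :: "'e \<Rightarrow> nat"
  fixes C :: "'f set" and k :: "'f \<Rightarrow> nat"
  assumes "finite A" "finite C" "\<forall>e\<in>A. n e \<ge> 2" "\<forall>e\<in>C. k e \<ge> 2" and N: "N > (0::nat)"
    and eq: "\<And>Y::nat. (N * Y) ^ c * (\<Prod>e\<in>A. 1 + (n e - 1) * Y) = (N * Y) ^ d * (\<Prod>e\<in>C. 1 + (k e - 1) * Y)"
  shows "image_mset n (mset_set A) = image_mset k (mset_set C)"
proof -
  let ?L = "[:0, real N:] ^ c * (\<Prod>e\<in>A. [:1, real (n e) - 1:])"
  let ?R = "[:0, real N:] ^ d * (\<Prod>e\<in>C. [:1, real (k e) - 1:])"
  have "poly (?L - ?R) (real Y) = 0" for Y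
  proof -
    have "real ((N * Y) ^ c * (\<Prod>e\<in>A. 1 + (n e - 1) * Y)) = real ((N * Y) ^ d * (\<Prod>e\<in>C. 1 + (k e - 1) * Y))"
      using eq by simp
    moreover have "real (\<Prod>e\<in>A. 1 + (n e - 1) * Y) = poly (\<Prod>e\<in>A. [:1, real (n e) - 1:]) (real Y)"
      unfolding of_nat_prod poly_prod by (rule prod.cong) (use assms(3) in \<open>auto simp: of_nat_diff mult.commute\<close>)
    moreover have "real (\<Prod>e\<in>C. 1 + (k e - 1) * Y) = poly (\<Prod>e\<in>C. [:1, real (k e) - 1:]) (real Y)"
      unfolding of_nat_prod poly_prod by (rule prod.cong) (use assms(4) in \<open>auto simp: of_nat_diff mult.commute\<close>)
    ultimately show ?thesis by (simp add: mult.commute)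
  qed
  then have "range real \<subseteq> {x. poly (?L - ?R) x = 0}" by auto
  moreover have "infinite (range real)" by (simp add: finite_image_iff inj_on_def)
  ultimately have "infinite {x. poly (?L - ?R) x = 0}" using finite_subset by blast
  then have "?L - ?R = 0" using poly_roots_finite by blast
  then have "?L = ?R" by simp
  then show ?thesis
    using assms(1-4) N
    by (intro mset_eq_of_prod_poly[of _ _ "real N" c d]) (auto simp: image_mset.compositionality o_def prod_unfold_prod_mset)
qed

text \<open>
  The value 0 kills the assignments of reflections that violate the relation of \<open>e\<close>, so that the sum of the
  products of edge weights counts the remaining ones by the number of edges with distinct end values.
\<close>

definition edge_weight :: "nat \<Rightarrow> nat \<Rightarrow> ('a set \<Rightarrow> nat) \<Rightarrow> ('a \<Rightarrow> nat) \<Rightarrow> 'a set \<Rightarrow> nat" where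
  "edge_weight N Y m x e = (if \<exists>t. x ` e = {t} then 1
     else if \<forall>u\<in>e. \<forall>w\<in>e. int N dvd int (m e) * (int (x u) - int (x w)) then Y else 0)"

lemma sum_PiE_insert:
  assumes w: "w \<notin> V"
  shows "(\<Sum>y\<in>PiE (insert w V) Y. h y) = (\<Sum>y\<in>PiE V Y. \<Sum>t\<in>Y w. h (y(w := t)))"
proof -
  have "(\<Sum>y\<in>PiE (insert w V) Y. h y) = (\<Sum>(t, y)\<in>Y w \<times> PiE V Y. h (y(w := t)))"
    unfolding PiE_insert_eq by (subst sum.reindex[OF inj_combinator[OF w]]) (simp add: case_prod_beta o_def)
  also have "\<dots> = (\<Sum>t\<in>Y w. \<Sum>y\<in>PiE V Y. h (y(w := t)))" by (rule sum.cartesian_product[symmetric])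
  also have "\<dots> = (\<Sum>y\<in>PiE V Y. \<Sum>t\<in>Y w. h (y(w := t)))" by (rule sum.swap)
  finally show ?thesis .
qed

text \<open>The condition describes one residue class modulo \<open>N div n\<close>.\<close>

lemma card_multiple_differences:
  assumes "n dvd N" "N > 0"
  shows "card {t\<in>{..<N}. int N dvd int n * (int a - int t)} = n"
proof -
  obtain k where k: "N = n * k" using assms(1) by blast
  have pos: "n > 0" "k > 0" using k assms(2) by auto
  have d: "int N dvd int n * (int a - int t) \<longleftrightarrow> t mod k = a mod k" for t
  proof -
    have "int N dvd int n * (int a - int t) \<longleftrightarrow> int k dvd int a - int t" using pos by (simp add: k)
    also have "\<dots> \<longleftrightarrow> int a mod int k = int t mod int k" by (simp add: mod_eq_dvd_iff)
    also have "\<dots> \<longleftrightarrow> t mod k = a mod k" by (metis of_nat_eq_iff zmod_int)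
    finally show ?thesis .
  qed
  have b: "bij_betw (\<lambda>j. a mod k + j * k) {..<n} {t\<in>{..<N}. t mod k = a mod k}"
  proof (rule bij_betw_byWitness[where f' = "\<lambda>t. t div k"])
    show "(\<lambda>j. a mod k + j * k) ` {..<n} \<subseteq> {t\<in>{..<N}. t mod k = a mod k}"
    proof safe
      fix j assume "j < n"
      then have "(j + 1) * k \<le> n * k" by (intro mult_right_mono) auto
      moreover have "a mod k < k" using pos by simp
      ultimately show "a mod k + j * k < N" unfolding k by simp
    qed auto
    show "\<forall>t\<in>{t \<in> {..<N}. t mod k = a mod k}. a mod k + t div k * k = t" by (auto) (metis add.commute div_mult_mod_eq)
    show "(\<lambda>t. t div k) ` {t \<in> {..<N}. t mod k = a mod k} \<subseteq> {..<n}"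
      using pos by (auto simp: k div_less_iff_less_mult)
  qed (use pos in auto)
  show ?thesis unfolding d using bij_betw_same_card[OF b] by simp
qed

lemma sum_edge_weight:
  assumes "n dvd N" "N > 0" "a < N"
  shows "(\<Sum>t<N. if t = a then 1 else if int N dvd int n * (int a - int t) then Y else 0) = 1 + (n - 1) * (Y::nat)"
proof -
  let ?D = "{t\<in>{..<N}. int N dvd int n * (int a - int t)}"
  have "(\<Sum>t<N. if t = a then 1 else if int N dvd int n * (int a - int t) then Y else 0)
    = (\<Sum>t\<in>?D. if t = a then 1 else Y)"
    using assms(3) by (intro sum.mono_neutral_cong_right) auto
  also have "\<dots> = 1 + (\<Sum>t\<in>?D - {a}. if t = a then 1 else Y)" using assms(3) by (subst sum.remove[of _ a]) auto
  also have "(\<Sum>t\<in>?D - {a}. if t = a then 1 else Y) = card (?D - {a}) * Y" by simp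
  also have "card (?D - {a}) = n - 1" using assms(3) card_multiple_differences[OF assms(1,2), of a] by simp
  finally show ?thesis .
qed

lemma rearrange_products:
  fixes F :: nat
  assumes "S * c = d * P"
  shows "(F * S) * (n * c) = n * d * (F * P)"
proof -
  have "(F * S) * (n * c) = n * F * (S * c)" by (simp only: ac_simps)
  also have "\<dots> = n * F * (d * P)" by (simp only: assms)
  finally show ?thesis by (simp only: ac_simps)
qed

text \<open>Summing over the value at a new leaf gives the same factor whatever the value of its
  neighbour, so the sum factors over the edges. Powers of \<open>N\<close> stand on both sides so
  that no exponent is a difference.\<close>

lemma forest_weight_sum:
  assumes "forest V E" "N > 0" "\<And>e. e \<in> E \<Longrightarrow> m e dvd N"
  shows "(\<Sum>x\<in>V \<rightarrow>\<^sub>E {..<N}. \<Prod>e\<in>E. edge_weight N Y m x e) * N ^ card E = N ^ card V * (\<Prod>e\<in>E. 1 + (m e - 1) * Y)"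
  using assms
proof (induction rule: forest.induct)
  case empty
  then show ?case by simp
next
  case (isolated V E w)
  have fin: "finite V" "finite E" using forest_finite[OF isolated.hyps(1)] by auto
  have ew: "edge_weight N Y m (x(w := t)) e = edge_weight N Y m x e" if "e \<in> E" for x t e
  proof -
    have we: "w \<notin> e" using forest_edge[OF isolated.hyps(1) that] isolated.hyps(2) by blast
    then have "(x(w := t)) ` e = x ` e" by auto
    moreover have "\<forall>u\<in>e. (x(w := t)) u = x u" using we by auto
    ultimately show ?thesis unfolding edge_weight_def by simp
  qed
  have "(\<Sum>x\<in>insert w V \<rightarrow>\<^sub>E {..<N}. \<Prod>e\<in>E. edge_weight N Y m x e)
    = N * (\<Sum>x\<in>V \<rightarrow>\<^sub>E {..<N}. \<Prod>e\<in>E. edge_weight N Y m x e)"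
    by (simp add: sum_PiE_insert[OF isolated.hyps(2)] ew sum_distrib_left cong: prod.cong)
  then show ?case using isolated.IH isolated.prems isolated.hyps(2) fin by (simp add: mult.assoc)
next
  case (leaf V E u w)
  have fin: "finite V" "finite E" using forest_finite[OF leaf.hyps(1)] by auto
  have ne: "{u, w} \<notin> E" by (rule forest_new_edge(1)[OF leaf.hyps(1,3)])
  have uw: "u \<noteq> w" using leaf.hyps by auto
  have ew: "edge_weight N Y m (x(w := t)) e = edge_weight N Y m x e" if "e \<in> E" for x t e
  proof -
    have we: "w \<notin> e" using forest_edge[OF leaf.hyps(1) that] leaf.hyps(3) by blast
    then have "(x(w := t)) ` e = x ` e" by auto
    moreover have "\<forall>u\<in>e. (x(w := t)) u = x u" using we by auto
    ultimately show ?thesis unfolding edge_weight_def by simp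
  qed
  have new: "edge_weight N Y m (x(w := t)) {u, w} = (if t = x u then 1 else if int N dvd int (m {u, w}) * (int (x u) - int t) then Y else 0)" for x t
  proof -
    have "(x(w := t)) ` {u, w} = {x u, t}" using uw by auto
    moreover have "(\<exists>z. {x u, t} = {z}) \<longleftrightarrow> t = x u" by auto
    moreover have "int N dvd int (m {u, w}) * (int t - int (x u)) \<longleftrightarrow> int N dvd int (m {u, w}) * (int (x u) - int t)"
      by (metis dvd_minus_iff minus_diff_eq mult_minus_right)
    ultimately show ?thesis using uw by (auto simp: edge_weight_def)
  qed
  have "(\<Sum>x\<in>insert w V \<rightarrow>\<^sub>E {..<N}. \<Prod>e\<in>insert {u, w} E. edge_weight N Y m x e)
    = (\<Sum>x\<in>V \<rightarrow>\<^sub>E {..<N}. \<Sum>t<N. edge_weight N Y m (x(w := t)) {u, w} * (\<Prod>e\<in>E. edge_weight N Y m x e))"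
    using fin ne by (simp add: sum_PiE_insert[OF leaf.hyps(3)] ew cong: prod.cong)
  also have "\<dots> = (\<Sum>x\<in>V \<rightarrow>\<^sub>E {..<N}. (1 + (m {u, w} - 1) * Y) * (\<Prod>e\<in>E. edge_weight N Y m x e))"
  proof (rule sum.cong[OF HOL.refl])
    fix x assume "x \<in> V \<rightarrow>\<^sub>E {..<N}"
    then have xu: "x u < N" using leaf.hyps(2) by auto
    show "(\<Sum>t<N. edge_weight N Y m (x(w := t)) {u, w} * (\<Prod>e\<in>E. edge_weight N Y m x e))
      = (1 + (m {u, w} - 1) * Y) * (\<Prod>e\<in>E. edge_weight N Y m x e)"
      unfolding sum_distrib_right[symmetric] new using sum_edge_weight[OF leaf.prems(2) leaf.prems(1) xu, of "{u, w}" Y] by simp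
  qed
  finally have sm: "(\<Sum>x\<in>insert w V \<rightarrow>\<^sub>E {..<N}. \<Prod>e\<in>insert {u, w} E. edge_weight N Y m x e)
    = (1 + (m {u, w} - 1) * Y) * (\<Sum>x\<in>V \<rightarrow>\<^sub>E {..<N}. \<Prod>e\<in>E. edge_weight N Y m x e)"
    unfolding sum_distrib_left .
  have "(\<Sum>x\<in>V \<rightarrow>\<^sub>E {..<N}. \<Prod>e\<in>E. edge_weight N Y m x e) * N ^ card E = N ^ card V * (\<Prod>e\<in>E. 1 + (m e - 1) * Y)"
    using leaf.IH leaf.prems by simp
  then have "((1 + (m {u, w} - 1) * Y) * (\<Sum>x\<in>V \<rightarrow>\<^sub>E {..<N}. \<Prod>e\<in>E. edge_weight N Y m x e)) * (N * N ^ card E)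
    = N * N ^ card V * ((1 + (m {u, w} - 1) * Y) * (\<Prod>e\<in>E. 1 + (m e - 1) * Y))" by (rule rearrange_products)
  then show ?case
    unfolding sm unfolding card_insert_disjoint[OF fin(2) ne] card_insert_disjoint[OF fin(1) leaf.hyps(3)] prod.insert[OF fin(2) ne] power_Suc .
qed

locale double_forest = A: forest_pair V E m V' E' m' \<phi> \<psi> \<rho> + B: forest_pair V' E' m' V E m \<psi> \<phi> \<rho>'
  for V :: "'a set" and E m and V' :: "'b set" and E' m' \<phi> \<psi> \<rho> \<rho>'
begin

text \<open>The abelian action of the primed group is transferred to the forest and compared there
  with the generator \<open>A.\<kappa> s\<close>. The two are conjugate by a word value, and
  conjugate elements of an abelian action coincide. So the two matchings of components are inverse
  to each other.\<close>

lemma \<kappa>\<kappa>: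
  assumes s: "s \<in> V'"
  shows "B.\<kappa> (A.\<kappa> s) = \<rho>' s"
proof -
  define f where "f = A.B.T B.\<delta>"
  have f: "cact V E m (Pow V') f" unfolding f_def by (rule A.B.cact_T[OF B.cact_\<delta>])
  have Tf: "A.F.T f = B.\<delta>" unfolding f_def by (rule A.FB[OF B.cact_\<delta>])
  note v = A.\<kappa>(1)[OF s]
  have "\<exists>w. set w \<subseteq> V \<and> f (A.\<kappa> s) \<circ> ev f w = ev f w \<circ> A.F.T f s"
    by (rule A.main_conj[OF f _ s v]) (use A.\<kappa>(2)[OF s] in auto)
  then obtain w where w: "set w \<subseteq> V" "f (A.\<kappa> s) \<circ> ev f w = ev f w \<circ> B.\<delta> s" unfolding Tf by blast
  have fv: "f (A.\<kappa> s) = B.\<delta> (B.\<kappa> (A.\<kappa> s))" unfolding f_def by (rule B.\<kappa>(3)[OF v])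
  obtain ys where ys: "set ys \<subseteq> V'" "ev f w = ev B.\<delta> ys" unfolding f_def by (rule A.B.T_approx[OF B.cact_\<delta> w(1)])
  let ?D = "ev B.\<delta> ys {}" and ?k = "B.\<kappa> (A.\<kappa> s)"
  have "B.\<delta> ?k (ev B.\<delta> ys {}) = ev B.\<delta> ys (B.\<delta> s {})" using w(2) unfolding fv ys(2) by (metis comp_apply)
  moreover have "B.\<delta> s {} = {\<rho>' s}" using B.\<delta>_apply[OF s, of "{}"] by (simp add: toggle_def)
  moreover have "?D \<subseteq> V'" using B.ev_\<delta>[OF ys(1), of "{}"] by simp
  then have "B.\<delta> ?k ?D = toggle ?k ?D" using B.\<delta>_apply[OF B.\<kappa>(1)[OF v]] B.\<kappa>(2)[OF v] by simp
  moreover have "ev B.\<delta> ys {\<rho>' s} = sdiff {\<rho>' s} ?D" using B.ev_\<delta>[OF ys(1), of "{\<rho>' s}"] B.\<rho>_in[OF s] by simp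
  ultimately have "toggle ?k ?D = sdiff {\<rho>' s} ?D" by simp
  then show ?thesis unfolding toggle_def sdiff_def by blast
qed

end

section \<open>Dihedral groups acting on a plane modulo \<open>p\<close>\<close>

locale dihedral_rep =
  fixes p N :: nat and a :: int
  assumes prime: "Factorial_Ring.prime p" and odd: "odd p" and N: "N > 0"
    and root: "[a ^ N = 1] (mod int p)" and primitive: "\<And>d. 0 < d \<Longrightarrow> d < N \<Longrightarrow> \<not> [a ^ d = 1] (mod int p)"
begin

definition G :: "(bool \<Rightarrow> int) monoid" where "G = zp_space p UNIV"

definition rz :: "int \<Rightarrow> int" where "rz k = a ^ nat (k mod int N) mod int p"

text \<open>Monomial matrices with entries a power of \<open>a\<close> and its inverse: diagonal for
  a rotation, off the diagonal for a reflection, where \<open>e\<close> is true. Coordinates are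
  indexed by truth values so that \<open>i \<noteq> e\<close> performs the exchange.\<close>

definition dih :: "bool \<Rightarrow> int \<Rightarrow> (bool \<Rightarrow> int) \<Rightarrow> bool \<Rightarrow> int" where
  "dih e k = (\<lambda>x. if x \<in> carrier G then (\<lambda>i. (rz (if i then k else - k) * x (i \<noteq> e)) mod int p) else x)"

lemma p2: "p > 2" "p > 1" "p > 0"
proof -
  have "p \<noteq> 2" using odd by auto
  then show "p > 2" using prime_ge_2_nat[OF prime] by simp
  then show "p > 1" "p > 0" by auto
qed

sublocale G: comm_group G unfolding G_def using p2 by (intro zp_comm_group)

lemma carrier_iff: "x \<in> carrier G \<longleftrightarrow> (\<forall>i. 0 \<le> x i \<and> x i < int p)"
  by (simp add: G_def zp_carrier)

lemma rz_0: "rz 0 = 1" using p2 by (simp add: rz_def)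

lemma pow_mod_N: "[a ^ k = a ^ (k mod N)] (mod int p)"
proof -
  have "a ^ k = (a ^ N) ^ (k div N) * a ^ (k mod N)" by (simp add: power_add[symmetric] power_mult[symmetric])
  moreover have "[(a ^ N) ^ (k div N) * a ^ (k mod N) = 1 ^ (k div N) * a ^ (k mod N)] (mod int p)"
    by (intro cong_mult cong_pow root cong_refl)
  ultimately show ?thesis by simp
qed

lemma rz_add: "rz (j + k) = (rz j * rz k) mod int p"
proof -
  have "nat ((j + k) mod int N) = (nat (j mod int N) + nat (k mod int N)) mod N"
  proof -
    have "(j + k) mod int N = (j mod int N + k mod int N) mod int N" by (simp add: mod_simps)
    also have "nat \<dots> = nat (j mod int N + k mod int N) mod nat (int N)" using N by (intro nat_mod_distrib) auto
    also have "nat (j mod int N + k mod int N) = nat (j mod int N) + nat (k mod int N)" using N by (intro nat_add_distrib) auto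
    finally show ?thesis by simp
  qed
  then have "[a ^ nat ((j + k) mod int N) = a ^ (nat (j mod int N) + nat (k mod int N))] (mod int p)"
    using pow_mod_N cong_sym by metis
  then show ?thesis by (simp add: rz_def cong_def power_add mod_simps)
qed

lemma rz_eq_iff: "rz j = rz k \<longleftrightarrow> int N dvd j - k"
proof
  assume "int N dvd j - k"
  then have "j mod int N = k mod int N" by (simp add: mod_eq_dvd_iff)
  then show "rz j = rz k" by (simp add: rz_def)
next
  assume eq: "rz j = rz k"
  have "rz (j - k) = (rz j * rz (- k)) mod int p" using rz_add[of j "- k"] by simp
  also have "\<dots> = rz 0" using rz_add[of k "- k"] eq by simp
  finally have "rz (j - k) = 1" using rz_0 by simp
  then have "[a ^ nat ((j - k) mod int N) = 1] (mod int p)" using p2 by (simp add: rz_def cong_def)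
  moreover have "nat ((j - k) mod int N) < N" using N by (simp add: nat_less_iff)
  ultimately have "nat ((j - k) mod int N) = 0" using primitive by blast
  then show "int N dvd j - k" using N by (simp add: dvd_eq_mod_eq_0) (metis Euclidean_Rings.pos_mod_sign antisym of_nat_0_less_iff)
qed

lemma dih_closed: "x \<in> carrier G \<Longrightarrow> dih e k x \<in> carrier G"
  using p2 unfolding dih_def carrier_iff by auto

lemma dih_comp: "dih e j \<circ> dih e' k = dih (e \<noteq> e') (j + (if e then - k else k))"
proof
  fix x
  show "(dih e j \<circ> dih e' k) x = dih (e \<noteq> e') (j + (if e then - k else k)) x"
  proof (cases "x \<in> carrier G")
    case True
    show ?thesis
    proof
      fix i
      have x1: "x ((i \<noteq> e) \<noteq> e') = x (i \<noteq> (e \<noteq> e'))" by (cases i; cases e; cases e') simp_all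
      have r1: "rz (if i then j + (if e then - k else k) else - (j + (if e then - k else k)))
        = (rz (if i then j else - j) * rz (if i \<noteq> e then k else - k)) mod int p"
        unfolding rz_add[symmetric] by (cases i; cases e) simp_all
      have "(dih e j \<circ> dih e' k) x i = (rz (if i then j else - j) * dih e' k x (i \<noteq> e)) mod int p"
        using dih_closed[OF True, of e' k] by (simp add: dih_def[of e j])
      also have "\<dots> = (rz (if i then j else - j) * (rz (if i \<noteq> e then k else - k) * x (i \<noteq> (e \<noteq> e')))) mod int p"
        using True by (simp only: dih_def[of e' k] if_True x1 mod_mult_right_eq)
      also have "\<dots> = dih (e \<noteq> e') (j + (if e then - k else k)) x i"
        using True by (simp only: dih_def if_True r1 mod_mult_left_eq mult.assoc)
      finally show "(dih e j \<circ> dih e' k) x i = dih (e \<noteq> e') (j + (if e then - k else k)) x i" .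
    qed
  qed (simp add: dih_def)
qed

lemma dih_id: "dih False 0 = id"
proof
  fix x show "dih False 0 x = id x"
    by (cases "x \<in> carrier G") (auto simp: dih_def rz_0 carrier_iff)
qed

lemma dih_cong: "int N dvd j - k \<Longrightarrow> dih e j = dih e k"
proof -
  assume d: "int N dvd j - k"
  then have "rz j = rz k" "rz (- j) = rz (- k)" unfolding rz_eq_iff by (auto simp: dvd_diff_commute)
  then have r: "rz (if i then j else - j) = rz (if i then k else - k)" for i by simp
  show "dih e j = dih e k" unfolding dih_def r ..
qed

lemma dih_eq_iff: "dih e j = dih e k \<longleftrightarrow> int N dvd j - k"
proof
  assume eq: "dih e j = dih e k"
  have 1: "(\<lambda>i. 1) \<in> carrier G" using p2 by (simp add: carrier_iff)
  have "dih e j (\<lambda>i. 1) True = dih e k (\<lambda>i. 1) True" using eq by simp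
  then have "rz j = rz k" using 1 by (simp add: dih_def rz_def)
  then show "int N dvd j - k" by (simp only: rz_eq_iff)
qed (rule dih_cong)

lemma dih_id_iff: "dih False k = id \<longleftrightarrow> int N dvd k"
  using dih_eq_iff[of False k 0] dih_id by simp

lemma dih_invol: "dih True k \<circ> dih True k = id"
  using dih_comp[of True k True k] dih_id by simp

lemma dih_power: "(dih True j \<circ> dih True k) ^^ n = dih False (int n * (j - k))"
proof (induction n)
  case (Suc n)
  have "dih True j \<circ> dih True k = dih False (j - k)" using dih_comp[of True j True k] by simp
  then show ?case using Suc dih_comp[of False "j - k" False] by (simp add: algebra_simps del: comp_apply)
qed (simp add: dih_id)

lemma dih_hom: "dih e k \<in> hom G G"
proof (rule homI)
  fix x y assume xy: "x \<in> carrier G" "y \<in> carrier G"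
  have xyc: "x \<otimes>\<^bsub>G\<^esub> y \<in> carrier G" using xy by (rule G.m_closed)
  show "dih e k (x \<otimes>\<^bsub>G\<^esub> y) = dih e k x \<otimes>\<^bsub>G\<^esub> dih e k y"
  proof
    fix i show "dih e k (x \<otimes>\<^bsub>G\<^esub> y) i = (dih e k x \<otimes>\<^bsub>G\<^esub> dih e k y) i"
      using xy xyc unfolding dih_def by (simp add: G_def zp_mult mod_simps distrib_left)
  qed
qed (rule dih_closed)

lemma card_eig_reflection: "card (eig G (dih True k)) = p"
proof -
  have inv: "inv\<^bsub>G\<^esub> x = (\<lambda>i. (- x i) mod int p)" if "x \<in> carrier G" for x
    using zp_inv[of p x UNIV] that p2 by (simp add: G_def)
  let ?f = "\<lambda>z i. if i then (- (rz k * z)) mod int p else (z::int)"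
  have rr: "(rz (- k) * rz k) mod int p = 1" using rz_add[of "- k" k] rz_0 by simp
  have b: "bij_betw ?f {0..<int p} (eig G (dih True k))"
  proof (rule bij_betw_byWitness[where f' = "\<lambda>x. x False"])
    show "?f ` {0..<int p} \<subseteq> eig G (dih True k)"
    proof
      fix x assume "x \<in> ?f ` {0..<int p}"
      then obtain z where z: "0 \<le> z" "z < int p" "x = ?f z" by auto
      have xc: "x \<in> carrier G" unfolding carrier_iff using z p2 by auto
      have "[(rz (- k) * rz k) * (- z) = 1 * (- z)] (mod int p)"
        by (rule cong_mult) (use rr p2 in \<open>simp_all add: cong_def\<close>)
      then have e: "(rz (- k) * ((- (rz k * z)) mod int p)) mod int p = (- z) mod int p"
        by (simp only: cong_def mod_mult_right_eq) (simp add: mult.assoc)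
      have "dih True k x = inv\<^bsub>G\<^esub> x"
      proof
        fix i show "dih True k x i = (inv\<^bsub>G\<^esub> x) i"
          using xc e unfolding inv[OF xc] by (cases i) (simp_all add: dih_def z(3) mod_simps)
      qed
      then show "x \<in> eig G (dih True k)" using xc by (simp add: eig_def)
    qed
    show "\<forall>x\<in>eig G (dih True k). ?f (x False) = x"
    proof
      fix x assume "x \<in> eig G (dih True k)"
      then have xc: "x \<in> carrier G" and e: "dih True k x = (\<lambda>i. (- x i) mod int p)" using inv by (auto simp: eig_def)
      have "(rz k * x False) mod int p = (- x True) mod int p" using fun_cong[OF e, of True] xc by (simp add: dih_def)
      then have "(- (rz k * x False)) mod int p = x True"
        using xc unfolding carrier_iff by (metis add.inverse_inverse mod_minus_eq mod_pos_pos_trivial)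
      then show "?f (x False) = x" by auto
    qed
    show "(\<lambda>x. x False) ` eig G (dih True k) \<subseteq> {0..<int p}" by (auto simp: eig_def carrier_iff)
  qed auto
  show ?thesis using bij_betw_same_card[OF b] by simp
qed

lemma card_eig_id: "card (eig G id) = 1"
proof -
  have "x = (\<lambda>i. 0)" if "x \<in> eig G id" for x
  proof
    fix i
    have xc: "x \<in> carrier G" using that by (simp add: eig_def)
    then have "x i = (- x i) mod int p" using that zp_inv[of p x UNIV] p2 by (simp add: eig_def G_def) (metis fun_cong)
    then have "(x i + x i) mod int p = (x i + (- x i) mod int p) mod int p" by simp
    also have "\<dots> = 0" by (simp add: mod_simps)
    finally have "int p dvd 2 * x i" by (simp add: mod_eq_0_iff_dvd)
    moreover have "\<not> int p dvd 2" using p2 by (auto dest: zdvd_imp_le)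
    ultimately have "int p dvd x i" using prime prime_dvd_multD[of "int p" 2 "x i"] by simp
    then show "x i = 0" using xc unfolding carrier_iff by (metis dvd_imp_mod_0 mod_pos_pos_trivial)
  qed
  moreover have "\<one>\<^bsub>G\<^esub> \<in> eig G id" by (simp add: eig_def)
  then have "(\<lambda>i. 0) \<in> eig G id" by (simp add: G_def zp_one)
  ultimately have "eig G id = {\<lambda>i. 0}" by blast
  then show ?thesis by simp
qed

text \<open>Letting everything outside \<open>C\<close> act trivially isolates the labels of one
  component.\<close>

definition refl_acts :: "'v set \<Rightarrow> 'v set set \<Rightarrow> ('v set \<Rightarrow> nat) \<Rightarrow> 'v set \<Rightarrow> ('v \<Rightarrow> (bool \<Rightarrow> int) \<Rightarrow> bool \<Rightarrow> int) set" where
  "refl_acts V E m C = {f. cact V E m (carrier G) f \<and>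
     (\<forall>v\<in>V. if v \<in> C then \<exists>k<N. f v = dih True (int k) else f v = id)}"

definition refl_act :: "'v set \<Rightarrow> ('v \<Rightarrow> nat) \<Rightarrow> 'v \<Rightarrow> (bool \<Rightarrow> int) \<Rightarrow> bool \<Rightarrow> int" where
  "refl_act C x = (\<lambda>v. if v \<in> C then dih True (int (x v)) else id)"

lemma id_hom: "id \<in> hom G G" by (rule homI) auto

lemma linear_refl_acts:
  assumes "f \<in> refl_acts V E m C"
  shows "linear_act V G f"
  unfolding linear_act_def
proof
  fix v assume "v \<in> V"
  then have "if v \<in> C then \<exists>k<N. f v = dih True (int k) else f v = id" using assms by (simp add: refl_acts_def)
  then show "f v \<in> hom G G" using dih_hom id_hom by (cases "v \<in> C") auto
qed

lemma bij_refl_act: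
  assumes "C \<subseteq> V"
  shows "bij_betw (refl_act C) {x \<in> C \<rightarrow>\<^sub>E {..<N}. cact V E m (carrier G) (refl_act C x)} (refl_acts V E m C)"
proof (rule bij_betw_imageI)
  show "inj_on (refl_act C) {x \<in> C \<rightarrow>\<^sub>E {..<N}. cact V E m (carrier G) (refl_act C x)}"
  proof (rule inj_onI)
    fix x y assume xy: "x \<in> {x \<in> C \<rightarrow>\<^sub>E {..<N}. cact V E m (carrier G) (refl_act C x)}"
      "y \<in> {x \<in> C \<rightarrow>\<^sub>E {..<N}. cact V E m (carrier G) (refl_act C x)}" and eq: "refl_act C x = refl_act C y"
    show "x = y"
    proof (rule PiE_ext[of x C "\<lambda>_. {..<N}" y])
      fix v assume v: "v \<in> C"
      then have "dih True (int (x v)) = dih True (int (y v))" using fun_cong[OF eq, of v] by (simp add: refl_act_def)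
      then have "int (x v) mod int N = int (y v) mod int N" unfolding dih_eq_iff by (simp add: mod_eq_dvd_iff)
      moreover have "x v < N" "y v < N" using xy v by auto
      ultimately show "x v = y v" by simp
    qed (use xy in auto)
  qed
  show "refl_act C ` {x \<in> C \<rightarrow>\<^sub>E {..<N}. cact V E m (carrier G) (refl_act C x)} = refl_acts V E m C"
  proof safe
    fix x assume "x \<in> C \<rightarrow>\<^sub>E {..<N}" "cact V E m (carrier G) (refl_act C x)"
    then show "refl_act C x \<in> refl_acts V E m C" by (auto simp: refl_acts_def refl_act_def)
  next
    fix f assume f: "f \<in> refl_acts V E m C"
    then have c: "cact V E m (carrier G) f" by (simp add: refl_acts_def)
    have "\<forall>v\<in>C. \<exists>k<N. f v = dih True (int k)" using f assms by (auto simp: refl_acts_def)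
    then obtain x where x: "\<forall>v\<in>C. x v < N \<and> f v = dih True (int (x v))" by metis
    have fx: "refl_act C (restrict x C) = f"
    proof
      fix v
      have "v \<notin> C \<Longrightarrow> f v = id" using f cactD(2)[OF c] by (cases "v \<in> V") (auto simp: refl_acts_def)
      then show "refl_act C (restrict x C) v = f v" using x by (simp add: refl_act_def)
    qed
    moreover have "restrict x C \<in> C \<rightarrow>\<^sub>E {..<N}" using x by auto
    ultimately show "f \<in> refl_act C ` {x \<in> C \<rightarrow>\<^sub>E {..<N}. cact V E m (carrier G) (refl_act C x)}" using c by force
  qed
qed

text \<open>The product of two reflections is the rotation by the difference of their parameters, so
  a braid relation is a divisibility. Edges outside \<open>C\<close> see only the identity.\<close>

lemma cact_refl_act_iff:
  assumes fo: "forest V E" and C: "C \<subseteq> V" and cl: "\<forall>e\<in>E. e \<subseteq> C \<or> e \<inter> C = {}"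
  shows "cact V E m (carrier G) (refl_act C x) \<longleftrightarrow>
    (\<forall>e\<in>{e \<in> E. e \<subseteq> C}. \<forall>u\<in>e. \<forall>w\<in>e. int N dvd int (m e) * (int (x u) - int (x w)))"
proof -
  have rel: "((refl_act C x u \<circ> refl_act C x w) ^^ m {u, w}) = id \<longleftrightarrow> int N dvd int (m {u, w}) * (int (x u) - int (x w))"
    if "{u, w} \<subseteq> C" for u w
  proof -
    have "((refl_act C x u \<circ> refl_act C x w) ^^ m {u, w}) = dih False (int (m {u, w}) * (int (x u) - int (x w)))"
      using that dih_power by (simp add: refl_act_def)
    then show ?thesis by (simp only: dih_id_iff)
  qed
  show ?thesis
  proof
    assume c: "cact V E m (carrier G) (refl_act C x)"
    show "\<forall>e\<in>{e \<in> E. e \<subseteq> C}. \<forall>u\<in>e. \<forall>w\<in>e. int N dvd int (m e) * (int (x u) - int (x w))"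
    proof (intro ballI)
      fix e u w assume e: "e \<in> {e \<in> E. e \<subseteq> C}" "u \<in> e" "w \<in> e"
      show "int N dvd int (m e) * (int (x u) - int (x w))"
      proof (cases "u = w")
        case False
        then have "e = {u, w}" using forest_edge[OF fo, of e] e by auto
        then show ?thesis using rel[of u w] cactD(5)[OF c, of u w] e by simp
      qed simp
    qed
  next
    assume r: "\<forall>e\<in>{e \<in> E. e \<subseteq> C}. \<forall>u\<in>e. \<forall>w\<in>e. int N dvd int (m e) * (int (x u) - int (x w))"
    have inv: "refl_act C x v \<circ> refl_act C x v = id" for v using dih_invol by (simp add: refl_act_def)
    have perm: "refl_act C x v permutes carrier G" for v
    proof (rule bij_imp_permutes)
      have i: "refl_act C x v (refl_act C x v y) = y" for y using inv by (metis comp_apply id_apply)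
      have cl': "refl_act C x v y \<in> carrier G" if "y \<in> carrier G" for y
        using that by (simp add: refl_act_def dih_closed)
      show "bij_betw (refl_act C x v) (carrier G) (carrier G)"
        by (rule bij_betw_byWitness[where f' = "refl_act C x v"]) (auto simp: i cl')
      show "\<And>y. y \<notin> carrier G \<Longrightarrow> refl_act C x v y = y" by (simp add: refl_act_def dih_def)
    qed
    have "((refl_act C x u \<circ> refl_act C x w) ^^ m {u, w}) = id" if e: "{u, w} \<in> E" for u w
    proof (cases "{u, w} \<subseteq> C")
      case True
      then show ?thesis using rel[OF True] r e by auto
    next
      case False
      then have "u \<notin> C" "w \<notin> C" using cl e by auto
      then show ?thesis by (simp add: refl_act_def id_def[symmetric])
    qed
    moreover have "finite (carrier G)" unfolding G_def using p2 by (intro zp_finite) auto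
    moreover have "\<forall>v. v \<notin> V \<longrightarrow> refl_act C x v = id" using C by (auto simp: refl_act_def)
    ultimately show "cact V E m (carrier G) (refl_act C x)" unfolding cact_def using inv perm by blast
  qed
qed

text \<open>A reflection of the plane has an eigenline of size \<open>p\<close>, and the identity
  has a trivial eigenspace because \<open>p\<close> is odd. Thus only edges inside \<open>C\<close>
  with equal reflections at their ends restrict a cocycle.\<close>

lemma card_lifts_refl_act:
  assumes fo: "forest V E" and C: "C \<subseteq> V" and cl: "\<forall>e\<in>E. e \<subseteq> C \<or> e \<inter> C = {}"
    and cop: "\<And>e. e \<in> E \<Longrightarrow> coprime (m e) p" and x: "x \<in> C \<rightarrow>\<^sub>E {..<N}"
    and c: "cact V E m (carrier G) (refl_act C x)"
  shows "card (lifts V E m G (refl_act C x)) * p ^ card {e \<in> {e \<in> E. e \<subseteq> C}. \<exists>t. x ` e = {t}} = p ^ card C"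
proof -
  let ?f = "refl_act C x" and ?P = "\<lambda>e. e \<subseteq> C \<and> (\<exists>t. x ` e = {t})"
  have fin: "finite V" "finite E" using forest_finite[OF fo] by auto
  have edges: "u \<in> V \<and> w \<in> V \<and> u \<noteq> w" if e: "{u, w} \<in> E" for u w
    using forest_edge[OF fo e] by (auto simp: doubleton_eq_iff)
  have f: "?f \<in> refl_acts V E m C" using bij_betw_apply[OF bij_refl_act[OF C]] x c by auto
  have lin: "linear_act V G ?f" by (rule linear_refl_acts[OF f])
  have eq_iff: "?f u = ?f w \<longleftrightarrow> x u = x w" if "u \<in> C" "w \<in> C" for u w
  proof -
    have "?f u = ?f w \<longleftrightarrow> int (x u) mod int N = int (x w) mod int N"
      using that by (simp add: refl_act_def dih_eq_iff mod_eq_dvd_iff)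
    moreover have "x u < N" "x w < N" using x that by auto
    ultimately show ?thesis by simp
  qed
  have ce: "card (eig G (?f v)) = (if v \<in> C then p else 1)" for v
    by (simp add: refl_act_def card_eig_reflection card_eig_id)
  have finE: "finite (eig G (?f v))" for v using ce[of v] p2 by (auto intro: card_ge_0_finite)
  have exp: "z [^]\<^bsub>G\<^esub> p = \<one>\<^bsub>G\<^esub>" for z unfolding G_def using p2 by (intro zp_exponent)
  have card: "?f u = ?f w \<or> card (eig G (?f u)) = p \<and> card (eig G (?f w)) = p" if e: "{u, w} \<in> E" for u w
  proof (cases "{u, w} \<subseteq> C")
    case True then show ?thesis by (simp add: ce)
  next
    case False
    then have "u \<notin> C" "w \<notin> C" using cl e by auto
    then show ?thesis by (simp add: refl_act_def)
  qed
  have co: "cocycles V E m G ?f = {y \<in> \<Pi>\<^sub>E v\<in>V. eig G (?f v). \<forall>u w. ({u, w} \<in> E) \<longrightarrow> (?f u = ?f w \<longrightarrow> y u = y w)}"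
    by (rule G.cocycles_collapse[OF c lin _ exp prime cop card]) (use edges in auto)
  have lc: "card (lifts V E m G ?f) = card (cocycles V E m G ?f)"
    by (rule bij_betw_same_card[OF G.bij_lifts_cocycles[OF c lin]]) (use edges in auto)
  have "card (cocycles V E m G ?f) * (\<Prod>e\<in>E. if ?P e then p else 1) = (\<Prod>v\<in>V. card (eig G (?f v)))"
    unfolding co
  proof (rule card_forest_collapse[OF fo])
    fix u w assume e: "{u, w} \<in> E"
    show "(if ?P {u, w} then p else 1) = (if ?f u = ?f w then card (eig G (?f w)) else 1)"
    proof (cases "{u, w} \<subseteq> C")
      case True
      then have "(\<exists>t. x ` {u, w} = {t}) \<longleftrightarrow> ?f u = ?f w" using eq_iff[of u w] by auto
      then show ?thesis using True by (simp add: ce)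
    next
      case False
      then have "u \<notin> C" "w \<notin> C" using cl e by auto
      then show ?thesis using False by (simp add: ce)
    qed
  qed (use finE in auto)
  then have 1: "card (lifts V E m G ?f) * p ^ card {e \<in> E. ?P e} = p ^ card {v \<in> V. v \<in> C}"
    unfolding ce prod_if_power[OF fin(2)] prod_if_power[OF fin(1)] lc .
  have 2: "{v \<in> V. v \<in> C} = C" using C by auto
  have 3: "{e \<in> E. ?P e} = {e \<in> {e \<in> E. e \<subseteq> C}. \<exists>t. x ` e = {t}}" by auto
  show ?thesis using 1 unfolding 2 3 .
qed

text \<open>The exponent of \<open>p\<close> in the number of lifts is \<open>card C\<close> less
  the number of collapsed edges. Apart from the constant shift \<open>card C - card E\<close> taken
  inside \<open>C\<close>, it counts the edges with different reflections at their ends, which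
  \<open>edge_weight\<close> marks by \<open>Y\<close>. Being expressed through numbers of lifts,
  the sum is preserved by transfer.\<close>

lemma sum_refl_acts:
  assumes fo: "forest V E" and C: "C \<subseteq> V" and cl: "\<forall>e\<in>E. e \<subseteq> C \<or> e \<inter> C = {}"
    and cop: "\<And>e. e \<in> E \<Longrightarrow> coprime (m e) p" and dvd: "\<And>e. e \<in> E \<Longrightarrow> m e dvd N"
  shows "(\<Sum>f\<in>refl_acts V E m C. Y ^ multiplicity p (card (lifts V E m G f)))
    = (N * Y) ^ (card C - card {e \<in> E. e \<subseteq> C}) * (\<Prod>e\<in>{e \<in> E. e \<subseteq> C}. 1 + (m e - 1) * Y)"
proof -
  let ?E = "{e \<in> E. e \<subseteq> C}" and ?K = "{x \<in> C \<rightarrow>\<^sub>E {..<N}. cact V E m (carrier G) (refl_act C x)}"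
  let ?d = "card C - card ?E"
  have foC: "forest C ?E" using forest_subset[OF fo cl] C by (simp add: Int_absorb1)
  have fin: "finite C" "finite ?E" using forest_finite[OF foC] by auto
  have le: "card ?E \<le> card C" by (rule forest_card_le[OF foC])
  have "(\<Sum>f\<in>refl_acts V E m C. Y ^ multiplicity p (card (lifts V E m G f)))
    = (\<Sum>x\<in>?K. Y ^ multiplicity p (card (lifts V E m G (refl_act C x))))"
    by (rule sum.reindex_bij_betw[OF bij_refl_act[OF C], symmetric])
  also have "\<dots> = (\<Sum>x\<in>?K. Y ^ ?d * (\<Prod>e\<in>?E. edge_weight N Y m x e))"
  proof (rule sum.cong[OF HOL.refl])
    fix x assume "x \<in> ?K"
    then have x: "x \<in> C \<rightarrow>\<^sub>E {..<N}" and c: "cact V E m (carrier G) (refl_act C x)" by auto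
    let ?c = "{e \<in> ?E. \<exists>t. x ` e = {t}}"
    have cle: "card ?c \<le> card ?E" by (rule card_mono) (use fin in auto)
    have "card (lifts V E m G (refl_act C x)) * p ^ card ?c = p ^ card C"
      by (rule card_lifts_refl_act[OF fo C cl cop x c])
    also have "\<dots> = p ^ (card C - card ?c) * p ^ card ?c" using cle le by (simp add: power_add[symmetric])
    finally have "card (lifts V E m G (refl_act C x)) = p ^ (card C - card ?c)" using p2 by simp
    \<comment> \<open>Here the number of collapsed edges is read off from the number of lifts
      alone.\<close>
    then have mu: "multiplicity p (card (lifts V E m G (refl_act C x))) = card C - card ?c"
      using prime by (simp add: multiplicity_same_power prime_gt_0_nat not_prime_unit)
    have "(\<Prod>e\<in>?E. edge_weight N Y m x e) = (\<Prod>e\<in>?E. if \<not> (\<exists>t. x ` e = {t}) then Y else 1)"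
      using c unfolding cact_refl_act_iff[OF fo C cl] by (intro prod.cong) (auto simp: edge_weight_def)
    also have "\<dots> = Y ^ card {e \<in> ?E. \<not> (\<exists>t. x ` e = {t})}" by (rule prod_if_power[OF fin(2)])
    also have "{e \<in> ?E. \<not> (\<exists>t. x ` e = {t})} = ?E - ?c" by auto
    also have "card (?E - ?c) = card ?E - card ?c" using fin by (intro card_Diff_subset) auto
    finally have "(\<Prod>e\<in>?E. edge_weight N Y m x e) = Y ^ (card ?E - card ?c)" .
    then show "Y ^ multiplicity p (card (lifts V E m G (refl_act C x))) = Y ^ ?d * (\<Prod>e\<in>?E. edge_weight N Y m x e)"
      unfolding mu using cle le by (simp add: power_add[symmetric])
  qed
  also have "\<dots> = Y ^ ?d * (\<Sum>x\<in>?K. \<Prod>e\<in>?E. edge_weight N Y m x e)" by (simp only: sum_distrib_left)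
  \<comment> \<open>Assignments violating a relation have weight zero, so all of them may be
    included.\<close>
  also have "(\<Sum>x\<in>?K. \<Prod>e\<in>?E. edge_weight N Y m x e) = (\<Sum>x\<in>C \<rightarrow>\<^sub>E {..<N}. \<Prod>e\<in>?E. edge_weight N Y m x e)"
  proof (rule sum.mono_neutral_left)
    show "finite (C \<rightarrow>\<^sub>E {..<N})" using fin by (intro finite_PiE) auto
    show "\<forall>x\<in>(C \<rightarrow>\<^sub>E {..<N}) - ?K. (\<Prod>e\<in>?E. edge_weight N Y m x e) = 0"
    proof
      fix x assume "x \<in> (C \<rightarrow>\<^sub>E {..<N}) - ?K"
      then have "\<not> cact V E m (carrier G) (refl_act C x)" by blast
      then obtain e u w where e: "e \<in> ?E" and uw: "u \<in> e" "w \<in> e" "\<not> int N dvd int (m e) * (int (x u) - int (x w))"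
        unfolding cact_refl_act_iff[OF fo C cl] by blast
      have "\<not> (\<exists>t. x ` e = {t})"
      proof
        assume "\<exists>t. x ` e = {t}"
        then have "x u = x w" using uw(1,2) by (metis imageI singletonD)
        then show False using uw(3) by simp
      qed
      then have "edge_weight N Y m x e = 0" using uw unfolding edge_weight_def by (simp only: if_False) (metis (full_types))
      then show "(\<Prod>e\<in>?E. edge_weight N Y m x e) = 0" using prod_zero[OF fin(2)] e by blast
    qed
  qed auto
  finally have s: "(\<Sum>f\<in>refl_acts V E m C. Y ^ multiplicity p (card (lifts V E m G f)))
    = Y ^ ?d * (\<Sum>x\<in>C \<rightarrow>\<^sub>E {..<N}. \<Prod>e\<in>?E. edge_weight N Y m x e)" .
  have "(\<Sum>x\<in>C \<rightarrow>\<^sub>E {..<N}. \<Prod>e\<in>?E. edge_weight N Y m x e) * N ^ card ?E = N ^ card C * (\<Prod>e\<in>?E. 1 + (m e - 1) * Y)"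
    by (rule forest_weight_sum[OF foC N]) (use dvd in auto)
  also have "N ^ card C = N ^ ?d * N ^ card ?E" using le by (simp add: power_add[symmetric])
  finally have "(\<Sum>x\<in>C \<rightarrow>\<^sub>E {..<N}. \<Prod>e\<in>?E. edge_weight N Y m x e) * N ^ card ?E = (N ^ ?d * (\<Prod>e\<in>?E. 1 + (m e - 1) * Y)) * N ^ card ?E"
    by (simp only: ac_simps)
  then have "(\<Sum>x\<in>C \<rightarrow>\<^sub>E {..<N}. \<Prod>e\<in>?E. edge_weight N Y m x e) = N ^ ?d * (\<Prod>e\<in>?E. 1 + (m e - 1) * Y)" using N by simp
  then show ?thesis unfolding s by (simp add: power_mult_distrib)
qed

lemma dih_reduce: "dih True k = dih True (int (nat (k mod int N)))" "nat (k mod int N) < N"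
proof -
  have "int N dvd k - k mod int N" by simp
  then show "dih True k = dih True (int (nat (k mod int N)))" using N by (simp add: dih_eq_iff)
  show "nat (k mod int N) < N" using N by (simp add: nat_less_iff)
qed

lemma dih_inverse: "\<exists>l. dih e l \<circ> dih e k = id \<and> (\<forall>j. \<exists>i<N. dih e l \<circ> (dih True j \<circ> dih e k) = dih True (int i))"
proof -
  let ?l = "if e then k else - k"
  have "dih e ?l \<circ> dih e k = id" using dih_id by (cases e) (simp_all add: dih_comp)
  moreover have "\<exists>i<N. dih e ?l \<circ> (dih True j \<circ> dih e k) = dih True (int i)" for j
  proof -
    have "dih e ?l \<circ> (dih True j \<circ> dih e k) = dih True (?l + (if e then k - j else j - k))"
      by (cases e) (simp_all only: dih_comp if_True if_False simp_thms, simp_all add: algebra_simps)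
    then show ?thesis using dih_reduce by metis
  qed
  ultimately show ?thesis by blast
qed

lemma ev_dih:
  assumes f: "f \<in> refl_acts V E m C" and "set w \<subseteq> V"
  shows "\<exists>e k. ev f w = dih e k"
  using assms(2)
proof (induction w)
  case Nil
  then show ?case using dih_id by (metis ev_simps(1))
next
  case (Cons v w)
  then obtain e k where w: "ev f w = dih e k" by auto
  have "v \<in> V" using Cons.prems by simp
  then have v: "if v \<in> C then \<exists>k<N. f v = dih True (int k) else f v = id" using f by (simp add: refl_acts_def)
  have "\<exists>e' k'. f v = dih e' k'"
  proof (cases "v \<in> C")
    case False
    then have "f v = dih False 0" using v dih_id by simp
    then show ?thesis by blast
  qed (use v in auto)
  then obtain e' k' where "f v = dih e' k'" by blast
  then have "ev f (v # w) = dih e' k' \<circ> dih e k" using w by simp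
  then show ?case unfolding dih_comp by blast
qed

end

text \<open>\<open>F.T f s\<close> is conjugate to \<open>f (\<kappa> s)\<close> by the value of a
  word, which is itself a dihedral map. So it is again a reflection of the same dihedral group if
  \<open>\<kappa> s = r\<close>, and trivial otherwise.\<close>

lemma (in forest_pair) refl_acts_T:
  assumes D: "dihedral_rep p N a"
    and f: "f \<in> dihedral_rep.refl_acts p N a V E m {v \<in> V. \<rho> v = r}"
  shows "F.T f \<in> dihedral_rep.refl_acts p N a V' E' m' {s \<in> V'. \<kappa> s = r}"
proof -
  interpret D: dihedral_rep p N a by fact
  have c: "cact V E m (carrier D.G) f" using f by (simp add: D.refl_acts_def)
  have "if s \<in> {s \<in> V'. \<kappa> s = r} then \<exists>k<N. F.T f s = D.dih True (int k) else F.T f s = id" if s: "s \<in> V'" for s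
  proof -
    note v = \<kappa>(1)[OF s] \<kappa>(2)[OF s]
    have "\<exists>w. set w \<subseteq> V \<and> f (\<kappa> s) \<circ> ev f w = ev f w \<circ> F.T f s"
      by (rule main_conj[OF c _ s v(1)]) (use v(2) D.G.one_closed in auto)
    then obtain w where w: "set w \<subseteq> V" "f (\<kappa> s) \<circ> ev f w = ev f w \<circ> F.T f s" by blast
    obtain e k where ek: "ev f w = D.dih e k" using D.ev_dih[OF f w(1)] by blast
    obtain l where l: "D.dih e l \<circ> D.dih e k = id"
      and lj: "\<forall>j. \<exists>i<N. D.dih e l \<circ> (D.dih True j \<circ> D.dih e k) = D.dih True (int i)" using D.dih_inverse[of e k] by blast
    have "D.dih e l \<circ> (f (\<kappa> s) \<circ> D.dih e k) = (D.dih e l \<circ> D.dih e k) \<circ> F.T f s"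
      using w(2) unfolding ek by (simp only: comp_assoc)
    then have T: "F.T f s = D.dih e l \<circ> (f (\<kappa> s) \<circ> D.dih e k)" unfolding l by simp
    have "\<forall>v\<in>V. if v \<in> {v \<in> V. \<rho> v = r} then \<exists>k<N. f v = D.dih True (int k) else f v = id"
      using f unfolding D.refl_acts_def by blast
    from bspec[OF this v(1)] have fv: "if \<kappa> s = r then \<exists>k<N. f (\<kappa> s) = D.dih True (int k) else f (\<kappa> s) = id"
      using v by (simp only: mem_Collect_eq simp_thms)
    show ?thesis
    proof (cases "\<kappa> s = r")
      case True
      then obtain j where j: "f (\<kappa> s) = D.dih True (int j)" using fv by auto
      obtain i where "i < N" "F.T f s = D.dih True (int i)" using spec[OF lj, of "int j"] unfolding T j by blast
      then show ?thesis using True s by auto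
    next
      case False
      then have "f (\<kappa> s) = id" using fv by simp
      then have "F.T f s = id" unfolding T using l by simp
      then show ?thesis using False by simp
    qed
  qed
  then have "\<forall>s\<in>V'. if s \<in> {s \<in> V'. \<kappa> s = r} then \<exists>k<N. F.T f s = D.dih True (int k) else F.T f s = id" by blast
  then show ?thesis using F.cact_T[OF c] unfolding D.refl_acts_def by (intro CollectI conjI)
qed

lemma (in forest_pair) odd_forest:
  assumes cg: "coxeter_graph V' E' m'"
  shows "forest V' E' \<and> (\<forall>e\<in>E'. odd (m' e))"
proof -
  have finV': "finite V'" and pairs0: "\<forall>e\<in>E'. \<exists>v w. v \<in> V' \<and> w \<in> V' \<and> v \<noteq> w \<and> e = {v, w}"
    and m2: "\<forall>e\<in>E'. 2 \<le> m' e" using cg unfolding coxeter_graph_def by simp_all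
  have pairs: "\<forall>e\<in>E'. \<exists>v w. e = {v, w} \<and> v \<in> V' \<and> w \<in> V' \<and> v \<noteq> w"
  proof
    fix e assume "e \<in> E'"
    then show "\<exists>v w. e = {v, w} \<and> v \<in> V' \<and> w \<in> V' \<and> v \<noteq> w" using bspec[OF pairs0, of e] by blast
  qed
  have "E' \<subseteq> Pow V'"
  proof
    fix e assume "e \<in> E'"
    then obtain v w where "e = {v, w}" "v \<in> V'" "w \<in> V'" using bspec[OF pairs, of e] by blast
    then show "e \<in> Pow V'" by simp
  qed
  then have finE': "finite E'" using finV' by (simp add: finite_subset)
  have finE: "finite E" using forest_finite[OF fo] by simp
  \<comment> \<open>Divisibility by all labels of both graphs lets one prime serve everywhere; the
    factor 3 secures \<open>N \<ge> 3\<close> even without edges.\<close>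
  define N where "N = 3 * ((\<Prod>e\<in>E. m e) * (\<Prod>e\<in>E'. m' e))"
  have "(\<Prod>e\<in>E. m e) > 0" using odd by (intro prod_pos) (auto intro: odd_pos)
  moreover have "(\<Prod>e\<in>E'. m' e) > 0" using m2 by (intro prod_pos) fastforce
  ultimately have N: "N \<ge> 3" by (simp add: N_def)
  have dE: "m e dvd N" if "e \<in> E" for e using dvd_prodI[OF finE that, of m] by (simp add: N_def)
  have dE': "m' e dvd N" if "e \<in> E'" for e using dvd_prodI[OF finE' that, of m'] by (simp add: N_def)
  obtain p \<zeta> where p: "Factorial_Ring.prime p" "odd p" and cop: "\<And>n. n dvd N \<Longrightarrow> coprime n p"
    and root: "\<And>n. n dvd N \<Longrightarrow> [\<zeta> n ^ n = (1::int)] (mod int p)"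
    and prim: "\<And>n d. n dvd N \<Longrightarrow> 0 < d \<Longrightarrow> d < n \<Longrightarrow> \<not> [\<zeta> n ^ d = 1] (mod int p)"
    using exists_primitive_roots[OF N] by blast
  \<comment> \<open>The pairing is a root of unity plus its inverse, the latter written as the power
    \<open>m' - 1\<close>. For the label 2 the root would be -1, whose square is 1, which
    \<open>good_weight_root\<close> excludes; orthogonal simple roots serve instead.\<close>
  define g where "g s t = (if s = t then 2 else if {s, t} \<in> E' then
    (if m' {s, t} = 2 then 0 else \<zeta> (m' {s, t}) + \<zeta> (m' {s, t}) ^ (m' {s, t} - 1)) else 0)" for s t
  have ed: "s \<in> V' \<and> t \<in> V' \<and> s \<noteq> t" if e: "{s, t} \<in> E'" for s t
    using bspec[OF pairs e] by (auto simp: doubleton_eq_iff)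
  have "tits_rep V' E' m' p g"
  proof (unfold_locales)
    show "finite V'" by (rule finV')
    show "Factorial_Ring.prime p" "odd p" by (rule p)+
    show "g s s = 2" for s by (simp add: g_def)
    show "g s t = g t s" for s t by (simp add: g_def insert_commute)
    show "coprime (m' e) p" if "e \<in> E'" for e by (rule cop[OF dE'[OF that]])
    show "s \<in> V' \<and> t \<in> V' \<and> s \<noteq> t" if "{s, t} \<in> E'" for s t by (rule ed[OF that])
    fix s t assume e: "{s, t} \<in> E'"
    let ?n = "m' {s, t}"
    have n2: "2 \<le> ?n" using m2 e by blast
    show "good_weight p ?n (g s t)"
    proof (cases "?n = 2")
      case True
      then show ?thesis using good_weight_two ed[OF e] e by (simp add: g_def)
    next
      case False
      have "good_weight p ?n (\<zeta> ?n + \<zeta> ?n ^ (?n - 1))"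
      proof (rule good_weight_root[OF p(1)])
        have "\<zeta> ?n * \<zeta> ?n ^ (?n - 1) = \<zeta> ?n ^ ?n" using n2 by (simp add: power_eq_if)
        then show "[\<zeta> ?n * \<zeta> ?n ^ (?n - 1) = 1] (mod int p)" using root[OF dE'[OF e]] by simp
        show "[\<zeta> ?n ^ ?n = 1] (mod int p)" by (rule root[OF dE'[OF e]])
        show "\<not> [(\<zeta> ?n)\<^sup>2 = 1] (mod int p)" using prim[OF dE'[OF e], of 2] n2 False by simp
      qed
      then show ?thesis using ed[OF e] e False by (simp add: g_def)
    qed
  qed
  then have "card E' + card V \<le> card E + card V'"
  proof (rule edge_count)
    show "coprime (m e) p" if "e \<in> E" for e by (rule cop[OF dE[OF that]])
    show "\<forall>e\<in>E'. \<exists>s t. e = {s, t}"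
    proof
      fix e assume "e \<in> E'"
      then show "\<exists>s t. e = {s, t}" using bspec[OF pairs, of e] by blast
    qed
  qed
  then show ?thesis by (rule odd_forest_criterion[OF finV' finE' pairs])
qed

lemma (in forest_pair) edges_in_component:
  "\<forall>e\<in>E. e \<subseteq> {v \<in> V. \<rho> v = r} \<or> e \<inter> {v \<in> V. \<rho> v = r} = {}"
proof
  fix e assume e: "e \<in> E"
  then obtain u w where uw: "e = {u, w}" "u \<in> V" "w \<in> V" using forest_edge[OF fo] by blast
  then have "\<rho> u = \<rho> w" using \<rho>_edge e by blast
  then show "e \<subseteq> {v \<in> V. \<rho> v = r} \<or> e \<inter> {v \<in> V. \<rho> v = r} = {}" using uw by auto
qed

context double_forest
begin

lemma flip_double: "double_forest V' E' m' V E m \<psi> \<phi> \<rho>' \<rho>"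
  by unfold_locales

lemma \<kappa>\<kappa>': "v \<in> V \<Longrightarrow> A.\<kappa> (B.\<kappa> v) = \<rho> v"
  by (rule double_forest.\<kappa>\<kappa>[OF flip_double])

text \<open>Both parts express that \<open>A.\<kappa>\<close> and \<open>B.\<kappa>\<close> are
  mutually inverse on roots, in the shape in which \<open>refl_acts_T\<close> describes its target
  in either direction.\<close>

lemma component_flip:
  assumes r: "r \<in> V" "\<rho> r = r"
  shows "{s \<in> V'. A.\<kappa> s = r} = {s \<in> V'. \<rho>' s = B.\<kappa> r}" "{v \<in> V. B.\<kappa> v = B.\<kappa> r} = {v \<in> V. \<rho> v = r}"
proof -
  have "A.\<kappa> s = r \<longleftrightarrow> \<rho>' s = B.\<kappa> r" if s: "s \<in> V'" for s
  proof
    assume "\<rho>' s = B.\<kappa> r"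
    then have "A.\<kappa> (B.\<kappa> (A.\<kappa> s)) = A.\<kappa> (B.\<kappa> r)" using \<kappa>\<kappa>[OF s] by simp
    then show "A.\<kappa> s = r" using \<kappa>\<kappa>'[OF A.\<kappa>(1)[OF s]] A.\<kappa>(2)[OF s] \<kappa>\<kappa>'[OF r(1)] r(2) by simp
  qed (use \<kappa>\<kappa>[OF s] in simp)
  then show "{s \<in> V'. A.\<kappa> s = r} = {s \<in> V'. \<rho>' s = B.\<kappa> r}" by blast
  have "B.\<kappa> v = B.\<kappa> r \<longleftrightarrow> \<rho> v = r" if v: "v \<in> V" for v
  proof
    assume "B.\<kappa> v = B.\<kappa> r"
    then show "\<rho> v = r" using \<kappa>\<kappa>'[OF v] \<kappa>\<kappa>'[OF r(1)] r(2) by simp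
  next
    assume "\<rho> v = r"
    then have "B.\<kappa> (A.\<kappa> (B.\<kappa> v)) = B.\<kappa> r" using \<kappa>\<kappa>'[OF v] by simp
    then show "B.\<kappa> v = B.\<kappa> r" using \<kappa>\<kappa>[OF B.\<kappa>(1)[OF v]] B.\<kappa>(2)[OF v] by simp
  qed
  then show "{v \<in> V. B.\<kappa> v = B.\<kappa> r} = {v \<in> V. \<rho> v = r}" by blast
qed

text \<open>Dihedral representations supported on a component transfer bijectively and keep their
  numbers of lifts, so the two generating functions agree at every \<open>Y\<close>, and
  \<open>mset_eq_of_products\<close> reads off the labels.\<close>

lemma component_labels:
  assumes m2: "\<forall>e\<in>E. 2 \<le> m e" and m2': "\<forall>e\<in>E'. 2 \<le> m' e" and r: "r \<in> V" "\<rho> r = r"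
  shows "image_mset m (mset_set {e \<in> E. e \<subseteq> {v \<in> V. \<rho> v = r}})
    = image_mset m' (mset_set {e \<in> E'. e \<subseteq> {s \<in> V'. \<rho>' s = B.\<kappa> r}})"
proof -
  let ?C = "{v \<in> V. \<rho> v = r}" and ?C' = "{s \<in> V'. \<rho>' s = B.\<kappa> r}"
  have fin: "finite E" "finite E'" using forest_finite[OF A.fo] forest_finite[OF B.fo] by auto
  define N where "N = 3 * ((\<Prod>e\<in>E. m e) * (\<Prod>e\<in>E'. m' e))"
  have "(\<Prod>e\<in>E. m e) > 0" using m2 by (intro prod_pos) fastforce
  moreover have "(\<Prod>e\<in>E'. m' e) > 0" using m2' by (intro prod_pos) fastforce
  ultimately have N: "N \<ge> 3" by (simp add: N_def)
  have dE: "m e dvd N" if "e \<in> E" for e using dvd_prodI[OF fin(1) that, of m] by (simp add: N_def)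
  have dE': "m' e dvd N" if "e \<in> E'" for e using dvd_prodI[OF fin(2) that, of m'] by (simp add: N_def)
  obtain p \<zeta> where p: "Factorial_Ring.prime p" "odd p" and cop: "\<And>n. n dvd N \<Longrightarrow> coprime n p"
    and root: "\<And>n. n dvd N \<Longrightarrow> [\<zeta> n ^ n = (1::int)] (mod int p)"
    and prim: "\<And>n d. n dvd N \<Longrightarrow> 0 < d \<Longrightarrow> d < n \<Longrightarrow> \<not> [\<zeta> n ^ d = 1] (mod int p)"
    using exists_primitive_roots[OF N] by blast
  have D: "dihedral_rep p N (\<zeta> N)" by unfold_locales (use p root[of N] prim[of N] N in auto)
  interpret D: dihedral_rep p N "\<zeta> N" by (rule D)
  let ?R = "D.refl_acts V E m ?C" and ?R' = "D.refl_acts V' E' m' ?C'"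
  have TR: "A.F.T f \<in> ?R'" if "f \<in> ?R" for f
    using A.refl_acts_T[OF D that] unfolding component_flip(1)[OF r] .
  have TR': "A.B.T f \<in> ?R" if "f \<in> ?R'" for f
    using B.refl_acts_T[OF D that] unfolding component_flip(2)[OF r] .
  have c: "cact V E m (carrier D.G) f" if "f \<in> ?R" for f using that by (simp add: D.refl_acts_def)
  have c': "cact V' E' m' (carrier D.G) f" if "f \<in> ?R'" for f using that by (simp add: D.refl_acts_def)
  have bij: "bij_betw A.F.T ?R ?R'"
  proof (rule bij_betw_byWitness[where f' = A.B.T])
    show "\<forall>f\<in>?R. A.B.T (A.F.T f) = f" using A.BF[OF c] by blast
    show "\<forall>f\<in>?R'. A.F.T (A.B.T f) = f" using A.FB[OF c'] by blast
  qed (use TR TR' in blast)+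
  have eq: "(N * Y) ^ (card ?C - card {e \<in> E. e \<subseteq> ?C}) * (\<Prod>e\<in>{e \<in> E. e \<subseteq> ?C}. 1 + (m e - 1) * Y)
    = (N * Y) ^ (card ?C' - card {e \<in> E'. e \<subseteq> ?C'}) * (\<Prod>e\<in>{e \<in> E'. e \<subseteq> ?C'}. 1 + (m' e - 1) * Y)" for Y
  proof -
    have "(\<Sum>f\<in>?R. Y ^ multiplicity p (card (lifts V E m D.G f)))
      = (\<Sum>f\<in>?R. Y ^ multiplicity p (card (lifts V' E' m' D.G (A.F.T f))))"
    proof (rule sum.cong[OF HOL.refl])
      fix f assume f: "f \<in> ?R"
      show "Y ^ multiplicity p (card (lifts V E m D.G f)) = Y ^ multiplicity p (card (lifts V' E' m' D.G (A.F.T f)))"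
        using A.card_lifts[OF D.G.is_group c[OF f] D.linear_refl_acts[OF f]] by simp
    qed
    also have "\<dots> = (\<Sum>f\<in>?R'. Y ^ multiplicity p (card (lifts V' E' m' D.G f)))"
      by (rule sum.reindex_bij_betw[OF bij])
    finally show ?thesis
      using D.sum_refl_acts[OF A.fo _ A.edges_in_component[of r], of m Y] D.sum_refl_acts[OF B.fo _ B.edges_in_component[of "B.\<kappa> r"], of m' Y]
        cop dE dE' by auto
  qed
  show ?thesis
    by (rule mset_eq_of_products[of _ _ _ _ N, OF _ _ _ _ _ eq]) (use fin m2 m2' N in auto)
qed

end

text \<open>Fibres of equal size are matched separately, and the matchings are glued.\<close>

lemma exists_bij_of_equal_fibres:
  assumes "finite A" "finite B" and card: "\<And>k. card {x \<in> A. f x = k} = card {y \<in> B. g y = k}"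
  obtains h where "bij_betw h A B" "\<And>x. x \<in> A \<Longrightarrow> g (h x) = f x"
proof -
  have "\<forall>k. \<exists>h. bij_betw h {x \<in> A. f x = k} {y \<in> B. g y = k}"
    using card assms(1,2) by (auto intro!: finite_same_card_bij)
  then obtain H where H: "\<And>k. bij_betw (H k) {x \<in> A. f x = k} {y \<in> B. g y = k}" by metis
  define h where "h x = H (f x) x" for x
  have h: "h x \<in> B \<and> g (h x) = f x" if "x \<in> A" for x
    using bij_betw_apply[OF H[of "f x"], of x] that by (simp add: h_def)
  have "inj_on h A"
  proof (rule inj_onI)
    fix x y assume xy: "x \<in> A" "y \<in> A" "h x = h y"
    then have "f x = f y" using h by metis
    then show "x = y" using xy bij_betw_imp_inj_on[OF H[of "f x"]] by (auto simp: h_def dest: inj_onD)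
  qed
  moreover have "B \<subseteq> h ` A"
  proof
    fix y assume "y \<in> B"
    then have "y \<in> H (g y) ` {x \<in> A. f x = g y}" using bij_betw_imp_surj_on[OF H[of "g y"]] by simp
    then obtain x where "x \<in> A" "f x = g y" "y = H (g y) x" by blast
    then show "y \<in> h ` A" unfolding h_def by (intro image_eqI[of _ _ x]) simp_all
  qed
  ultimately have "bij_betw h A B" using h by (auto simp: bij_betw_def)
  then show ?thesis using that h by blast
qed

section \<open>Star normal form\<close>

text \<open>Actions without a finite support, so that the regular action of an infinite group is
  included.\<close>

definition gact :: "'a set \<Rightarrow> 'a set set \<Rightarrow> ('a set \<Rightarrow> nat) \<Rightarrow> ('a \<Rightarrow> 'x \<Rightarrow> 'x) \<Rightarrow> bool" where
  "gact V E m a \<longleftrightarrow> (\<forall>v\<in>V. a v \<circ> a v = id) \<and> (\<forall>v w. ({v, w} \<in> E) \<longrightarrow> ((a v \<circ> a w) ^^ m {v, w}) = id)"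

lemma gactD:
  assumes "gact V E m a"
  shows "v \<in> V \<Longrightarrow> a v \<circ> a v = id" "{v, w} \<in> E \<Longrightarrow> (a v \<circ> a w) ^^ m {v, w} = id"
  using assms unfolding gact_def by blast+

lemma ev_cong: "(\<And>v. v \<in> set xs \<Longrightarrow> a v = b v) \<Longrightarrow> ev a xs = ev b xs"
  by (induction xs) auto

lemma ev_concat: "ev a (concat (map F xs)) = ev (\<lambda>v. ev a (F v)) xs"
  by (induction xs) (simp_all add: ev_append)

lemma ev_rev_cancel:
  assumes "\<forall>v\<in>set k. a v \<circ> a v = id"
  shows "ev a (rev k) \<circ> ev a k = id" "ev a k \<circ> ev a (rev k) = id"
proof -
  have "ev a (rev k) \<circ> ev a k = id \<and> ev a k \<circ> ev a (rev k) = id"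
    using assms
  proof (induction k)
    case (Cons v k)
    have vv: "a v \<circ> a v = id" by (rule bspec[OF Cons.prems]) simp
    have "\<forall>v\<in>set k. a v \<circ> a v = id" by (intro ballI bspec[OF Cons.prems]) simp
    from Cons.IH[OF this] have IH: "ev a (rev k) \<circ> ev a k = id" "ev a k \<circ> ev a (rev k) = id" by (rule conjunct1, rule conjunct2)
    have "ev a (rev (v # k)) \<circ> ev a (v # k) = ev a (rev k) \<circ> (a v \<circ> a v) \<circ> ev a k" by (simp add: ev_append comp_assoc)
    moreover have "ev a (v # k) \<circ> ev a (rev (v # k)) = a v \<circ> (ev a k \<circ> ev a (rev k)) \<circ> a v" by (simp add: ev_append comp_assoc)
    ultimately show ?case unfolding vv IH by (simp only: comp_id IH vv simp_thms)
  qed simp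
  then show "ev a (rev k) \<circ> ev a k = id" "ev a k \<circ> ev a (rev k) = id" by auto
qed

lemma inverse_unique: "q' \<circ> q = id \<Longrightarrow> q \<circ> q'' = id \<Longrightarrow> q' = q''"
  by (metis comp_assoc comp_id id_comp)

lemma conj_power:
  assumes "q' \<circ> q = id" "q \<circ> q' = id"
  shows "(q \<circ> f \<circ> q') ^^ n = q \<circ> f ^^ n \<circ> q'"
proof (induction n)
  case (Suc n)
  have "(q \<circ> f \<circ> q') ^^ Suc n = q \<circ> f \<circ> (q' \<circ> q) \<circ> f ^^ n \<circ> q'" using Suc by (simp only: funpow.simps(2) comp_assoc)
  then show ?case by (simp only: assms comp_id funpow.simps(2) comp_assoc)
qed (simp only: funpow.simps(1) comp_id assms)

lemma conj_comp:
  assumes "q' \<circ> q = id"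
  shows "(q \<circ> f \<circ> q') \<circ> (q \<circ> g \<circ> q') = q \<circ> (f \<circ> g) \<circ> q'"
proof -
  have "(q \<circ> f \<circ> q') \<circ> (q \<circ> g \<circ> q') = q \<circ> f \<circ> (q' \<circ> q) \<circ> g \<circ> q'" by (simp only: comp_assoc)
  then show ?thesis by (simp only: assms comp_id comp_assoc)
qed

lemma conj_cancel:
  assumes "q' \<circ> q = id"
  shows "q' \<circ> (q \<circ> f \<circ> q') \<circ> q = f"
proof -
  have "q' \<circ> (q \<circ> f \<circ> q') \<circ> q = (q' \<circ> q) \<circ> f \<circ> (q' \<circ> q)" by (simp only: comp_assoc)
  then show ?thesis by (simp only: assms comp_id id_comp)
qed

lemma power_swap:
  fixes s t :: "'x \<Rightarrow> 'x"
  assumes "s \<circ> s = id" "t \<circ> t = id" "(s \<circ> t) ^^ n = id"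
  shows "(t \<circ> s) ^^ n = id"
  using funpow_invol_cancel[OF assms(1,2), of n] assms(3) by simp

lemma gact_coxeq:
  assumes a: "gact V E m a"
  shows "coxeq V E m xs ys \<Longrightarrow> ev a xs = ev a ys"
proof (induction rule: coxeq.induct)
  case (braid v w)
  then show ?case using gactD(2)[OF a] by (simp add: ev_replicate)
qed (use gactD(1)[OF a] in \<open>simp_all add: ev_append\<close>)

text \<open>The left regular action, continued by the identity. It is faithful, so congruence of
  words becomes equality of functions (\<open>ev_reg_eq_iff\<close>), and words can be manipulated
  by composing maps.\<close>

definition reg :: "'a set \<Rightarrow> 'a set set \<Rightarrow> ('a set \<Rightarrow> nat) \<Rightarrow> 'a \<Rightarrow> 'a list set \<Rightarrow> 'a list set" where
  "reg V E m v = (\<lambda>g. if g \<in> carrier (coxeter_group V E m) then cox_class V E m [v] \<otimes>\<^bsub>coxeter_group V E m\<^esub> g else g)"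

lemma ev_reg:
  assumes "set xs \<subseteq> V" "set ys \<subseteq> V"
  shows "ev (reg V E m) xs (cox_class V E m ys) = cox_class V E m (xs @ ys)"
  using assms(1)
proof (induction xs)
  case (Cons v xs)
  have "cox_class V E m (xs @ ys) \<in> carrier (coxeter_group V E m)" unfolding cox_carrier using Cons.prems assms(2) by (intro exI[of _ "xs @ ys"]) simp
  then show ?case using Cons cox_mult[of "[v]" V "xs @ ys" E m] assms(2) by (simp add: reg_def)
qed simp

lemma ev_reg_outside: "g \<notin> carrier (coxeter_group V E m) \<Longrightarrow> ev (reg V E m) xs g = g"
  by (induction xs) (simp_all add: reg_def)

lemma ev_reg_eq_iff:
  assumes "set xs \<subseteq> V" "set ys \<subseteq> V"
  shows "ev (reg V E m) xs = ev (reg V E m) ys \<longleftrightarrow> coxeq V E m xs ys"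
proof
  assume "ev (reg V E m) xs = ev (reg V E m) ys"
  then have "ev (reg V E m) xs (cox_class V E m []) = ev (reg V E m) ys (cox_class V E m [])" by simp
  then show "coxeq V E m xs ys" using assms by (simp add: ev_reg cox_class_eq_iff)
next
  assume c: "coxeq V E m xs ys"
  show "ev (reg V E m) xs = ev (reg V E m) ys"
  proof
    fix g
    show "ev (reg V E m) xs g = ev (reg V E m) ys g"
    proof (cases "g \<in> carrier (coxeter_group V E m)")
      case True
      then obtain zs where zs: "set zs \<subseteq> V" "g = cox_class V E m zs" unfolding cox_carrier by blast
      have "coxeq V E m (xs @ zs) (ys @ zs)" by (rule coxeq_cong[OF c coxeq.refl assms(2) zs(1)])
      then show ?thesis using assms zs by (simp add: ev_reg cox_class_eq_iff)
    qed (simp add: ev_reg_outside)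
  qed
qed

lemma gact_reg:
  assumes edges: "\<And>v w. {v, w} \<in> E \<Longrightarrow> v \<in> V \<and> w \<in> V"
  shows "gact V E m (reg V E m)"
  unfolding gact_def
proof (intro conjI ballI allI impI)
  fix v assume v: "v \<in> V"
  have "ev (reg V E m) [v, v] = ev (reg V E m) []" by (subst ev_reg_eq_iff) (use v in \<open>auto intro: coxeq.invol\<close>)
  then show "reg V E m v \<circ> reg V E m v = id" by simp
next
  fix v w assume e: "{v, w} \<in> E"
  note vw = edges[OF e]
  have "set (concat (replicate (m {v, w}) [v, w])) \<subseteq> V" using vw by auto
  then have "ev (reg V E m) (concat (replicate (m {v, w}) [v, w])) = ev (reg V E m) []"
    by (subst ev_reg_eq_iff) (use vw e in \<open>auto intro: coxeq.braid\<close>)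
  then show "((reg V E m v \<circ> reg V E m w) ^^ m {v, w}) = id" by (simp add: ev_replicate)
qed

text \<open>Von Dyck's criterion, with the relations of the images tested in the regular action of
  the target.\<close>

lemma coxeter_group_hom:
  assumes F: "\<And>v. v \<in> V \<Longrightarrow> set (F v) \<subseteq> V2" and g: "gact V E m (\<lambda>v. ev (reg V2 E2 m2) (F v))"
  obtains h where "h \<in> hom (coxeter_group V E m) (coxeter_group V2 E2 m2)"
    "\<And>xs. set xs \<subseteq> V \<Longrightarrow> h (cox_class V E m xs) = cox_class V2 E2 m2 (concat (map F xs))"
proof -
  define h where "h c = cox_class V2 E2 m2 (concat (map F (SOME xs. xs \<in> c)))" for c
  have Fs: "set (concat (map F xs)) \<subseteq> V2" if "set xs \<subseteq> V" for xs using F that by fastforce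
  have h: "h (cox_class V E m xs) = cox_class V2 E2 m2 (concat (map F xs))" if xs: "set xs \<subseteq> V" for xs
  proof -
    let ?x = "SOME zs. zs \<in> cox_class V E m xs"
    note x = cox_class_some[OF xs, of E m]
    have "ev (reg V2 E2 m2) (concat (map F xs)) = ev (reg V2 E2 m2) (concat (map F ?x))"
      unfolding ev_concat by (rule gact_coxeq[OF g x(2)])
    then show ?thesis
      unfolding h_def ev_reg_eq_iff[OF Fs[OF xs] Fs[OF x(1)]] by (rule cox_class_eq_iff[OF Fs[OF xs] Fs[OF x(1)], THEN iffD2, symmetric])
  qed
  have "h \<in> hom (coxeter_group V E m) (coxeter_group V2 E2 m2)"
  proof (rule homI)
    fix c assume "c \<in> carrier (coxeter_group V E m)"
    then obtain xs where "set xs \<subseteq> V" "c = cox_class V E m xs" unfolding cox_carrier by blast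
    then show "h c \<in> carrier (coxeter_group V2 E2 m2)" using h Fs unfolding cox_carrier by metis
  next
    fix c d assume "c \<in> carrier (coxeter_group V E m)" "d \<in> carrier (coxeter_group V E m)"
    then obtain xs ys where xs: "set xs \<subseteq> V" "c = cox_class V E m xs" and ys: "set ys \<subseteq> V" "d = cox_class V E m ys"
      unfolding cox_carrier by blast
    then have xy: "set (xs @ ys) \<subseteq> V" by simp
    show "h (c \<otimes>\<^bsub>coxeter_group V E m\<^esub> d) = h c \<otimes>\<^bsub>coxeter_group V2 E2 m2\<^esub> h d"
      unfolding xs(2) ys(2) cox_mult[OF xs(1) ys(1)] h[OF xs(1)] h[OF ys(1)] h[OF xy] cox_mult[OF Fs[OF xs(1)] Fs[OF ys(1)]] by simp
  qed
  then show ?thesis using h that by blast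
qed

lemma coxeter_iso:
  assumes F: "\<And>v. v \<in> V \<Longrightarrow> set (F v) \<subseteq> V2" and F2: "\<And>v. v \<in> V2 \<Longrightarrow> set (F2 v) \<subseteq> V"
    and g: "gact V E m (\<lambda>v. ev (reg V2 E2 m2) (F v))" and g2: "gact V2 E2 m2 (\<lambda>v. ev (reg V E m) (F2 v))"
    and inv: "\<And>v. v \<in> V \<Longrightarrow> ev (\<lambda>u. ev (reg V E m) (F2 u)) (F v) = reg V E m v"
    and inv2: "\<And>v. v \<in> V2 \<Longrightarrow> ev (\<lambda>u. ev (reg V2 E2 m2) (F u)) (F2 v) = reg V2 E2 m2 v"
  shows "coxeter_group V E m \<cong> coxeter_group V2 E2 m2"
proof -
  obtain h where h: "h \<in> hom (coxeter_group V E m) (coxeter_group V2 E2 m2)"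
    "\<And>xs. set xs \<subseteq> V \<Longrightarrow> h (cox_class V E m xs) = cox_class V2 E2 m2 (concat (map F xs))"
    using coxeter_group_hom[OF F g] by blast
  obtain h2 where h2: "h2 \<in> hom (coxeter_group V2 E2 m2) (coxeter_group V E m)"
    "\<And>xs. set xs \<subseteq> V2 \<Longrightarrow> h2 (cox_class V2 E2 m2 xs) = cox_class V E m (concat (map F2 xs))"
    using coxeter_group_hom[OF F2 g2] by blast
  have Fs: "set (concat (map F xs)) \<subseteq> V2" if "set xs \<subseteq> V" for xs using F that by fastforce
  have Fs2: "set (concat (map F2 xs)) \<subseteq> V" if "set xs \<subseteq> V2" for xs using F2 that by fastforce
  have "h2 (h c) = c" if c: "c \<in> carrier (coxeter_group V E m)" for c
  proof -
    obtain xs where xs: "set xs \<subseteq> V" "c = cox_class V E m xs" using c unfolding cox_carrier by blast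
    have "ev (reg V E m) (concat (map F2 (concat (map F xs)))) = ev (\<lambda>v. ev (\<lambda>u. ev (reg V E m) (F2 u)) (F v)) xs"
      by (simp only: ev_concat)
    also have "\<dots> = ev (reg V E m) xs" using xs(1) inv by (intro ev_cong) auto
    finally show ?thesis using ev_reg_eq_iff[OF Fs2[OF Fs[OF xs(1)]] xs(1)] cox_class_eq_iff[OF Fs2[OF Fs[OF xs(1)]] xs(1)]
      unfolding xs(2) h(2)[OF xs(1)] h2(2)[OF Fs[OF xs(1)]] by simp
  qed
  moreover have "h (h2 c) = c" if c: "c \<in> carrier (coxeter_group V2 E2 m2)" for c
  proof -
    obtain xs where xs: "set xs \<subseteq> V2" "c = cox_class V2 E2 m2 xs" using c unfolding cox_carrier by blast
    have "ev (reg V2 E2 m2) (concat (map F (concat (map F2 xs)))) = ev (\<lambda>v. ev (\<lambda>u. ev (reg V2 E2 m2) (F u)) (F2 v)) xs"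
      by (simp only: ev_concat)
    also have "\<dots> = ev (reg V2 E2 m2) xs" using xs(1) inv2 by (intro ev_cong) auto
    finally show ?thesis using ev_reg_eq_iff[OF Fs[OF Fs2[OF xs(1)]] xs(1)] cox_class_eq_iff[OF Fs[OF Fs2[OF xs(1)]] xs(1)]
      unfolding xs(2) h2(2)[OF xs(1)] h(2)[OF Fs2[OF xs(1)]] by simp
  qed
  ultimately have "bij_betw h (carrier (coxeter_group V E m)) (carrier (coxeter_group V2 E2 m2))"
    using hom_in_carrier[OF h(1)] hom_in_carrier[OF h2(1)] by (intro bij_betw_byWitness[where f' = h2]) auto
  then show ?thesis using h(1) unfolding is_iso_def iso_def by blast
qed

text \<open>An action of the group of a disjoint union of stars, given by the root map and by a
  label at each vertex that is not a root, without mention of edges.\<close>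

definition sact :: "'a set \<Rightarrow> ('a \<Rightarrow> 'a) \<Rightarrow> ('a \<Rightarrow> nat) \<Rightarrow> ('a \<Rightarrow> 'x \<Rightarrow> 'x) \<Rightarrow> bool" where
  "sact V \<rho> \<mu> b \<longleftrightarrow> (\<forall>v\<in>V. b v \<circ> b v = id \<and> (\<rho> v \<noteq> v \<longrightarrow> ((b (\<rho> v) \<circ> b v) ^^ \<mu> v) = id))"

lemma sactD:
  assumes "sact V \<rho> \<mu> b" "v \<in> V"
  shows "b v \<circ> b v = id" "\<rho> v \<noteq> v \<Longrightarrow> (b (\<rho> v) \<circ> b v) ^^ \<mu> v = id"
  using assms unfolding sact_def by blast+

definition star_edges :: "'a set \<Rightarrow> ('a \<Rightarrow> 'a) \<Rightarrow> 'a set set" where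
  "star_edges V \<rho> = {{\<rho> v, v} | v. v \<in> V \<and> \<rho> v \<noteq> v}"

text \<open>A star edge has exactly one end that is not a root; the sum over this single vertex
  extracts its label.\<close>

definition star_label :: "('a \<Rightarrow> 'a) \<Rightarrow> ('a \<Rightarrow> nat) \<Rightarrow> 'a set \<Rightarrow> nat" where
  "star_label \<rho> \<mu> e = (\<Sum>v\<in>{v \<in> e. \<rho> v \<noteq> v}. \<mu> v)"

lemma gact_star_iff:
  assumes \<rho>: "\<And>v. v \<in> V \<Longrightarrow> \<rho> v \<in> V \<and> \<rho> (\<rho> v) = \<rho> v"
  shows "gact V (star_edges V \<rho>) (star_label \<rho> \<mu>) b \<longleftrightarrow> sact V \<rho> \<mu> b"
proof -
  have lab: "star_label \<rho> \<mu> {\<rho> v, v} = \<mu> v" if v: "v \<in> V" "\<rho> v \<noteq> v" for v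
  proof -
    have "{x \<in> {\<rho> v, v}. \<rho> x \<noteq> x} = {v}" using v \<rho>[OF v(1)] by auto
    then show ?thesis unfolding star_label_def by simp
  qed
  show ?thesis
  proof
    assume g: "gact V (star_edges V \<rho>) (star_label \<rho> \<mu>) b"
    show "sact V \<rho> \<mu> b"
      unfolding sact_def
    proof (intro ballI conjI impI)
      fix v assume v: "v \<in> V"
      show "b v \<circ> b v = id" by (rule gactD(1)[OF g v])
      assume n: "\<rho> v \<noteq> v"
      then have "{\<rho> v, v} \<in> star_edges V \<rho>" using v unfolding star_edges_def by blast
      then show "((b (\<rho> v) \<circ> b v) ^^ \<mu> v) = id" using gactD(2)[OF g, of "\<rho> v" v] lab[OF v n] by simp
    qed
  next
    assume s: "sact V \<rho> \<mu> b"
    show "gact V (star_edges V \<rho>) (star_label \<rho> \<mu>) b"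
      unfolding gact_def
    proof (intro conjI ballI allI impI)
      fix v assume "v \<in> V" then show "b v \<circ> b v = id" by (rule sactD(1)[OF s])
    next
      fix x y assume "{x, y} \<in> star_edges V \<rho>"
      then obtain v where v: "{x, y} = {\<rho> v, v}" "v \<in> V" "\<rho> v \<noteq> v" unfolding star_edges_def by blast
      have r: "(b (\<rho> v) \<circ> b v) ^^ \<mu> v = id" by (rule sactD(2)[OF s v(2,3)])
      have r': "(b v \<circ> b (\<rho> v)) ^^ \<mu> v = id"
        by (rule power_swap[OF _ _ r]) (use sactD(1)[OF s] v(2) \<rho>[OF v(2)] in blast)+
      have "x = \<rho> v \<and> y = v \<or> x = v \<and> y = \<rho> v" using v(1) by (auto simp: doubleton_eq_iff)
      then show "((b x \<circ> b y) ^^ star_label \<rho> \<mu> {x, y}) = id"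
        unfolding v(1) lab[OF v(2,3)] using r r' by blast
    qed
  qed
qed

text \<open>\<open>F\<close> writes the generators of the forest group as words in star generators,
  and \<open>F2\<close> goes back. Words are tested on actions on the type
  \<open>'a list set\<close>, which carries both regular actions. The last clause is the invariant
  that lets the induction continue: every old generator is conjugate to its root by a word that does
  not depend on the action.\<close>

definition normal_form :: "'a set \<Rightarrow> 'a set set \<Rightarrow> ('a set \<Rightarrow> nat) \<Rightarrow> ('a \<Rightarrow> 'a) \<Rightarrow> ('a \<Rightarrow> nat) \<Rightarrow> ('a \<Rightarrow> 'a list) \<Rightarrow> ('a \<Rightarrow> 'a list) \<Rightarrow> bool" where
  "normal_form V E m \<rho> \<mu> F F2 \<longleftrightarrow>
    (\<forall>v\<in>V. \<rho> v \<in> V \<and> \<rho> (\<rho> v) = \<rho> v \<and> set (F v) \<subseteq> V \<and> set (F2 v) \<subseteq> V) \<and>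
    (\<forall>v\<in>V. (v, \<rho> v) \<in> {(x, y). {x, y} \<in> E}\<^sup>*) \<and>
    (\<forall>u w. ({u, w} \<in> E) \<longrightarrow> \<rho> u = \<rho> w) \<and>
    (\<forall>r. image_mset \<mu> (mset_set {v \<in> V. \<rho> v = r \<and> v \<noteq> r}) = image_mset m (mset_set {e \<in> E. e \<subseteq> {v \<in> V. \<rho> v = r}})) \<and>
    (\<forall>b :: 'a \<Rightarrow> 'a list set \<Rightarrow> 'a list set. sact V \<rho> \<mu> b \<longrightarrow>
      gact V E m (\<lambda>v. ev b (F v)) \<and> (\<forall>v\<in>V. ev (\<lambda>u. ev b (F u)) (F2 v) = b v)) \<and>
    (\<forall>a :: 'a \<Rightarrow> 'a list set \<Rightarrow> 'a list set. gact V E m a \<longrightarrow>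
      sact V \<rho> \<mu> (\<lambda>v. ev a (F2 v)) \<and> (\<forall>v\<in>V. ev (\<lambda>u. ev a (F2 u)) (F v) = a v)) \<and>
    (\<forall>v\<in>V. \<exists>k. set k \<subseteq> V \<and> (\<forall>b :: 'a \<Rightarrow> 'a list set \<Rightarrow> 'a list set. sact V \<rho> \<mu> b \<longrightarrow>
      ev b (F v) = ev b k \<circ> b (\<rho> v) \<circ> ev b (rev k)))"

lemma normal_formI:
  fixes V :: "'a set"
  assumes "\<And>v. v \<in> V \<Longrightarrow> \<rho> v \<in> V \<and> \<rho> (\<rho> v) = \<rho> v \<and> set (F v) \<subseteq> V \<and> set (F2 v) \<subseteq> V"
    "\<And>v. v \<in> V \<Longrightarrow> (v, \<rho> v) \<in> {(x, y). {x, y} \<in> E}\<^sup>*"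
    "\<And>u w. {u, w} \<in> E \<Longrightarrow> \<rho> u = \<rho> w"
    "\<And>r. image_mset \<mu> (mset_set {v \<in> V. \<rho> v = r \<and> v \<noteq> r}) = image_mset m (mset_set {e \<in> E. e \<subseteq> {v \<in> V. \<rho> v = r}})"
    "\<And>b :: 'a \<Rightarrow> 'a list set \<Rightarrow> 'a list set. sact V \<rho> \<mu> b \<Longrightarrow> gact V E m (\<lambda>v. ev b (F v))"
    "\<And>(b :: 'a \<Rightarrow> 'a list set \<Rightarrow> 'a list set) v. sact V \<rho> \<mu> b \<Longrightarrow> v \<in> V \<Longrightarrow> ev (\<lambda>u. ev b (F u)) (F2 v) = b v"
    "\<And>a :: 'a \<Rightarrow> 'a list set \<Rightarrow> 'a list set. gact V E m a \<Longrightarrow> sact V \<rho> \<mu> (\<lambda>v. ev a (F2 v))"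
    "\<And>(a :: 'a \<Rightarrow> 'a list set \<Rightarrow> 'a list set) v. gact V E m a \<Longrightarrow> v \<in> V \<Longrightarrow> ev (\<lambda>u. ev a (F2 u)) (F v) = a v"
    "\<And>v. v \<in> V \<Longrightarrow> \<exists>k. set k \<subseteq> V \<and> (\<forall>b :: 'a \<Rightarrow> 'a list set \<Rightarrow> 'a list set. sact V \<rho> \<mu> b \<longrightarrow>
      ev b (F v) = ev b k \<circ> b (\<rho> v) \<circ> ev b (rev k))"
  shows "normal_form V E m \<rho> \<mu> F F2"
  unfolding normal_form_def using assms by (intro conjI ballI allI impI) blast+

lemma normal_formD:
  fixes V :: "'a set" and a b :: "'a \<Rightarrow> 'a list set \<Rightarrow> 'a list set"
  assumes "normal_form V E m \<rho> \<mu> F F2"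
  shows "v \<in> V \<Longrightarrow> \<rho> v \<in> V" "v \<in> V \<Longrightarrow> \<rho> (\<rho> v) = \<rho> v" "v \<in> V \<Longrightarrow> set (F v) \<subseteq> V" "v \<in> V \<Longrightarrow> set (F2 v) \<subseteq> V"
    "v \<in> V \<Longrightarrow> (v, \<rho> v) \<in> {(x, y). {x, y} \<in> E}\<^sup>*"
    "{u, w} \<in> E \<Longrightarrow> \<rho> u = \<rho> w"
    "image_mset \<mu> (mset_set {v \<in> V. \<rho> v = r \<and> v \<noteq> r}) = image_mset m (mset_set {e \<in> E. e \<subseteq> {v \<in> V. \<rho> v = r}})"
    "sact V \<rho> \<mu> b \<Longrightarrow> gact V E m (\<lambda>v. ev b (F v))"
    "sact V \<rho> \<mu> b \<Longrightarrow> v \<in> V \<Longrightarrow> ev (\<lambda>u. ev b (F u)) (F2 v) = b v"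
    "gact V E m a \<Longrightarrow> sact V \<rho> \<mu> (\<lambda>v. ev a (F2 v))"
    "gact V E m a \<Longrightarrow> v \<in> V \<Longrightarrow> ev (\<lambda>u. ev a (F2 u)) (F v) = a v"
    "v \<in> V \<Longrightarrow> \<exists>k. set k \<subseteq> V \<and> (\<forall>b :: 'a \<Rightarrow> 'a list set \<Rightarrow> 'a list set. sact V \<rho> \<mu> b \<longrightarrow>
      ev b (F v) = ev b k \<circ> b (\<rho> v) \<circ> ev b (rev k))"
  using assms unfolding normal_form_def by blast+

lemma normal_form_isolated:
  assumes fo: "forest V E" and nf: "normal_form V E m \<rho> \<mu> F F2" and w: "w \<notin> V"
  shows "normal_form (insert w V) E m (\<rho>(w := w)) \<mu> (F(w := [w])) (F2(w := [w]))"
proof -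
  note N = normal_formD[OF nf]
  have ne: "x \<noteq> w" if "x \<in> V" for x using that w by blast
  have edge: "x \<in> V \<and> y \<in> V" if e: "{x, y} \<in> E" for x y using forest_edge[OF fo e] by (auto simp: doubleton_eq_iff)
  have Fs: "ev c (xs :: 'a list) = ev d xs" if "set xs \<subseteq> V" "\<And>x. x \<in> V \<Longrightarrow> c x = d x" for xs and c d :: "'a \<Rightarrow> 'a list set \<Rightarrow> 'a list set"
    using that by (intro ev_cong) auto
  have s: "sact V \<rho> \<mu> b \<and> b w \<circ> b w = id" if "sact (insert w V) (\<rho>(w := w)) \<mu> b" for b :: "'a \<Rightarrow> 'a list set \<Rightarrow> 'a list set"
    using that ne unfolding sact_def by simp
  have g: "gact V E m a \<and> a w \<circ> a w = id" if "gact (insert w V) E m a" for a :: "'a \<Rightarrow> 'a list set \<Rightarrow> 'a list set"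
    using that unfolding gact_def by blast
  show ?thesis
  proof (rule normal_formI)
    fix v assume "v \<in> insert w V"
    then show "(\<rho>(w := w)) v \<in> insert w V \<and> (\<rho>(w := w)) ((\<rho>(w := w)) v) = (\<rho>(w := w)) v \<and> set ((F(w := [w])) v) \<subseteq> insert w V \<and> set ((F2(w := [w])) v) \<subseteq> insert w V"
      using N(1-4)[of v] ne by (cases "v = w") auto
  next
    fix v assume "v \<in> insert w V"
    then show "(v, (\<rho>(w := w)) v) \<in> {(x, y). {x, y} \<in> E}\<^sup>*" using N(5)[of v] by (cases "v = w") auto
  next
    fix u x assume e: "{u, x} \<in> E"
    then show "(\<rho>(w := w)) u = (\<rho>(w := w)) x" using N(6)[OF e] edge[OF e] ne by simp
  next
    fix r
    have 1: "{v \<in> insert w V. (\<rho>(w := w)) v = r \<and> v \<noteq> r} = {v \<in> V. \<rho> v = r \<and> v \<noteq> r}" using ne by auto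
    have "e \<subseteq> {v \<in> insert w V. (\<rho>(w := w)) v = r} \<longleftrightarrow> e \<subseteq> {v \<in> V. \<rho> v = r}" if "e \<in> E" for e
      using forest_edge[OF fo that] ne by auto
    then have 2: "{e \<in> E. e \<subseteq> {v \<in> insert w V. (\<rho>(w := w)) v = r}} = {e \<in> E. e \<subseteq> {v \<in> V. \<rho> v = r}}" by blast
    show "image_mset \<mu> (mset_set {v \<in> insert w V. (\<rho>(w := w)) v = r \<and> v \<noteq> r}) = image_mset m (mset_set {e \<in> E. e \<subseteq> {v \<in> insert w V. (\<rho>(w := w)) v = r}})"
      unfolding 1 2 by (rule N(7))
  next
    fix b :: "'a \<Rightarrow> 'a list set \<Rightarrow> 'a list set" assume "sact (insert w V) (\<rho>(w := w)) \<mu> b"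
    then have b: "sact V \<rho> \<mu> b" "b w \<circ> b w = id" using s by auto
    show "gact (insert w V) E m (\<lambda>v. ev b ((F(w := [w])) v))"
      unfolding gact_def
    proof (intro conjI ballI allI impI)
      fix v assume "v \<in> insert w V"
      then show "ev b ((F(w := [w])) v) \<circ> ev b ((F(w := [w])) v) = id"
        using b gactD(1)[OF N(8)[OF b(1)], of v] by (cases "v = w") auto
    next
      fix x y assume e: "{x, y} \<in> E"
      then show "((ev b ((F(w := [w])) x) \<circ> ev b ((F(w := [w])) y)) ^^ m {x, y}) = id"
        using gactD(2)[OF N(8)[OF b(1)] e] edge[OF e] ne by simp
    qed
    fix v assume v: "v \<in> insert w V"
    show "ev (\<lambda>u. ev b ((F(w := [w])) u)) ((F2(w := [w])) v) = b v"
    proof (cases "v = w")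
      case False
      then have v: "v \<in> V" using v by simp
      have "ev (\<lambda>u. ev b ((F(w := [w])) u)) (F2 v) = ev (\<lambda>u. ev b (F u)) (F2 v)"
        by (rule Fs[OF N(4)[OF v]]) (use ne in auto)
      then show ?thesis using N(9)[OF b(1) v] False by simp
    qed simp
  next
    fix a :: "'a \<Rightarrow> 'a list set \<Rightarrow> 'a list set" assume "gact (insert w V) E m a"
    then have a: "gact V E m a" "a w \<circ> a w = id" using g by auto
    show "sact (insert w V) (\<rho>(w := w)) \<mu> (\<lambda>v. ev a ((F2(w := [w])) v))"
      unfolding sact_def
    proof (intro ballI conjI impI)
      fix v assume "v \<in> insert w V"
      then show "ev a ((F2(w := [w])) v) \<circ> ev a ((F2(w := [w])) v) = id"
        using a sactD(1)[OF N(10)[OF a(1)], of v] by (cases "v = w") auto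
    next
      fix v assume "v \<in> insert w V" "(\<rho>(w := w)) v \<noteq> v"
      then have v: "v \<in> V" "v \<noteq> w" "\<rho> v \<noteq> v" by (auto split: if_splits)
      then show "((ev a ((F2(w := [w])) ((\<rho>(w := w)) v)) \<circ> ev a ((F2(w := [w])) v)) ^^ \<mu> v) = id"
        using sactD(2)[OF N(10)[OF a(1)] v(1,3)] N(1)[OF v(1)] ne by simp
    qed
    fix v assume v: "v \<in> insert w V"
    show "ev (\<lambda>u. ev a ((F2(w := [w])) u)) ((F(w := [w])) v) = a v"
    proof (cases "v = w")
      case False
      then have v: "v \<in> V" using v by simp
      have "ev (\<lambda>u. ev a ((F2(w := [w])) u)) (F v) = ev (\<lambda>u. ev a (F2 u)) (F v)"
        by (rule Fs[OF N(3)[OF v]]) (use ne in auto)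
      then show ?thesis using N(11)[OF a(1) v] False by simp
    qed simp
  next
    fix v assume v: "v \<in> insert w V"
    show "\<exists>k. set k \<subseteq> insert w V \<and> (\<forall>b :: 'a \<Rightarrow> 'a list set \<Rightarrow> 'a list set. sact (insert w V) (\<rho>(w := w)) \<mu> b \<longrightarrow>
      ev b ((F(w := [w])) v) = ev b k \<circ> b ((\<rho>(w := w)) v) \<circ> ev b (rev k))"
    proof (cases "v = w")
      case True
      then show ?thesis by (intro exI[of _ "[]"]) simp
    next
      case False
      then obtain k where "set k \<subseteq> V" "\<forall>b :: 'a \<Rightarrow> 'a list set \<Rightarrow> 'a list set. sact V \<rho> \<mu> b \<longrightarrow>
        ev b (F v) = ev b k \<circ> b (\<rho> v) \<circ> ev b (rev k)" using N(12)[of v] v by blast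
      then show ?thesis using s False by (intro exI[of _ k]) auto
    qed
  qed
qed


lemma odd_conjugate:
  assumes inv: "b s \<circ> b s = id" "b t \<circ> b t = id" and rel: "(b s \<circ> b t) ^^ (2 * j + 1) = id"
  shows "b t = ev b (rev (concat (replicate j [t, s]))) \<circ> b s \<circ> ev b (concat (replicate j [t, s]))"
proof -
  let ?q = "ev b (concat (replicate j [t, s]))" and ?q' = "ev b (rev (concat (replicate j [t, s])))"
  have "set (concat (replicate j [t, s])) \<subseteq> {t, s}" by (induction j) auto
  then have "\<forall>v\<in>set (concat (replicate j [t, s])). b v \<circ> b v = id" using inv by blast
  then have qq: "?q' \<circ> ?q = id" by (rule ev_rev_cancel)
  have "b s \<circ> ?q = ?q \<circ> b t" using odd_dihedral_conjugate[OF inv rel] by (simp only: ev_replicate ev_simps comp_id)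
  then have "?q' \<circ> b s \<circ> ?q = (?q' \<circ> ?q) \<circ> b t" by (simp only: comp_assoc)
  then show ?thesis by (simp only: qq id_comp)
qed

text \<open>In star generators \<open>u\<close> is the conjugate of its root by a word
  \<open>k\<close>. Conjugating the new generator back by \<open>k\<close> moves the new edge from
  \<open>u\<close> to the root and keeps its label. As the label is odd, the new generator is in
  turn conjugate to the root, which restores the last clause.\<close>

lemma normal_form_leaf:
  fixes V :: "'a set" and m :: "'a set \<Rightarrow> nat"
  assumes fo: "forest V E" and nf: "normal_form V E m \<rho> \<mu> F F2" and u: "u \<in> V" and w: "w \<notin> V"
    and odd: "odd (m {u, w})"
  shows "\<exists>\<rho> \<mu> F F2. normal_form (insert w V) (insert {u, w} E) m \<rho> \<mu> F F2"
proof -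
  note N = normal_formD[OF nf]
  obtain j where j: "m {u, w} = 2 * j + 1" using odd by (elim oddE)
  have ne: "x \<noteq> w" if "x \<in> V" for x using that w by blast
  have edge: "x \<in> V \<and> y \<in> V" if e: "{x, y} \<in> E" for x y using forest_edge[OF fo e] by (auto simp: doubleton_eq_iff)
  have new_edge: "{u, w} \<notin> E" by (rule forest_new_edge(1)[OF fo w])
  obtain k where k: "set k \<subseteq> V" and kb: "\<forall>b :: 'a \<Rightarrow> 'a list set \<Rightarrow> 'a list set. sact V \<rho> \<mu> b \<longrightarrow>
      ev b (F u) = ev b k \<circ> b (\<rho> u) \<circ> ev b (rev k)" using N(12)[OF u] by blast
  \<comment> \<open>The conjugating word rewritten in the forest generators; the change of variables
    needs it on either side.\<close>
  define K where "K = concat (map F2 k)"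
  have K: "set K \<subseteq> V" using k N(4) by (fastforce simp: K_def)
  define \<rho>1 where "\<rho>1 = \<rho>(w := \<rho> u)"
  define \<mu>1 where "\<mu>1 = \<mu>(w := m {u, w})"
  define F1 where "F1 = F(w := k @ [w] @ rev k)"
  define F3 where "F3 = F2(w := rev K @ [w] @ K)"
  have old: "\<rho>1 x = \<rho> x" "\<mu>1 x = \<mu> x" "F1 x = F x" "F3 x = F2 x" if "x \<in> V" for x
    using ne[OF that] by (auto simp: \<rho>1_def \<mu>1_def F1_def F3_def)
  have new: "\<rho>1 w = \<rho> u" "\<mu>1 w = m {u, w}" "F1 w = k @ [w] @ rev k" "F3 w = rev K @ [w] @ K"
    by (auto simp: \<rho>1_def \<mu>1_def F1_def F3_def)
  have ru: "\<rho> u \<in> V" by (rule N(1)[OF u])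
  have Fs: "ev c (xs :: 'a list) = ev d xs" if "set xs \<subseteq> V" "\<And>x. x \<in> V \<Longrightarrow> c x = d x" for xs and c d :: "'a \<Rightarrow> 'a list set \<Rightarrow> 'a list set"
    using that by (intro ev_cong) auto
  have s: "sact V \<rho> \<mu> b" "b w \<circ> b w = id" "(b (\<rho> u) \<circ> b w) ^^ m {u, w} = id"
    if b: "sact (insert w V) \<rho>1 \<mu>1 b" for b :: "'a \<Rightarrow> 'a list set \<Rightarrow> 'a list set"
  proof -
    show "sact V \<rho> \<mu> b" unfolding sact_def
    proof (intro ballI conjI impI)
      fix v assume v: "v \<in> V"
      show "b v \<circ> b v = id" by (rule sactD(1)[OF b]) (use v in simp)
      assume "\<rho> v \<noteq> v"
      then show "((b (\<rho> v) \<circ> b v) ^^ \<mu> v) = id" using sactD(2)[OF b, of v] old[OF v] v by simp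
    qed
    show "b w \<circ> b w = id" by (rule sactD(1)[OF b]) simp
    show "(b (\<rho> u) \<circ> b w) ^^ m {u, w} = id" using sactD(2)[OF b, of w] new ne[OF ru] by simp
  qed
  have g: "gact V E m a" "a w \<circ> a w = id" "(a u \<circ> a w) ^^ m {u, w} = id"
    if a: "gact (insert w V) (insert {u, w} E) m a" for a :: "'a \<Rightarrow> 'a list set \<Rightarrow> 'a list set"
  proof -
    show "gact V E m a" unfolding gact_def
    proof (intro conjI ballI allI impI)
      fix v assume "v \<in> V" then show "a v \<circ> a v = id" by (intro gactD(1)[OF a]) simp
    next
      fix x y assume "{x, y} \<in> E" then show "((a x \<circ> a y) ^^ m {x, y}) = id" by (intro gactD(2)[OF a]) simp
    qed
    show "a w \<circ> a w = id" by (rule gactD(1)[OF a]) simp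
    show "(a u \<circ> a w) ^^ m {u, w} = id" by (rule gactD(2)[OF a]) simp
  qed
  have main_b: "gact (insert w V) (insert {u, w} E) m (\<lambda>v. ev b (F1 v)) \<and> (\<forall>v\<in>insert w V. ev (\<lambda>u. ev b (F1 u)) (F3 v) = b v)"
    if b1: "sact (insert w V) \<rho>1 \<mu>1 b" for b :: "'a \<Rightarrow> 'a list set \<Rightarrow> 'a list set"
  proof -
    note b = s[OF b1]
    note G = N(8)[OF b(1)]
    have "\<forall>v\<in>set k. b v \<circ> b v = id" using k sactD(1)[OF b(1)] by blast
    note kk = ev_rev_cancel[OF this]
    define f where "f = (\<lambda>v. ev b (F1 v))"
    have fV: "f x = ev b (F x)" if "x \<in> V" for x using old[OF that] by (simp add: f_def)
    have fw: "f w = ev b k \<circ> b w \<circ> ev b (rev k)" by (simp add: f_def new ev_append comp_assoc)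
    have fu: "f u = ev b k \<circ> b (\<rho> u) \<circ> ev b (rev k)" using kb b(1) fV[OF u] by simp
    have finv: "f v \<circ> f v = id" if "v \<in> insert w V" for v
    proof (cases "v = w")
      case True
      show ?thesis unfolding True fw conj_comp[OF kk(1)] b(2) by (simp only: comp_id kk)
    next
      case False
      then have v: "v \<in> V" using that by simp
      show ?thesis unfolding fV[OF v] by (rule gactD(1)[OF G v])
    qed
    have rel: "(f u \<circ> f w) ^^ m {u, w} = id"
      unfolding fu fw conj_comp[OF kk(1)] conj_power[OF kk] b(3) by (simp only: comp_id kk)
    have gf: "gact (insert w V) (insert {u, w} E) m f" unfolding gact_def
    proof (intro conjI ballI allI impI)
      fix v assume "v \<in> insert w V" then show "f v \<circ> f v = id" by (rule finv)
    next
      fix x y assume e: "{x, y} \<in> insert {u, w} E"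
      show "((f x \<circ> f y) ^^ m {x, y}) = id"
      proof (cases "{x, y} \<in> E")
        case True
        then have "x \<in> V" "y \<in> V" using edge by auto
        then show ?thesis unfolding fV[OF \<open>x \<in> V\<close>] fV[OF \<open>y \<in> V\<close>] by (intro gactD(2)[OF G True])
      next
        case False
        then have xy: "{x, y} = {u, w}" using e by simp
        have rel': "(f w \<circ> f u) ^^ m {u, w} = id" by (rule power_swap[OF finv finv rel]) (use u in simp_all)
        have "x = u \<and> y = w \<or> x = w \<and> y = u" using xy by (auto simp: doubleton_eq_iff)
        then show ?thesis unfolding xy using rel rel' by blast
      qed
    qed
    have oldinv: "ev f (F2 v) = b v" if v: "v \<in> V" for v
    proof -
      have "ev f (F2 v) = ev (\<lambda>u. ev b (F u)) (F2 v)" by (rule Fs[OF N(4)[OF v]]) (rule fV)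
      then show ?thesis using N(9)[OF b(1) v] by simp
    qed
    have fK: "ev f K = ev b k" unfolding K_def ev_concat by (rule Fs[OF k oldinv])
    have "\<forall>v\<in>set K. f v \<circ> f v = id" using K finv by blast
    note KK = ev_rev_cancel[OF this]
    \<comment> \<open>Reversing \<open>K\<close> also reverses the substituted words, so it does not
      match \<open>rev k\<close> letter by letter; the two are identified as inverses of the same
      map.\<close>
    have fK': "ev f (rev K) = ev b (rev k)" by (rule inverse_unique[OF KK(1)]) (simp only: fK kk)
    have "ev f (F3 v) = b v" if "v \<in> insert w V" for v
    proof (cases "v = w")
      case True
      have "ev f (F3 w) = ev b (rev k) \<circ> (ev b k \<circ> b w \<circ> ev b (rev k)) \<circ> ev b k"
        by (simp add: new ev_append fK fK' fw comp_assoc)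
      then show ?thesis unfolding True conj_cancel[OF kk(1)] .
    next
      case False
      then have "v \<in> V" using that by simp
      then show ?thesis using oldinv old(4) by simp
    qed
    then show ?thesis using gf unfolding f_def by blast
  qed
  have main_a: "sact (insert w V) \<rho>1 \<mu>1 (\<lambda>v. ev a (F3 v)) \<and> (\<forall>v\<in>insert w V. ev (\<lambda>u. ev a (F3 u)) (F1 v) = a v)"
    if a1: "gact (insert w V) (insert {u, w} E) m a" for a :: "'a \<Rightarrow> 'a list set \<Rightarrow> 'a list set"
  proof -
    note a = g[OF a1]
    note S = N(10)[OF a(1)]
    define d where "d = (\<lambda>v. ev a (F3 v))"
    have dV: "d x = ev a (F2 x)" if "x \<in> V" for x using old[OF that] by (simp add: d_def)
    have "\<forall>v\<in>set K. a v \<circ> a v = id" using K gactD(1)[OF a(1)] by blast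
    note KK = ev_rev_cancel[OF this]
    have "\<forall>v\<in>set k. d v \<circ> d v = id"
    proof
      fix v assume "v \<in> set k"
      then have v: "v \<in> V" using k by blast
      show "d v \<circ> d v = id" unfolding dV[OF v] by (rule sactD(1)[OF S v])
    qed
    note kk = ev_rev_cancel[OF this]
    have dk: "ev d k = ev a K" unfolding K_def ev_concat by (rule Fs[OF k dV])
    have dk': "ev d (rev k) = ev a (rev K)" by (rule inverse_unique[OF kk(1)]) (simp only: dk KK)
    have dw: "d w = ev a (rev K) \<circ> a w \<circ> ev a K" by (simp add: d_def new ev_append comp_assoc)
    have sd: "sact V \<rho> \<mu> d" unfolding sact_def
    proof (intro ballI conjI impI)
      fix v assume v: "v \<in> V"
      show "d v \<circ> d v = id" unfolding dV[OF v] by (rule sactD(1)[OF S v])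
      assume "\<rho> v \<noteq> v"
      then show "((d (\<rho> v) \<circ> d v) ^^ \<mu> v) = id" unfolding dV[OF v] dV[OF N(1)[OF v]] by (rule sactD(2)[OF S v])
    qed
    have oldinv: "ev d (F v) = a v" if v: "v \<in> V" for v
    proof -
      have "ev d (F v) = ev (\<lambda>u. ev a (F2 u)) (F v)" by (rule Fs[OF N(3)[OF v]]) (rule dV)
      then show ?thesis using N(11)[OF a(1) v] by simp
    qed
    have "a u = ev d k \<circ> d (\<rho> u) \<circ> ev d (rev k)" using kb sd oldinv[OF u] by metis
    then have "ev d (rev k) \<circ> a u \<circ> ev d k = d (\<rho> u)" using conj_cancel[OF kk(1)] by simp
    then have dr: "d (\<rho> u) = ev a (rev K) \<circ> a u \<circ> ev a K" unfolding dk dk' by simp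
    have "sact (insert w V) \<rho>1 \<mu>1 d" unfolding sact_def
    proof (intro ballI conjI impI)
      fix v assume v: "v \<in> insert w V"
      show "d v \<circ> d v = id"
      proof (cases "v = w")
        case True
        show ?thesis unfolding True dw conj_comp[OF KK(2)] a(2) by (simp only: comp_id KK)
      next
        case False
        then show ?thesis using v sactD(1)[OF sd] by blast
      qed
      assume r: "\<rho>1 v \<noteq> v"
      show "((d (\<rho>1 v) \<circ> d v) ^^ \<mu>1 v) = id"
      proof (cases "v = w")
        case True
        show ?thesis unfolding True new dw dr conj_comp[OF KK(2)] conj_power[OF KK(2,1)] a(3) by (simp only: comp_id KK)
      next
        case False
        then have "v \<in> V" using v by simp
        then show ?thesis using sactD(2)[OF sd] r old by metis
      qed
    qed
    moreover have "ev d (F1 v) = a v" if "v \<in> insert w V" for v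
    proof (cases "v = w")
      case True
      have "ev d (F1 w) = ev a K \<circ> (ev a (rev K) \<circ> a w \<circ> ev a K) \<circ> ev a (rev K)"
        by (simp add: new ev_append dk dk' dw comp_assoc)
      then show ?thesis unfolding True conj_cancel[OF KK(2)] .
    next
      case False
      then have "v \<in> V" using that by simp
      then show ?thesis using oldinv old(3) by simp
    qed
    ultimately show ?thesis unfolding d_def by blast
  qed
  have "normal_form (insert w V) (insert {u, w} E) m \<rho>1 \<mu>1 F1 F3"
  proof (rule normal_formI)
    fix v assume v: "v \<in> insert w V"
    show "\<rho>1 v \<in> insert w V \<and> \<rho>1 (\<rho>1 v) = \<rho>1 v \<and> set (F1 v) \<subseteq> insert w V \<and> set (F3 v) \<subseteq> insert w V"
    proof (cases "v = w")
      case True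
      then show ?thesis using new old(1)[OF ru] ru N(2)[OF u] k K by auto
    next
      case False
      then have "v \<in> V" using v by simp
      then show ?thesis using old N(1-4)[of v] by auto
    qed
    have mono: "{(x, y). {x, y} \<in> E}\<^sup>* \<subseteq> {(x, y). {x, y} \<in> insert {u, w} E}\<^sup>*" by (rule rtrancl_mono) auto
    show "(v, \<rho>1 v) \<in> {(x, y). {x, y} \<in> insert {u, w} E}\<^sup>*"
    proof (cases "v = w")
      case True
      have "(w, u) \<in> {(x, y). {x, y} \<in> insert {u, w} E}" by (simp add: insert_commute)
      moreover have "(u, \<rho> u) \<in> {(x, y). {x, y} \<in> insert {u, w} E}\<^sup>*" using N(5)[OF u] mono by blast
      ultimately show ?thesis unfolding True new by (rule converse_rtrancl_into_rtrancl)
    next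
      case False
      then have v: "v \<in> V" using v by simp
      then show ?thesis using N(5)[OF v] mono old(1)[OF v] by auto
    qed
  next
    fix x y assume e: "{x, y} \<in> insert {u, w} E"
    show "\<rho>1 x = \<rho>1 y"
    proof (cases "{x, y} \<in> E")
      case True
      have "\<rho> x = \<rho> y" by (rule N(6)[OF True])
      then show ?thesis using edge[OF True] old(1) by simp
    next
      case False
      then have "{x, y} = {u, w}" using e by simp
      then have "x = u \<and> y = w \<or> x = w \<and> y = u" by (auto simp: doubleton_eq_iff)
      then show ?thesis using new(1) old(1)[OF u] by auto
    qed
  next
    fix r
    have fin: "finite V" "finite E" using forest_finite[OF fo] by auto
    let ?A = "{v \<in> V. \<rho> v = r \<and> v \<noteq> r}" and ?B = "{e \<in> E. e \<subseteq> {v \<in> V. \<rho> v = r}}"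
    let ?A1 = "{v \<in> insert w V. \<rho>1 v = r \<and> v \<noteq> r}" and ?B1 = "{e \<in> insert {u, w} E. e \<subseteq> {v \<in> insert w V. \<rho>1 v = r}}"
    have Aeq: "?A1 = (if \<rho> u = r then insert w ?A else ?A)" using new(1) old(1) ne ru by auto
    have sub: "e \<subseteq> {v \<in> insert w V. \<rho>1 v = r} \<longleftrightarrow> e \<subseteq> {v \<in> V. \<rho> v = r}" if "e \<in> E" for e
    proof -
      have "e \<subseteq> V" using forest_edge[OF fo that] by auto
      then have "\<forall>x\<in>e. x \<in> V \<and> \<rho>1 x = \<rho> x" using old(1) by blast
      then show ?thesis unfolding subset_iff mem_Collect_eq by (metis insertCI)
    qed
    have uw: "{u, w} \<subseteq> {v \<in> insert w V. \<rho>1 v = r} \<longleftrightarrow> \<rho> u = r" using new(1) old(1)[OF u] u by auto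
    have Beq: "?B1 = (if \<rho> u = r then insert {u, w} ?B else ?B)" using sub uw by auto
    have "image_mset \<mu>1 (mset_set ?A) = image_mset \<mu> (mset_set ?A)" using old(2) fin by (intro image_mset_cong) auto
    then have IH: "image_mset \<mu>1 (mset_set ?A) = image_mset m (mset_set ?B)" using N(7)[of r] by simp
    have "w \<notin> ?A" "{u, w} \<notin> ?B" using w new_edge by auto
    then show "image_mset \<mu>1 (mset_set ?A1) = image_mset m (mset_set ?B1)"
      unfolding Aeq Beq using IH fin new(2) by simp
  next
    fix v assume v: "v \<in> insert w V"
    show "\<exists>k. set k \<subseteq> insert w V \<and> (\<forall>b :: 'a \<Rightarrow> 'a list set \<Rightarrow> 'a list set. sact (insert w V) \<rho>1 \<mu>1 b \<longrightarrow>
      ev b (F1 v) = ev b k \<circ> b (\<rho>1 v) \<circ> ev b (rev k))"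
    proof (cases "v = w")
      case True
      \<comment> \<open>By \<open>odd_conjugate\<close> this alternating word carries the new star
        generator to the root.\<close>
      let ?c = "concat (replicate j [w, \<rho> u])"
      have c: "set ?c \<subseteq> insert w V" using ru by (induction j) auto
      have "ev b (F1 w) = ev b (k @ rev ?c) \<circ> b (\<rho> u) \<circ> ev b (rev (k @ rev ?c))" if b1: "sact (insert w V) \<rho>1 \<mu>1 b"
        for b :: "'a \<Rightarrow> 'a list set \<Rightarrow> 'a list set"
      proof -
        note b = s[OF b1]
        have bw: "b w = ev b (rev ?c) \<circ> b (\<rho> u) \<circ> ev b ?c"
          by (rule odd_conjugate[OF sactD(1)[OF b(1) ru] b(2)]) (use b(3) j in simp)
        have "ev b (F1 w) = ev b k \<circ> b w \<circ> ev b (rev k)" by (simp add: new ev_append comp_assoc)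
        also have "\<dots> = ev b k \<circ> (ev b (rev ?c) \<circ> b (\<rho> u) \<circ> ev b ?c) \<circ> ev b (rev k)" by (subst bw) (rule HOL.refl)
        finally show ?thesis by (simp only: ev_append rev_append rev_rev_ident comp_assoc)
      qed
      moreover have "set (k @ rev ?c) \<subseteq> insert w V" using c k by auto
      ultimately show ?thesis unfolding True new(1) by blast
    next
      case False
      then have v: "v \<in> V" using v by simp
      then obtain k' where k': "set k' \<subseteq> V" "\<forall>b :: 'a \<Rightarrow> 'a list set \<Rightarrow> 'a list set. sact V \<rho> \<mu> b \<longrightarrow>
        ev b (F v) = ev b k' \<circ> b (\<rho> v) \<circ> ev b (rev k')" using N(12)[of v] by blast
      have "set k' \<subseteq> insert w V" using k'(1) by blast
      moreover have "\<forall>b :: 'a \<Rightarrow> 'a list set \<Rightarrow> 'a list set. sact (insert w V) \<rho>1 \<mu>1 b \<longrightarrow>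
        ev b (F1 v) = ev b k' \<circ> b (\<rho>1 v) \<circ> ev b (rev k')" unfolding old[OF v] using k'(2) s(1) by blast
      ultimately show ?thesis by blast
    qed
  qed (use main_b main_a in blast)+
  then show ?thesis by blast
qed

lemma exists_normal_form:
  "forest V E \<Longrightarrow> \<forall>e\<in>E. odd (m e) \<Longrightarrow> \<exists>\<rho> \<mu> F F2. normal_form V E m \<rho> \<mu> F F2"
proof (induction rule: forest.induct)
  case empty
  then show ?case by (intro exI[of _ undefined] normal_formI) (auto simp: gact_def sact_def)
next
  case (isolated V E w)
  then show ?case using normal_form_isolated[OF isolated.hyps(1) _ isolated.hyps(2)] by blast
next
  case (leaf V E u w)
  then obtain \<rho> \<mu> F F2 where "normal_form V E m \<rho> \<mu> F F2" by auto
  from normal_form_leaf[OF leaf.hyps(1) this leaf.hyps(2,3)] show ?case using leaf.prems by simp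
qed

lemma coxeter_iso_star:
  assumes nf: "normal_form V E m \<rho> \<mu> F F2" and edges: "\<And>v w. {v, w} \<in> E \<Longrightarrow> v \<in> V \<and> w \<in> V"
  shows "coxeter_group V E m \<cong> coxeter_group V (star_edges V \<rho>) (star_label \<rho> \<mu>)"
proof -
  note N = normal_formD[OF nf]
  have \<rho>: "\<rho> v \<in> V \<and> \<rho> (\<rho> v) = \<rho> v" if "v \<in> V" for v using N(1,2)[OF that] by simp
  have g: "gact V E m (reg V E m)" by (rule gact_reg[OF edges])
  have "gact V (star_edges V \<rho>) (star_label \<rho> \<mu>) (reg V (star_edges V \<rho>) (star_label \<rho> \<mu>))"
    by (rule gact_reg) (use N(1) in \<open>auto simp: star_edges_def doubleton_eq_iff\<close>)
  then have s: "sact V \<rho> \<mu> (reg V (star_edges V \<rho>) (star_label \<rho> \<mu>))" using gact_star_iff[OF \<rho>] by blast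
  show ?thesis
  proof (rule coxeter_iso[of V F V F2])
    show "gact V (star_edges V \<rho>) (star_label \<rho> \<mu>) (\<lambda>v. ev (reg V E m) (F2 v))"
      by (rule gact_star_iff[THEN iffD2, OF _ N(10)[OF g]]) (rule \<rho>)
  qed (fact N(3) N(4) N(8)[OF s] N(11)[OF g] N(9)[OF s])+
qed

section \<open>Matching the two unions of stars\<close>

lemma star_relabel:
  assumes \<rho>: "\<And>v. v \<in> V \<Longrightarrow> \<rho> v \<in> V \<and> \<rho> (\<rho> v) = \<rho> v" and \<rho>': "\<And>s. s \<in> V' \<Longrightarrow> \<rho>' s \<in> V' \<and> \<rho>' (\<rho>' s) = \<rho>' s"
    and \<beta>: "bij_betw \<beta> V V'" and com: "\<And>v. v \<in> V \<Longrightarrow> \<beta> (\<rho> v) = \<rho>' (\<beta> v)"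
    and lab: "\<And>v. v \<in> V \<Longrightarrow> \<rho> v \<noteq> v \<Longrightarrow> \<mu>' (\<beta> v) = \<mu> v"
  shows "coxeter_group V (star_edges V \<rho>) (star_label \<rho> \<mu>) \<cong> coxeter_group V' (star_edges V' \<rho>') (star_label \<rho>' \<mu>')"
proof -
  define \<gamma> where "\<gamma> = inv_into V \<beta>"
  have b: "\<beta> v \<in> V'" "\<gamma> (\<beta> v) = v" if "v \<in> V" for v
    using \<beta> that bij_betw_apply bij_betw_inv_into_left unfolding \<gamma>_def by fast+
  have c: "\<gamma> s \<in> V" "\<beta> (\<gamma> s) = s" if "s \<in> V'" for s
    using \<beta> that bij_betw_apply[OF bij_betw_inv_into] bij_betw_inv_into_right unfolding \<gamma>_def by fast+
  let ?R = "reg V (star_edges V \<rho>) (star_label \<rho> \<mu>)" and ?R' = "reg V' (star_edges V' \<rho>') (star_label \<rho>' \<mu>')"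
  have "gact V (star_edges V \<rho>) (star_label \<rho> \<mu>) ?R"
    by (rule gact_reg) (use \<rho> in \<open>auto simp: star_edges_def doubleton_eq_iff\<close>)
  then have s: "sact V \<rho> \<mu> ?R" using gact_star_iff[OF \<rho>] by blast
  have "gact V' (star_edges V' \<rho>') (star_label \<rho>' \<mu>') ?R'"
    by (rule gact_reg) (use \<rho>' in \<open>auto simp: star_edges_def doubleton_eq_iff\<close>)
  then have s': "sact V' \<rho>' \<mu>' ?R'" using gact_star_iff[OF \<rho>'] by blast
  show ?thesis
  proof (rule coxeter_iso[of V "\<lambda>v. [\<beta> v]" V' "\<lambda>s. [\<gamma> s]"])
    show "gact V (star_edges V \<rho>) (star_label \<rho> \<mu>) (\<lambda>v. ev ?R' [\<beta> v])"
    proof (rule gact_star_iff[THEN iffD2, OF \<rho>], assumption, unfold sact_def, intro ballI conjI impI)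
      fix v assume v: "v \<in> V"
      show "ev ?R' [\<beta> v] \<circ> ev ?R' [\<beta> v] = id" using sactD(1)[OF s' b(1)[OF v]] by simp
      assume n: "\<rho> v \<noteq> v"
      have "\<rho>' (\<beta> v) \<noteq> \<beta> v" using n com[OF v] b(2)[OF v] b(2)[of "\<rho> v"] \<rho>[OF v] by metis
      from sactD(2)[OF s' b(1)[OF v] this] show "((ev ?R' [\<beta> (\<rho> v)] \<circ> ev ?R' [\<beta> v]) ^^ \<mu> v) = id"
        unfolding com[OF v] lab[OF v n] by simp
    qed
    show "gact V' (star_edges V' \<rho>') (star_label \<rho>' \<mu>') (\<lambda>s. ev ?R [\<gamma> s])"
    proof (rule gact_star_iff[THEN iffD2, OF \<rho>'], assumption, unfold sact_def, intro ballI conjI impI)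
      fix t assume t: "t \<in> V'"
      note v = c(1)[OF t]
      show "ev ?R [\<gamma> t] \<circ> ev ?R [\<gamma> t] = id" using sactD(1)[OF s v] by simp
      assume n: "\<rho>' t \<noteq> t"
      have e: "\<rho>' t = \<beta> (\<rho> (\<gamma> t))" using com[OF v] c(2)[OF t] by simp
      then have n': "\<rho> (\<gamma> t) \<noteq> \<gamma> t" using n c(2)[OF t] by metis
      have e': "\<gamma> (\<rho>' t) = \<rho> (\<gamma> t)" unfolding e using b(2) \<rho>[OF v] by blast
      have "\<mu>' t = \<mu> (\<gamma> t)" using lab[OF v n'] c(2)[OF t] by simp
      then show "((ev ?R [\<gamma> (\<rho>' t)] \<circ> ev ?R [\<gamma> t]) ^^ \<mu>' t) = id"
        using sactD(2)[OF s v n'] unfolding e' by simp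
    qed
  qed (use b c in simp_all)
qed

lemma count_image_mset_set:
  assumes "finite S"
  shows "count (image_mset f (mset_set S)) k = card {x \<in> S. f x = k}"
  using assms
proof (induction S)
  case (insert y S)
  have "{x \<in> insert y S. f x = k} = (if f y = k then insert y {x \<in> S. f x = k} else {x \<in> S. f x = k})" by auto
  then show ?case using insert by simp
qed simp

text \<open>Roots are matched by \<open>B.\<kappa>\<close>. The other vertices are matched by
  corresponding component and label, a pair that occurs equally often on both sides by
  \<open>component_labels\<close>, carried over from edges to vertices by the multiset clause of
  \<open>normal_form\<close>.\<close>

lemma (in double_forest) star_bijection:
  assumes nf: "normal_form V E m \<rho> \<mu> F F2" and nf': "normal_form V' E' m' \<rho>' \<mu>' F' F2'"
    and m2: "\<forall>e\<in>E. 2 \<le> m e" and m2': "\<forall>e\<in>E'. 2 \<le> m' e"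
  obtains \<beta> where "bij_betw \<beta> V V'" "\<And>v. v \<in> V \<Longrightarrow> \<beta> (\<rho> v) = \<rho>' (\<beta> v)"
    "\<And>v. v \<in> V \<Longrightarrow> \<rho> v \<noteq> v \<Longrightarrow> \<mu>' (\<beta> v) = \<mu> v"
proof -
  have fin: "finite V" "finite V'" using forest_finite[OF A.fo] forest_finite[OF B.fo] by auto
  let ?A = "{v \<in> V. \<rho> v \<noteq> v}" and ?B = "{s \<in> V'. \<rho>' s \<noteq> s}"
  let ?f = "\<lambda>v. (B.\<kappa> (\<rho> v), \<mu> v)" and ?g = "\<lambda>s. (\<rho>' s, \<mu>' s)"
  have card: "card {v \<in> ?A. ?f v = rk} = card {s \<in> ?B. ?g s = rk}" for rk
  proof -
    obtain r' k where rk: "rk = (r', k)" by (cases rk)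
    show ?thesis
    proof (cases "r' \<in> V' \<and> \<rho>' r' = r'")
      case True
      define r where "r = A.\<kappa> r'"
      have r: "r \<in> V" "\<rho> r = r" unfolding r_def using A.\<kappa>(1,2) True by blast+
      have kr: "B.\<kappa> r = r'" unfolding r_def using \<kappa>\<kappa> True by simp
      let ?S = "{v \<in> V. \<rho> v = r \<and> v \<noteq> r}" and ?S' = "{s \<in> V'. \<rho>' s = r' \<and> s \<noteq> r'}"
      have "image_mset \<mu> (mset_set ?S) = image_mset \<mu>' (mset_set ?S')"
        using normal_formD(7)[OF nf, of r] normal_formD(7)[OF nf', of r'] component_labels[OF m2 m2' r] unfolding kr by simp
      then have "card {v \<in> ?S. \<mu> v = k} = card {s \<in> ?S'. \<mu>' s = k}"
        using count_image_mset_set[of ?S \<mu> k] count_image_mset_set[of ?S' \<mu>' k] fin by simp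
      moreover have "{v \<in> ?A. ?f v = rk} = {v \<in> ?S. \<mu> v = k}"
      proof (rule Set.set_eqI)
        fix v
        have "B.\<kappa> (\<rho> v) = r' \<longleftrightarrow> \<rho> v = r" if v: "v \<in> V"
        proof
          assume "B.\<kappa> (\<rho> v) = r'"
          then have "A.\<kappa> (B.\<kappa> (\<rho> v)) = r" by (simp add: r_def)
          then show "\<rho> v = r" using \<kappa>\<kappa>'[OF A.\<rho>_in[OF v]] A.\<rho>\<rho>[OF v] by simp
        qed (use kr in simp)
        then show "v \<in> {v \<in> ?A. ?f v = rk} \<longleftrightarrow> v \<in> {v \<in> ?S. \<mu> v = k}" unfolding rk by auto
      qed
      moreover have "{s \<in> ?B. ?g s = rk} = {s \<in> ?S'. \<mu>' s = k}" unfolding rk by auto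
      ultimately show ?thesis by simp
    next
      \<comment> \<open>Pairs whose first entry is not a root of the primed graph have empty fibres
        on both sides.\<close>
      case False
      have "{v \<in> ?A. ?f v = rk} = {}"
      proof -
        have "B.\<kappa> (\<rho> v) \<noteq> r'" if "v \<in> V" for v using B.\<kappa>(1,2)[OF A.\<rho>_in[OF that]] False by blast
        then show ?thesis unfolding rk by auto
      qed
      moreover have "{s \<in> ?B. ?g s = rk} = {}"
      proof -
        have "\<rho>' s \<noteq> r'" if "s \<in> V'" for s using B.\<rho>_in[OF that] B.\<rho>\<rho>[OF that] False by blast
        then show ?thesis unfolding rk by auto
      qed
      ultimately show ?thesis by (simp only: card.empty)
    qed
  qed
  obtain h where h: "bij_betw h ?A ?B" "\<And>v. v \<in> ?A \<Longrightarrow> ?g (h v) = ?f v"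
    by (rule exists_bij_of_equal_fibres[OF _ _ card]) (use fin in auto)
  define \<beta> where "\<beta> v = (if \<rho> v = v then B.\<kappa> v else h v)" for v
  have "bij_betw B.\<kappa> {v \<in> V. \<rho> v = v} {s \<in> V'. \<rho>' s = s}"
  proof (rule bij_betw_byWitness[where f' = A.\<kappa>])
    show "\<forall>v\<in>{v \<in> V. \<rho> v = v}. A.\<kappa> (B.\<kappa> v) = v" using \<kappa>\<kappa>' by simp
    show "\<forall>s\<in>{s \<in> V'. \<rho>' s = s}. B.\<kappa> (A.\<kappa> s) = s" using \<kappa>\<kappa> by simp
    show "B.\<kappa> ` {v \<in> V. \<rho> v = v} \<subseteq> {s \<in> V'. \<rho>' s = s}" using B.\<kappa>(1,2) by blast
    show "A.\<kappa> ` {s \<in> V'. \<rho>' s = s} \<subseteq> {v \<in> V. \<rho> v = v}" using A.\<kappa>(1,2) by blast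
  qed
  then have "bij_betw \<beta> {v \<in> V. \<rho> v = v} {s \<in> V'. \<rho>' s = s}" by (rule bij_betw_cong[THEN iffD1, rotated]) (simp add: \<beta>_def)
  moreover have "bij_betw \<beta> ?A ?B" using h(1) by (rule bij_betw_cong[THEN iffD1, rotated]) (simp add: \<beta>_def)
  ultimately have "bij_betw \<beta> ({v \<in> V. \<rho> v = v} \<union> ?A) ({s \<in> V'. \<rho>' s = s} \<union> ?B)" by (rule bij_betw_combine) auto
  moreover have "{v \<in> V. \<rho> v = v} \<union> ?A = V" "{s \<in> V'. \<rho>' s = s} \<union> ?B = V'" by auto
  ultimately have "bij_betw \<beta> V V'" by simp
  moreover have "\<beta> (\<rho> v) = \<rho>' (\<beta> v)" if v: "v \<in> V" for v
  proof (cases "\<rho> v = v")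
    case True
    then show ?thesis using B.\<kappa>(2)[OF v] by (simp add: \<beta>_def)
  next
    case False
    then have "\<rho>' (h v) = B.\<kappa> (\<rho> v)" using h(2)[of v] v by simp
    then show ?thesis using False A.\<rho>\<rho>[OF v] by (simp add: \<beta>_def)
  qed
  moreover have "\<mu>' (\<beta> v) = \<mu> v" if v: "v \<in> V" "\<rho> v \<noteq> v" for v
    using h(2)[of v] v by (simp add: \<beta>_def)
  ultimately show ?thesis by (rule that)
qed

theorem theorem9p10:
  fixes V :: "'a set" and E :: "'a set set" and m :: "'a set \<Rightarrow> nat"
    and V' :: "'b set" and E' :: "'b set set" and m' :: "'b set \<Rightarrow> nat"
  assumes "coxeter_graph V E m"
    and "\<forall>C\<in>graph_components V E. is_tree C (induced_edges E C)"
    and "\<forall>e\<in>E. odd (m e)"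
    and "coxeter_graph V' E' m'"
    and "profinite_iso (coxeter_group V' E' m') (coxeter_group V E m)"
  shows "coxeter_group V' E' m' \<cong> coxeter_group V E m"
proof -
  have m2: "\<forall>e\<in>E. 2 \<le> m e" and m2': "\<forall>e\<in>E'. 2 \<le> m' e" using assms(1,4) by (simp_all add: coxeter_graph_def)
  have fo: "forest V E"
    by (rule acyclic_forest[OF _ _ tree_components_acyclic[OF assms(1,2)]]) (use assms(1) in \<open>simp_all add: coxeter_graph_def\<close>)
  obtain \<rho> \<mu> F F2 where nf: "normal_form V E m \<rho> \<mu> F F2" using exists_normal_form[OF fo assms(3)] by blast
  obtain \<phi> \<psi> where tp: "transfer_pair V E m V' E' m' \<phi> \<psi>" by (rule profinite_iso_transfer[OF assms(5,1,4)])
  have fp: "forest_pair V E m V' E' m' \<phi> \<psi> \<rho>"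
    by (intro forest_pair.intro tp forest_pair_axioms.intro fo assms(3)) (use normal_formD(1,2,5,6)[OF nf] in blast)+
  \<comment> \<open>Once the other graph is known to be an odd forest, the whole argument can be run
    with the roles exchanged; \<open>double_forest\<close> combines both directions.\<close>
  have fo': "forest V' E'" and odd': "\<forall>e\<in>E'. odd (m' e)" using forest_pair.odd_forest[OF fp assms(4)] by auto
  obtain \<rho>' \<mu>' F' F2' where nf': "normal_form V' E' m' \<rho>' \<mu>' F' F2'" using exists_normal_form[OF fo' odd'] by blast
  have fp': "forest_pair V' E' m' V E m \<psi> \<phi> \<rho>'"
    by (intro forest_pair.intro transfer_pair.flip[OF tp] forest_pair_axioms.intro fo' odd') (use normal_formD(1,2,5,6)[OF nf'] in blast)+
  interpret D: double_forest V E m V' E' m' \<phi> \<psi> \<rho> \<rho>' by (rule double_forest.intro[OF fp fp'])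
  obtain \<beta> where \<beta>: "bij_betw \<beta> V V'" "\<And>v. v \<in> V \<Longrightarrow> \<beta> (\<rho> v) = \<rho>' (\<beta> v)"
    "\<And>v. v \<in> V \<Longrightarrow> \<rho> v \<noteq> v \<Longrightarrow> \<mu>' (\<beta> v) = \<mu> v"
    by (rule D.star_bijection[OF nf nf' m2 m2']) (rule that)
  have "coxeter_group V E m \<cong> coxeter_group V (star_edges V \<rho>) (star_label \<rho> \<mu>)"
    by (rule coxeter_iso_star[OF nf]) (rule D.A.F.edges)
  also have "\<dots> \<cong> coxeter_group V' (star_edges V' \<rho>') (star_label \<rho>' \<mu>')"
    by (rule star_relabel[where \<rho> = \<rho> and \<rho>' = \<rho>' and \<mu> = \<mu> and \<mu>' = \<mu>', OF _ _ \<beta>]) (use normal_formD(1,2)[OF nf] normal_formD(1,2)[OF nf'] in auto)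
  also have "\<dots> \<cong> coxeter_group V' E' m'"
    by (rule group.iso_sym[OF coxeter_group_group coxeter_iso_star[OF nf']]) (rule D.A.F.edges')
  finally show ?thesis by (rule group.iso_sym[OF coxeter_group_group])
qed

end
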